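(* Let $Y$ be an isolated irreducible component of $\mathbf{Hilb}_{p(t)}^{n}$. If $\mathbf{gin}(Y)$ corresponds to a smooth point in $Y$ (i.e. the point $\mathrm{vs}(\mathbf{gin}(Y))$ of $Y$ is a smooth point of $Y$), then $Y$ is rational.
   Context: $K$ is an infinite field, $S=K[x_0,\dots,x_n]$ with the standard grading, $S_m$ is its degree $m$ component, a term is a monic monomial, $\prec$ is any term order on $S$ with $x_0\prec\dots\prec x_n$. $\mathbf{Hilb}_{p(t)}^{n}$ is the Hilbert scheme parameterizing the closed subschemes of $\mathbb P^n_K$ with Hilbert polynomial $p(t)$; $r$ is the Gotzmann number of $p(t)$ (the smallest integer such that the saturated ideals of all subschemes with Hilbert polynomial $p(t)$ are $r$-regular). Fix $m\ge r$ and $q=\binom{n+m}{n}-p(m)$. Then $\mathbf{Hilb}_{p(t)}^{n}$ is regarded as a closed subscheme of the Grassmannian $\mathbf{Gr}_{S_m}^{q}$ of $q$-dimensional subspaces of $S_m$, by sending a subscheme with saturated ideal $I$ to $I_m$; $\mathbf{Gr}_{S_m}^{q}$ is embedded in $\mathbb P(\wedge^qS_m)$ by the Plücker embedding. An isolated irreducible component is an irreducible component in the topological sense (not an embedded one), considered with its reduced structure. $\mathbf T_{S_m}^{q}$ is the set of terms $\tau_1\wedge\dots\wedge\tau_q$ with $\tau_i$ terms in $S_m$ and $\tau_1\succ\dots\succ\tau_q$, totally ordered by: $\tau_1\wedge\dots\wedge\tau_q\prec\sigma_1\wedge\dots\wedge\sigma_q$ iff there is $j$ with $\tau_i=\sigma_i$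 for $i<j$ and $\tau_j\prec\sigma_j$. For $L=\tau_1\wedge\dots\wedge\tau_q$, $U_L\subseteq\mathbf{Gr}_{S_m}^{q}$ is the open set where the Plücker coordinate $\Delta_L$ is invertible, and $\mathrm{vs}(L):=\langle\tau_1,\dots,\tau_q\rangle$. $\mathrm{GL}=\mathrm{GL}_K(n+1)$ acts on $S$ by $g(f)=f(\sum_j g_{0j}x_j,\dots,\sum_j g_{nj}x_j)$ and correspondingly on $\mathbf{Gr}_{S_m}^{q}$; $\mathcal O(Y)=\{g(V):V\in Y,\ g\in \mathrm{GL}\}$. For a non-empty set of points $Y$, $\Delta\mathrm{Supp}(Y):=\{L\in\mathbf T_{S_m}^{q}: U_L\cap Y\ne\emptyset\}$ and $\mathbf{gin}(Y):=\max_\prec\Delta\mathrm{Supp}(\mathcal O(Y))$. (For an irreducible component $Y$ of $\mathbf{Hilb}_{p(t)}^{n}$ the point $\mathrm{vs}(\mathbf{gin}(Y))$ belongs to $Y$.) *)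

theory Defs
  imports
    "HOL-Library.Poly_Mapping"
    "HOL-Library.Extended_Nat"
    "HOL-Algebra.Algebraic_Closure_Type"
    "HOL-Analysis.Cartesian_Space"
    "HOL-Analysis.Function_Topology"
    "Jordan_Normal_Form.Determinant"
begin

no_notation Matrix.vec_index (infixl "$" 100)

section \<open>Polynomials\<close>

text \<open>
  The index type \<open>'x\<close> of the variables is arbitrary; for the ring \<open>S = K[x\<^sub>0,\<dots>,x\<^sub>n]\<close> it will be a
  finite linear order with \<open>n + 1\<close> elements, for the homogeneous coordinate ring of the space
  containing the Pluecker embedding it will be the type of lists of terms.
\<close>

type_synonym 'x trm = "'x \<Rightarrow>\<^sub>0 nat"
type_synonym ('x, 'f) mpoly = "('x \<Rightarrow>\<^sub>0 nat) \<Rightarrow>\<^sub>0 'f"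

definition tdeg :: "'x trm \<Rightarrow> nat" where
  "tdeg t = (\<Sum>x\<in>Poly_Mapping.keys t. Poly_Mapping.lookup t x)"

definition const :: "'f::comm_ring_1 \<Rightarrow> ('x, 'f) mpoly" where
  "const a = Poly_Mapping.single 0 a"

definition monomial :: "'x trm \<Rightarrow> ('x, 'f::comm_ring_1) mpoly" where
  "monomial t = Poly_Mapping.single t 1"

definition var :: "'x \<Rightarrow> 'x trm" where
  "var x = Poly_Mapping.single x 1"

definition scale :: "'f::comm_ring_1 \<Rightarrow> ('x, 'f) mpoly \<Rightarrow> ('x, 'f) mpoly" where
  "scale a f = const a * f"

definition homog :: "nat \<Rightarrow> ('x, 'f::comm_ring_1) mpoly set" where
  "homog d = {f. \<forall>t\<in>Poly_Mapping.keys f. tdeg t = d}"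

definition hcomp :: "nat \<Rightarrow> ('x, 'f::comm_ring_1) mpoly \<Rightarrow> ('x, 'f) mpoly" where
  "hcomp d f = (\<Sum>t\<in>{t\<in>Poly_Mapping.keys f. tdeg t = d}. Poly_Mapping.single t (Poly_Mapping.lookup f t))"

text \<open>Evaluation at the values \<open>a\<close> of the variables, the coefficients being mapped by \<open>h\<close>.\<close>

definition evalp :: "('f \<Rightarrow> 'r) \<Rightarrow> ('x \<Rightarrow> 'r) \<Rightarrow> ('x, 'f::comm_ring_1) mpoly \<Rightarrow> 'r::comm_ring_1" where
  "evalp h a f = (\<Sum>t\<in>Poly_Mapping.keys f. h (Poly_Mapping.lookup f t) * (\<Prod>x\<in>Poly_Mapping.keys t. a x ^ Poly_Mapping.lookup t x))"

text \<open>If \<open>x\<close> does not occur in \<open>t\<close>, the truncated exponent is harmless as the coefficient is \<open>0\<close>.\<close>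

definition pdiff :: "'x \<Rightarrow> ('x, 'f::comm_ring_1) mpoly \<Rightarrow> ('x, 'f) mpoly" where
  "pdiff x f =
     (\<Sum>t\<in>Poly_Mapping.keys f. Poly_Mapping.single (t - var x) (of_nat (Poly_Mapping.lookup t x) * Poly_Mapping.lookup f t))"

definition term_order :: "('x trm \<Rightarrow> 'x trm \<Rightarrow> bool) \<Rightarrow> bool" where
  "term_order prec \<longleftrightarrow>
     (\<forall>s. \<not> prec s s) \<and>
     (\<forall>s t u. prec s t \<longrightarrow> prec t u \<longrightarrow> prec s u) \<and>
     (\<forall>s t. s \<noteq> t \<longrightarrow> prec s t \<or> prec t s) \<and>
     (\<forall>s t u. prec s t \<longrightarrow> prec (s + u) (t + u)) \<and>
     (\<forall>t. t \<noteq> 0 \<longrightarrow> prec 0 t)"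


section \<open>Homogeneous ideals, Hilbert polynomials, regularity\<close>

definition vdim :: "('x, 'f::field) mpoly set \<Rightarrow> nat" where
  "vdim V = vector_space.dim scale V"

definition homogeneous_ideal :: "('x, 'f::field) mpoly set \<Rightarrow> bool" where
  "homogeneous_ideal I \<longleftrightarrow> module.subspace (*) I \<and> (\<forall>f\<in>I. \<forall>d. hcomp d f \<in> I)"

text \<open>\<open>(I : \<mm>\<^sup>\<infinity>) = I\<close> for the irrelevant ideal \<open>\<mm>\<close>; the unit ideal, which defines the empty
  subscheme, is saturated.\<close>

definition saturated :: "('x, 'f::field) mpoly set \<Rightarrow> bool" where
  "saturated I \<longleftrightarrow> (\<forall>f. (\<exists>k. \<forall>g\<in>homog k. g * f \<in> I) \<longrightarrow> f \<in> I)"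

text \<open>The Hilbert polynomial meant is that of \<open>S/I\<close>.\<close>

definition has_hilbert_poly :: "('x, 'f::field) mpoly set \<Rightarrow> rat poly \<Rightarrow> bool" where
  "has_hilbert_poly I p \<longleftrightarrow>
     (\<forall>\<^sub>F d in sequentially. poly p (of_nat d) =
        of_nat (vdim (homog d :: ('x, 'f) mpoly set)) - of_nat (vdim (I \<inter> homog d)))"

definition subscheme_ideals :: "rat poly \<Rightarrow> ('x, 'f::field) mpoly set set" where
  "subscheme_ideals p = {I. homogeneous_ideal I \<and> saturated I \<and> has_hilbert_poly I p}"

text \<open>
  The graded free module \<open>\<Oplus>\<^bsub>j < b\<^esub> S(-a\<^sub>j)\<close> is represented by the list \<open>a\<close> of its twists; its
  elements are the functions vanishing outside \<open>{..<b}\<close>. A graded homomorphism is a matrix with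
  suitable homogeneous entries.
\<close>

definition free_mod :: "nat list \<Rightarrow> (nat \<Rightarrow> ('x, 'f::field) mpoly) set" where
  "free_mod a = {v. \<forall>j\<ge>length a. v j = 0}"

definition graded_matrix ::
  "nat list \<Rightarrow> nat list \<Rightarrow> (nat \<Rightarrow> nat \<Rightarrow> ('x, 'f::field) mpoly) \<Rightarrow> bool" where
  "graded_matrix a b D \<longleftrightarrow> (\<forall>k j. D k j = 0 \<or>
     (k < length b \<and> j < length a \<and> b ! k \<le> a ! j \<and> D k j \<in> homog (a ! j - b ! k)))"

definition apply_matrix :: "nat list \<Rightarrow> (nat \<Rightarrow> nat \<Rightarrow> ('x, 'f::field) mpoly) \<Rightarrow>
    (nat \<Rightarrow> ('x, 'f) mpoly) \<Rightarrow> nat \<Rightarrow> ('x, 'f) mpoly" where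
  "apply_matrix a D v = (\<lambda>k. \<Sum>j<length a. D k j * v j)"

text \<open>
  Castelnuovo-Mumford regularity: \<open>I\<close> is \<open>r\<close>-regular if it has a graded free resolution
  \<open>0 \<rightarrow> F\<^bsub>n+1\<^esub> \<rightarrow> \<dots> \<rightarrow> F\<^sub>1 \<rightarrow> I \<rightarrow> 0\<close> with \<open>F\<^bsub>i+1\<^esub>\<close> generated in degrees \<open>\<le> r + i\<close>. Here \<open>a i\<close> is
  the list of twists of \<open>F\<^sub>i\<close> and \<open>F\<^sub>0 = S\<close>. The bound \<open>n + 1 = CARD('x)\<close> on the length is that of
  Hilbert's syzygy theorem, which is met by the minimal free resolution.
\<close>

definition regular_ideal :: "nat \<Rightarrow> ('x::finite, 'f::field) mpoly set \<Rightarrow> bool" where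
  "regular_ideal r I \<longleftrightarrow>
     (\<exists>(a :: nat \<Rightarrow> nat list) (D :: nat \<Rightarrow> nat \<Rightarrow> nat \<Rightarrow> ('x, 'f) mpoly).
        a 0 = [0] \<and>
        (\<forall>i. graded_matrix (a (Suc i)) (a i) (D i)) \<and>
        apply_matrix (a 1) (D 0) ` free_mod (a 1) = {v\<in>free_mod [0]. v 0 \<in> I} \<and>
        (\<forall>i. apply_matrix (a (Suc (Suc i))) (D (Suc i)) ` free_mod (a (Suc (Suc i))) =
             {v\<in>free_mod (a (Suc i)). apply_matrix (a (Suc i)) (D i) v = (\<lambda>_. 0)}) \<and>
        (\<forall>i. \<forall>e\<in>set (a (Suc i)). e \<le> r + i) \<and>
        (\<forall>i>CARD('x). a i = []))"

text \<open>Used for \<open>\<I>\<close> the set of the saturated ideals with a given Hilbert polynomial.\<close>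

definition gotzmann_number :: "('x::finite, 'f::field) mpoly set set \<Rightarrow> nat \<Rightarrow> bool" where
  "gotzmann_number \<I> r \<longleftrightarrow>
     (\<forall>I\<in>\<I>. regular_ideal r I) \<and> (\<forall>s<r. \<not> (\<forall>I\<in>\<I>. regular_ideal s I))"


section \<open>Irreducible spaces and Krull dimension\<close>

definition irreducible_space :: "'a topology \<Rightarrow> bool" where
  "irreducible_space T \<longleftrightarrow> topspace T \<noteq> {} \<and>
     (\<forall>C D. closedin T C \<longrightarrow> closedin T D \<longrightarrow> C \<union> D = topspace T \<longrightarrow>
        C = topspace T \<or> D = topspace T)"

definition irreducible_component :: "'a topology \<Rightarrow> 'a set \<Rightarrow> bool" where
  "irreducible_component T Y \<longleftrightarrow>
     Y \<subseteq> topspace T \<and> irreducible_space (subtopology T Y) \<and>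
     (\<forall>Z. Y \<subseteq> Z \<longrightarrow> Z \<subseteq> topspace T \<longrightarrow> irreducible_space (subtopology T Z) \<longrightarrow> Z = Y)"

definition krull_dim :: "'a topology \<Rightarrow> enat" where
  "krull_dim T =
     (SUP k \<in> {k. \<exists>Z. (\<forall>i\<le>k. closedin T (Z i) \<and> irreducible_space (subtopology T (Z i))) \<and>
                      (\<forall>i<k. Z i \<subset> Z (Suc i))}. enat k)"


section \<open>Reduced quasi-projective schemes over a field\<close>

text \<open>
  Let \<open>K\<close> be the field \<open>'k\<close>. A reduced (locally closed) subscheme of a projective space over \<open>K\<close>
  is represented by the set of its points with values in the algebraic closure of \<open>K\<close>, with the
  \<open>K\<close>-Zariski topology, whose closed sets are the zero sets of polynomials with coefficients in
  \<open>K\<close>. This topology has the same lattice of closed sets as the scheme, and the sections of the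
  structure sheaf and the morphisms over \<open>K\<close> are given by polynomials with coefficients in \<open>K\<close>.
  A point of the projective space with finite set \<open>A\<close> of coordinates is the set of its homogeneous
  coordinate vectors.
\<close>

definition proj_point :: "('i \<Rightarrow> 'f::field) \<Rightarrow> ('i \<Rightarrow> 'f) set" where
  "proj_point c = {\<lambda>i. a * c i | a. a \<noteq> 0}"

definition proj_space :: "'i set \<Rightarrow> ('i \<Rightarrow> 'f::field) set set" where
  "proj_space A = {proj_point c | c. (\<forall>i. i \<notin> A \<longrightarrow> c i = 0) \<and> c \<noteq> (\<lambda>_. 0)}"

definition proj_zeros :: "'i set \<Rightarrow> ('i, 'k::field) mpoly \<Rightarrow> ('i \<Rightarrow> 'k alg_closure) set set" where
  "proj_zeros A F = {P\<in>proj_space A. \<forall>c\<in>P. evalp to_ac c F = 0}"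

definition zariski :: "'i set \<Rightarrow> ('i \<Rightarrow> 'k::field alg_closure) set topology" where
  "zariski A = topology_generated_by
     {proj_space A - proj_zeros A F | (F :: ('i, 'k) mpoly) d. F \<in> homog d}"

text \<open>Polynomials over \<open>K\<close> vanishing on the affine chart \<open>c i = 1\<close> of \<open>Y\<close>.\<close>

definition chart_ideal ::
  "'i \<Rightarrow> ('i \<Rightarrow> 'k::field alg_closure) set set \<Rightarrow> ('i, 'k) mpoly set" where
  "chart_ideal i Y = {f. \<forall>P\<in>Y. \<forall>c\<in>P. c i = 1 \<longrightarrow> evalp to_ac c f = 0}"

text \<open>The Zariski tangent space of that chart at its point with coordinates \<open>c\<close>. Since \<open>x\<^sub>i - 1\<close>
  belongs to the chart ideal, its vectors have \<open>i\<close>-th entry \<open>0\<close>.\<close>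

definition tangent_space :: "'i set \<Rightarrow> 'i \<Rightarrow> ('i \<Rightarrow> 'k::field alg_closure) set set \<Rightarrow>
    ('i \<Rightarrow> 'k alg_closure) \<Rightarrow> ('i \<Rightarrow>\<^sub>0 'k alg_closure) set" where
  "tangent_space A i Y c =
     {v. Poly_Mapping.keys v \<subseteq> A \<and>
         (\<forall>f\<in>chart_ideal i Y.
            (\<Sum>j\<in>A. evalp to_ac c (pdiff j f) * Poly_Mapping.lookup v j) = 0)}"

text \<open>
  Smoothness over \<open>K\<close> of a point of an irreducible closed \<open>Y\<close>, i.e. the Jacobian matrix of the
  ideal of \<open>Y\<close> has corank \<open>dim Y\<close>. At a \<open>K\<close>-rational point this says that the local ring is
  regular.
\<close>

definition smooth_point :: "'i set \<Rightarrow> ('i \<Rightarrow> 'k::field alg_closure) set set \<Rightarrow>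
    ('i \<Rightarrow> 'k alg_closure) set \<Rightarrow> bool" where
  "smooth_point A Y P \<longleftrightarrow> P \<in> Y \<and>
     (\<exists>i\<in>A. \<exists>c\<in>P. c i = 1 \<and>
        enat (vector_space.dim (\<lambda>a. Poly_Mapping.map ((*) a)) (tangent_space A i Y c)) =
        krull_dim (subtopology (zariski A) Y))"

text \<open>Morphisms over \<open>K\<close> to the projective space with coordinates \<open>B\<close>: locally given by forms of the
  same degree over \<open>K\<close> without common zero (the latter since \<open>\<phi> Q\<close> contains only non-zero vectors).\<close>

definition regular_map :: "'i set \<Rightarrow> ('i \<Rightarrow> 'k::field alg_closure) set set \<Rightarrow> 'j set \<Rightarrow>
    (('i \<Rightarrow> 'k alg_closure) set \<Rightarrow> ('j \<Rightarrow> 'k alg_closure) set) \<Rightarrow> bool" where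
  "regular_map A U B \<phi> \<longleftrightarrow> \<phi> ` U \<subseteq> proj_space B \<and>
     (\<forall>P\<in>U. \<exists>N (F :: 'j \<Rightarrow> ('i, 'k) mpoly) d.
        openin (subtopology (zariski A) U) N \<and> P \<in> N \<and> (\<forall>j. F j \<in> homog d) \<and>
        (\<forall>Q\<in>N. \<forall>c\<in>Q. (\<lambda>j. if j \<in> B then evalp to_ac c (F j) else 0) \<in> \<phi> Q))"

definition birational :: "'i set \<Rightarrow> ('i \<Rightarrow> 'k::field alg_closure) set set \<Rightarrow>
    'j set \<Rightarrow> ('j \<Rightarrow> 'k alg_closure) set set \<Rightarrow> bool" where
  "birational A T B Z \<longleftrightarrow>
     (\<exists>U W \<phi> \<psi>.
        openin (subtopology (zariski A) T) U \<and> U \<noteq> {} \<and>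
        openin (subtopology (zariski B) Z) W \<and> W \<noteq> {} \<and>
        regular_map A U B \<phi> \<and> \<phi> ` U \<subseteq> W \<and>
        regular_map B W A \<psi> \<and> \<psi> ` W \<subseteq> U \<and>
        (\<forall>P\<in>U. \<psi> (\<phi> P) = P) \<and> (\<forall>Q\<in>W. \<phi> (\<psi> Q) = Q))"

definition rational_variety :: "'i set \<Rightarrow> ('i \<Rightarrow> 'k::field alg_closure) set set \<Rightarrow> bool" where
  "rational_variety A T \<longleftrightarrow> (\<exists>d::nat. birational A T {..d} (proj_space {..d}))"


section \<open>The Grassmannian and the Hilbert scheme\<close>

text \<open>\<open>\<tau>\<^sub>1 \<and> \<dots> \<and> \<tau>\<^sub>q\<close> is represented by the list \<open>[\<tau>\<^sub>1, \<dots>, \<tau>\<^sub>q]\<close>.\<close>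

definition wedge_terms :: "('x trm \<Rightarrow> 'x trm \<Rightarrow> bool) \<Rightarrow> nat \<Rightarrow> nat \<Rightarrow> 'x trm list set" where
  "wedge_terms prec m q =
     {L. length L = q \<and> (\<forall>t\<in>set L. tdeg t = m) \<and> sorted_wrt (\<lambda>s t. prec t s) L}"

definition wedge_less ::
  "('x trm \<Rightarrow> 'x trm \<Rightarrow> bool) \<Rightarrow> 'x trm list \<Rightarrow> 'x trm list \<Rightarrow> bool" where
  "wedge_less prec L M \<longleftrightarrow>
     (\<exists>j. j < length L \<and> j < length M \<and> (\<forall>i<j. L ! i = M ! i) \<and> prec (L ! j) (M ! j))"

definition grassmannian :: "nat \<Rightarrow> nat \<Rightarrow> ('x, 'f::field) mpoly set set" where
  "grassmannian m q = {V. module.subspace scale V \<and> V \<subseteq> homog m \<and> vdim V = q}"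

definition ordered_basis :: "('x, 'f::field) mpoly set \<Rightarrow> ('x, 'f) mpoly list \<Rightarrow> bool" where
  "ordered_basis V B \<longleftrightarrow>
     distinct B \<and> \<not> module.dependent scale (set B) \<and> module.span scale (set B) = V"

definition pluecker_coord :: "('x, 'f::field) mpoly list \<Rightarrow> 'x trm list \<Rightarrow> 'f" where
  "pluecker_coord B L =
     Determinant.det (Matrix.mat (length L) (length L) (\<lambda>(i, j). Poly_Mapping.lookup (B ! i) (L ! j)))"

definition pluecker :: "('x trm \<Rightarrow> 'x trm \<Rightarrow> bool) \<Rightarrow> nat \<Rightarrow> nat \<Rightarrow>
    ('x, 'f::field) mpoly set \<Rightarrow> ('x trm list \<Rightarrow> 'f) set" where
  "pluecker prec m q V =
     (\<Union>B\<in>{B. ordered_basis V B}.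
        proj_point (\<lambda>L. if L \<in> wedge_terms prec m q then pluecker_coord B L else 0))"

definition grassmannian_top :: "('x trm \<Rightarrow> 'x trm \<Rightarrow> bool) \<Rightarrow> nat \<Rightarrow> nat \<Rightarrow>
    ('x, 'k::field alg_closure) mpoly set topology" where
  "grassmannian_top prec m q =
     pullback_topology (grassmannian m q) (pluecker prec m q) (zariski (wedge_terms prec m q))"

definition hilbert_scheme ::
  "rat poly \<Rightarrow> nat \<Rightarrow> nat \<Rightarrow> ('x, 'k::field alg_closure) mpoly set set" where
  "hilbert_scheme p m q =
     {V\<in>grassmannian m q. \<exists>I\<in>subscheme_ideals p. V = I \<inter> homog m}"

definition hilbert_top :: "('x trm \<Rightarrow> 'x trm \<Rightarrow> bool) \<Rightarrow> rat poly \<Rightarrow> nat \<Rightarrow> nat \<Rightarrow>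
    ('x, 'k::field alg_closure) mpoly set topology" where
  "hilbert_top prec p m q = subtopology (grassmannian_top prec m q) (hilbert_scheme p m q)"


section \<open>The generic initial of a set of points\<close>

text \<open>The \<open>K\<close>-linear substitution \<open>f \<mapsto> f(\<Sum>\<^sub>j g\<^sub>0\<^sub>j x\<^sub>j, \<dots>, \<Sum>\<^sub>j g\<^sub>n\<^sub>j x\<^sub>j)\<close>.\<close>

definition lin_subst :: "'k::field ^ 'x ^ 'x \<Rightarrow>
    ('x::finite, 'k alg_closure) mpoly \<Rightarrow> ('x, 'k alg_closure) mpoly" where
  "lin_subst g = evalp const (\<lambda>i. \<Sum>j\<in>UNIV. scale (to_ac (g $ i $ j)) (monomial (var j)))"

definition gl_orbit ::
  "('x::finite, 'k::field alg_closure) mpoly set set \<Rightarrow> ('x, 'k alg_closure) mpoly set set" where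
  "gl_orbit Y = {lin_subst g ` V | (g :: 'k ^ 'x ^ 'x) V. invertible g \<and> V \<in> Y}"

text \<open>The set \<open>U\<^sub>L\<close>.\<close>

definition pluecker_open :: "('x trm \<Rightarrow> 'x trm \<Rightarrow> bool) \<Rightarrow> nat \<Rightarrow> nat \<Rightarrow> 'x trm list \<Rightarrow>
    ('x, 'f::field) mpoly set set" where
  "pluecker_open prec m q L = {V\<in>grassmannian m q. \<forall>c\<in>pluecker prec m q V. c L \<noteq> 0}"

definition delta_supp :: "('x trm \<Rightarrow> 'x trm \<Rightarrow> bool) \<Rightarrow> nat \<Rightarrow> nat \<Rightarrow>
    ('x, 'f::field) mpoly set set \<Rightarrow> 'x trm list set" where
  "delta_supp prec m q Y = {L\<in>wedge_terms prec m q. pluecker_open prec m q L \<inter> Y \<noteq> {}}"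

definition gin :: "('x::finite trm \<Rightarrow> 'x trm \<Rightarrow> bool) \<Rightarrow> nat \<Rightarrow> nat \<Rightarrow>
    ('x, 'k::field alg_closure) mpoly set set \<Rightarrow> 'x trm list" where
  "gin prec m q Y =
     (THE L. L \<in> delta_supp prec m q (gl_orbit Y) \<and>
             (\<forall>M\<in>delta_supp prec m q (gl_orbit Y). M = L \<or> wedge_less prec M L))"

definition vs :: "'x trm list \<Rightarrow> ('x, 'f::field) mpoly set" where
  "vs L = module.span scale (monomial ` set L)"

end

theory Submission
  imports Defs "HOL-Library.Function_Algebras"
begin

text \<open>Let \<open>L = gin(Y)\<close>. As \<open>Y\<close> is contained in its orbit, all Pluecker coordinates above \<open>L\<close> vanish on \<open>Y\<close>;
  hence the points of \<open>Y\<close> with non-zero coordinate at \<open>L\<close> are the spaces in \<open>Y\<close> with initial space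
  \<open>vs(L)\<close>, and they have affine coordinates indexed by the pairs \<open>\<eta> \<prec> \<tau>\<close> with \<open>\<tau>\<close> in \<open>L\<close> and \<open>\<eta>\<close> outside
  \<open>L\<close>. The diagonal torus preserves \<open>Y\<close> and acts on the coordinate of \<open>(\<tau>, \<eta>)\<close> with weight
  \<open>\<eta> - \<tau>\<close>; all these weights lie on one side of the term order, so the
  chart is a cone with positive weights and vertex \<open>vs(L)\<close>. In such a cone, every coordinate whose differential at the vertex depends on those of a
  basis \<open>D\<close> of the cotangent space is, by induction along the weights, a polynomial in the
  coordinates of \<open>D\<close>. Smoothness says that the cardinality of \<open>D\<close> is the Krull dimension of \<open>Y\<close>, so
  there is no relation among the coordinates of \<open>D\<close>, because a relation would leave too few
  monomials for a chain of irreducible closed sets of that length. Therefore the chart is an affine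
  space, and \<open>Y\<close> is rational.\<close>

section \<open>Polynomial arithmetic\<close>

text \<open>Three passages carry the weight. The chart must be closed in affine space, although
  being the degree \<open>m\<close> part of a suitable ideal is not visibly a closed condition. By
  regularity, the dimension of S_k V on the Hilbert scheme depends only on \<open>k\<close>; on the
  chart this dimension is the least possible one, so membership is the vanishing of minors over K.
  The torus must preserve \<open>Y\<close>, but only its K-points act. As K is infinite, the union
  of all translates is still irreducible, and maximality of \<open>Y\<close> absorbs it. Rescaling
  one variable at a time keeps the action in one parameter. Krull dimension enters only through
  chains. A chain of length \<open>k\<close> yields \<open>k + 1\<close> forms of equal degree
  without a homogeneous relation, whereas a relation between the \<open>d\<close> coordinates of the
  chart forces a homogeneous relation on any \<open>d + 1\<close> such forms. So all that is
  extracted from smoothness is that \<open>D\<close> has at most as many elements as the Krull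
  dimension, and the tangent space is only bounded from below. Points have coordinates in the
  algebraic closure while equations have coefficients in K; polynomial identities are therefore
  tested at infinitely many parameters from K.\<close>

abbreviation pkeys :: "('a \<Rightarrow>\<^sub>0 'b::zero) \<Rightarrow> 'a set" where "pkeys \<equiv> Poly_Mapping.keys"
abbreviation plk :: "('a \<Rightarrow>\<^sub>0 'b::zero) \<Rightarrow> 'a \<Rightarrow> 'b" where "plk \<equiv> Poly_Mapping.lookup"
abbreviation psingle :: "'a \<Rightarrow> 'b \<Rightarrow> 'a \<Rightarrow>\<^sub>0 'b::zero" where "psingle \<equiv> Poly_Mapping.single"

section \<open>Values and degrees of terms\<close>

definition monev :: "('x \<Rightarrow> 'r::comm_ring_1) \<Rightarrow> 'x trm \<Rightarrow> 'r" where
  "monev a t = (\<Prod>x\<in>pkeys t. a x ^ plk t x)"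

lemma keys_empty_iff: "pkeys t = {} \<longleftrightarrow> t = 0"
  by (metis (no_types) keys_zero ex_in_conv in_keys_iff lookup_zero poly_mapping_eqI)

lemma monev_superset:
  assumes "finite S" "pkeys t \<subseteq> S"
  shows "monev a t = (\<Prod>x\<in>S. a x ^ plk t x)"
  unfolding monev_def using assms
  by (intro prod.mono_neutral_left) (auto simp: in_keys_iff)

lemma monev_add: "monev a (s + t) = monev a s * monev a t"
proof -
  let ?S = "pkeys s \<union> pkeys t"
  have "monev a (s + t) = (\<Prod>x\<in>?S. a x ^ plk (s + t) x)"
    by (rule monev_superset) (use Poly_Mapping.keys_add[of s t] in auto)
  also have "\<dots> = (\<Prod>x\<in>?S. a x ^ plk s x) * (\<Prod>x\<in>?S. a x ^ plk t x)"
    by (simp add: lookup_add power_add prod.distrib)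
  also have "\<dots> = monev a s * monev a t"
    by (subst (1 2) monev_superset[of ?S]) auto
  finally show ?thesis .
qed

lemma monev_zero [simp]: "monev a 0 = 1"
  by (simp add: monev_def)

lemma monev_single: "monev a (psingle x k) = a x ^ k"
  by (cases "k = 0") (simp_all add: monev_def)

lemma monev_var [simp]: "monev a (var x) = a x"
  by (simp add: var_def monev_single)

lemma monev_cong: "(\<And>x. x \<in> pkeys t \<Longrightarrow> a x = b x) \<Longrightarrow> monev a t = monev b t"
  by (simp add: monev_def)

lemma monev_mult: "monev (\<lambda>x. a x * b x) t = monev a t * monev b t"
  by (simp add: monev_def power_mult_distrib prod.distrib)

lemma tdeg_superset:
  assumes "finite S" "pkeys t \<subseteq> S"
  shows "tdeg t = (\<Sum>x\<in>S. plk t x)"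
  unfolding tdeg_def using assms
  by (intro sum.mono_neutral_left) (auto simp: in_keys_iff)

lemma tdeg_add: "tdeg (s + t) = tdeg s + tdeg t"
proof -
  let ?S = "pkeys s \<union> pkeys t"
  have "tdeg (s + t) = (\<Sum>x\<in>?S. plk (s + t) x)"
    by (rule tdeg_superset) (use Poly_Mapping.keys_add[of s t] in auto)
  also have "\<dots> = (\<Sum>x\<in>?S. plk s x) + (\<Sum>x\<in>?S. plk t x)"
    by (simp add: lookup_add sum.distrib)
  also have "\<dots> = tdeg s + tdeg t"
    by (subst (1 2) tdeg_superset[of ?S]) auto
  finally show ?thesis .
qed

lemma tdeg_zero [simp]: "tdeg 0 = 0"
  by (simp add: tdeg_def)

lemma tdeg_eq_0_iff: "tdeg t = 0 \<longleftrightarrow> t = 0"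
proof
  assume "tdeg t = 0"
  then have "\<forall>x\<in>pkeys t. plk t x = 0" by (simp add: tdeg_def)
  then have "pkeys t = {}" by (meson ex_in_conv in_keys_iff)
  then show "t = 0" by (simp only: keys_empty_iff)
qed simp

lemma tdeg_single [simp]: "tdeg (psingle x k) = k"
  by (cases "k = 0") (simp_all add: tdeg_def)

lemma tdeg_var [simp]: "tdeg (var x) = 1"
  by (simp add: var_def)

lemma tdeg_minus_var: "x \<in> pkeys t \<Longrightarrow> t = (t - var x) + var x"
  by (rule poly_mapping_eqI)
    (auto simp: lookup_add lookup_minus var_def lookup_single when_def in_keys_iff)

lemma trm_eq_var_add: assumes "tdeg t = Suc d" obtains x u where "t = var x + u" "tdeg u = d"
proof -
  have "t \<noteq> 0" using assms by auto
  then obtain x where "x \<in> pkeys t" by (metis keys_empty_iff ex_in_conv)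
  then have *: "t = (t - var x) + var x" by (rule tdeg_minus_var)
  then have "tdeg t = tdeg (t - var x) + 1" by (metis tdeg_add tdeg_var)
  with * that[of x "t - var x"] assms show thesis by (simp add: add.commute)
qed

lemma tdeg_1_var: assumes "tdeg t = 1" obtains x where "t = var x"
  using trm_eq_var_add[of t 0] assms by (metis One_nat_def add.right_neutral tdeg_eq_0_iff)

lemma finite_tdeg_eq:
  assumes "finite S" shows "finite {t :: 'x trm. pkeys t \<subseteq> S \<and> tdeg t \<le> d}"
proof -
  let ?r = "\<lambda>t. restrict (plk t) S"
  have "inj_on ?r {t. pkeys t \<subseteq> S \<and> tdeg t \<le> d}"
  proof (rule inj_onI)
    fix s t :: "'x trm"
    assume *: "s \<in> {t. pkeys t \<subseteq> S \<and> tdeg t \<le> d}" "t \<in> {t. pkeys t \<subseteq> S \<and> tdeg t \<le> d}" "?r s = ?r t"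
    show "s = t"
    proof (rule poly_mapping_eqI)
      fix x show "plk s x = plk t x"
      proof (cases "x \<in> S")
        case True
        then show ?thesis using *(3) by (metis restrict_apply')
      next
        case False
        then have "x \<notin> pkeys s" "x \<notin> pkeys t" using * by auto
        then show ?thesis by (simp add: in_keys_iff)
      qed
    qed
  qed
  moreover have "?r ` {t. pkeys t \<subseteq> S \<and> tdeg t \<le> d} \<subseteq> (\<Pi>\<^sub>E x\<in>S. {..d})"
  proof
    fix g assume "g \<in> ?r ` {t. pkeys t \<subseteq> S \<and> tdeg t \<le> d}"
    then obtain t where t: "g = ?r t" "tdeg t \<le> d" by blast
    have "plk t x \<le> tdeg t" for x
    proof (cases "x \<in> pkeys t")
      case True then show ?thesis unfolding tdeg_def by (intro member_le_sum) auto
    qed (simp add: in_keys_iff)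
    then show "g \<in> (\<Pi>\<^sub>E x\<in>S. {..d})"
      using t order_trans by (fastforce simp: PiE_def extensional_def)
  qed
  ultimately show ?thesis
    using finite_PiE[OF assms, of "\<lambda>_. {..d}"] by (meson finite_atMost finite_imageD finite_subset)
qed

lemma finite_terms_of_degree [simp]: "finite {t :: 'x::finite trm. tdeg t = d}"
  by (rule finite_subset[OF _ finite_tdeg_eq[of UNIV d]]) auto

lemma sum_singles: "(\<Sum>t\<in>pkeys f. psingle t (plk f t)) = f"
proof (rule poly_mapping_eqI)
  fix t
  show "plk (\<Sum>t\<in>pkeys f. psingle t (plk f t)) t = plk f t"
    by (simp add: lookup_sum lookup_single when_def sum.delta' in_keys_iff)
qed

text \<open>Additive statements reduce to single terms. Two nested inductions of this kind give
  multiplicativity of evaluation and of rescaling.\<close>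

lemma poly_mapping_single_induct [case_names zero add]:
  assumes "P 0" "\<And>f t c. P f \<Longrightarrow> P (f + psingle t c)"
  shows "P (f :: 'a \<Rightarrow>\<^sub>0 'b::comm_monoid_add)"
proof -
  have "P (\<Sum>t\<in>T. psingle t (plk f t))" if "finite T" for T
    using that
  proof (induction T)
    case (insert x F)
    then show ?case using assms(2)[of "\<Sum>t\<in>F. psingle t (plk f t)" x "plk f x"] by (simp add: add.commute)
  qed (simp add: assms)
  then show ?thesis using sum_singles[of f] by (metis finite_keys)
qed

subsection \<open>Evaluation\<close>

lemma evalp_monev: "evalp h a f = (\<Sum>t\<in>pkeys f. h (plk f t) * monev a t)"
  by (simp add: evalp_def monev_def)

lemma evalp_superset:
  assumes "h 0 = 0" "finite S" "pkeys f \<subseteq> S"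
  shows "evalp h a f = (\<Sum>t\<in>S. h (plk f t) * monev a t)"
  unfolding evalp_monev using assms
  by (intro sum.mono_neutral_left) (auto simp: in_keys_iff)

context
  fixes h :: "'f::comm_ring_1 \<Rightarrow> 'r::comm_ring_1"
  assumes hom: "comm_ring_hom h"
begin

interpretation h: comm_ring_hom h by (rule hom)

lemma evalp_add: "evalp h a (f + g) = evalp h a f + evalp h a g"
proof -
  let ?S = "pkeys f \<union> pkeys g"
  have "evalp h a (f + g) = (\<Sum>t\<in>?S. h (plk (f + g) t) * monev a t)"
    by (rule evalp_superset) (use Poly_Mapping.keys_add[of f g] in auto)
  also have "\<dots> = (\<Sum>t\<in>?S. h (plk f t) * monev a t) + (\<Sum>t\<in>?S. h (plk g t) * monev a t)"
    by (simp add: lookup_add h.hom_add algebra_simps sum.distrib)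
  also have "\<dots> = evalp h a f + evalp h a g"
    by (subst (1 2) evalp_superset[of h ?S]) auto
  finally show ?thesis .
qed

lemma evalp_0 [simp]: "evalp h a 0 = 0"
  by (simp add: evalp_monev)

lemma evalp_psingle: "evalp h a (psingle t c) = h c * monev a t"
  by (cases "c = 0") (simp_all add: evalp_monev)

lemma evalp_sum: "evalp h a (sum F A) = (\<Sum>i\<in>A. evalp h a (F i))"
  by (induction A rule: infinite_finite_induct) (auto simp: evalp_add)

lemma evalp_mult: "evalp h a (f * g) = evalp h a f * evalp h a g"
proof (induction f rule: poly_mapping_single_induct)
  case (add f s c)
  have "evalp h a (psingle s c * g) = evalp h a (psingle s c) * evalp h a g"
  proof (induction g rule: poly_mapping_single_induct)
    case (add g t d)
    then show ?case
      by (simp add: evalp_add distrib_left mult_single evalp_psingle h.hom_mult monev_add algebra_simps)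
  qed simp
  with add show ?case by (simp add: distrib_right evalp_add)
qed simp

lemma evalp_1: "evalp h a 1 = 1"
  using evalp_psingle[of a 0 1] by simp

lemma evalp_hom: "comm_ring_hom (evalp h a)"
  by unfold_locales (auto simp: evalp_add evalp_mult evalp_1)

lemma evalp_power: "evalp h a (f ^ n) = evalp h a f ^ n"
  by (induction n) (auto simp: evalp_mult evalp_1)

lemma evalp_monomial: "evalp h a (monomial t) = monev a t"
  by (simp add: monomial_def evalp_psingle)

lemma evalp_const: "evalp h a (const c) = h c"
  by (simp add: const_def evalp_psingle)

lemma evalp_scale: "evalp h a (scale c f) = h c * evalp h a f"
  by (simp add: scale_def evalp_mult evalp_const)

lemma evalp_uminus: "evalp h a (- f) = - evalp h a f"
proof -
  interpret e: comm_ring_hom "evalp h a" by (rule evalp_hom)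
  show ?thesis by (rule e.hom_uminus)
qed

lemma evalp_diff: "evalp h a (f - g) = evalp h a f - evalp h a g"
  using evalp_add[of a f "- g"] by (simp add: evalp_uminus)

end

lemma to_ac_hom: "comm_ring_hom (to_ac :: 'k::field \<Rightarrow> _)"
  by unfold_locales auto

lemma const_add: "const (a + b) = const a + const b"
  by (simp add: const_def single_add)

lemma const_mult: "const (a * b) = const a * const b"
  by (simp add: const_def mult_single)

lemma const_hom: "comm_ring_hom (const :: 'f::comm_ring_1 \<Rightarrow> ('x, 'f) mpoly)"
  by unfold_locales (auto simp: const_add const_mult, auto simp: const_def)

lemma hom_monev:
  assumes "comm_ring_hom h" shows "h (monev F t) = monev (\<lambda>i. h (F i)) t"
proof -
  interpret comm_ring_hom h by fact
  show ?thesis by (simp add: monev_def hom_prod hom_power)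
qed

lemma hom_evalp:
  assumes "comm_ring_hom g" "comm_ring_hom h"
  shows "g (evalp h F P) = evalp (\<lambda>c. g (h c)) (\<lambda>i. g (F i)) P"
proof -
  interpret g: comm_ring_hom g by fact
  show ?thesis by (simp add: evalp_monev g.hom_sum g.hom_mult hom_monev[OF assms(1)])
qed

text \<open>With \<open>const\<close> as coefficient map, \<open>evalp\<close> is substitution of
  polynomials for variables. Forms in Pluecker coordinates are pulled back to the chart, and
  functions on the chart to the coordinates in \<open>D\<close>, by such substitutions.\<close>

lemma evalp_compose:
  assumes "comm_ring_hom h"
  shows "evalp h a (evalp const F P) = evalp h (\<lambda>i. evalp h a (F i)) P"
  by (subst hom_evalp[OF evalp_hom[OF assms] const_hom]) (simp add: evalp_const[OF assms])

definition pvars :: "('x, 'f::zero) mpoly \<Rightarrow> 'x set" where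
  "pvars f = (\<Union>t\<in>pkeys f. pkeys t)"

lemmas evalp_ac_simps = evalp_add[OF to_ac_hom] evalp_mult[OF to_ac_hom] evalp_diff[OF to_ac_hom]
  evalp_uminus[OF to_ac_hom] evalp_0[OF to_ac_hom] evalp_1[OF to_ac_hom]
  evalp_scale[OF to_ac_hom] evalp_const[OF to_ac_hom] evalp_monomial[OF to_ac_hom]

lemma plk_const_mult: "plk (const c * f) t = c * plk f t"
proof (induction f rule: poly_mapping_single_induct)
  case (add f s d)
  then show ?case
    by (auto simp: distrib_left lookup_add const_def mult_single lookup_single when_def)
qed simp

lemma plk_scale [simp]: "plk (scale c f) t = c * plk f t"
  by (simp add: scale_def plk_const_mult)

lemma plk_monomial: "plk (monomial t) s = (if s = t then 1 else 0)"
  by (simp add: monomial_def lookup_single when_def)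

lemma plk_monomial_mult: "plk (monomial s * f) (s + t) = plk f (t :: 'x trm)"
proof (induction f rule: poly_mapping_single_induct)
  case (add f s d)
  then show ?case
    by (auto simp: distrib_left lookup_add monomial_def mult_single lookup_single when_def)
qed simp

lemma monomial_mult_keys: "pkeys (monomial s * f) = (+) s ` pkeys (f :: ('x, 'f::comm_ring_1) mpoly)"
proof
  show "pkeys (monomial s * f) \<subseteq> (+) s ` pkeys f"
  proof
    fix u assume "u \<in> pkeys (monomial s * f)"
    then obtain v w where "v \<in> pkeys (monomial s :: ('x, 'f) mpoly)" "w \<in> pkeys f" "u = v + w"
      using Poly_Mapping.keys_mult[of "monomial s" f] by blast
    then show "u \<in> (+) s ` pkeys f" by (auto simp: monomial_def)
  qed
  show "(+) s ` pkeys f \<subseteq> pkeys (monomial s * f)"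
    by (auto simp: in_keys_iff plk_monomial_mult)
qed

lemma monomial_add: "monomial (s + t) = monomial s * (monomial t :: ('x, 'f::comm_ring_1) mpoly)"
  by (simp add: monomial_def mult_single)

lemma monomial_0 [simp]: "monomial 0 = 1"
  by (simp add: monomial_def)

lemma monomial_nonzero [simp]: "monomial s \<noteq> (0 :: ('x, 'f::comm_ring_1) mpoly)"
  by (metis lookup_zero plk_monomial zero_neq_one)

lemma psingle_scale: "psingle t c = scale c (monomial t)"
  by (simp add: scale_def const_def monomial_def mult_single)

lemma sum_scale_monomials: "(\<Sum>t\<in>pkeys f. scale (plk f t) (monomial t)) = f"
  using sum_singles[of f] by (simp add: psingle_scale)

lemma sum_scale_monomials_superset:
  assumes "finite S" "pkeys f \<subseteq> S"
  shows "(\<Sum>t\<in>S. scale (plk f t) (monomial t)) = f"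
proof -
  have "(\<Sum>t\<in>S. scale (plk f t) (monomial t)) = (\<Sum>t\<in>pkeys f. scale (plk f t) (monomial t))"
    using assms by (intro sum.mono_neutral_right) (auto simp: in_keys_iff scale_def const_def)
  then show ?thesis by (simp add: sum_scale_monomials)
qed

subsection \<open>Homogeneous polynomials\<close>

lemma homogI: "(\<And>t. plk f t \<noteq> 0 \<Longrightarrow> tdeg t = d) \<Longrightarrow> f \<in> homog d"
  by (auto simp: homog_def in_keys_iff)

lemma homogD: "f \<in> homog d \<Longrightarrow> plk f t \<noteq> 0 \<Longrightarrow> tdeg t = d"
  by (auto simp: homog_def in_keys_iff)

lemma homog_0 [simp]: "0 \<in> homog d" by (simp add: homog_def)

lemma homog_add: "f \<in> homog d \<Longrightarrow> g \<in> homog d \<Longrightarrow> f + g \<in> homog d"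
  by (rule homogI) (metis add.right_neutral homogD lookup_add)

lemma homog_sum: "(\<And>i. i \<in> A \<Longrightarrow> F i \<in> homog d) \<Longrightarrow> sum F A \<in> homog d"
  by (induction A rule: infinite_finite_induct) (auto intro: homog_add)

lemma homog_scale: "f \<in> homog d \<Longrightarrow> scale c f \<in> homog d"
  by (rule homogI) (metis homogD mult_zero_right plk_scale)

lemma homog_monomial: "monomial t \<in> homog d \<longleftrightarrow> tdeg t = d"
  by (auto simp: homog_def monomial_def)

lemma homog_mult: "f \<in> homog d \<Longrightarrow> g \<in> homog e \<Longrightarrow> f * g \<in> homog (d + e)"
  using Poly_Mapping.keys_mult[of f g] by (fastforce simp: homog_def tdeg_add)

lemma homog_const: "const c \<in> homog 0"
  by (rule homogI) (auto simp: const_def lookup_single when_def split: if_splits)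

lemma homog_1: "1 \<in> homog 0"
  using homog_monomial[of 0 0] by simp

lemma homog_power: "f \<in> homog d \<Longrightarrow> f ^ n \<in> homog (d * n)"
  by (induction n) (auto simp: homog_1 dest: homog_mult)

lemma homog_prod: "(\<And>i. i \<in> A \<Longrightarrow> F i \<in> homog (d i)) \<Longrightarrow> prod F A \<in> homog (sum d A)"
  by (induction A rule: infinite_finite_induct) (auto simp: homog_1 intro: homog_mult)

lemma homog_subst:
  assumes "P \<in> homog s" "\<And>i. i \<in> pvars P \<Longrightarrow> F i \<in> homog e"
  shows "evalp const F P \<in> homog (e * s)"
  unfolding evalp_monev
proof (rule homog_sum)
  fix t assume t: "t \<in> pkeys P"
  have "monev F t \<in> homog (\<Sum>x\<in>pkeys t. e * plk t x)"
    unfolding monev_def by (rule homog_prod, rule homog_power, rule assms) (use t in \<open>auto simp: pvars_def\<close>)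
  also have "(\<Sum>x\<in>pkeys t. e * plk t x) = e * s"
    using t assms(1) by (simp add: homog_def tdeg_def flip: sum_distrib_left)
  finally show "const (plk P t) * monev F t \<in> homog (e * s)"
    using homog_scale unfolding scale_def by blast
qed

lemma monev_scale: "monev (\<lambda>x. s * a x) t = s ^ tdeg t * monev a t"
  by (simp add: monev_def tdeg_def power_mult_distrib prod.distrib power_sum)

lemma evalp_homog_scale:
  assumes "F \<in> homog d" shows "evalp h (\<lambda>x. s * a x) F = s ^ d * evalp h a F"
  using assms unfolding evalp_monev homog_def
  by (simp add: monev_scale sum_distrib_left mult_ac cong: sum.cong)

lemma plk_hcomp: "plk (hcomp d f) t = (if tdeg t = d then plk f t else 0)"
  by (auto simp: hcomp_def lookup_sum lookup_single when_def sum.delta' in_keys_iff)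

lemma hcomp_homog [simp]: "hcomp d f \<in> homog d"
  by (rule homogI) (simp add: plk_hcomp split: if_splits)

lemma hcomp_of_homog: "f \<in> homog d \<Longrightarrow> hcomp e f = (if e = d then f else 0)"
  by (rule poly_mapping_eqI) (auto simp: plk_hcomp dest: homogD)

lemma hcomp_add: "hcomp d (f + g) = hcomp d f + hcomp d g"
  by (rule poly_mapping_eqI) (auto simp: plk_hcomp lookup_add)

lemma hcomp_0 [simp]: "hcomp d 0 = 0"
  by (rule poly_mapping_eqI) (auto simp: plk_hcomp)

lemma hcomp_sum: "hcomp d (sum F A) = (\<Sum>i\<in>A. hcomp d (F i))"
  by (induction A rule: infinite_finite_induct) (auto simp: hcomp_add)

lemma sum_hcomp: assumes "finite D" "tdeg ` pkeys f \<subseteq> D" shows "(\<Sum>d\<in>D. hcomp d f) = f"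
proof (rule poly_mapping_eqI)
  fix t
  have "plk (\<Sum>d\<in>D. hcomp d f) t = (if tdeg t \<in> D then plk f t else 0)"
    using assms by (simp add: lookup_sum plk_hcomp sum.delta)
  then show "plk (\<Sum>d\<in>D. hcomp d f) t = plk f t"
    using assms(2) by (metis image_eqI in_keys_iff subsetD)
qed

lemma hcomp_mult_homog:
  assumes "g \<in> homog e"
  shows "hcomp d (g * f) = (if e \<le> d then g * hcomp (d - e) f else 0)"
proof -
  \<comment> \<open>The degree \<open>d - e\<close> is added so that the last sum picks out this
    component also when it is zero.\<close>
  let ?D = "tdeg ` pkeys f \<union> {d - e}"
  have "g * f = (\<Sum>i\<in>?D. g * hcomp i f)"
    by (subst sum_distrib_left[symmetric], subst sum_hcomp) auto
  then have "hcomp d (g * f) = (\<Sum>i\<in>?D. hcomp d (g * hcomp i f))"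
    by (simp only: hcomp_sum)
  also have "\<dots> = (\<Sum>i\<in>?D. if d = e + i then g * hcomp i f else 0)"
    by (rule sum.cong) (simp_all add: hcomp_of_homog[OF homog_mult[OF assms hcomp_homog]])
  also have "\<dots> = (\<Sum>i\<in>?D. if i = d - e then (if e \<le> d then g * hcomp (d - e) f else 0) else 0)"
    by (rule sum.cong) auto
  also have "\<dots> = (if e \<le> d then g * hcomp (d - e) f else 0)"
    by (subst sum.delta) auto
  finally show ?thesis .
qed

lemma homog_eq_sum_monomials:
  fixes f :: "('x::finite, 'f::comm_ring_1) mpoly"
  assumes "f \<in> homog d" shows "f = (\<Sum>t\<in>{t. tdeg t = d}. scale (plk f t) (monomial t))"
  by (rule sum_scale_monomials_superset[symmetric]) (use assms in \<open>auto simp: homog_def\<close>)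

subsection \<open>Vector spaces of polynomials\<close>

lemma scale_vector_space: "vector_space (scale :: 'f::field \<Rightarrow> ('x, 'f) mpoly \<Rightarrow> _)"
  by unfold_locales (auto simp: scale_def const_add const_mult algebra_simps, simp add: const_def)

global_interpretation mp: vector_space "scale :: 'f::field \<Rightarrow> ('x, 'f) mpoly \<Rightarrow> ('x, 'f) mpoly"
  by (rule scale_vector_space)

lemma scale_mult_left: "scale c f * g = scale c (f * g)"
  by (simp add: scale_def mult.assoc)

lemma scale_mult_right: "f * scale c g = scale c (f * g)"
  by (simp add: scale_def mult_ac)

lemma subspace_homog: "mp.subspace (homog d)"
  by (rule mp.subspaceI) (auto intro: homog_add homog_scale)

section \<open>Linear algebra\<close>

context vector_space
begin

text \<open>Independence of a set does not see repetitions, so injectivity is derived too: if two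
  members agree, the coefficients 1 and -1 give a relation.\<close>

lemma family_independent:
  assumes "finite I" "\<And>a. (\<Sum>i\<in>I. scale (a i) (F i)) = 0 \<Longrightarrow> \<forall>i\<in>I. a i = 0"
  shows "inj_on F I" "independent (F ` I)"
proof -
  show inj: "inj_on F I"
  proof (rule inj_onI, rule ccontr)
    fix i j assume ij: "i \<in> I" "j \<in> I" "F i = F j" "i \<noteq> j"
    let ?a = "\<lambda>k. if k = i then 1 else if k = j then - 1 else 0 :: 'a"
    have "(\<Sum>k\<in>I. scale (?a k) (F k)) = (\<Sum>k\<in>{i, j}. scale (?a k) (F k))"
      using assms(1) ij by (intro sum.mono_neutral_right) auto
    also have "\<dots> = 0" using ij by simp
    finally have "(\<Sum>k\<in>I. scale (?a k) (F k)) = 0" .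
    then have "\<forall>k\<in>I. ?a k = 0" by (rule assms(2))
    from bspec[OF this ij(1)] show False by simp
  qed
  show "independent (F ` I)"
  proof (rule independent_if_scalars_zero)
    fix f x assume f: "(\<Sum>x\<in>F ` I. scale (f x) x) = 0" and x: "x \<in> F ` I"
    have "(\<Sum>i\<in>I. scale (f (F i)) (F i)) = 0"
      using f by (simp add: sum.reindex[OF inj])
    then show "f x = 0" using assms(2)[of "f \<circ> F"] x by auto
  qed (use assms in auto)
qed

lemma family_dependent:
  assumes "finite I" "finite B" "\<And>i. i \<in> I \<Longrightarrow> F i \<in> span B" "card B < card I"
  obtains a where "(\<Sum>i\<in>I. scale (a i) (F i)) = 0" "\<exists>i\<in>I. a i \<noteq> 0"
proof (rule ccontr)
  assume "\<not> thesis"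
  then have "\<And>a. (\<Sum>i\<in>I. scale (a i) (F i)) = 0 \<Longrightarrow> \<forall>i\<in>I. a i = 0"
    using that by blast
  then have "inj_on F I" "independent (F ` I)"
    using family_independent[OF assms(1)] by blast+
  moreover have "F ` I \<subseteq> span B" using assms by auto
  ultimately show False
    using independent_span_bound[OF assms(2), of "F ` I"] assms(4) by (simp add: card_image)
qed

lemma span_image_finite:
  assumes "finite I" "v \<in> span (F ` I)"
  obtains a where "v = (\<Sum>i\<in>I. scale (a i) (F i))"
proof -
  let ?U = "{v. \<exists>a. v = (\<Sum>i\<in>I. scale (a i) (F i))}"
  have "subspace ?U"
  proof (rule subspaceI)
    have "0 = (\<Sum>i\<in>I. scale ((\<lambda>_. 0) i) (F i))" by simp
    then show "0 \<in> ?U" by (intro CollectI exI)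
  next
    fix x y assume "x \<in> ?U" "y \<in> ?U"
    then obtain a b where "x = (\<Sum>i\<in>I. scale (a i) (F i))" "y = (\<Sum>i\<in>I. scale (b i) (F i))" by auto
    then have "x + y = (\<Sum>i\<in>I. scale (a i + b i) (F i))" by (simp add: scale_left_distrib sum.distrib)
    then show "x + y \<in> ?U" by (intro CollectI exI[of _ "\<lambda>i. a i + b i"])
  next
    fix c x assume "x \<in> ?U"
    then obtain a where "x = (\<Sum>i\<in>I. scale (a i) (F i))" by auto
    then have "scale c x = (\<Sum>i\<in>I. scale (c * a i) (F i))" by (simp add: scale_sum_right)
    then show "scale c x \<in> ?U" by (intro CollectI exI[of _ "\<lambda>i. c * a i"])
  qed
  moreover have "F ` I \<subseteq> ?U"
  proof safe
    fix i assume "i \<in> I"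
    then have "F i = (\<Sum>j\<in>I. scale (if j = i then 1 else 0) (F j))"
      using assms(1) by (simp add: if_distrib[of "\<lambda>c. scale c _"] cong: if_cong)
    then show "\<exists>a. F i = (\<Sum>i\<in>I. scale (a i) (F i))" by (rule exI[of _ "\<lambda>j. if j = i then 1 else 0"])
  qed
  ultimately have "span (F ` I) \<subseteq> ?U" by (rule span_minimal[rotated])
  with assms(2) that show thesis by auto
qed

text \<open>\<open>dim\<close> is a cardinality and hence 0 for an infinite basis; a lower bound for
  it therefore requires \<open>W\<close> to lie in the span of a finite set.\<close>

lemma card_le_dim:
  assumes "finite I" "finite B" "W \<subseteq> span B" "\<And>i. i \<in> I \<Longrightarrow> F i \<in> W"
    "\<And>a. (\<Sum>i\<in>I. scale (a i) (F i)) = 0 \<Longrightarrow> \<forall>i\<in>I. a i = 0"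
  shows "card I \<le> dim W"
proof -
  have ind: "inj_on F I" "independent (F ` I)"
    using family_independent[OF assms(1,5)] by blast+
  have "F ` I \<subseteq> W" using assms(4) by auto
  then obtain C where C: "F ` I \<subseteq> C" "C \<subseteq> W" "independent C" "W \<subseteq> span C"
    using ind(2) by (rule maximal_independent_subset_extend)
  have "finite C" using independent_span_bound[OF assms(2) C(3)] C(2) assms(3) by blast
  moreover have "dim W = card C" using C(2,4,3) by (rule basis_card_eq_dim[symmetric])
  ultimately show ?thesis
    using C(1) ind(1) by (metis card_image card_mono)
qed

lemma dim_eq_card_family:
  assumes "finite I" "\<And>i. i \<in> I \<Longrightarrow> F i \<in> W" "W \<subseteq> span (F ` I)"
    "\<And>a. (\<Sum>i\<in>I. scale (a i) (F i)) = 0 \<Longrightarrow> \<forall>i\<in>I. a i = 0"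
  shows "dim W = card I"
proof -
  have ind: "inj_on F I" "independent (F ` I)"
    using family_independent[OF assms(1,4)] by blast+
  show ?thesis
    by (rule dim_unique[of "F ` I"]) (use assms ind in \<open>auto simp: card_image\<close>)
qed

end

text \<open>A basis \<open>C\<close> of the kernel inside \<open>W\<close> is extended to a basis
  \<open>D\<close> of \<open>W\<close>; then \<open>f\<close> maps \<open>D - C\<close> to a basis
  of the image. The finite set \<open>B\<close> makes all three dimensions genuine.\<close>

lemma rank_nullity:
  assumes "vector_space s1" "vector_space s2" "Vector_Spaces.linear s1 s2 f"
    and W: "module.subspace s1 W" and B: "finite B" "W \<subseteq> module.span s1 B"
  shows "vector_space.dim s1 W = vector_space.dim s1 {w\<in>W. f w = 0} + vector_space.dim s2 (f ` W)"
proof -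
  interpret a: vector_space s1 by (rule assms)
  interpret b: vector_space s2 by (rule assms)
  interpret f: Vector_Spaces.linear s1 s2 f by (rule assms)
  let ?N = "{w\<in>W. f w = 0}"
  obtain C where C: "C \<subseteq> ?N" "a.independent C" "?N \<subseteq> a.span C" "card C = a.dim ?N"
    by (rule a.basis_exists)
  have "C \<subseteq> W" using C by auto
  then obtain D where D: "C \<subseteq> D" "D \<subseteq> W" "a.independent D" "W \<subseteq> a.span D"
    using C(2) by (rule a.maximal_independent_subset_extend)
  have finD: "finite D" using a.independent_span_bound[OF B(1) D(3)] D(2) B(2) by blast
  have dW: "a.dim W = card D" using D(2,4,3) by (rule a.basis_card_eq_dim[symmetric])
  have dN: "a.dim ?N = card C" using C(4) by simp
  have "b.dim (f ` W) = card (D - C)"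
  proof (rule b.dim_eq_card_family)
    show "finite (D - C)" using finD by simp
    show "f i \<in> f ` W" if "i \<in> D - C" for i using that D by auto
    show "f ` W \<subseteq> b.span (f ` (D - C))"
    proof safe
      fix w assume "w \<in> W"
      then have "w \<in> a.span D" using D by auto
      then have "f w \<in> b.span (f ` D)" unfolding f.span_image by (rule imageI)
      moreover have "b.span (f ` D) \<subseteq> b.span (f ` (D - C))"
      proof (rule b.span_minimal)
        show "f ` D \<subseteq> b.span (f ` (D - C))"
        proof safe
          fix x assume x: "x \<in> D"
          show "f x \<in> b.span (f ` (D - C))"
          proof (cases "x \<in> C")
            case True then have "f x = 0" using C by auto
            then show ?thesis by (simp add: b.span_zero)
          next
            case False with x show ?thesis by (intro b.span_base) auto
          qed
        qed
      qed simp
      ultimately show "f w \<in> b.span (f ` (D - C))" by blast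
    qed
  next
    fix c assume c: "(\<Sum>i\<in>D - C. s2 (c i) (f i)) = 0"
    let ?w = "\<Sum>i\<in>D - C. s1 (c i) i"
    have "f ?w = 0" using c by (simp add: f.sum f.scale)
    moreover have "?w \<in> W" using D by (intro a.subspace_sum[OF W] a.subspace_scale[OF W]) auto
    ultimately have "?w \<in> a.span C" using C by auto
    then have "?w \<in> a.span ((\<lambda>i. i) ` C)" by simp
    with finite_subset[OF D(1) finD] obtain e where e: "?w = (\<Sum>i\<in>C. s1 (e i) i)"
      by (rule a.span_image_finite)
    \<comment> \<open>Subtracting the expansion of \<open>?w\<close> in \<open>C\<close> from its
      defining sum gives a relation on all of \<open>D\<close>.\<close>
    let ?g = "\<lambda>i. if i \<in> C then - e i else c i"
    have "(\<Sum>i\<in>D. s1 (?g i) i) = (\<Sum>i\<in>D - C. s1 (?g i) i) + (\<Sum>i\<in>C. s1 (?g i) i)"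
      using sum.subset_diff[OF D(1) finD] by blast
    also have "(\<Sum>i\<in>D - C. s1 (?g i) i) = ?w" by (rule sum.cong) auto
    also have "(\<Sum>i\<in>C. s1 (?g i) i) = - ?w" by (simp add: e a.scale_minus_left sum_negf)
    finally have "(\<Sum>i\<in>D. s1 (?g i) i) = 0" by simp
    then have "\<forall>i\<in>D. ?g i = 0"
      using a.independentD[OF D(3) finD subset_refl, of ?g] by blast
    then show "\<forall>i\<in>D - C. c i = 0" by auto
  qed
  moreover have "card (D - C) = card D - card C" "card C \<le> card D"
    using D finD by (simp_all add: card_Diff_subset finite_subset card_mono)
  ultimately show ?thesis using dW dN by simp
qed

section \<open>Leading terms\<close>

definition lt :: "('x trm \<Rightarrow> 'x trm \<Rightarrow> bool) \<Rightarrow> ('x, 'f::zero) mpoly \<Rightarrow> 'x trm" where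
  "lt prec f = (THE t. t \<in> pkeys f \<and> (\<forall>s\<in>pkeys f. s = t \<or> prec s t))"

locale tord =
  fixes prec :: "'x trm \<Rightarrow> 'x trm \<Rightarrow> bool"
  assumes torder: "term_order prec"
begin

lemma prec_irrefl: "\<not> prec s s" using torder by (simp add: term_order_def)
lemma prec_trans: "prec s t \<Longrightarrow> prec t u \<Longrightarrow> prec s u" using torder unfolding term_order_def by blast
lemma prec_total: "s \<noteq> t \<Longrightarrow> prec s t \<or> prec t s" using torder unfolding term_order_def by blast
lemma prec_add: "prec s t \<Longrightarrow> prec (s + u) (t + u)" using torder unfolding term_order_def by blast
lemma prec_asym: "prec s t \<Longrightarrow> \<not> prec t s" using prec_irrefl prec_trans by blast

lemma prec_add_left: "prec s t \<Longrightarrow> prec (u + s) (u + t)"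
  using prec_add by (simp add: add.commute)

lemma prec_add_cancel: "prec (s + u) (t + u) \<longleftrightarrow> prec s t"
  by (metis prec_add prec_asym prec_irrefl prec_total)

lemma prec_add_mono: "prec s t \<Longrightarrow> prec u v \<Longrightarrow> prec (s + u) (t + v)"
  using prec_add prec_add_left prec_trans by blast

lemma finite_has_max:
  assumes "finite T" "T \<noteq> {}" shows "\<exists>t\<in>T. \<forall>s\<in>T. s = t \<or> prec s t"
  using assms
proof (induction T rule: finite_ne_induct)
  case (insert x F)
  then obtain t where t: "t \<in> F" "\<forall>s\<in>F. s = t \<or> prec s t" by blast
  show ?case
  proof (cases "prec x t")
    case True then show ?thesis using t by auto
  next
    case False
    then have "x = t \<or> prec t x" using prec_total by blast
    then have "\<forall>s\<in>F. s = x \<or> prec s x" using t prec_trans by metis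
    then show ?thesis by auto
  qed
qed simp

lemma lt_unique:
  assumes "t \<in> pkeys f" "\<And>s. s \<in> pkeys f \<Longrightarrow> s = t \<or> prec s t"
  shows "lt prec f = t"
  unfolding lt_def
proof (rule the_equality)
  show "t \<in> pkeys f \<and> (\<forall>s\<in>pkeys f. s = t \<or> prec s t)" using assms by simp
  fix u assume u: "u \<in> pkeys f \<and> (\<forall>s\<in>pkeys f. s = u \<or> prec s u)"
  show "u = t" using u assms(1) assms(2)[of u] prec_asym[of u t] by auto
qed

lemma lt_props:
  assumes "f \<noteq> 0"
  shows lt_in_keys: "lt prec f \<in> pkeys f"
    and lt_max: "s \<in> pkeys f \<Longrightarrow> s = lt prec f \<or> prec s (lt prec f)"
proof -
  have "pkeys f \<noteq> {}" using assms by (simp add: keys_empty_iff)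
  then obtain t where "t \<in> pkeys f" "\<forall>s\<in>pkeys f. s = t \<or> prec s t"
    using finite_has_max[of "pkeys f"] by auto
  moreover from this have "lt prec f = t" by (intro lt_unique) auto
  ultimately show "lt prec f \<in> pkeys f" "s \<in> pkeys f \<Longrightarrow> s = lt prec f \<or> prec s (lt prec f)"
    by auto
qed

lemma plk_lt_nonzero: "f \<noteq> 0 \<Longrightarrow> plk f (lt prec f) \<noteq> 0"
  using lt_in_keys by (simp add: in_keys_iff)

lemma plk_above_lt: "f \<noteq> 0 \<Longrightarrow> prec (lt prec f) s \<Longrightarrow> plk f s = 0"
  using lt_max prec_asym prec_irrefl by (metis in_keys_iff)

lemma lt_monomial_mult:
  fixes f :: "('x, 'f::comm_ring_1) mpoly"
  assumes "f \<noteq> 0"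
  shows "lt prec (monomial s * f) = s + lt prec f"
proof (rule lt_unique)
  show "s + lt prec f \<in> pkeys (monomial s * f)"
    using lt_in_keys[OF assms] by (auto simp: monomial_mult_keys)
  fix u assume "u \<in> pkeys (monomial s * f)"
  then obtain v where "v \<in> pkeys f" "u = s + v" by (auto simp: monomial_mult_keys)
  then show "u = s + lt prec f \<or> prec u (s + lt prec f)"
    using lt_max[OF assms, of v] prec_add_left[of v "lt prec f" s] by auto
qed

lemma monomial_mult_nonzero: "(f :: ('x, 'f::comm_ring_1) mpoly) \<noteq> 0 \<Longrightarrow> monomial s * f \<noteq> 0"
  by (metis image_is_empty keys_empty_iff monomial_mult_keys)

text \<open>Among the members with non-zero coefficient, the one with the largest leading term is
  the only one in which this term occurs, so it cannot cancel.\<close>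

lemma lt_independent:
  fixes F :: "'i \<Rightarrow> ('x, 'f::field) mpoly"
  assumes "finite I" "\<And>i. i \<in> I \<Longrightarrow> F i \<noteq> 0" "inj_on (\<lambda>i. lt prec (F i)) I"
    and sum: "(\<Sum>i\<in>I. scale (a i) (F i)) = 0"
  shows "\<forall>i\<in>I. a i = 0"
proof (rule ccontr)
  let ?J = "{i\<in>I. a i \<noteq> 0}"
  assume "\<not> ?thesis"
  then have "finite ((\<lambda>i. lt prec (F i)) ` ?J)" "(\<lambda>i. lt prec (F i)) ` ?J \<noteq> {}" using assms(1) by auto
  then obtain i where i: "i \<in> ?J" "\<forall>j\<in>?J. lt prec (F j) = lt prec (F i) \<or> prec (lt prec (F j)) (lt prec (F i))"
    using finite_has_max[of "(\<lambda>i. lt prec (F i)) ` ?J"] by auto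
  let ?t = "lt prec (F i)"
  have "0 = plk (\<Sum>i\<in>I. scale (a i) (F i)) ?t" by (simp add: sum)
  also have "\<dots> = (\<Sum>j\<in>I. a j * plk (F j) ?t)" by (simp add: lookup_sum)
  also have "\<dots> = (\<Sum>j\<in>{i}. a j * plk (F j) ?t)"
  proof (rule sum.mono_neutral_right)
    show "\<forall>j\<in>I - {i}. a j * plk (F j) ?t = 0"
    proof
      fix j assume j: "j \<in> I - {i}"
      show "a j * plk (F j) ?t = 0"
      proof (cases "a j = 0")
        case False
        then have "lt prec (F j) \<noteq> ?t" using assms(3) j i by (auto simp: inj_on_def)
        with False j i have "prec (lt prec (F j)) ?t" by auto
        then show ?thesis using plk_above_lt[of "F j"] assms(2) j by auto
      qed simp
    qed
  qed (use i assms in auto)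
  also have "\<dots> \<noteq> 0" using i plk_lt_nonzero[OF assms(2)] by auto
  finally show False by simp
qed

text \<open>Division: a multiple of an element of \<open>U\<close> with the same leading term is
  subtracted. The number of terms of \<open>S\<close> below the leading term decreases.\<close>

lemma lt_spans:
  fixes W U :: "('x, 'f::field) mpoly set"
  assumes "mp.subspace W" "mp.subspace U" "U \<subseteq> W" "finite S" "\<And>f. f \<in> W \<Longrightarrow> pkeys f \<subseteq> S"
    and lts: "lt prec ` (W - {0}) \<subseteq> lt prec ` (U - {0})"
  shows "W \<subseteq> U"
proof
  fix f assume "f \<in> W"
  then show "f \<in> U"
  proof (induction "card {s\<in>S. prec s (lt prec f)}" arbitrary: f rule: less_induct)
    case less
    show ?case
    proof (cases "f = 0")
      case True then show ?thesis using assms(2) by (simp add: mp.subspace_0)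
    next
      case False
      then have "lt prec f \<in> lt prec ` (W - {0})" using less.prems by simp
      then have "lt prec f \<in> lt prec ` (U - {0})" by (rule subsetD[OF lts])
      then obtain g where g': "lt prec f = lt prec g" "g \<in> U - {0}" by (rule imageE)
      then have g: "g \<in> U" "g \<noteq> 0" "lt prec g = lt prec f" by auto
      let ?t = "lt prec f"
      define c where "c = plk f ?t / plk g ?t"
      define h where "h = f - scale c g"
      have hW: "h \<in> W"
        unfolding h_def
        by (intro mp.subspace_diff[OF assms(1)] mp.subspace_scale[OF assms(1)] less.prems subsetD[OF assms(3)] g)
      have ht: "plk h ?t = 0"
        using plk_lt_nonzero[OF g(2)] g by (simp add: h_def lookup_minus c_def)
      have "h \<in> U"
      proof (cases "h = 0")
        case True then show ?thesis using assms(2) by (simp add: mp.subspace_0)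
      next
        case hn: False
        have hlt: "prec (lt prec h) ?t"
        proof (rule ccontr)
          assume "\<not> prec (lt prec h) ?t"
          moreover have "lt prec h \<noteq> ?t" using ht plk_lt_nonzero[OF hn] by auto
          ultimately have *: "prec ?t (lt prec h)" using prec_total by blast
          then have "plk f (lt prec h) = 0" "plk g (lt prec h) = 0"
            using plk_above_lt[OF False] plk_above_lt[OF g(2)] g(3) by auto
          then have "plk h (lt prec h) = 0" by (simp add: h_def lookup_minus)
          then show False using plk_lt_nonzero[OF hn] by simp
        qed
        have "{s\<in>S. prec s (lt prec h)} \<subseteq> {s\<in>S. prec s ?t}"
          using prec_trans[OF _ hlt] by auto
        moreover have "lt prec h \<in> S" using lt_in_keys[OF hn] assms(5)[OF hW] by auto
        ultimately have "{s\<in>S. prec s (lt prec h)} \<subset> {s\<in>S. prec s ?t}"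
          using hlt prec_irrefl by blast
        then have "card {s\<in>S. prec s (lt prec h)} < card {s\<in>S. prec s ?t}"
          using assms(4) by (intro psubset_card_mono) auto
        then show ?thesis using less.hyps hW by blast
      qed
      moreover have "f = h + scale c g" by (simp add: h_def)
      ultimately show ?thesis using mp.subspace_add[OF assms(2) _ mp.subspace_scale[OF assms(2) g(1)]] by simp
    qed
  qed
qed

text \<open>One element for each leading term makes a basis, by \<open>lt_independent\<close> and
  \<open>lt_spans\<close>. Dimensions become numbers of terms, which is how points are compared with
  the monomial point \<open>vs L\<close>.\<close>

lemma vdim_lt:
  fixes W :: "('x, 'f::field) mpoly set"
  assumes "mp.subspace W" "finite S" "\<And>f. f \<in> W \<Longrightarrow> pkeys f \<subseteq> S"
  shows "vdim W = card (lt prec ` (W - {0}))"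
proof -
  let ?T = "lt prec ` (W - {0})"
  have "?T \<subseteq> S" using subsetD[OF assms(3) lt_in_keys] by auto
  then have fin: "finite ?T" using assms(2) finite_subset by blast
  have "\<forall>t\<in>?T. \<exists>f. f \<in> W \<and> f \<noteq> 0 \<and> lt prec f = t" by auto
  then obtain F where "\<forall>t\<in>?T. F t \<in> W \<and> F t \<noteq> 0 \<and> lt prec (F t) = t" by (rule bchoice[THEN exE])
  then have F: "\<And>t. t \<in> ?T \<Longrightarrow> F t \<in> W" "\<And>t. t \<in> ?T \<Longrightarrow> F t \<noteq> 0" "\<And>t. t \<in> ?T \<Longrightarrow> lt prec (F t) = t"
    by blast+
  have "mp.span (F ` ?T) \<subseteq> W" using F(1) by (intro mp.span_minimal assms) auto
  moreover have "?T \<subseteq> lt prec ` (mp.span (F ` ?T) - {0})"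
  proof
    fix t assume t: "t \<in> ?T"
    then have "F t \<in> mp.span (F ` ?T) - {0}" using F(2)[OF t] by (simp add: mp.span_base)
    then show "t \<in> lt prec ` (mp.span (F ` ?T) - {0})" using F(3)[OF t] by (metis imageI)
  qed
  ultimately have "W \<subseteq> mp.span (F ` ?T)"
    using assms by (intro lt_spans[of W _ S]) auto
  moreover have "inj_on (\<lambda>t. lt prec (F t)) ?T" by (rule inj_onI) (simp only: F(3))
  ultimately show ?thesis
    unfolding vdim_def
    by (intro mp.dim_eq_card_family[OF fin F(1)] lt_independent[OF fin F(2)]) simp_all
qed

lemma sorted_list_exists:
  assumes "finite T" shows "\<exists>xs. set xs = T \<and> length xs = card T \<and> sorted_wrt (\<lambda>s t. prec t s) xs"
  using assms
proof (induction "card T" arbitrary: T)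
  case (Suc n)
  then have "T \<noteq> {}" by auto
  then obtain t where t: "t \<in> T" "\<forall>s\<in>T. s = t \<or> prec s t" using finite_has_max Suc by blast
  have "card (T - {t}) = n" using Suc t by simp
  then obtain xs where xs: "set xs = T - {t}" "length xs = n" "sorted_wrt (\<lambda>s t. prec t s) xs"
    using Suc.hyps(1)[of "T - {t}"] Suc.prems by auto
  then have "set (t # xs) = T" "length (t # xs) = card T" "sorted_wrt (\<lambda>s t. prec t s) (t # xs)"
    using t Suc.hyps(2) by auto
  then show ?case by blast
qed simp

lemma sorted_distinct: "sorted_wrt (\<lambda>s t. prec t s) xs \<Longrightarrow> distinct xs"
  by (induction xs) (auto simp: prec_irrefl)

lemma sorted_unique:
  "sorted_wrt (\<lambda>s t. prec t s) xs \<Longrightarrow> sorted_wrt (\<lambda>s t. prec t s) ys \<Longrightarrow> set xs = set ys \<Longrightarrow> xs = ys"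
proof (induction xs arbitrary: ys)
  case (Cons x xs)
  then obtain y ys' where y: "ys = y # ys'" by (cases ys) auto
  have xy: "x = y"
  proof (rule ccontr)
    assume "x \<noteq> y"
    then have "x \<in> set ys'" "y \<in> set xs" using Cons.prems(3) y by auto
    then show False using Cons.prems y prec_asym by auto
  qed
  moreover have "x \<notin> set xs" "y \<notin> set ys'"
    using sorted_distinct[OF Cons.prems(1)] sorted_distinct[OF Cons.prems(2)] y by auto
  ultimately have "set xs = set ys'" using Cons.prems(3) y by auto
  then show ?case using Cons y xy by auto
qed simp

end

subsection \<open>Minors\<close>

definition cmat :: "nat \<Rightarrow> (nat \<Rightarrow> ('x, 'f::comm_ring_1) mpoly) \<Rightarrow> (nat \<Rightarrow> 'x trm) \<Rightarrow> 'f mat" where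
  "cmat N F \<rho> = Matrix.mat N N (\<lambda>(i, j). plk (F i) (\<rho> j))"

lemma cmat_carrier [simp]: "cmat N F \<rho> \<in> carrier_mat N N"
  by (simp add: cmat_def)

lemma det_cmat_independent:
  fixes F :: "nat \<Rightarrow> ('x, 'f::field) mpoly"
  assumes "Determinant.det (cmat N F \<rho>) \<noteq> 0" "(\<Sum>i<N. scale (a i) (F i)) = 0" "i < N"
  shows "a i = 0"
proof (rule ccontr)
  assume ai: "a i \<noteq> 0"
  let ?v = "Matrix.vec N a"
  have "transpose_mat (cmat N F \<rho>) *\<^sub>v ?v = 0\<^sub>v N"
  proof (rule eq_vecI)
    fix j assume j: "j < dim_vec (0\<^sub>v N :: 'f Matrix.vec)"
    have "vec_index (transpose_mat (cmat N F \<rho>) *\<^sub>v ?v) j = (\<Sum>i<N. a i * plk (F i) (\<rho> j))"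
      using j by (simp add: cmat_def scalar_prod_def mult.commute lessThan_atLeast0)
    also have "\<dots> = plk (\<Sum>i<N. scale (a i) (F i)) (\<rho> j)" by (simp add: lookup_sum)
    also have "\<dots> = 0" using assms by simp
    finally show "vec_index (transpose_mat (cmat N F \<rho>) *\<^sub>v ?v) j = vec_index (0\<^sub>v N) j" using j by simp
  qed (simp add: cmat_def)
  moreover have "?v \<noteq> 0\<^sub>v N" using ai assms(3) by (metis index_vec index_zero_vec(1))
  ultimately have "Determinant.det (transpose_mat (cmat N F \<rho>)) = 0"
    by (subst det_0_iff_vec_prod_zero_field[of _ N]) (auto intro!: exI[of _ ?v])
  then show False using assms(1) by (simp add: Determinant.det_transpose[of _ N])
qed

lemma cmat_mult:
  fixes F :: "nat \<Rightarrow> ('x, 'f::field) mpoly"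
  assumes "\<And>i. i < N \<Longrightarrow> G i = (\<Sum>j<N. scale (A i j) (F j))"
  shows "cmat N G \<rho> = Matrix.mat N N (\<lambda>(i, j). A i j) * cmat N F \<rho>"
  by (rule eq_matI) (auto simp: cmat_def assms lookup_sum scalar_prod_def lessThan_atLeast0)

text \<open>Echelon form: elements of the span with the descending leading terms \<open>xs\<close>
  as columns have a triangular coefficient matrix with non-zero diagonal. It is the product of a
  base change matrix and the minor of \<open>F\<close>.\<close>

lemma (in tord) minor_nonzero:
  fixes F :: "nat \<Rightarrow> ('x, 'f::field) mpoly"
  assumes "\<And>a. (\<Sum>i<N. scale (a i) (F i)) = 0 \<Longrightarrow> \<forall>i<N. a i = 0"
  obtains \<rho> where "Determinant.det (cmat N F \<rho>) \<noteq> 0"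
proof -
  let ?W = "mp.span (F ` {..<N})" and ?S = "\<Union>i<N. pkeys (F i)"
  have keys: "pkeys f \<subseteq> ?S" if f: "f \<in> ?W" for f
  proof
    fix t assume t: "t \<in> pkeys f"
    obtain a where "f = (\<Sum>i<N. scale (a i) (F i))" using mp.span_image_finite[OF _ f] by auto
    then have "plk f t = (\<Sum>i<N. a i * plk (F i) t)" by (simp add: lookup_sum)
    then have "\<exists>i<N. plk (F i) t \<noteq> 0" using t
      by (metis (mono_tags, lifting) in_keys_iff lessThan_iff mult_zero_right sum.neutral)
    then show "t \<in> ?S" by (auto simp: in_keys_iff)
  qed
  let ?T = "lt prec ` (?W - {0})"
  have "vdim ?W = card {..<N}" unfolding vdim_def
  proof (rule mp.dim_eq_card_family)
    show "\<forall>i\<in>{..<N}. a i = 0" if "(\<Sum>i<N. scale (a i) (F i)) = 0" for a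
      using assms[OF that] by simp
  qed (simp_all add: mp.span_base)
  moreover have "vdim ?W = card ?T" by (rule vdim_lt[of _ ?S]) (simp_all add: keys)
  ultimately have cT: "card ?T = N" by simp
  have "?T \<subseteq> ?S" using subsetD[OF keys lt_in_keys] by auto
  moreover have "finite ?S" by auto
  ultimately have "finite ?T" by (meson finite_subset)
  then obtain xs where xs: "set xs = ?T" "length xs = N" "sorted_wrt (\<lambda>s t. prec t s) xs"
    using sorted_list_exists[of ?T] cT by auto
  have "\<forall>j<N. \<exists>g. g \<in> ?W \<and> g \<noteq> 0 \<and> lt prec g = xs ! j"
  proof (intro allI impI)
    fix j assume "j < N"
    then have "xs ! j \<in> ?T" using xs by (metis nth_mem)
    then obtain g where "xs ! j = lt prec g" "g \<in> ?W - {0}" by (rule imageE)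
    then show "\<exists>g. g \<in> ?W \<and> g \<noteq> 0 \<and> lt prec g = xs ! j" by auto
  qed
  then obtain G where "\<forall>j<N. G j \<in> ?W \<and> G j \<noteq> 0 \<and> lt prec (G j) = xs ! j"
    unfolding choice_iff' by (rule exE)
  then have G: "\<And>j. j < N \<Longrightarrow> G j \<in> ?W \<and> G j \<noteq> 0 \<and> lt prec (G j) = xs ! j" by simp
  have "\<forall>j<N. \<exists>a. G j = (\<Sum>i<N. scale (a i) (F i))"
  proof (intro allI impI)
    fix j assume "j < N"
    then have "G j \<in> ?W" using G by simp
    with finite_lessThan obtain a where "G j = (\<Sum>i<N. scale (a i) (F i))" by (rule mp.span_image_finite)
    then show "\<exists>a. G j = (\<Sum>i<N. scale (a i) (F i))" by (rule exI[of _ a])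
  qed
  then obtain A where "\<forall>j<N. G j = (\<Sum>i<N. scale (A j i) (F i))"
    unfolding choice_iff' by (rule exE)
  then have A: "\<And>j. j < N \<Longrightarrow> G j = (\<Sum>i<N. scale (A j i) (F i))" by simp
  let ?\<rho> = "(!) xs"
  have "upper_triangular (cmat N G ?\<rho>)"
  proof (rule upper_triangularI)
    fix i j assume ij: "j < i" "i < dim_row (cmat N G ?\<rho>)"
    then have "prec (lt prec (G i)) (xs ! j)"
      using G xs by (simp add: cmat_def sorted_wrt_iff_nth_less)
    then show "cmat N G ?\<rho> $$ (i, j) = 0"
      using ij plk_above_lt[of "G i" "xs ! j"] G[of i] by (simp add: cmat_def)
  qed
  then have "Determinant.det (cmat N G ?\<rho>) = prod_list (diag_mat (cmat N G ?\<rho>))"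
    by (rule det_upper_triangular[of _ N]) simp
  also have "\<dots> \<noteq> 0"
  proof -
    have "plk (G i) (xs ! i) \<noteq> 0" if "i < N" for i
      using G[OF that] plk_lt_nonzero[of "G i"] by simp
    then show ?thesis by (auto simp: prod_list_zero_iff diag_mat_def cmat_def)
  qed
  finally have "Determinant.det (cmat N G ?\<rho>) \<noteq> 0" .
  moreover have "Determinant.det (cmat N G ?\<rho>) = Determinant.det (Matrix.mat N N (\<lambda>(i, j). A i j)) * Determinant.det (cmat N F ?\<rho>)"
    by (subst cmat_mult[OF A]) (simp, rule Determinant.det_mult[of _ N], simp_all)
  ultimately have "Determinant.det (cmat N F ?\<rho>) \<noteq> 0" by auto
  then show thesis by (rule that)
qed

lemma sum_fun_apply: "(\<Sum>i\<in>A. f i) x = (\<Sum>i\<in>A. f i x)"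
  by (induction A rule: infinite_finite_induct) auto


section \<open>Hilbert functions\<close>

text \<open>Pascal's rule: a term either avoids \<open>x\<close>, or is \<open>x\<close> times a
  term of degree smaller by one.\<close>

lemma card_terms_le:
  assumes "finite S"
  shows "card {t :: 'x trm. pkeys t \<subseteq> S \<and> tdeg t \<le> N} = (card S + N) choose card S"
  using assms
proof (induction S arbitrary: N rule: finite_induct)
  case empty
  have "{t :: 'x trm. pkeys t \<subseteq> {} \<and> tdeg t \<le> N} = {0}" by (auto simp: keys_empty_iff)
  then show ?case by simp
next
  case (insert x S)
  let ?M = "\<lambda>S N. {t :: 'x trm. pkeys t \<subseteq> S \<and> tdeg t \<le> N}"
  show ?case
  proof (induction N)
    case 0
    have "?M (insert x S) 0 = {0}" by (auto simp: tdeg_eq_0_iff)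
    then show ?case by simp
  next
    case (Suc N)
    have eq: "?M (insert x S) (Suc N) = ?M S (Suc N) \<union> (+) (var x) ` ?M (insert x S) N"
    proof (intro equalityI subsetI)
      fix t assume t: "t \<in> ?M (insert x S) (Suc N)"
      show "t \<in> ?M S (Suc N) \<union> (+) (var x) ` ?M (insert x S) N"
      proof (cases "x \<in> pkeys t")
        case True
        then have *: "t = (t - var x) + var x" by (rule tdeg_minus_var)
        then have "tdeg t = tdeg (t - var x) + 1" by (metis tdeg_add tdeg_var)
        moreover have "pkeys (t - var x) \<subseteq> pkeys t"
          by (auto simp: in_keys_iff lookup_minus)
        ultimately have "t - var x \<in> ?M (insert x S) N" using t by auto
        moreover have "t = var x + (t - var x)" by (subst add.commute) (rule *)
        ultimately show ?thesis by (intro UnI2 image_eqI)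
      qed (use t in auto)
    next
      fix t assume "t \<in> ?M S (Suc N) \<union> (+) (var x) ` ?M (insert x S) N"
      then show "t \<in> ?M (insert x S) (Suc N)"
      proof
        assume "t \<in> (+) (var x) ` ?M (insert x S) N"
        then obtain u where u: "t = var x + u" "u \<in> ?M (insert x S) N" by auto
        have "pkeys t \<subseteq> insert x (pkeys u)"
          using u Poly_Mapping.keys_add[of "var x" u] by (auto simp: var_def)
        then show ?thesis using u by (auto simp: tdeg_add)
      qed auto
    qed
    have "?M S (Suc N) \<inter> (+) (var x) ` ?M (insert x S) N = {}"
    proof -
      have "x \<in> pkeys (var x + u)" for u :: "'x trm"
        by (simp add: in_keys_iff lookup_add var_def)
      then show ?thesis using insert.hyps by auto
    qed
    then have "card (?M (insert x S) (Suc N)) = card (?M S (Suc N)) + card ((+) (var x) ` ?M (insert x S) N)"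
      unfolding eq using finite_tdeg_eq[of S "Suc N"] finite_tdeg_eq[of "insert x S" N] insert.hyps(1)
      by (intro card_Un_disjoint) auto
    also have "card ((+) (var x) ` ?M (insert x S) N) = card (?M (insert x S) N)"
      by (intro card_image inj_onI) simp
    finally show ?case using insert Suc by simp
  qed
qed

lemma card_terms_eq:
  assumes "CARD('x::finite) = n + 1"
  shows "card {t :: 'x trm. tdeg t = d} = (n + d) choose n"
proof (cases d)
  case 0
  have "{t :: 'x trm. tdeg t = 0} = {0}" by (auto simp: tdeg_eq_0_iff)
  then show ?thesis using 0 by simp
next
  case (Suc e)
  let ?M = "\<lambda>N. {t :: 'x trm. tdeg t \<le> N}"
  have c: "card (?M N) = (n + 1 + N) choose (n + 1)" for N
    using card_terms_le[of "UNIV :: 'x set" N] assms by simp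
  have "{t :: 'x trm. tdeg t = d} = ?M d - ?M e" using Suc by auto
  moreover have "finite (?M e)" using finite_tdeg_eq[of "UNIV :: 'x set" e] by simp
  moreover have "?M e \<subseteq> ?M d" using Suc by auto
  ultimately have "card {t :: 'x trm. tdeg t = d} = card (?M d) - card (?M e)"
    by (simp add: card_Diff_subset)
  then show ?thesis unfolding c by (simp add: Suc)
qed

lemma monomials_independent:
  assumes "finite T" "(\<Sum>t\<in>T. scale (a t) (monomial t)) = (0 :: ('x, 'f::field) mpoly)" "t \<in> T"
  shows "a t = 0"
proof -
  have "0 = plk (\<Sum>t\<in>T. scale (a t) (monomial t :: ('x, 'f) mpoly)) t" using assms by simp
  also have "\<dots> = (\<Sum>s\<in>T. if s = t then a s else 0)"
    unfolding lookup_sum by (rule sum.cong) (auto simp: plk_monomial)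
  also have "\<dots> = a t" using assms(1,3) by simp
  finally show ?thesis by simp
qed

lemma homog_span_monomials: "homog d = mp.span (monomial ` {t :: 'x::finite trm. tdeg t = d})"
proof
  show "homog d \<subseteq> mp.span (monomial ` {t :: 'x::finite trm. tdeg t = d})"
  proof
    fix f :: "('x, 'b) mpoly" assume "f \<in> homog d"
    then have *: "f = (\<Sum>t\<in>{t. tdeg t = d}. scale (plk f t) (monomial t))" by (rule homog_eq_sum_monomials)
    show "f \<in> mp.span (monomial ` {t :: 'x::finite trm. tdeg t = d})"
      by (subst *) (intro mp.span_sum mp.span_scale mp.span_base imageI)
  qed
  show "mp.span (monomial ` {t :: 'x::finite trm. tdeg t = d}) \<subseteq> homog d"
    by (rule mp.span_minimal[OF _ subspace_homog]) (auto simp: homog_monomial)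
qed

lemma vdim_homog:
  "vdim (homog d :: ('x::finite, 'f::field) mpoly set) = card {t :: 'x trm. tdeg t = d}"
  unfolding vdim_def
proof (rule mp.dim_eq_card_family)
  show "\<forall>t\<in>{t :: 'x trm. tdeg t = d}. a t = 0"
    if "(\<Sum>t\<in>{t. tdeg t = d}. scale (a t) (monomial t)) = (0 :: ('x, 'f) mpoly)" for a
    using monomials_independent[OF _ that] by simp
qed (simp_all add: homog_monomial flip: homog_span_monomials)

text \<open>The binomial coefficient of \<open>t + n - a\<close> over \<open>n\<close> as a
  polynomial in \<open>t\<close>: the Hilbert polynomial of S(-a) in \<open>n + 1\<close>
  variables.\<close>

definition hpoly :: "nat \<Rightarrow> nat \<Rightarrow> rat poly" where
  "hpoly n a = Polynomial.smult (1 / fact n) (\<Prod>i<n. [:of_nat n - of_nat a - of_nat i, 1:])"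

text \<open>The range reaches \<open>n\<close> degrees below the twist: for \<open>d < a\<close>
  both sides are 0. This is what lets the \<open>i\<close>-th step of a resolution have twists up to
  \<open>r + i\<close>.\<close>

lemma poly_hpoly:
  assumes "a \<le> d + n" shows "poly (hpoly n a) (of_nat d) = of_nat ((d + n - a) choose n)"
proof -
  have "(of_nat (d + n - a) :: rat) = of_nat d + of_nat n - of_nat a"
    using assms by (simp add: of_nat_diff)
  then show ?thesis
    by (simp add: hpoly_def binomial_gbinomial gbinomial_prod_rev poly_prod lessThan_atLeast0 algebra_simps)
qed

lemma ideal_iff:
  "module.subspace (*) (I :: ('x, 'f::comm_ring_1) mpoly set) \<longleftrightarrow>
     0 \<in> I \<and> (\<forall>f\<in>I. \<forall>g\<in>I. f + g \<in> I) \<and> (\<forall>f. \<forall>g\<in>I. f * g \<in> I)"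
proof -
  interpret Modules.module "(*) :: ('x, 'f) mpoly \<Rightarrow> _" by unfold_locales (auto simp: algebra_simps)
  show ?thesis by (auto simp: subspace_def)
qed

lemma ideal_subspace: "module.subspace (*) (I :: ('x, 'f::field) mpoly set) \<Longrightarrow> mp.subspace I"
  unfolding ideal_iff by (rule mp.subspaceI) (auto simp: scale_def)

subsection \<open>Graded free modules\<close>

definition fscale :: "'f::field \<Rightarrow> (nat \<Rightarrow> ('x, 'f) mpoly) \<Rightarrow> nat \<Rightarrow> ('x, 'f) mpoly" where
  "fscale c v = (\<lambda>j. scale c (v j))"

lemma fscale_apply [simp]: "fscale c v j = scale c (v j)" by (simp add: fscale_def)

global_interpretation fm: vector_space "fscale :: 'f::field \<Rightarrow> (nat \<Rightarrow> ('x, 'f) mpoly) \<Rightarrow> _"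
  by unfold_locales
    (auto simp: fscale_def fun_eq_iff mp.scale_right_distrib mp.scale_left_distrib)

text \<open>The part of degree \<open>d\<close> of the graded free module. Entries with twist above
  \<open>d\<close> are set to 0 explicitly, because the truncated difference would admit constants
  there.\<close>

definition fdeg :: "nat \<Rightarrow> nat list \<Rightarrow> (nat \<Rightarrow> ('x, 'f::field) mpoly) set" where
  "fdeg d a = {v\<in>free_mod a. \<forall>j<length a. if a ! j \<le> d then v j \<in> homog (d - a ! j) else v j = 0}"

definition fcomp :: "nat \<Rightarrow> nat list \<Rightarrow> (nat \<Rightarrow> ('x, 'f::field) mpoly) \<Rightarrow> nat \<Rightarrow> ('x, 'f) mpoly" where
  "fcomp d a v = (\<lambda>j. if j < length a \<and> a ! j \<le> d then hcomp (d - a ! j) (v j) else 0)"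

lemma fcomp_fdeg: "fcomp d a v \<in> fdeg d a"
  by (auto simp: fcomp_def fdeg_def free_mod_def)

lemma fdegI:
  assumes "\<And>j. j < length a \<Longrightarrow> a ! j \<le> d \<Longrightarrow> v j \<in> homog (d - a ! j)"
    "\<And>j. \<not> (j < length a \<and> a ! j \<le> d) \<Longrightarrow> v j = 0"
  shows "v \<in> fdeg d a"
  using assms by (simp add: fdeg_def free_mod_def)

lemma fdegD1: "v \<in> fdeg d a \<Longrightarrow> j < length a \<Longrightarrow> a ! j \<le> d \<Longrightarrow> v j \<in> homog (d - a ! j)"
  by (simp add: fdeg_def)

lemma fdegD2: "v \<in> fdeg d a \<Longrightarrow> \<not> (j < length a \<and> a ! j \<le> d) \<Longrightarrow> v j = 0"
  by (cases "j < length a") (auto simp: fdeg_def free_mod_def)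

lemma fcomp_id: "v \<in> fdeg d a \<Longrightarrow> fcomp d a v = v"
proof
  fix j assume v: "v \<in> fdeg d a"
  show "fcomp d a v j = v j"
  proof (cases "j < length a \<and> a ! j \<le> d")
    case True
    then show ?thesis using fdegD1[OF v, of j] by (simp add: fcomp_def hcomp_of_homog)
  next
    case False
    then show ?thesis using fdegD2[OF v False] by (simp add: fcomp_def)
  qed
qed

lemma fdeg_free: "v \<in> fdeg d a \<Longrightarrow> v \<in> free_mod a" by (simp add: fdeg_def)

lemma subspace_fdeg: "fm.subspace (fdeg d a)"
proof (rule fm.subspaceI)
  show "0 \<in> fdeg d a" by (simp add: fdeg_def free_mod_def)
  show "x + y \<in> fdeg d a" if "x \<in> fdeg d a" "y \<in> fdeg d a" for x y
    by (rule fdegI) (simp_all add: homog_add fdegD1[OF that(1)] fdegD1[OF that(2)] fdegD2[OF that(1)] fdegD2[OF that(2)])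
  show "fscale c x \<in> fdeg d a" if "x \<in> fdeg d a" for c x
    by (rule fdegI) (simp_all add: homog_scale fdegD1[OF that] fdegD2[OF that])
qed

definition fbasis :: "nat \<times> 'x trm \<Rightarrow> nat \<Rightarrow> ('x, 'f::field) mpoly" where
  "fbasis i = (\<lambda>k. if k = fst i then monomial (snd i) else 0)"

definition findex :: "nat \<Rightarrow> nat list \<Rightarrow> (nat \<times> 'x trm) set" where
  "findex d a = (SIGMA j:{j. j < length a \<and> a ! j \<le> d}. {t. tdeg t = d - a ! j})"

lemma finite_findex [simp]: "finite (findex d a :: (nat \<times> 'x::finite trm) set)"
  by (auto simp: findex_def intro!: finite_SigmaI)

lemma fdeg_span: "fdeg d a \<subseteq> fm.span ((fbasis :: _ \<Rightarrow> nat \<Rightarrow> ('x::finite, 'f::field) mpoly) ` findex d a)"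
proof
  fix v :: "nat \<Rightarrow> ('x, 'f) mpoly" assume v: "v \<in> fdeg d a"
  have "v = (\<Sum>i\<in>findex d a. fscale (plk (v (fst i)) (snd i)) (fbasis i))"
  proof
    fix k
    have "(\<Sum>i\<in>findex d a. fscale (plk (v (fst i)) (snd i)) (fbasis i)) k
        = (\<Sum>i\<in>findex d a. if fst i = k then scale (plk (v k) (snd i)) (monomial (snd i)) else 0)"
      by (subst sum_fun_apply) (auto simp: fbasis_def intro!: sum.cong)
    also have "\<dots> = (\<Sum>i\<in>{i\<in>findex d a. fst i = k}. scale (plk (v k) (snd i)) (monomial (snd i)))"
      by (subst sum.inter_filter) auto
    also have "\<dots> = v k"
    proof (cases "k < length a \<and> a ! k \<le> d")
      case True
      then have "{i\<in>findex d a. fst i = k} = Pair k ` {t :: 'x trm. tdeg t = d - a ! k}"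
        by (auto simp: findex_def)
      then have "(\<Sum>i\<in>{i\<in>findex d a. fst i = k}. scale (plk (v k) (snd i)) (monomial (snd i)))
          = (\<Sum>t\<in>{t :: 'x trm. tdeg t = d - a ! k}. scale (plk (v k) t) (monomial t))"
        by (simp add: sum.reindex inj_on_def)
      then show ?thesis using v True homog_eq_sum_monomials[of "v k" "d - a ! k"] by (auto simp: fdeg_def)
    next
      case False
      then have "{i\<in>findex d a :: (nat \<times> 'x trm) set. fst i = k} = {}" by (auto simp: findex_def)
      moreover have "v k = 0"
        using v False by (cases "k < length a") (auto simp: fdeg_def free_mod_def)
      ultimately show ?thesis by (simp only: sum.empty)
    qed
    finally show "v k = (\<Sum>i\<in>findex d a. fscale (plk (v (fst i)) (snd i)) (fbasis i)) k" by simp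
  qed
  also have "\<dots> \<in> fm.span ((fbasis :: _ \<Rightarrow> nat \<Rightarrow> ('x, 'f) mpoly) ` findex d a)"
    by (intro fm.span_sum fm.span_scale fm.span_base imageI)
  finally show "v \<in> fm.span ((fbasis :: _ \<Rightarrow> nat \<Rightarrow> ('x, 'f) mpoly) ` findex d a)" .
qed

lemma dim_fdeg:
  assumes "CARD('x::finite) = n + 1" "\<And>e. e \<in> set a \<Longrightarrow> e \<le> d + n"
  shows "vector_space.dim fscale (fdeg d a :: (nat \<Rightarrow> ('x, 'f::field) mpoly) set)
    = (\<Sum>j<length a. (d + n - a ! j) choose n)"
proof -
  have "fm.dim (fdeg d a :: (nat \<Rightarrow> ('x, 'f) mpoly) set) = card (findex d a :: (nat \<times> 'x trm) set)"
  proof (rule fm.dim_eq_card_family[OF finite_findex _ fdeg_span])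
    fix i :: "nat \<times> 'x trm" assume "i \<in> findex d a"
    then show "fbasis i \<in> (fdeg d a :: (nat \<Rightarrow> ('x, 'f) mpoly) set)"
      by (auto simp: findex_def fbasis_def fdeg_def free_mod_def homog_monomial)
  next
    fix c assume c: "(\<Sum>i\<in>findex d a. fscale (c i) (fbasis i)) = (0 :: nat \<Rightarrow> ('x, 'f) mpoly)"
    show "\<forall>i\<in>findex d a. c i = 0"
    proof
      fix i :: "nat \<times> 'x trm" assume i: "i \<in> findex d a"
      have "0 = plk ((\<Sum>i\<in>findex d a. fscale (c i) (fbasis i :: nat \<Rightarrow> ('x, 'f) mpoly)) (fst i)) (snd i)"
        by (simp add: c)
      also have "\<dots> = (\<Sum>k\<in>findex d a. if k = i then c k else 0)"
        unfolding sum_fun_apply lookup_sum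
        by (rule sum.cong) (auto simp: fbasis_def plk_monomial prod_eq_iff)
      also have "\<dots> = c i" using i by (simp add: sum.delta)
      finally show "c i = 0" by simp
    qed
  qed
  also have "card (findex d a :: (nat \<times> 'x trm) set) = (\<Sum>j\<in>{j. j < length a \<and> a ! j \<le> d}. (n + (d - a ! j)) choose n)"
    unfolding findex_def by (subst card_SigmaI) (auto simp: card_terms_eq[OF assms(1)])
  \<comment> \<open>A twist above \<open>d\<close> has no terms of degree \<open>d\<close>; on the
    right it contributes a binomial coefficient whose upper entry is below \<open>n\<close>, that is
    0.\<close>
  also have "\<dots> = (\<Sum>j<length a. (d + n - a ! j) choose n)"
  proof (rule sum.mono_neutral_cong_left)
    show "\<forall>i\<in>{..<length a} - {j. j < length a \<and> a ! j \<le> d}. d + n - a ! i choose n = 0"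
    proof
      fix i assume i: "i \<in> {..<length a} - {j. j < length a \<and> a ! j \<le> d}"
      then have "a ! i \<le> d + n" "\<not> a ! i \<le> d" using assms(2)[of "a ! i"] by auto
      then have "d + n - a ! i < n" by linarith
      then show "d + n - a ! i choose n = 0" by simp
    qed
    show "n + (d - a ! j) choose n = d + n - a ! j choose n" if "j \<in> {j. j < length a \<and> a ! j \<le> d}" for j
      using that by (simp add: add.commute)
  qed auto
  finally show ?thesis .
qed

lemma apply_matrix_fcomp:
  assumes "graded_matrix a b D"
  shows "apply_matrix a D (fcomp d a v) = fcomp d b (apply_matrix a D v)"
proof
  fix k
  have ent: "D k j = 0 \<or> k < length b \<and> b ! k \<le> a ! j \<and> D k j \<in> homog (a ! j - b ! k)" for j
    using assms unfolding graded_matrix_def by blast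
  show "apply_matrix a D (fcomp d a v) k = fcomp d b (apply_matrix a D v) k"
  proof (cases "k < length b \<and> b ! k \<le> d")
    case True
    have "D k j * fcomp d a v j = hcomp (d - b ! k) (D k j * v j)" if "j < length a" for j
    proof (cases "D k j = 0")
      case False
      then have e: "b ! k \<le> a ! j" "D k j \<in> homog (a ! j - b ! k)" using ent by auto
      have "a ! j - b ! k \<le> d - b ! k \<longleftrightarrow> a ! j \<le> d" using True e by linarith
      moreover have "d - b ! k - (a ! j - b ! k) = d - a ! j" using e by linarith
      ultimately show ?thesis using that by (simp add: hcomp_mult_homog[OF e(2)] fcomp_def)
    qed simp
    then show ?thesis using True by (simp add: apply_matrix_def fcomp_def hcomp_sum)
  next
    case False
    have "D k j * fcomp d a v j = 0" if "j < length a" for j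
    proof (cases "D k j = 0")
      case False
      then have "\<not> a ! j \<le> d" using ent[of j] \<open>\<not> (k < length b \<and> b ! k \<le> d)\<close> by auto
      then show ?thesis by (simp add: fcomp_def)
    qed simp
    then show ?thesis using False by (auto simp: apply_matrix_def fcomp_def)
  qed
qed

lemma apply_matrix_linear: "Vector_Spaces.linear fscale fscale (apply_matrix a D)"
  by unfold_locales
    (auto simp: apply_matrix_def fun_eq_iff fscale_def distrib_left sum.distrib mp.scale_sum_right scale_mult_right)

text \<open>A graded matrix commutes with taking components, so a preimage of an element of degree
  \<open>d\<close> can be replaced by its component of degree \<open>d\<close>. Thus exactness of a
  resolution holds in each degree.\<close>

lemma image_fdeg:
  assumes "graded_matrix a b D"
  shows "apply_matrix a D ` fdeg d a = {w\<in>apply_matrix a D ` free_mod a. w \<in> fdeg d b}"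
proof (intro equalityI subsetI)
  fix w assume "w \<in> apply_matrix a D ` fdeg d a"
  then obtain v where v: "v \<in> fdeg d a" "w = apply_matrix a D v" by auto
  then have "w = fcomp d b w" using apply_matrix_fcomp[OF assms, of d v] by (simp add: fcomp_id)
  then have "w \<in> fdeg d b" by (metis fcomp_fdeg)
  then show "w \<in> {w\<in>apply_matrix a D ` free_mod a. w \<in> fdeg d b}" using v fdeg_free by blast
next
  fix w assume "w \<in> {w\<in>apply_matrix a D ` free_mod a. w \<in> fdeg d b}"
  then obtain v where v: "w = apply_matrix a D v" "w \<in> fdeg d b" by auto
  then have "w = apply_matrix a D (fcomp d a v)"
    using apply_matrix_fcomp[OF assms, of d v] by (simp add: fcomp_id)
  then show "w \<in> apply_matrix a D ` fdeg d a" using fcomp_fdeg by blast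
qed

subsection \<open>The Hilbert function of a regular ideal\<close>

lemma poly_eq_if_eventually_eq:
  fixes P Q :: "rat poly"
  assumes "\<forall>\<^sub>F d in sequentially. poly P (of_nat d) = poly Q (of_nat d)"
  shows "P = Q"
proof (rule ccontr)
  assume "P \<noteq> Q"
  then have "finite {x. poly (P - Q) x = 0}" by (intro poly_roots_finite) simp
  moreover obtain N where N: "\<And>d. d \<ge> N \<Longrightarrow> poly P (of_nat d) = poly Q (of_nat d)"
    using assms by (auto simp: eventually_sequentially)
  then have "of_nat ` {N..} \<subseteq> {x. poly (P - Q) x = 0}" by auto
  ultimately have "finite (of_nat ` {N..} :: rat set)" by (rule finite_subset[rotated])
  then have "finite {N..}" by (rule finite_imageD) (simp add: inj_on_def)
  then show False by (simp add: infinite_Ici)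
qed

text \<open>With \<open>z i d\<close> the dimension of the image of the \<open>i\<close>-th map in
  degree \<open>d\<close>, exactness gives that \<open>z i d + z (Suc i) d\<close> is the dimension
  of the free module between them, a sum of binomial coefficients that is polynomial for
  \<open>d \<ge> r\<close>. And \<open>z 0 d\<close> belongs to \<open>I\<close>.\<close>

lemma regular_hilbert_function:
  fixes I :: "('x::finite, 'f::field) mpoly set"
  assumes card: "CARD('x) = n + 1" and ideal: "module.subspace (*) I" and reg: "regular_ideal r I"
  obtains R :: "rat poly" where "\<And>d. d \<ge> r \<Longrightarrow> of_nat (vdim (I \<inter> homog d)) = poly R (of_nat d)"
proof -
  obtain a :: "nat \<Rightarrow> nat list" and D :: "nat \<Rightarrow> nat \<Rightarrow> nat \<Rightarrow> ('x, 'f) mpoly"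
    where a0: "a 0 = [0]"
      and gr: "\<And>i. graded_matrix (a (Suc i)) (a i) (D i)"
      and im0: "apply_matrix (a 1) (D 0) ` free_mod (a 1) = {v\<in>free_mod [0]. v 0 \<in> I}"
      and ex: "\<And>i. apply_matrix (a (Suc (Suc i))) (D (Suc i)) ` free_mod (a (Suc (Suc i))) =
             {v\<in>free_mod (a (Suc i)). apply_matrix (a (Suc i)) (D i) v = (\<lambda>_. 0)}"
      and deg: "\<And>i e. e \<in> set (a (Suc i)) \<Longrightarrow> e \<le> r + i"
      and fin: "\<And>i. i > CARD('x) \<Longrightarrow> a i = []"
    using reg unfolding regular_ideal_def by blast
  define A where "A i = apply_matrix (a (Suc i)) (D i)" for i
  define z where "z i d = fm.dim (A i ` fdeg d (a (Suc i)))" for i d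
  have step: "fm.dim (fdeg d (a (Suc i)) :: (nat \<Rightarrow> ('x, 'f) mpoly) set) = z (Suc i) d + z i d" for i d
  proof -
    have "fm.dim (fdeg d (a (Suc i)) :: (nat \<Rightarrow> ('x, 'f) mpoly) set) = fm.dim {w\<in>fdeg d (a (Suc i)). A i w = 0} + fm.dim (A i ` fdeg d (a (Suc i)))"
      by (rule rank_nullity[OF fm.vector_space_axioms fm.vector_space_axioms _ subspace_fdeg _ fdeg_span])
        (simp_all add: A_def apply_matrix_linear)
    moreover have "{w\<in>fdeg d (a (Suc i)). A i w = 0} = A (Suc i) ` fdeg d (a (Suc (Suc i)))"
      unfolding A_def image_fdeg[OF gr] ex using fdeg_free by (auto simp: zero_fun_def)
    ultimately show ?thesis by (simp add: z_def)
  qed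
  have tail: "z i d = 0" if "i > n" for i d
  proof -
    have "a (Suc i) = []" using fin card that by simp
    then have "fdeg d (a (Suc i)) = ({0} :: (nat \<Rightarrow> ('x, 'f) mpoly) set)"
      by (auto simp: fdeg_def free_mod_def)
    moreover have "A i 0 = 0" by (simp add: A_def apply_matrix_def fun_eq_iff)
    moreover have "fm.dim {0 :: nat \<Rightarrow> ('x, 'f) mpoly} = 0"
      by (rule fm.dim_unique[of "{}"]) (simp_all add: fm.independent_empty)
    ultimately show ?thesis by (simp add: z_def)
  qed
  have polys: "\<exists>R. \<forall>d\<ge>r. of_nat (z i d) = poly R (of_nat d :: rat)" for i
  \<comment> \<open>Downwards from the end of the resolution, where \<open>z i d\<close> is
    0.\<close>
  proof (induction "Suc n - i" arbitrary: i)
    case 0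
    then have "z i d = 0" for d using tail by simp
    then show ?case by (intro exI[of _ 0]) simp
  next
    case (Suc k)
    have "k = Suc n - Suc i" using Suc.hyps(2) by simp
    then obtain R :: "rat poly" where R: "\<forall>d\<ge>r. of_nat (z (Suc i) d) = poly R (of_nat d)"
      using Suc.hyps(1) by blast
    let ?a = "a (Suc i)"
    have "of_nat (z i d) = poly ((\<Sum>j<length ?a. hpoly n (?a ! j)) - R) (of_nat d :: rat)" if d: "d \<ge> r" for d
    proof -
      \<comment> \<open>In this case \<open>i \<le> n\<close>, so that the twist bound
        \<open>r + i\<close> is within the range of \<open>poly_hpoly\<close>.\<close>
      have le: "e \<le> d + n" if "e \<in> set ?a" for e
        using deg[OF that] d Suc.hyps(2) by simp
      have "of_nat (z (Suc i) d) + of_nat (z i d) = (of_nat (\<Sum>j<length ?a. (d + n - ?a ! j) choose n) :: rat)"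
        using step[of d i] dim_fdeg[OF card le, where 'f='f] by simp
      also have "\<dots> = (\<Sum>j<length ?a. poly (hpoly n (?a ! j)) (of_nat d))"
        unfolding of_nat_sum by (rule sum.cong) (simp_all add: poly_hpoly le)
      finally show ?thesis using R d by (simp add: poly_sum algebra_simps)
    qed
    then show ?case by blast
  qed
  have z0: "z 0 d = vdim (I \<inter> homog d)" for d
  proof -
    let ?h = "\<lambda>f k. if k = (0::nat) then f else 0 :: ('x, 'f) mpoly"
    have "A 0 ` fdeg d (a 1) = {v\<in>free_mod [0]. v 0 \<in> I \<and> v 0 \<in> homog d}"
      using image_fdeg[OF gr[of 0], of d] im0 unfolding A_def a0 by (auto simp: fdeg_def)
    also have "\<dots> = ?h ` (I \<inter> homog d)"
    proof (intro equalityI subsetI)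
      fix v :: "nat \<Rightarrow> ('x, 'f) mpoly" assume v: "v \<in> {v\<in>free_mod [0]. v 0 \<in> I \<and> v 0 \<in> homog d}"
      then have "v = ?h (v 0)" by (auto simp: free_mod_def fun_eq_iff)
      then show "v \<in> ?h ` (I \<inter> homog d)" using v by blast
    qed (auto simp: free_mod_def)
    finally have im: "A 0 ` fdeg d (a 1) = ?h ` (I \<inter> homog d)" .
    have lin: "Vector_Spaces.linear scale fscale ?h"
      by unfold_locales (auto simp: fun_eq_iff)
    have sub: "mp.subspace (I \<inter> homog d)"
      by (intro mp.subspace_inter ideal_subspace ideal subspace_homog)
    have B: "finite (monomial ` {t. tdeg t = d} :: ('x, 'f) mpoly set)"
      "I \<inter> homog d \<subseteq> mp.span (monomial ` {t. tdeg t = d})"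
      by (auto simp flip: homog_span_monomials)
    have "vdim (I \<inter> homog d) = mp.dim {w\<in>I \<inter> homog d. ?h w = 0} + fm.dim (?h ` (I \<inter> homog d))"
      unfolding vdim_def
      by (rule rank_nullity[OF mp.vector_space_axioms fm.vector_space_axioms lin sub B])
    moreover have "{w\<in>I \<inter> homog d. ?h w = 0} = {0}"
      using mp.subspace_0[OF sub] by (auto simp: fun_eq_iff)
    moreover have "mp.dim {0 :: ('x, 'f) mpoly} = 0"
      by (rule mp.dim_unique[of "{}"]) (simp_all add: mp.independent_empty)
    ultimately show ?thesis unfolding z_def using im by simp
  qed
  obtain R where "\<forall>d\<ge>r. of_nat (z 0 d) = poly R (of_nat d :: rat)" using polys by blast
  then show thesis unfolding z0 by (intro that[of R]) simp
qed

text \<open>Two polynomials that agree for large degrees are equal; regularity thus moves the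
  validity of the Hilbert polynomial down to degree \<open>r\<close>.\<close>

lemma regular_vdim:
  fixes I :: "('x::finite, 'f::field) mpoly set"
  assumes card: "CARD('x) = n + 1" and I: "I \<in> subscheme_ideals p" and reg: "regular_ideal r I" and "d \<ge> r"
  shows "of_nat (vdim (I \<inter> homog d)) = of_nat ((n + d) choose n) - poly p (of_nat d)"
proof -
  have ideal: "module.subspace (*) I" and hp: "has_hilbert_poly I p"
    using I by (auto simp: subscheme_ideals_def homogeneous_ideal_def)
  obtain R :: "rat poly" where R: "\<And>d. d \<ge> r \<Longrightarrow> of_nat (vdim (I \<inter> homog d)) = poly R (of_nat d)"
    using regular_hilbert_function[OF card ideal reg] by metis
  have S: "of_nat (vdim (homog e :: ('x, 'f) mpoly set)) = poly (hpoly n 0) (of_nat e)" for e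
    by (simp add: vdim_homog card_terms_eq[OF card] poly_hpoly add.commute)
  have "\<forall>\<^sub>F d in sequentially. poly p (of_nat d) = poly (hpoly n 0 - R) (of_nat d)"
    using hp[unfolded has_hilbert_poly_def] eventually_ge_at_top[of r]
    by eventually_elim (simp add: S R)
  then have "p = hpoly n 0 - R" by (rule poly_eq_if_eventually_eq)
  then show ?thesis using R[OF assms(4)] by (simp add: poly_hpoly add.commute)
qed

subsection \<open>Generation in one degree\<close>

text \<open>The space S_k V of the ideal generated by \<open>V\<close>, as long as \<open>V\<close>
  lies in a single degree.\<close>

definition smul :: "nat \<Rightarrow> ('x, 'f::field) mpoly set \<Rightarrow> ('x, 'f) mpoly set" where
  "smul k V = mp.span {monomial s * f | s f. tdeg s = k \<and> f \<in> V}"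

lemma smul_subspace: "mp.subspace (smul k V)"
  by (simp add: smul_def)

lemma smul_base: "tdeg s = k \<Longrightarrow> f \<in> V \<Longrightarrow> monomial s * f \<in> smul k V"
  unfolding smul_def by (rule mp.span_base) auto

lemma smul_homog: assumes "V \<subseteq> homog m" shows "smul k V \<subseteq> homog (m + k)"
  unfolding smul_def
proof (rule mp.span_minimal[OF _ subspace_homog])
  show "{monomial s * f | s f. tdeg s = k \<and> f \<in> V} \<subseteq> homog (m + k)"
    using assms by (auto simp: add.commute intro!: homog_mult simp: homog_monomial)
qed

lemma smul_monomial:
  fixes V :: "('x, 'f::field) mpoly set"
  assumes "f \<in> smul k V" "tdeg s = j" shows "monomial s * f \<in> smul (k + j) V"
proof -
  let ?W = "{f. monomial s * f \<in> smul (k + j) V}"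
  have "mp.subspace ?W"
    by (rule mp.subspaceI)
      (auto simp: mp.subspace_0 smul_subspace distrib_left scale_mult_right intro: mp.subspace_add mp.subspace_scale)
  moreover have "{monomial u * f | u f. tdeg u = k \<and> f \<in> V} \<subseteq> ?W"
  proof safe
    fix u :: "'x trm" and f assume "f \<in> V" "k = tdeg u"
    then show "monomial s * (monomial u * f) \<in> smul (tdeg u + j) V"
      using smul_base[of "s + u" "tdeg u + j" f V] assms(2) by (simp add: tdeg_add monomial_add mult.assoc)
  qed
  ultimately have "smul k V \<subseteq> ?W" unfolding smul_def by (intro mp.span_minimal)
  then show ?thesis using assms by auto
qed

lemma smul_homog_mult:
  fixes f :: "('x::finite, 'f::field) mpoly"
  assumes "f \<in> smul k V" "g \<in> homog j" shows "g * f \<in> smul (k + j) V"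
proof -
  have "g * f = (\<Sum>t\<in>{t. tdeg t = j}. scale (plk g t) (monomial t * f))"
    by (subst homog_eq_sum_monomials[OF assms(2)]) (simp add: sum_distrib_right scale_mult_left)
  also have "\<dots> \<in> smul (k + j) V"
    by (intro mp.subspace_sum[OF smul_subspace] mp.subspace_scale[OF smul_subspace] smul_monomial assms(1)) simp
  finally show ?thesis .
qed

lemma smul_0: "mp.subspace V \<Longrightarrow> smul 0 V = V"
proof -
  assume V: "mp.subspace V"
  have "{monomial s * f | s f. tdeg s = 0 \<and> f \<in> V} = V"
    by (auto simp: tdeg_eq_0_iff)
  then show ?thesis using V by (simp add: smul_def mp.span_eq_iff)
qed

text \<open>The generators of \<open>I\<close> have degree at most \<open>r \<le> d\<close>, so
  their coefficients in an element of degree \<open>d + 1\<close> have positive degree. A variable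
  can be split off each term of a coefficient, and the rest times the generator is in
  \<open>I\<close> of degree \<open>d\<close>.\<close>

lemma regular_generated_step:
  fixes I :: "('x::finite, 'f::field) mpoly set"
  assumes ideal: "module.subspace (*) I" and reg: "regular_ideal r I" and d: "d \<ge> r"
  shows "I \<inter> homog (Suc d) \<subseteq> smul 1 (I \<inter> homog d)"
proof
  obtain a :: "nat \<Rightarrow> nat list" and D :: "nat \<Rightarrow> nat \<Rightarrow> nat \<Rightarrow> ('x, 'f) mpoly"
    where a0: "a 0 = [0]"
      and gr: "\<And>i. graded_matrix (a (Suc i)) (a i) (D i)"
      and im0: "apply_matrix (a 1) (D 0) ` free_mod (a 1) = {v\<in>free_mod [0]. v 0 \<in> I}"
      and deg: "\<And>i e. e \<in> set (a (Suc i)) \<Longrightarrow> e \<le> r + i"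
    using reg unfolding regular_ideal_def by blast
  fix f assume f: "f \<in> I \<inter> homog (Suc d)"
  let ?v = "\<lambda>k. if k = 0 then f else 0 :: ('x, 'f) mpoly"
  have "?v \<in> apply_matrix (a 1) (D 0) ` fdeg (Suc d) (a 1)"
    using image_fdeg[OF gr[of 0], of "Suc d"] im0 f unfolding a0 by (auto simp: fdeg_def free_mod_def)
  then obtain v where v: "v \<in> fdeg (Suc d) (a 1)" "?v = apply_matrix (a 1) (D 0) v" by auto
  have "f = (\<Sum>j<length (a 1). D 0 0 j * v j)"
    using fun_cong[OF v(2), of 0] by (simp add: apply_matrix_def)
  also have "\<dots> \<in> smul 1 (I \<inter> homog d)"
  proof (rule mp.subspace_sum[OF smul_subspace])
    fix j assume "j \<in> {..<length (a 1)}"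
    then have j: "j < length (a 1)" by simp
    have aj: "a 1 ! j \<le> d" using deg[of "a 1 ! j" 0] j d by simp
    let ?e = "\<lambda>k. if k = j then 1 else 0 :: ('x, 'f) mpoly"
    have "?e \<in> free_mod (a 1)" using j by (simp add: free_mod_def)
    then have "apply_matrix (a 1) (D 0) ?e 0 \<in> I" using im0 by blast
    moreover have "apply_matrix (a 1) (D 0) ?e 0 = D 0 0 j"
      using j by (simp add: apply_matrix_def if_distrib[of "\<lambda>x. _ * x"] cong: if_cong)
    ultimately have DI: "D 0 0 j \<in> I" by simp
    have Dh: "D 0 0 j \<in> homog (a 1 ! j)"
      using gr[of 0] unfolding graded_matrix_def a0 by (cases "D 0 0 j = 0") (simp, force dest: spec[of _ 0])
    have vj: "v j \<in> homog (Suc d - a 1 ! j)" using v j aj by (auto simp: fdeg_def)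
    let ?T = "{t :: 'x trm. tdeg t = Suc d - a 1 ! j}"
    have "D 0 0 j * v j = (\<Sum>t\<in>?T. scale (plk (v j) t) (monomial t * D 0 0 j))"
      by (subst homog_eq_sum_monomials[OF vj]) (simp add: sum_distrib_left scale_mult_right mult.commute)
    also have "\<dots> \<in> smul 1 (I \<inter> homog d)"
    proof (intro mp.subspace_sum[OF smul_subspace] mp.subspace_scale[OF smul_subspace])
      fix t assume "t \<in> ?T"
      then have "tdeg t = Suc (d - a 1 ! j)" using aj by simp
      then obtain x u where u: "t = var x + u" "tdeg u = d - a 1 ! j" by (rule trm_eq_var_add)
      have "monomial u * D 0 0 j \<in> I" using ideal DI unfolding ideal_iff by blast
      moreover have "monomial u * D 0 0 j \<in> homog d"
        using homog_mult[of "monomial u" "tdeg u" "D 0 0 j" "a 1 ! j"] Dh u aj by (simp add: homog_monomial)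
      ultimately show "monomial t * D 0 0 j \<in> smul 1 (I \<inter> homog d)"
        using u by (auto simp: monomial_add mult.assoc intro!: smul_base)
    qed
    finally show "D 0 0 j * v j \<in> smul 1 (I \<inter> homog d)" .
  qed
  finally show "f \<in> smul 1 (I \<inter> homog d)" .
qed

lemma ideal_smul: "module.subspace (*) I \<Longrightarrow> smul k (I \<inter> homog m) \<subseteq> I \<inter> homog (m + k)"
proof -
  assume I: "module.subspace (*) I"
  have "smul k (I \<inter> homog m) \<subseteq> I"
    unfolding smul_def by (rule mp.span_minimal[OF _ ideal_subspace[OF I]]) (use I in \<open>auto simp: ideal_iff\<close>)
  then show ?thesis using smul_homog[of "I \<inter> homog m" m k] by auto
qed

lemma regular_generated:
  fixes I :: "('x::finite, 'f::field) mpoly set"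
  assumes ideal: "module.subspace (*) I" and reg: "regular_ideal r I" and m: "m \<ge> r"
  shows "I \<inter> homog (m + k) = smul k (I \<inter> homog m)"
proof (induction k)
  case 0
  show ?case using smul_0[of "I \<inter> homog m"] ideal_subspace[OF ideal] subspace_homog mp.subspace_inter by auto
next
  case (Suc k)
  have "I \<inter> homog (m + Suc k) \<subseteq> smul 1 (smul k (I \<inter> homog m))"
    using regular_generated_step[OF ideal reg, of "m + k"] m Suc by simp
  also have "smul 1 (smul k (I \<inter> homog m)) \<subseteq> smul (Suc k) (I \<inter> homog m)"
    unfolding smul_def[of 1]
    by (rule mp.span_minimal[OF _ smul_subspace]) (use smul_monomial in fastforce)
  finally show ?case using ideal_smul[OF ideal, of "Suc k" m] by auto
qed

section \<open>Pluecker coordinates\<close>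

lemma pluecker_coord_cmat: "pluecker_coord B M = Determinant.det (cmat (length M) ((!) B) ((!) M))"
  by (simp add: pluecker_coord_def cmat_def)

lemma ordered_basis_expand:
  assumes "ordered_basis V B" "f \<in> V"
  obtains a where "f = (\<Sum>i<length B. scale (a i) (B ! i))"
proof -
  have "set B = (!) B ` {..<length B}" by (auto simp: set_conv_nth)
  then have "f \<in> mp.span ((!) B ` {..<length B})" using assms by (simp add: ordered_basis_def)
  with finite_lessThan show thesis by (rule mp.span_image_finite) (rule that)
qed

lemma ordered_basis_independent:
  assumes B: "ordered_basis V B" and a: "(\<Sum>i<length B. scale (a i) (B ! i)) = 0" and i: "i < length B"
  shows "a i = 0"
proof -
  have d: "distinct B" and ind: "mp.independent (set B)" using B by (auto simp: ordered_basis_def)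
  have bij: "bij_betw ((!) B) {..<length B} (set B)" using d by (rule bij_betw_nth) auto
  let ?u = "\<lambda>v. a (inv_into {..<length B} ((!) B) v)"
  have "(\<Sum>v\<in>set B. scale (?u v) v) = (\<Sum>i<length B. scale (?u (B ! i)) (B ! i))"
    by (rule sum.reindex_bij_betw[OF bij, symmetric])
  also have "\<dots> = (\<Sum>i<length B. scale (a i) (B ! i))"
    using bij by (intro sum.cong refl) (simp add: bij_betw_def inv_into_f_f)
  finally have "(\<Sum>v\<in>set B. scale (?u v) v) = 0" using a by simp
  then have "?u (B ! i) = 0"
    using mp.independentD[OF ind finite_set subset_refl, of ?u] i by simp
  then show ?thesis using bij i by (simp add: bij_betw_def inv_into_f_f)
qed

lemma ordered_basis_in: "ordered_basis V B \<Longrightarrow> i < length B \<Longrightarrow> B ! i \<in> V"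
  by (metis mp.span_base nth_mem ordered_basis_def)

lemma ordered_basis_subspace: "ordered_basis V B \<Longrightarrow> mp.subspace V"
  by (metis mp.subspace_span ordered_basis_def)

lemma ordered_basis_vdim: "ordered_basis V B \<Longrightarrow> vdim V = length B"
  unfolding vdim_def ordered_basis_def
  by (metis distinct_card mp.dim_span_eq_card_independent)

text \<open>The factor is the determinant of the base change matrix. It is non-zero, as a kernel
  vector of the transpose would be a relation in \<open>B'\<close>.\<close>

lemma ordered_basis_change:
  assumes B: "ordered_basis V B" and B': "ordered_basis V B'"
  obtains a where "a \<noteq> 0" "\<And>M. length M = length B \<Longrightarrow> pluecker_coord B' M = a * pluecker_coord B M"
proof -
  let ?n = "length B"
  have n: "length B' = ?n" using ordered_basis_vdim[OF B] ordered_basis_vdim[OF B'] by simp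
  have "\<forall>i<?n. \<exists>a. B' ! i = (\<Sum>j<?n. scale (a j) (B ! j))"
  proof (intro allI impI)
    fix i assume "i < ?n"
    then have "B' ! i \<in> V" using ordered_basis_in[OF B'] n by simp
    with B obtain a where "B' ! i = (\<Sum>j<?n. scale (a j) (B ! j))" by (rule ordered_basis_expand)
    then show "\<exists>a. B' ! i = (\<Sum>j<?n. scale (a j) (B ! j))" by (rule exI[of _ a])
  qed
  then obtain A where "\<forall>i<?n. B' ! i = (\<Sum>j<?n. scale (A i j) (B ! j))"
    unfolding choice_iff' by (rule exE)
  then have A: "\<And>i. i < ?n \<Longrightarrow> B' ! i = (\<Sum>j<?n. scale (A i j) (B ! j))" by simp
  let ?A = "Matrix.mat ?n ?n (\<lambda>(i, j). A i j)"
  have mult: "pluecker_coord B' M = Determinant.det ?A * pluecker_coord B M" if "length M = ?n" for M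
    unfolding pluecker_coord_cmat that
    by (subst cmat_mult[OF A]) (simp, rule Determinant.det_mult[of _ ?n], simp_all)
  have "Determinant.det ?A \<noteq> 0"
  proof
    assume "Determinant.det ?A = 0"
    then have "Determinant.det (transpose_mat ?A) = 0" by (simp add: Determinant.det_transpose[of _ ?n])
    then obtain v where v: "v \<in> carrier_vec ?n" "v \<noteq> 0\<^sub>v ?n" "transpose_mat ?A *\<^sub>v v = 0\<^sub>v ?n"
      using det_0_iff_vec_prod_zero_field[of "transpose_mat ?A" ?n] by auto
    have "(\<Sum>i<length B'. scale (vec_index v i) (B' ! i)) = 0"
    proof -
      have "(\<Sum>i<length B'. scale (vec_index v i) (B' ! i))
        = (\<Sum>i<?n. \<Sum>j<?n. scale (vec_index v i * A i j) (B ! j))"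
        unfolding n by (rule sum.cong) (simp_all add: A mp.scale_sum_right)
      also have "\<dots> = (\<Sum>j<?n. scale (\<Sum>i<?n. vec_index v i * A i j) (B ! j))"
        by (subst sum.swap) (simp add: mp.scale_sum_left)
      also have "\<dots> = (\<Sum>j<?n. 0)"
      proof (rule sum.cong)
        fix j assume j: "j \<in> {..<?n}"
        have "vec_index (transpose_mat ?A *\<^sub>v v) j = (\<Sum>i<?n. vec_index v i * A i j)"
          using j v(1) by (simp add: scalar_prod_def lessThan_atLeast0 mult.commute)
        then show "scale (\<Sum>i<?n. vec_index v i * A i j) (B ! j) = 0" using v(3) j by simp
      qed simp
      finally show ?thesis by simp
    qed
    then have "vec_index v i = 0" if "i < ?n" for i
      using ordered_basis_independent[OF B', of "vec_index v"] that n by simp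
    then have "v = 0\<^sub>v ?n" using v(1) by (intro eq_vecI) auto
    then show False using v(2) by simp
  qed
  with mult show thesis by (rule that[rotated])
qed

definition pvec :: "('x trm \<Rightarrow> 'x trm \<Rightarrow> bool) \<Rightarrow> nat \<Rightarrow> nat \<Rightarrow> ('x, 'f::field) mpoly list \<Rightarrow> 'x trm list \<Rightarrow> 'f" where
  "pvec prec m q B = (\<lambda>L. if L \<in> wedge_terms prec m q then pluecker_coord B L else 0)"

lemma proj_point_scale: assumes "(a :: 'f::field) \<noteq> 0" shows "proj_point (\<lambda>i. a * c i) = proj_point c"
proof -
  have "\<exists>b'. (\<lambda>i. b * c i) = (\<lambda>i. b' * (a * c i)) \<and> b' \<noteq> 0" if "b \<noteq> 0" for b
    using assms that by (intro exI[of _ "b / a"]) auto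
  moreover have "\<exists>b'. (\<lambda>i. b * (a * c i)) = (\<lambda>i. b' * c i) \<and> b' \<noteq> 0" if "b \<noteq> 0" for b
    using assms that by (intro exI[of _ "b * a"]) (auto simp: mult.assoc)
  ultimately show ?thesis unfolding proj_point_def by auto
qed

lemma proj_point_self: "c \<in> proj_point c"
  unfolding proj_point_def by (intro CollectI exI[of _ 1]) auto

lemma pluecker_eq:
  assumes B: "ordered_basis V B" "length B = q"
  shows "pluecker prec m q V = proj_point (pvec prec m q B)"
proof -
  have key: "proj_point (pvec prec m q B') = proj_point (pvec prec m q B)" if B': "ordered_basis V B'" for B'
  proof -
    obtain a where a: "a \<noteq> 0" "\<And>M. length M = length B \<Longrightarrow> pluecker_coord B' M = a * pluecker_coord B M"
      by (rule ordered_basis_change[OF B(1) B']) blast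
    have "pvec prec m q B' = (\<lambda>i. a * pvec prec m q B i)"
      using a(2) B(2) by (auto simp: pvec_def fun_eq_iff wedge_terms_def)
    then show ?thesis by (simp only: proj_point_scale[OF a(1)])
  qed
  have "(\<Union>B'\<in>{B'. ordered_basis V B'}. proj_point (pvec prec m q B')) = proj_point (pvec prec m q B)"
  proof (intro equalityI UN_least)
    fix B' assume "B' \<in> {B'. ordered_basis V B'}"
    then show "proj_point (pvec prec m q B') \<subseteq> proj_point (pvec prec m q B)"
      using key[of B'] by simp
  qed (rule UN_upper, use B in simp)
  then show ?thesis by (simp add: pluecker_def pvec_def)
qed

text \<open>The minor is the determinant of the linear map that sends an element of \<open>V\<close>
  to its coefficients at \<open>M\<close>; between spaces of equal dimension it is non-zero iff this
  map is injective.\<close>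

lemma pluecker_coord_nonzero_iff:
  assumes B: "ordered_basis V B" and M: "length M = length B"
  shows "pluecker_coord B M \<noteq> 0 \<longleftrightarrow> (\<forall>f\<in>V. (\<forall>t\<in>set M. plk f t = 0) \<longrightarrow> f = 0)"
proof -
  let ?n = "length B" and ?C = "cmat (length B) ((!) B) ((!) M)"
  have idx: "vec_index (transpose_mat ?C *\<^sub>v v) j = plk (\<Sum>i<?n. scale (vec_index v i) (B ! i)) (M ! j)"
    if "v \<in> carrier_vec ?n" "j < ?n" for v j
    using that by (simp add: cmat_def scalar_prod_def lessThan_atLeast0 lookup_sum mult.commute)
  have "pluecker_coord B M = Determinant.det (transpose_mat ?C)"
    unfolding pluecker_coord_cmat M by (rule Determinant.det_transpose[OF cmat_carrier, symmetric])
  then have *: "pluecker_coord B M = 0 \<longleftrightarrow>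
      (\<exists>v. v \<in> carrier_vec ?n \<and> v \<noteq> 0\<^sub>v ?n \<and> transpose_mat ?C *\<^sub>v v = 0\<^sub>v ?n)"
    using det_0_iff_vec_prod_zero_field[of "transpose_mat ?C" ?n] by simp
  show ?thesis
  proof
    assume nz: "pluecker_coord B M \<noteq> 0"
    show "\<forall>f\<in>V. (\<forall>t\<in>set M. plk f t = 0) \<longrightarrow> f = 0"
    proof (intro ballI impI)
      fix f assume f: "f \<in> V" "\<forall>t\<in>set M. plk f t = 0"
      from B f(1) obtain a where a: "f = (\<Sum>i<?n. scale (a i) (B ! i))" by (rule ordered_basis_expand)
      let ?v = "Matrix.vec ?n a"
      have s: "(\<Sum>i<?n. scale (vec_index ?v i) (B ! i)) = f" unfolding a by (rule sum.cong) auto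
      have "transpose_mat ?C *\<^sub>v ?v = 0\<^sub>v ?n"
      proof (rule eq_vecI)
        fix j assume "j < dim_vec (0\<^sub>v ?n :: 'b Matrix.vec)"
        then have j: "j < ?n" by simp
        then have "M ! j \<in> set M" using M by simp
        then show "vec_index (transpose_mat ?C *\<^sub>v ?v) j = vec_index (0\<^sub>v ?n) j"
          using idx[of ?v j] j f(2) s by simp
      qed (simp add: cmat_def)
      then have "?v = 0\<^sub>v ?n" using * nz vec_carrier by blast
      then have "\<forall>i<?n. a i = 0" by (metis index_vec index_zero_vec(1))
      then show "f = 0" unfolding a by simp
    qed
  next
    assume inj: "\<forall>f\<in>V. (\<forall>t\<in>set M. plk f t = 0) \<longrightarrow> f = 0"
    show "pluecker_coord B M \<noteq> 0"
    proof
      assume "pluecker_coord B M = 0"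
      then obtain v where v: "v \<in> carrier_vec ?n" "v \<noteq> 0\<^sub>v ?n" "transpose_mat ?C *\<^sub>v v = 0\<^sub>v ?n"
        using * by blast
      let ?f = "\<Sum>i<?n. scale (vec_index v i) (B ! i)"
      have "?f \<in> V"
        using ordered_basis_subspace[OF B] ordered_basis_in[OF B]
        by (intro mp.subspace_sum mp.subspace_scale) auto
      moreover have "\<forall>t\<in>set M. plk ?f t = 0"
      proof
        fix t assume "t \<in> set M"
        then obtain j where j: "j < ?n" "t = M ! j" using M by (metis in_set_conv_nth)
        show "plk ?f t = 0" using idx[OF v(1) j(1)] v(3) j by simp
      qed
      ultimately have "?f = 0" using inj by blast
      then have "vec_index v i = 0" if "i < ?n" for i
        using ordered_basis_independent[OF B, of "vec_index v"] that by simp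
      then have "v = 0\<^sub>v ?n" using v(1) by (intro eq_vecI) auto
      then show False using v(2) by simp
    qed
  qed
qed

text \<open>A row of the inverse of the coefficient matrix gives the coefficients of
  \<open>f\<close> in the basis.\<close>

lemma dual_basis_exists:
  assumes B: "ordered_basis V B" and L: "length L = length B" "distinct L"
    and nz: "pluecker_coord B L \<noteq> 0" and \<tau>: "\<tau> \<in> set L"
  obtains f where "f \<in> V" "plk f \<tau> = 1" "\<And>t. t \<in> set L \<Longrightarrow> t \<noteq> \<tau> \<Longrightarrow> plk f t = 0"
proof -
  let ?n = "length B" and ?C = "cmat (length B) ((!) B) ((!) L)"
  obtain k where k: "k < ?n" "\<tau> = L ! k" using \<tau> L(1) by (metis in_set_conv_nth)
  have "Determinant.det ?C \<noteq> 0" using nz L(1) by (simp add: pluecker_coord_cmat)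
  from det_non_zero_imp_unit[OF cmat_carrier this, of "()"]
  obtain A where A: "A \<in> carrier_mat ?n ?n" "A * ?C = 1\<^sub>m ?n"
    by (auto simp: Units_def ring_mat_def)
  let ?f = "\<Sum>i<?n. scale (A $$ (k, i)) (B ! i)"
  have val: "plk ?f (L ! j) = (if j = k then 1 else 0)" if "j < ?n" for j
  proof -
    have "(A * ?C) $$ (k, j) = plk ?f (L ! j)"
      using that k A(1) by (simp add: cmat_def scalar_prod_def lessThan_atLeast0 lookup_sum)
    then show ?thesis using that k unfolding A(2) by auto
  qed
  show thesis
  proof (rule that[of ?f])
    show "?f \<in> V"
      using ordered_basis_subspace[OF B] ordered_basis_in[OF B]
      by (intro mp.subspace_sum mp.subspace_scale) auto
    show "plk ?f \<tau> = 1" using val k by simp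
    fix t assume t: "t \<in> set L" "t \<noteq> \<tau>"
    then obtain j where "j < ?n" "t = L ! j" using L(1) by (metis in_set_conv_nth)
    then show "plk ?f t = 0" using val[of j] t k by auto
  qed
qed

section \<open>The affine chart around a point spanned by terms\<close>

text \<open>The coordinates of the chart are indexed by the pairs \<open>(\<tau>, \<eta>)\<close> with \<open>\<tau>\<close> in \<open>L\<close> and a smaller
  term \<open>\<eta>\<close> outside \<open>L\<close>; coefficients at larger terms are zero on a set of points on which \<open>L\<close> is
  the maximal non-vanishing Pluecker coordinate.\<close>

locale chart = tord prec for prec :: "'x::finite trm \<Rightarrow> 'x trm \<Rightarrow> bool" +
  fixes L :: "'x trm list" and m :: nat
  assumes L_wedge: "L \<in> wedge_terms prec m (length L)"
begin

lemma L_sorted: "sorted_wrt (\<lambda>s t. prec t s) L" using L_wedge by (simp add: wedge_terms_def)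
lemma L_distinct: "distinct L" by (rule sorted_distinct[OF L_sorted])
lemma L_deg: "t \<in> set L \<Longrightarrow> tdeg t = m" using L_wedge by (auto simp: wedge_terms_def)

definition E :: "('x trm \<times> 'x trm) set" where
  "E = {(\<tau>, \<eta>). \<tau> \<in> set L \<and> \<eta> \<notin> set L \<and> tdeg \<eta> = m \<and> prec \<eta> \<tau>}"

lemma finite_E [simp]: "finite E"
  by (rule finite_subset[of _ "set L \<times> {t. tdeg t = m}"]) (auto simp: E_def)

text \<open>The rows of the reduced echelon form with pivots in \<open>L\<close>. Only the values of
  \<open>c\<close> on \<open>E\<close> matter.\<close>

definition bas :: "('x trm \<times> 'x trm \<Rightarrow> 'f::field) \<Rightarrow> 'x trm \<Rightarrow> ('x, 'f) mpoly" where
  "bas c \<tau> = monomial \<tau> + (\<Sum>\<eta>\<in>{\<eta>. (\<tau>, \<eta>) \<in> E}. scale (c (\<tau>, \<eta>)) (monomial \<eta>))"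

definition pt :: "('x trm \<times> 'x trm \<Rightarrow> 'f::field) \<Rightarrow> ('x, 'f) mpoly set" where
  "pt c = mp.span (bas c ` set L)"

lemma finite_E_slice [simp]: "finite {\<eta>. (\<tau>, \<eta>) \<in> E}"
proof -
  have "finite (Pair \<tau> -` E)" by (rule finite_vimageI) (simp_all add: inj_on_def)
  then show ?thesis by (simp add: vimage_def)
qed

lemma plk_bas: "plk (bas c \<tau>) \<mu> = (if \<mu> = \<tau> then 1 else 0) + (if (\<tau>, \<mu>) \<in> E then c (\<tau>, \<mu>) else 0)"
proof -
  have "plk (\<Sum>\<eta>\<in>{\<eta>. (\<tau>, \<eta>) \<in> E}. scale (c (\<tau>, \<eta>)) (monomial \<eta>)) \<mu>
      = (\<Sum>\<eta>\<in>{\<eta>. (\<tau>, \<eta>) \<in> E}. if \<eta> = \<mu> then c (\<tau>, \<eta>) else 0)"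
    unfolding lookup_sum by (rule sum.cong) (auto simp: plk_monomial)
  then show ?thesis by (simp add: bas_def lookup_add plk_monomial)
qed

lemma plk_bas_L: "t \<in> set L \<Longrightarrow> plk (bas c \<tau>) t = (if t = \<tau> then 1 else 0)"
  by (auto simp: plk_bas E_def)

lemma bas_homog: "\<tau> \<in> set L \<Longrightarrow> bas c \<tau> \<in> homog m"
  by (rule homogI) (auto simp: plk_bas L_deg E_def split: if_splits)

lemma bas_nonzero: "\<tau> \<in> set L \<Longrightarrow> bas c \<tau> \<noteq> 0"
  by (metis lookup_zero plk_bas_L zero_neq_one)

lemma lt_bas: "\<tau> \<in> set L \<Longrightarrow> lt prec (bas c \<tau>) = \<tau>"
  by (rule lt_unique) (auto simp: in_keys_iff plk_bas E_def split: if_splits)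

lemma bas_independent:
  assumes "(\<Sum>\<tau>\<in>set L. scale (a \<tau>) (bas c \<tau>)) = 0" "\<tau> \<in> set L" shows "a \<tau> = 0"
proof -
  have "0 = plk (\<Sum>\<tau>\<in>set L. scale (a \<tau>) (bas c \<tau>)) \<tau>" by (simp add: assms)
  also have "\<dots> = (\<Sum>t\<in>set L. if t = \<tau> then a t else 0)"
    unfolding lookup_sum using assms(2) by (intro sum.cong) (auto simp: plk_bas_L)
  also have "\<dots> = a \<tau>" using assms(2) by simp
  finally show ?thesis by simp
qed

lemma pt_subspace: "mp.subspace (pt c)" by (simp add: pt_def)

lemma pt_homog: "pt c \<subseteq> homog m"
  unfolding pt_def by (rule mp.span_minimal[OF _ subspace_homog]) (auto simp: bas_homog)

lemma vdim_pt: "vdim (pt c) = length L"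
proof -
  have "vdim (pt c) = card (set L)"
    unfolding vdim_def
  proof (rule mp.dim_eq_card_family)
    show "\<forall>\<tau>\<in>set L. a \<tau> = 0" if "(\<Sum>\<tau>\<in>set L. scale (a \<tau>) (bas c \<tau>)) = 0" for a
      using bas_independent[OF that] by simp
  qed (auto simp: pt_def mp.span_base)
  then show ?thesis by (simp add: distinct_card L_distinct)
qed

lemma pt_grassmannian: "pt c \<in> grassmannian m (length L)"
  by (simp add: grassmannian_def pt_subspace pt_homog vdim_pt)

lemma pt_basis: "ordered_basis (pt c) (map (bas c) L)"
proof -
  have ind: "inj_on (bas c) (set L)" "mp.independent (bas c ` set L)"
    by (rule mp.family_independent; use bas_independent in blast)+
  then show ?thesis by (simp add: ordered_basis_def distinct_map L_distinct pt_def)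
qed

text \<open>The Pluecker vector of \<open>pt c\<close>, normalized by the choice of basis: its entry
  at \<open>L\<close> is 1.\<close>

definition pc :: "('x trm \<times> 'x trm \<Rightarrow> 'f::field) \<Rightarrow> 'x trm list \<Rightarrow> 'f" where
  "pc c = pvec prec m (length L) (map (bas c) L)"

lemma pluecker_pt: "pluecker prec m (length L) (pt c) = proj_point (pc c)"
  unfolding pc_def by (rule pluecker_eq[OF pt_basis]) simp

lemma pc_eq: "M \<in> wedge_terms prec m (length L) \<Longrightarrow> pc c M = Determinant.det (cmat (length L) (\<lambda>i. bas c (L ! i)) ((!) M))"
  unfolding pc_def pvec_def pluecker_coord_cmat
  by (auto simp: wedge_terms_def cmat_def intro!: arg_cong[of _ _ Determinant.det] cong_mat)

lemma pc_outside: "M \<notin> wedge_terms prec m (length L) \<Longrightarrow> pc c M = 0"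
  by (simp add: pc_def pvec_def)

lemma cmat_L: "cmat (length L) (\<lambda>i. bas c (L ! i)) ((!) L) = 1\<^sub>m (length L)"
  by (rule eq_matI) (auto simp: cmat_def plk_bas_L nth_eq_iff_index_eq L_distinct)

lemma pc_L: "pc c L = 1"
  by (simp add: pc_eq[OF L_wedge] cmat_L)

lemma vs_eq_pt: "vs L = pt (\<lambda>_. 0)"
  by (simp add: vs_def pt_def bas_def)

subsection \<open>Coordinates recovered from Pluecker coordinates\<close>

definition swap :: "'x trm \<times> 'x trm \<Rightarrow> 'x trm list" where
  "swap e = (SOME M. set M = insert (snd e) (set L - {fst e}) \<and> length M = length L \<and> sorted_wrt (\<lambda>s t. prec t s) M)"

lemma swap_exists:
  assumes "\<tau> \<in> set L" "\<eta> \<notin> set L"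
  shows "\<exists>M. set M = insert \<eta> (set L - {\<tau>}) \<and> length M = length L \<and> sorted_wrt (\<lambda>s t. prec t s) M"
proof -
  have "card (insert \<eta> (set L - {\<tau>})) = length L"
    using assms L_distinct by (simp add: card_Diff_singleton distinct_card)
      (metis Suc_pred card_gt_0_iff distinct_card empty_iff finite_set)
  then show ?thesis using sorted_list_exists[of "insert \<eta> (set L - {\<tau>})"] by simp
qed

lemma swap_props:
  assumes "(\<tau>, \<eta>) \<in> E"
  shows "set (swap (\<tau>, \<eta>)) = insert \<eta> (set L - {\<tau>})" "length (swap (\<tau>, \<eta>)) = length L"
    "sorted_wrt (\<lambda>s t. prec t s) (swap (\<tau>, \<eta>))"
  using someI_ex[OF swap_exists[of \<tau> \<eta>]] assms by (auto simp: swap_def E_def)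

lemma swap_wedge: "e \<in> E \<Longrightarrow> swap e \<in> wedge_terms prec m (length L)"
proof -
  assume e: "e \<in> E"
  obtain \<tau> \<eta> where te: "e = (\<tau>, \<eta>)" by force
  have "tdeg t = m" if "t \<in> set (swap e)" for t
    using that e swap_props(1)[of \<tau> \<eta>] L_deg unfolding te by (auto simp: E_def)
  then show ?thesis using e swap_props[of \<tau> \<eta>] by (simp add: wedge_terms_def te)
qed

text \<open>With \<eta> put in the place of \<tau>, the matrix is the identity with one column
  replaced, and its determinant is read off by Cramer's rule. Sorting the list contributes a sign,
  which is the same for all \<open>c\<close>.\<close>

lemma pc_swap:
  assumes e: "e \<in> E"
  obtains s :: int where "s = 1 \<or> s = - 1" "\<And>c :: _ \<Rightarrow> 'f::field. pc c (swap e) = of_int s * c e"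
proof -
  obtain \<tau> \<eta> where te: "e = (\<tau>, \<eta>)" by force
  have \<tau>: "\<tau> \<in> set L" "\<eta> \<notin> set L" using e by (auto simp: te E_def)
  then obtain k where k: "k < length L" "L ! k = \<tau>" by (metis in_set_conv_nth)
  let ?q = "length L" and ?L = "L[k := \<eta>]" and ?M = "swap e"
  have setL: "set ?L = insert \<eta> (set L - {\<tau>})"
    using set_update_distinct[OF L_distinct k(1), of \<eta>] k(2) by simp
  have dL: "distinct ?L" using L_distinct \<tau>(2) by (simp add: distinct_list_update)
  have M: "set ?M = set ?L" "length ?M = ?q" "distinct ?M"
    using swap_props[of \<tau> \<eta>] e sorted_distinct[OF swap_props(3)[of \<tau> \<eta>]] by (auto simp: te setL)
  then have "mset ?M = mset ?L" using dL set_eq_iff_mset_eq_distinct by blast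
  then obtain p where p: "p permutes {..<length ?L}" "permute_list p ?L = ?M"
    using mset_eq_permutation by metis
  then have p': "p permutes {0..<?q}" by (simp add: lessThan_atLeast0)
  have Mj: "?M ! j = ?L ! p j" if "j < ?q" for j
    using permute_list_nth[OF p(1), of j] that p(2) by simp
  have "pc c ?M = of_int (sign p) * c e" for c :: "_ \<Rightarrow> 'f"
  proof -
    let ?F = "\<lambda>i. bas c (L ! i)"
    let ?C = "cmat ?q ?F ((!) ?L)"
    have pj: "p j < ?q" if "j < ?q" for j using permutes_in_image[OF p'] that by simp
    have "pc c ?M = Determinant.det (cmat ?q ?F ((!) ?M))" by (rule pc_eq[OF swap_wedge[OF e]])
    also have "\<dots> = Determinant.det (transpose_mat (cmat ?q ?F ((!) ?M)))"
      by (rule Determinant.det_transpose[OF cmat_carrier, symmetric])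
    also have "transpose_mat (cmat ?q ?F ((!) ?M)) = Matrix.mat ?q ?q (\<lambda>(i, j). transpose_mat ?C $$ (p i, j))"
      by (rule eq_matI) (auto simp: cmat_def Mj pj)
    also have "Determinant.det \<dots> = signof p * Determinant.det (transpose_mat ?C)"
      by (rule det_permute_rows[OF _ p']) simp
    also have "Determinant.det (transpose_mat ?C) = Determinant.det ?C"
      by (rule Determinant.det_transpose[OF cmat_carrier])
    also have "?C = replace_col (1\<^sub>m ?q) (1\<^sub>m ?q *\<^sub>v Matrix.vec ?q (\<lambda>i. plk (?F i) \<eta>)) k"
    proof (rule eq_matI)
      fix i j assume ij: "i < dim_row (replace_col (1\<^sub>m ?q) (1\<^sub>m ?q *\<^sub>v Matrix.vec ?q (\<lambda>i. plk (?F i) \<eta>)) k)"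
        "j < dim_col (replace_col (1\<^sub>m ?q) (1\<^sub>m ?q *\<^sub>v Matrix.vec ?q (\<lambda>i. plk (?F i) \<eta>)) k)"
      then have ij: "i < ?q" "j < ?q" by (simp_all add: replace_col_def)
      show "?C $$ (i, j) = replace_col (1\<^sub>m ?q) (1\<^sub>m ?q *\<^sub>v Matrix.vec ?q (\<lambda>i. plk (?F i) \<eta>)) k $$ (i, j)"
        using ij k by (auto simp: cmat_def replace_col_def plk_bas_L nth_eq_iff_index_eq[OF L_distinct] nth_list_update)
    qed (simp_all add: cmat_def replace_col_def)
    also have "Determinant.det \<dots> = plk (?F k) \<eta>"
      by (subst cramer_lemma_mat[of _ ?q]) (use k in simp_all)
    also have "plk (?F k) \<eta> = c e" using e k \<tau> by (auto simp: plk_bas te)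
    finally show ?thesis by simp
  qed
  moreover have "sign p = 1 \<or> sign p = - 1" by (simp add: sign_def)
  ultimately show thesis using that by blast
qed

subsection \<open>Points with maximal Pluecker coordinate\<close>

text \<open>The basis dual to \<open>L\<close> consists of reduced rows \<open>G \<tau>\<close>. A
  coefficient of \<open>G \<tau>\<close> at a term \<eta> above \<tau> and outside \<open>L\<close>
  would make the coordinate at \<open>L\<close> with \<tau> exchanged for \<eta> non-zero, and this
  index is larger than \<open>L\<close>.\<close>

lemma pt_of_max:
  assumes V: "V \<in> grassmannian m (length L)" and B: "ordered_basis V B"
    and nz: "pluecker_coord B L \<noteq> 0"
    and max: "\<And>M. M \<in> wedge_terms prec m (length L) \<Longrightarrow> pluecker_coord B M \<noteq> 0 \<Longrightarrow> M = L \<or> wedge_less prec M L"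
  obtains c where "V = pt c"
proof -
  have lB: "length B = length L" using ordered_basis_vdim[OF B] V by (simp add: grassmannian_def)
  have sub: "mp.subspace V" by (rule ordered_basis_subspace[OF B])
  have Vh: "V \<subseteq> homog m" using V by (simp add: grassmannian_def)
  have "\<forall>\<tau>\<in>set L. \<exists>f. f \<in> V \<and> plk f \<tau> = 1 \<and> (\<forall>t\<in>set L. t \<noteq> \<tau> \<longrightarrow> plk f t = 0)"
  proof
    fix \<tau> assume \<tau>: "\<tau> \<in> set L"
    obtain f where "f \<in> V" "plk f \<tau> = 1" "\<And>t. t \<in> set L \<Longrightarrow> t \<noteq> \<tau> \<Longrightarrow> plk f t = 0"
      using dual_basis_exists[OF B lB[symmetric] L_distinct nz \<tau>] by metis
    then show "\<exists>f. f \<in> V \<and> plk f \<tau> = 1 \<and> (\<forall>t\<in>set L. t \<noteq> \<tau> \<longrightarrow> plk f t = 0)" by auto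
  qed
  then obtain G where "\<forall>\<tau>\<in>set L. G \<tau> \<in> V \<and> plk (G \<tau>) \<tau> = 1 \<and> (\<forall>t\<in>set L. t \<noteq> \<tau> \<longrightarrow> plk (G \<tau>) t = 0)"
    by (rule bchoice[THEN exE])
  then have G: "\<And>\<tau>. \<tau> \<in> set L \<Longrightarrow> G \<tau> \<in> V"
    "\<And>\<tau> t. \<tau> \<in> set L \<Longrightarrow> t \<in> set L \<Longrightarrow> plk (G \<tau>) t = (if t = \<tau> then 1 else 0)" by auto
  have expand: "f = (\<Sum>\<tau>\<in>set L. scale (plk f \<tau>) (G \<tau>))" if f: "f \<in> V" for f
  proof -
    let ?g = "f - (\<Sum>\<tau>\<in>set L. scale (plk f \<tau>) (G \<tau>))"
    have "?g \<in> V"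
      by (intro mp.subspace_diff[OF sub] mp.subspace_sum[OF sub] mp.subspace_scale[OF sub] f G)
    moreover have "\<forall>t\<in>set L. plk ?g t = 0"
    proof
      fix t assume t: "t \<in> set L"
      have "plk (\<Sum>\<tau>\<in>set L. scale (plk f \<tau>) (G \<tau>)) t = (\<Sum>\<tau>\<in>set L. if \<tau> = t then plk f \<tau> else 0)"
        unfolding lookup_sum using t by (intro sum.cong) (auto simp: G)
      then show "plk ?g t = 0" using t by (simp add: lookup_minus)
    qed
    ultimately have "?g = 0" using pluecker_coord_nonzero_iff[OF B lB[symmetric]] nz by blast
    then show ?thesis by simp
  qed
  have below: "prec \<eta> \<tau>" if \<tau>: "\<tau> \<in> set L" and \<eta>: "\<eta> \<notin> set L" "plk (G \<tau>) \<eta> \<noteq> 0" for \<tau> \<eta>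
  proof (rule ccontr)
    assume "\<not> prec \<eta> \<tau>"
    moreover have "\<eta> \<noteq> \<tau>" using \<tau> \<eta> by auto
    ultimately have above: "prec \<tau> \<eta>" using prec_total by blast
    obtain M where M: "set M = insert \<eta> (set L - {\<tau>})" "length M = length L" "sorted_wrt (\<lambda>s t. prec t s) M"
      using swap_exists[OF \<tau> \<eta>(1)] by auto
    have "tdeg \<eta> = m" using homogD[OF subsetD[OF Vh G(1)[OF \<tau>]] \<eta>(2)] .
    then have Mw: "M \<in> wedge_terms prec m (length L)" using M L_deg by (auto simp: wedge_terms_def)
    \<comment> \<open>If \<open>f\<close> vanishes at the terms of \<open>L\<close> other than
      \<tau>, it is a multiple of \<open>G \<tau>\<close>, and its coefficient at \<eta> detects the
      factor.\<close>
    have "\<forall>f\<in>V. (\<forall>t\<in>set M. plk f t = 0) \<longrightarrow> f = 0"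
    proof (intro ballI impI)
      fix f assume f: "f \<in> V" "\<forall>t\<in>set M. plk f t = 0"
      have "f = (\<Sum>t\<in>{\<tau>}. scale (plk f t) (G t))"
      proof (subst expand[OF f(1)], rule sum.mono_neutral_right)
        show "\<forall>i\<in>set L - {\<tau>}. scale (plk f i) (G i) = 0" using f(2) M(1) by (simp add: scale_def const_def)
      qed (use \<tau> in auto)
      then have f': "f = scale (plk f \<tau>) (G \<tau>)" by simp
      have "plk f \<eta> = 0" using f(2) M(1) by simp
      moreover have "plk f \<eta> = plk f \<tau> * plk (G \<tau>) \<eta>" by (subst f') simp
      ultimately have "plk f \<tau> = 0" using \<eta>(2) by simp
      then show "f = 0" using f' by (simp add: scale_def const_def)
    qed
    then have "pluecker_coord B M \<noteq> 0" using pluecker_coord_nonzero_iff[OF B, of M] M(2) lB by simp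
    then have "M = L \<or> wedge_less prec M L" by (rule max[OF Mw])
    moreover have "M \<noteq> L" using M(1) \<eta>(1) by auto
    ultimately obtain j where j: "j < length L" "\<forall>i<j. M ! i = L ! i" "prec (M ! j) (L ! j)"
      by (auto simp: wedge_less_def)
    have dist: "L ! i = L ! i' \<longleftrightarrow> i = i'" if "i < length L" "i' < length L" for i i'
      using L_distinct that by (simp add: nth_eq_iff_index_eq)
    have desc: "prec (M ! i') (M ! i)" if "i < i'" "i' < length L" for i i'
      using M(2,3) that by (simp add: sorted_wrt_iff_nth_less)
    \<comment> \<open>Any other entry of \<open>L\<close> also occurs in \<open>M\<close>; at the
      first difference it would have to be both above and below \<open>M ! j\<close>.\<close>
    have "L ! j = \<tau>"
    proof (rule ccontr)
      assume "L ! j \<noteq> \<tau>"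
      then have "L ! j \<in> set M" using M(1) j(1) by simp
      then obtain i where i: "i < length L" "M ! i = L ! j" using M(2) by (metis in_set_conv_nth)
      consider "i < j" | "i = j" | "j < i" by linarith
      then show False
      proof cases
        case 1 then show False using j i dist[of i j] by auto
      next
        case 2 then show False using i j prec_irrefl by auto
      next
        case 3
        from desc[OF 3 i(1)] i(2) have "prec (L ! j) (M ! j)" by simp
        then show False using j(3) prec_asym by blast
      qed
    qed
    \<comment> \<open>Since \<eta> is not among the common initial entries, it is at most
      \<open>M ! j\<close>, hence below \<tau>.\<close>
    have "\<eta> \<in> set M" using M(1) by simp
    then obtain i where i: "i < length L" "M ! i = \<eta>" using M(2) by (metis in_set_conv_nth)
    show False
    proof (cases "i < j")
      case True then show False using j i \<eta>(1) by auto
    next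
      case False
      have "prec \<eta> \<tau>"
      proof (cases "i = j")
        case True then show ?thesis using j i \<open>L ! j = \<tau>\<close> by simp
      next
        case ne: False
        then have "prec (M ! i) (M ! j)" using desc[of j i] False i by simp
        then show ?thesis using prec_trans[OF _ j(3)] i \<open>L ! j = \<tau>\<close> by simp
      qed
      then show False using above prec_asym by blast
    qed
  qed
  define c where "c e = plk (G (fst e)) (snd e)" for e
  have "G \<tau> = bas c \<tau>" if \<tau>: "\<tau> \<in> set L" for \<tau>
  proof (rule poly_mapping_eqI)
    fix \<mu> show "plk (G \<tau>) \<mu> = plk (bas c \<tau>) \<mu>"
    proof (cases "\<mu> \<in> set L")
      case True then show ?thesis using \<tau> by (simp add: plk_bas_L G)
    next
      case False
      then have ne: "\<mu> \<noteq> \<tau>" using \<tau> by auto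
      show ?thesis
      proof (cases "plk (G \<tau>) \<mu> = 0")
        case True then show ?thesis using ne by (simp add: plk_bas c_def)
      next
        case nz: False
        have "tdeg \<mu> = m" using homogD[OF subsetD[OF Vh G(1)[OF \<tau>]] nz] .
        then have "(\<tau>, \<mu>) \<in> E" using below[OF \<tau> False nz] \<tau> False by (simp add: E_def)
        then show ?thesis using ne by (simp add: plk_bas c_def)
      qed
    qed
  qed
  then have im: "G ` set L = bas c ` set L" by (rule image_cong[OF refl])
  have "V = mp.span (G ` set L)"
  proof
    show "V \<subseteq> mp.span (G ` set L)"
    proof
      fix f assume f: "f \<in> V"
      have "(\<Sum>\<tau>\<in>set L. scale (plk f \<tau>) (G \<tau>)) \<in> mp.span (G ` set L)"
        by (intro mp.span_sum mp.span_scale mp.span_base imageI)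
      then show "f \<in> mp.span (G ` set L)" using expand[OF f] by simp
    qed
    show "mp.span (G ` set L) \<subseteq> V" by (rule mp.span_minimal[OF _ sub]) (use G in auto)
  qed
  then have "V = pt c" unfolding pt_def im .
  then show thesis by (rule that)
qed

end

subsection \<open>Initial spaces\<close>

lemma hcomp_scale: "hcomp d (scale a f) = scale a (hcomp d f)"
  by (rule poly_mapping_eqI) (simp add: plk_hcomp)

lemma (in tord) lt_spans_homog:
  fixes W U :: "('x, 'f::field) mpoly set"
  assumes "finite {t :: 'x trm. tdeg t = e}" "mp.subspace W" "mp.subspace U" "U \<subseteq> W" "W \<subseteq> homog e"
    "lt prec ` (W - {0}) \<subseteq> lt prec ` (U - {0})"
  shows "W \<subseteq> U"
proof (rule lt_spans[OF assms(2-4,1) _ assms(6)])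
  show "pkeys f \<subseteq> {t. tdeg t = e}" if "f \<in> W" for f
    using subsetD[OF assms(5) that] by (auto simp: homog_def)
qed

lemma (in tord) vdim_lt_homog:
  fixes W :: "('x, 'f::field) mpoly set"
  assumes "finite {t :: 'x trm. tdeg t = e}" "mp.subspace W" "W \<subseteq> homog e"
  shows "vdim W = card (lt prec ` (W - {0}))" "finite (lt prec ` (W - {0}))"
proof -
  have k: "pkeys f \<subseteq> {t. tdeg t = e}" if "f \<in> W" for f
    using subsetD[OF assms(3) that] by (auto simp: homog_def)
  show "vdim W = card (lt prec ` (W - {0}))" by (rule vdim_lt[OF assms(2,1) k])
  have "lt prec ` (W - {0}) \<subseteq> {t. tdeg t = e}" using subsetD[OF k lt_in_keys] by auto
  then show "finite (lt prec ` (W - {0}))" using assms(1) finite_subset by blast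
qed

context chart
begin

text \<open>The monomial basis of \<open>smul k (vs L)\<close>.\<close>

definition T :: "nat \<Rightarrow> 'x trm set" where
  "T k = {s + \<tau> | s \<tau>. tdeg s = k \<and> \<tau> \<in> set L}"

lemma T_deg: "t \<in> T k \<Longrightarrow> tdeg t = m + k"
  by (auto simp: T_def tdeg_add L_deg)

lemma finite_T [simp]: "finite (T k)"
  by (rule finite_subset[of _ "{t. tdeg t = m + k}"]) (auto dest: T_deg)

lemma smul_pt: "smul k (pt c) = mp.span ((\<lambda>(s, \<tau>). monomial s * bas c \<tau>) ` ({s. tdeg s = k} \<times> set L))"
  (is "_ = mp.span ?G")
proof
  show "smul k (pt c) \<subseteq> mp.span ?G"
    unfolding smul_def
  proof (rule mp.span_minimal[OF _ mp.subspace_span], safe)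
    fix s :: "'x trm" and f assume s: "k = tdeg s" and f: "f \<in> pt c"
    obtain a where a: "f = (\<Sum>\<tau>\<in>set L. scale (a \<tau>) (bas c \<tau>))"
      using mp.span_image_finite[OF finite_set, of f "bas c" L] f unfolding pt_def by metis
    have "monomial s * f = (\<Sum>\<tau>\<in>set L. scale (a \<tau>) (monomial s * bas c \<tau>))"
      by (simp add: a sum_distrib_left scale_mult_right)
    also have "\<dots> \<in> mp.span ((\<lambda>(s, \<tau>). monomial s * bas c \<tau>) ` ({s'. tdeg s' = tdeg s} \<times> set L))"
      by (intro mp.span_sum mp.span_scale mp.span_base) force
    finally show "monomial s * f \<in> mp.span ((\<lambda>(s, \<tau>). monomial s * bas c \<tau>) ` ({s'. tdeg s' = tdeg s} \<times> set L))" .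
  qed
  show "mp.span ?G \<subseteq> smul k (pt c)"
  proof (rule mp.span_minimal[OF _ smul_subspace])
    show "?G \<subseteq> smul k (pt c)" by (auto simp: pt_def intro!: smul_base mp.span_base)
  qed
qed

lemma smul_pt_homog: "smul k (pt c) \<subseteq> homog (m + k)"
  by (rule smul_homog[OF pt_homog])

text \<open>The product of a row with pivot \<tau> and a term \<open>s\<close> has leading term
  \<open>s + \<tau>\<close>. Consequently S_k V has its smallest dimension on the chart at the
  special point.\<close>

lemma lt_smul_pt: "T k \<subseteq> lt prec ` (smul k (pt c) - {0})"
proof
  fix t assume "t \<in> T k"
  then obtain s \<tau> where t: "t = s + \<tau>" "tdeg s = k" "\<tau> \<in> set L" by (auto simp: T_def)
  let ?f = "monomial s * bas c \<tau>"
  have "?f \<in> smul k (pt c)" using t by (intro smul_base) (auto simp: pt_def mp.span_base)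
  moreover have "?f \<noteq> 0" by (rule monomial_mult_nonzero[OF bas_nonzero[OF t(3)]])
  moreover have "lt prec ?f = t" by (simp add: lt_monomial_mult[OF bas_nonzero[OF t(3)]] lt_bas[OF t(3)] t(1))
  ultimately show "t \<in> lt prec ` (smul k (pt c) - {0})" by (intro image_eqI[of _ _ ?f]) auto
qed

lemma smul_vs: "smul k (vs L :: ('x, 'f::field) mpoly set) = mp.span (monomial ` T k)"
proof -
  have "(\<lambda>(s, \<tau>). monomial s * bas (\<lambda>_. 0 :: 'f) \<tau>) ` ({s. tdeg s = k} \<times> set L) = monomial ` T k"
    by (force simp: T_def bas_def monomial_add)
  then show ?thesis unfolding vs_eq_pt smul_pt by simp
qed

lemma smul_vs_keys: "f \<in> smul k (vs L) \<Longrightarrow> pkeys f \<subseteq> T k"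
proof -
  assume "f \<in> smul k (vs L)"
  then obtain a where a: "f = (\<Sum>t\<in>T k. scale (a t) (monomial t))"
    using mp.span_image_finite[OF finite_T, of f monomial k] unfolding smul_vs by metis
  show ?thesis
  proof
    fix t assume "t \<in> pkeys f"
    then have "(\<Sum>s\<in>T k. a s * plk (monomial s) t) \<noteq> 0" by (simp add: in_keys_iff a lookup_sum)
    then obtain s where "s \<in> T k" "a s * plk (monomial s) t \<noteq> 0"
      by (rule sum.not_neutral_contains_not_neutral)
    then show "t \<in> T k" by (simp add: plk_monomial split: if_splits)
  qed
qed

lemma vdim_smul_vs: "vdim (smul k (vs L) :: ('x, 'f::field) mpoly set) = card (T k)"
  unfolding smul_vs vdim_def
proof (rule mp.dim_eq_card_family)
  show "\<forall>i\<in>T k. a i = 0" if "(\<Sum>i\<in>T k. scale (a i) (monomial i)) = (0 :: ('x, 'f) mpoly)" for a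
    using monomials_independent[OF finite_T that] by simp
qed (auto simp: mp.span_base)

text \<open>All spaces \<open>S\<^sub>k V\<close> have at least the dimension that they have at the special point; if they have
  exactly this dimension, then their initial spaces are those of the special point, and the
  saturation of the ideal generated by \<open>V\<close> does not change them as this holds at the special point.\<close>

lemma hilbert_scheme_of_vdim_le:
  fixes c :: "_ \<Rightarrow> 'k::field alg_closure" and I0 :: "('x, 'k alg_closure) mpoly set"
  assumes I0: "I0 \<in> subscheme_ideals p" "\<And>k. I0 \<inter> homog (m + k) = smul k (vs L)"
    and le: "\<And>k. vdim (smul k (pt c)) \<le> card (T k)"
  shows "pt c \<in> hilbert_scheme p m (length L)"
proof -
  let ?J = "\<lambda>k. smul k (pt c)"
  have ltJ: "lt prec ` (?J k - {0}) = T k" for k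
  proof -
    note * = vdim_lt_homog[OF finite_terms_of_degree smul_subspace smul_pt_homog, of k c]
    show ?thesis using card_seteq[OF *(2) lt_smul_pt] *(1) le[of k] by auto
  qed
  have dimJ: "vdim (?J k) = card (T k)" for k
    using vdim_lt_homog(1)[OF finite_terms_of_degree smul_subspace smul_pt_homog, of k c] ltJ by simp
  have sat0: "saturated I0" and id0: "module.subspace (*) I0" and hp0: "has_hilbert_poly I0 p"
    using I0(1) by (auto simp: subscheme_ideals_def homogeneous_ideal_def)
  \<comment> \<open>Removing forms of degree \<open>k\<close> stays inside \<open>?J\<close>: if
    \<open>w\<close> is such a quotient, all products of its leading term with terms of degree
    \<open>k\<close> are in \<open>I0\<close>, hence so is the leading term by saturation. Equal
    leading terms then force equal spaces.\<close>
  have key: "h \<in> ?J d" if h: "h \<in> homog (m + d)" "\<And>g. g \<in> homog k \<Longrightarrow> g * h \<in> ?J (d + k)" for h d k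
  proof -
    let ?W = "{h\<in>homog (m + d). \<forall>g\<in>homog k. g * h \<in> ?J (d + k)}"
    have "?W \<subseteq> ?J d"
    proof (rule lt_spans_homog[OF finite_terms_of_degree])
      show "mp.subspace ?W"
        by (rule mp.subspaceI)
          (auto simp: homog_add homog_scale distrib_left scale_mult_right mp.subspace_0[OF smul_subspace]
            mp.subspace_add[OF smul_subspace] mp.subspace_scale[OF smul_subspace])
      show "mp.subspace (?J d)" by (rule smul_subspace)
      show "?J d \<subseteq> ?W" using smul_pt_homog[of d c] smul_homog_mult by blast
      show "?W \<subseteq> homog (m + d)" by auto
      show "lt prec ` (?W - {0}) \<subseteq> lt prec ` (?J d - {0})"
        unfolding ltJ
      proof (rule image_subsetI)
        fix w assume w: "w \<in> ?W - {0}"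
        then have w0: "w \<noteq> 0" and wh: "w \<in> homog (m + d)" by auto
        have mon: "monomial (s + lt prec w) \<in> I0" if s: "tdeg s = k" for s
        proof -
          have "monomial s * w \<in> ?J (d + k)" using w s by (simp add: homog_monomial)
          moreover have "monomial s * w \<noteq> 0" by (rule monomial_mult_nonzero[OF w0])
          ultimately have "lt prec (monomial s * w) \<in> lt prec ` (?J (d + k) - {0})" by (intro imageI) simp
          then have "s + lt prec w \<in> T (d + k)" unfolding ltJ by (simp add: lt_monomial_mult[OF w0])
          then have "monomial (s + lt prec w) \<in> smul (d + k) (vs L)"
            unfolding smul_vs by (intro mp.span_base imageI)
          then show ?thesis using I0(2)[of "d + k"] by auto
        qed
        have "g * monomial (lt prec w) \<in> I0" if g: "g \<in> homog k" for g
        proof -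
          have "g * monomial (lt prec w) = (\<Sum>t\<in>{t. tdeg t = k}. scale (plk g t) (monomial (t + lt prec w)))"
            by (subst homog_eq_sum_monomials[OF g]) (simp add: sum_distrib_right scale_mult_left monomial_add)
          also have "\<dots> \<in> I0"
            by (intro mp.subspace_sum[OF ideal_subspace[OF id0]] mp.subspace_scale[OF ideal_subspace[OF id0]] mon) simp
          finally show ?thesis .
        qed
        then have "monomial (lt prec w) \<in> I0" using sat0 unfolding saturated_def by blast
        moreover have "tdeg (lt prec w) = m + d" using wh lt_in_keys[OF w0] by (auto simp: homog_def)
        ultimately have "monomial (lt prec w) \<in> I0 \<inter> homog (m + d)" by (simp add: homog_monomial)
        then have "monomial (lt prec w) \<in> (smul d (vs L) :: ('x, 'k alg_closure) mpoly set)" by (simp only: I0(2))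
        then have "pkeys (monomial (lt prec w) :: ('x, 'k alg_closure) mpoly) \<subseteq> T d" by (rule smul_vs_keys)
        then show "lt prec w \<in> T d" by (simp add: monomial_def)
      qed
    qed
    then show ?thesis using h by blast
  qed
  \<comment> \<open>The saturated ideal to be constructed, given by components. Forms of degree
    \<open>m\<close> move the component of degree \<open>d\<close> to degree \<open>m + d\<close>,
    where \<open>?J d\<close> lives; so components of degree below \<open>m\<close> are covered as
    well.\<close>
  define I where "I = {f. \<forall>d. \<forall>g\<in>homog m. g * hcomp d f \<in> ?J d}"
  have Im: "I \<inter> homog (m + d) = ?J d" for d
  proof (intro equalityI subsetI)
    fix h assume h: "h \<in> I \<inter> homog (m + d)"
    have "g * h \<in> ?J (d + m)" if "g \<in> homog m" for g
    proof -
      have "hcomp (d + m) h = h" using h hcomp_of_homog[of h "m + d" "d + m"] by simp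
      moreover have "g * hcomp (d + m) h \<in> ?J (d + m)" using h that unfolding I_def by blast
      ultimately show ?thesis by simp
    qed
    with h show "h \<in> ?J d" by (intro key[of h d m]) auto
  next
    fix h assume h: "h \<in> ?J d"
    then have hh: "h \<in> homog (m + d)" using smul_pt_homog by blast
    have "g * hcomp e h \<in> ?J e" if "g \<in> homog m" for g e
    proof (cases "e = m + d")
      case True
      then show ?thesis using smul_homog_mult[OF h that] by (simp add: hcomp_of_homog[OF hh] add.commute)
    next
      case False
      then show ?thesis by (simp add: hcomp_of_homog[OF hh] mp.subspace_0[OF smul_subspace])
    qed
    then show "h \<in> I \<inter> homog (m + d)" using hh by (simp add: I_def)
  qed
  have subI: "mp.subspace I"
  proof (rule mp.subspaceI)
    show "0 \<in> I" by (simp add: I_def mp.subspace_0[OF smul_subspace])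
    show "x + y \<in> I" if "x \<in> I" "y \<in> I" for x y
      using that by (simp add: I_def hcomp_add distrib_left mp.subspace_add[OF smul_subspace])
    show "scale a x \<in> I" if "x \<in> I" for a x
      using that by (simp add: I_def hcomp_scale scale_mult_right mp.subspace_scale[OF smul_subspace])
  qed
  have monI: "monomial s * f \<in> I" if f: "f \<in> I" for s f
    unfolding I_def
  proof (intro CollectI allI ballI)
    fix d and g :: "('x, 'k alg_closure) mpoly" assume g: "g \<in> homog m"
    have hs: "monomial s \<in> homog (tdeg s)" by (simp add: homog_monomial)
    show "g * hcomp d (monomial s * f) \<in> ?J d"
    proof (cases "tdeg s \<le> d")
      case True
      have "g * hcomp (d - tdeg s) f \<in> ?J (d - tdeg s)" using f g by (simp add: I_def)
      from smul_monomial[OF this refl, of s] True show ?thesis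
        by (simp add: hcomp_mult_homog[OF hs] mult.left_commute)
    qed (simp add: hcomp_mult_homog[OF hs] mp.subspace_0[OF smul_subspace])
  qed
  have idI: "module.subspace (*) I"
    unfolding ideal_iff
  proof (intro conjI ballI allI)
    show "0 \<in> I" by (rule mp.subspace_0[OF subI])
    show "f + g \<in> I" if "f \<in> I" "g \<in> I" for f g using that by (rule mp.subspace_add[OF subI])
    show "h * f \<in> I" if f: "f \<in> I" for h f
    proof -
      have "h * f = (\<Sum>t\<in>pkeys h. scale (plk h t) (monomial t * f))"
        by (subst (1) sum_scale_monomials[of h, symmetric]) (simp add: sum_distrib_right scale_mult_left)
      also have "\<dots> \<in> I" by (intro mp.subspace_sum[OF subI] mp.subspace_scale[OF subI] monI f)
      finally show ?thesis .
    qed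
  qed
  have "hcomp e f \<in> I" if "f \<in> I" for e f
    unfolding I_def
  proof (intro CollectI allI ballI)
    fix d and g :: "('x, 'k alg_closure) mpoly" assume "g \<in> homog m"
    then show "g * hcomp d (hcomp e f) \<in> ?J d"
      using that hcomp_of_homog[OF hcomp_homog, of d e f]
      by (auto simp: I_def mp.subspace_0[OF smul_subspace])
  qed
  then have hI: "homogeneous_ideal I" using idI by (simp add: homogeneous_ideal_def)
  have satI: "saturated I"
    unfolding saturated_def
  proof (intro allI impI)
    fix f assume "\<exists>k. \<forall>g\<in>homog k. g * f \<in> I"
    then obtain k where k: "\<And>g. g \<in> homog k \<Longrightarrow> g * f \<in> I" by blast
    show "f \<in> I" unfolding I_def
    proof (intro CollectI allI ballI)
      fix d and g :: "('x, 'k alg_closure) mpoly" assume g: "g \<in> homog m"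
      show "g * hcomp d f \<in> ?J d"
      proof (rule key[of _ d k])
        show "g * hcomp d f \<in> homog (m + d)" by (rule homog_mult[OF g hcomp_homog])
        fix g' :: "('x, 'k alg_closure) mpoly" assume g': "g' \<in> homog k"
        have "g * hcomp (d + k) (g' * f) \<in> ?J (d + k)" using k[OF g'] g by (simp add: I_def)
        then show "g' * (g * hcomp d f) \<in> ?J (d + k)"
          by (simp add: hcomp_mult_homog[OF g'] mult.left_commute)
      qed
    qed
  qed
  have "has_hilbert_poly I p"
    unfolding has_hilbert_poly_def
    using hp0[unfolded has_hilbert_poly_def] eventually_ge_at_top[of m]
  proof eventually_elim
    case (elim d)
    have "vdim (I0 \<inter> homog d) = vdim (I \<inter> homog d)"
      using I0(2)[of "d - m"] Im[of "d - m"] elim(2) by (simp add: vdim_smul_vs dimJ)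
    then show ?case using elim(1) by simp
  qed
  then have "I \<in> subscheme_ideals p" using hI satI by (simp add: subscheme_ideals_def)
  moreover have "pt c = I \<inter> homog m" using Im[of 0] smul_0[OF pt_subspace, of c] by simp
  ultimately show ?thesis using pt_grassmannian[of c] unfolding hilbert_scheme_def by blast
qed

subsection \<open>Polynomials in the chart coordinates\<close>

text \<open>Coefficients of the rows as polynomials over K in the chart coordinates, so that
  conditions on \<open>pt c\<close> become equations over K.\<close>

definition cpoly :: "'x trm \<Rightarrow> 'x trm \<Rightarrow> ('x trm \<times> 'x trm, 'k::field) mpoly" where
  "cpoly \<tau> \<mu> = (if \<mu> = \<tau> then 1 else 0) + (if (\<tau>, \<mu>) \<in> E then monomial (var (\<tau>, \<mu>)) else 0)"

lemma evalp_cpoly: "evalp to_ac c (cpoly \<tau> \<mu>) = plk (bas c \<tau>) \<mu>"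
  by (simp add: cpoly_def plk_bas evalp_ac_simps)

text \<open>The coefficient at \<rho> after multiplication by \<open>s\<close>; the existential
  statement is divisibility of \<rho> by \<open>s\<close>.\<close>

definition cpoly2 :: "'x trm \<Rightarrow> 'x trm \<Rightarrow> 'x trm \<Rightarrow> ('x trm \<times> 'x trm, 'k::field) mpoly" where
  "cpoly2 s \<tau> \<rho> = (if \<exists>\<mu>. \<rho> = s + \<mu> then cpoly \<tau> (\<rho> - s) else 0)"

lemma evalp_cpoly2: "evalp to_ac c (cpoly2 s \<tau> \<rho>) = plk (monomial s * bas c \<tau>) \<rho>"
proof (cases "\<exists>\<mu>. \<rho> = s + \<mu>")
  case True
  then obtain \<mu> where "\<rho> = s + \<mu>" by blast
  then show ?thesis by (simp add: cpoly2_def evalp_cpoly plk_monomial_mult)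
next
  case False
  then have "\<rho> \<notin> pkeys (monomial s * bas c \<tau>)" by (auto simp: monomial_mult_keys)
  then show ?thesis using False by (simp add: cpoly2_def evalp_ac_simps in_keys_iff)
qed

lemma evalp_det:
  fixes c :: "'e \<Rightarrow> 'k::field alg_closure"
  shows "evalp to_ac c (Determinant.det (Matrix.mat N N (\<lambda>(i, j). P i j))) =
     Determinant.det (Matrix.mat N N (\<lambda>(i, j). evalp to_ac c (P i j)))"
proof -
  interpret e: comm_ring_hom "evalp to_ac c :: _ \<Rightarrow> 'k alg_closure" by (rule evalp_hom[OF to_ac_hom])
  have "map_mat (evalp to_ac c) (Matrix.mat N N (\<lambda>(i, j). P i j)) = Matrix.mat N N (\<lambda>(i, j). evalp to_ac c (P i j))"
    by (rule eq_matI) auto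
  then show ?thesis using e.hom_det[of "Matrix.mat N N (\<lambda>(i, j). P i j)"] by simp
qed

definition pcpoly :: "'x trm list \<Rightarrow> ('x trm \<times> 'x trm, 'k::field) mpoly" where
  "pcpoly M = (if M \<in> wedge_terms prec m (length L)
     then Determinant.det (Matrix.mat (length L) (length L) (\<lambda>(i, j). cpoly (L ! i) (M ! j))) else 0)"

lemma evalp_pcpoly: "evalp to_ac c (pcpoly M) = pc c M"
  by (simp add: pcpoly_def evalp_det evalp_cpoly pc_eq cmat_def pc_outside evalp_ac_simps)

lemma evalp_pc_form: "evalp to_ac c (evalp const pcpoly F) = evalp to_ac (pc c) F"
  by (subst evalp_compose[OF to_ac_hom]) (simp add: evalp_pcpoly)

text \<open>Large dimension is an open condition: \<open>N + 1\<close> independent products of terms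
  and rows have a non-zero minor, and \<open>D\<close> is this minor with indeterminate chart
  coordinates. Where it does not vanish, the same products remain independent.\<close>

lemma vdim_gt_polynomial:
  fixes c :: "_ \<Rightarrow> 'k::field alg_closure"
  assumes "vdim (smul k (pt c)) > N"
  obtains D :: "('x trm \<times> 'x trm, 'k) mpoly" where "evalp to_ac c D \<noteq> 0"
    "\<And>c'. evalp to_ac c' D \<noteq> 0 \<Longrightarrow> vdim (smul k (pt c')) > N"
proof -
  let ?g = "\<lambda>c :: _ \<Rightarrow> 'k alg_closure. \<lambda>(s, \<tau>). monomial s * bas c \<tau>" and ?I = "{s :: 'x trm. tdeg s = k} \<times> set L"
  obtain B where B: "B \<subseteq> ?g c ` ?I" "mp.independent B" "?g c ` ?I \<subseteq> mp.span B"
    by (rule mp.maximal_independent_subset)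
  have fB: "finite B" using B(1) by (rule finite_subset) simp
  have spB: "smul k (pt c) = mp.span B"
    unfolding smul_pt using B mp.span_minimal[OF B(3) mp.subspace_span] mp.span_mono[OF B(1)] by auto
  have "vdim (smul k (pt c)) = card B"
    unfolding spB vdim_def by (rule mp.dim_span_eq_card_independent[OF B(2)])
  then have "Suc N \<le> card B" using assms by simp
  then obtain B' where B': "B' \<subseteq> B" "card B' = Suc N" by (metis obtain_subset_with_card_n)
  have fB': "finite B'" using B'(1) fB finite_subset by blast
  obtain h where h: "bij_betw h {0..<Suc N} B'" using ex_bij_betw_nat_finite[OF fB'] B'(2) by auto
  have "\<forall>i<Suc N. \<exists>x. x \<in> ?I \<and> h i = ?g c x"
  proof (intro allI impI)
    fix i assume "i < Suc N"
    then have "h i \<in> B'" using h by (auto simp: bij_betw_def)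
    then have "h i \<in> ?g c ` ?I" using B'(1) B(1) by blast
    then show "\<exists>x. x \<in> ?I \<and> h i = ?g c x" by blast
  qed
  then obtain Z where "\<forall>i<Suc N. Z i \<in> ?I \<and> h i = ?g c (Z i)" unfolding choice_iff' by (rule exE)
  then have Z: "\<And>i. i < Suc N \<Longrightarrow> Z i \<in> ?I" "\<And>i. i < Suc N \<Longrightarrow> h i = ?g c (Z i)" by auto
  let ?F = "\<lambda>c i. ?g c (Z i)"
  have ind: "\<forall>i<Suc N. a i = 0" if a: "(\<Sum>i<Suc N. scale (a i) (?F c i)) = 0" for a
  proof -
    let ?u = "\<lambda>v. a (inv_into {0..<Suc N} h v)"
    have inj: "inj_on h {0..<Suc N}" using h by (simp add: bij_betw_def)
    have "(\<Sum>v\<in>B'. scale (?u v) v) = (\<Sum>i\<in>{0..<Suc N}. scale (?u (h i)) (h i))"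
      by (rule sum.reindex_bij_betw[OF h, symmetric])
    also have "\<dots> = (\<Sum>i\<in>{0..<Suc N}. scale (a i) (?F c i))"
    proof (rule sum.cong[OF refl])
      fix i assume i: "i \<in> {0..<Suc N}"
      show "scale (?u (h i)) (h i) = scale (a i) (?F c i)"
        by (subst inv_into_f_f[OF inj i]) (use Z(2)[of i] i in simp)
    qed
    also have "\<dots> = 0" using a by (simp add: lessThan_atLeast0)
    finally have "\<forall>v\<in>B'. ?u v = 0"
      using mp.independentD[OF B(2) fB' B'(1), of ?u] by blast
    then show ?thesis using h inv_into_f_f[OF inj] by (auto simp: bij_betw_def)
  qed
  obtain \<rho> where \<rho>: "Determinant.det (cmat (Suc N) (?F c) \<rho>) \<noteq> 0"
  proof (rule minor_nonzero[of "?F c" "Suc N"])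
    show "\<forall>i<Suc N. a i = 0" if "(\<Sum>i<Suc N. scale (a i) (?F c i)) = 0" for a
      using that by (rule ind)
  qed
  define D :: "('x trm \<times> 'x trm, 'k) mpoly" where
    "D = Determinant.det (Matrix.mat (Suc N) (Suc N) (\<lambda>(i, j). cpoly2 (fst (Z i)) (snd (Z i)) (\<rho> j)))"
  have D: "evalp to_ac c' D = Determinant.det (cmat (Suc N) (?F c') \<rho>)" for c'
    unfolding D_def evalp_det evalp_cpoly2 cmat_def by (simp add: case_prod_unfold)
  show thesis
  proof (rule that[of D])
    show "evalp to_ac c D \<noteq> 0" using \<rho> D by simp
    fix c' assume "evalp to_ac c' D \<noteq> 0"
    then have nz: "Determinant.det (cmat (Suc N) (?F c') \<rho>) \<noteq> 0" using D by simp
    have "card {..<Suc N} \<le> mp.dim (smul k (pt c'))"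
    proof (rule mp.card_le_dim[of _ "?g c' ` ?I"])
      show "smul k (pt c') \<subseteq> mp.span (?g c' ` ?I)" by (simp add: smul_pt)
      show "?F c' i \<in> smul k (pt c')" if "i \<in> {..<Suc N}" for i
        unfolding smul_pt using Z(1)[of i] that by (intro mp.span_base imageI) auto
      show "\<forall>i\<in>{..<Suc N}. a i = 0" if "(\<Sum>i\<in>{..<Suc N}. scale (a i) (?F c' i)) = 0" for a
        using det_cmat_independent[OF nz that] by simp
    qed simp_all
    then show "vdim (smul k (pt c')) > N" by (simp add: vdim_def)
  qed
qed

end

section \<open>Zariski topology and irreducibility\<close>

lemma evalp_proj_point_zero:
  assumes "F \<in> homog d" "c' \<in> proj_point c" "evalp to_ac c F = 0"
  shows "evalp to_ac c' F = 0"
proof -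
  obtain a where "c' = (\<lambda>i. a * c i)" using assms(2) by (auto simp: proj_point_def)
  then show ?thesis using evalp_homog_scale[OF assms(1), of to_ac a c] assms(3) by simp
qed

lemma proj_zeros_iff:
  assumes "F \<in> homog d" "proj_point c \<in> proj_space A"
  shows "proj_point c \<in> proj_zeros A F \<longleftrightarrow> evalp to_ac c F = 0"
  using assms(2) proj_point_self[of c] evalp_proj_point_zero[OF assms(1)] unfolding proj_zeros_def by blast

lemma proj_spaceE:
  assumes "P \<in> proj_space A" obtains c where "P = proj_point c" "\<forall>i. i \<notin> A \<longrightarrow> c i = 0" "c \<noteq> (\<lambda>_. 0)"
  using assms unfolding proj_space_def by blast

lemma proj_zeros_mult:
  assumes "F \<in> homog d" "G \<in> homog e"
  shows "proj_zeros A (F * G) = proj_zeros A F \<union> proj_zeros A G"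
proof (rule Set.set_eqI)
  fix P
  show "P \<in> proj_zeros A (F * G) \<longleftrightarrow> P \<in> proj_zeros A F \<union> proj_zeros A G"
  proof (cases "P \<in> proj_space A")
    case True
    then obtain c where c: "P = proj_point c" by (rule proj_spaceE)
    note T = True[unfolded c]
    show ?thesis unfolding c Un_iff
        proj_zeros_iff[OF homog_mult[OF assms] T] proj_zeros_iff[OF assms(1) T] proj_zeros_iff[OF assms(2) T]
      by (simp add: evalp_ac_simps)
  qed (simp add: proj_zeros_def)
qed

lemma topspace_zariski: "topspace (zariski A :: ('i \<Rightarrow> 'k::field alg_closure) set topology) = proj_space A"
proof -
  have "proj_zeros A (1 :: ('i, 'k) mpoly) = {}"
    using proj_point_self by (auto simp: proj_zeros_def evalp_ac_simps elim!: proj_spaceE)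
  then have "proj_space A \<in> {proj_space A - proj_zeros A F | (F :: ('i, 'k) mpoly) d. F \<in> homog d}"
    using homog_1 by blast
  then show ?thesis unfolding zariski_def topology_generated_by_topspace by auto
qed

lemma zariski_basic_open:
  assumes "(F :: ('i, 'k::field) mpoly) \<in> homog d"
  shows "openin (zariski A) (topspace (zariski A) - proj_zeros A F)"
  unfolding topspace_zariski zariski_def using assms by (intro topology_generated_by_Basis) auto

text \<open>The generating open sets are closed under intersection because zeros of a product are a
  union of zeros; the subbasis is thus a basis.\<close>

lemma zariski_basis:
  fixes U :: "('i \<Rightarrow> 'k::field alg_closure) set set"
  assumes "openin (zariski A) U" "P \<in> U"
  shows "\<exists>(F :: ('i, 'k) mpoly) d. F \<in> homog d \<and> P \<notin> proj_zeros A F \<and> proj_space A - proj_zeros A F \<subseteq> U"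
proof -
  let ?S = "{proj_space A - proj_zeros A F | (F :: ('i, 'k) mpoly) d. F \<in> homog d}"
  have "generate_topology_on ?S U" using assms(1) unfolding zariski_def openin_topology_generated_by_iff .
  then show ?thesis using assms(2)
  proof (induction rule: generate_topology_on.induct)
    case (Int a b)
    then obtain F G :: "('i, 'k) mpoly" and d e where
      F: "F \<in> homog d" "P \<notin> proj_zeros A F" "proj_space A - proj_zeros A F \<subseteq> a" and
      G: "G \<in> homog e" "P \<notin> proj_zeros A G" "proj_space A - proj_zeros A G \<subseteq> b" by blast
    then have "P \<notin> proj_zeros A (F * G)" "proj_space A - proj_zeros A (F * G) \<subseteq> a \<inter> b"
      unfolding proj_zeros_mult[OF F(1) G(1)] by auto
    then show ?case using homog_mult[OF F(1) G(1)] by blast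
  next
    case (UN K)
    then obtain k where "k \<in> K" "P \<in> k" by blast
    then show ?case using UN.IH[of k] by blast
  qed auto
qed

text \<open>The members of \<B> are described by their complements, which form a basis of the open
  sets; they may exceed the space. This treats projective space and the Hilbert scheme alike, with
  zero sets of single forms as \<B>.\<close>

definition top_basis :: "'a topology \<Rightarrow> 'a set set \<Rightarrow> bool" where
  "top_basis T \<B> \<longleftrightarrow> (\<forall>b\<in>\<B>. openin T (topspace T - b)) \<and>
     (\<forall>U x. openin T U \<longrightarrow> x \<in> U \<longrightarrow> (\<exists>b\<in>\<B>. x \<notin> b \<and> topspace T - b \<subseteq> U))"

lemma closedin_separate:
  assumes "top_basis T \<B>" "closedin (subtopology T S) C" "x \<in> S" "x \<notin> C" "S \<subseteq> topspace T"
  obtains b where "b \<in> \<B>" "x \<notin> b" "C \<subseteq> b"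
proof -
  obtain K where K: "closedin T K" "C = K \<inter> S" using assms(2) by (auto simp: closedin_subtopology)
  have "openin T (topspace T - K)" "x \<in> topspace T - K" using K assms by auto
  then obtain b where b: "b \<in> \<B>" "x \<notin> b" "topspace T - b \<subseteq> topspace T - K"
    using assms(1) unfolding top_basis_def by blast
  have "C \<subseteq> b" using b(3) K assms(5) by auto
  with b that show thesis by blast
qed

lemma closedin_basis:
  assumes "top_basis T \<B>" "b \<in> \<B>" "S \<subseteq> topspace T"
  shows "closedin (subtopology T S) (b \<inter> S)"
proof -
  have "openin T (topspace T - b)" using assms(1,2) by (simp add: top_basis_def)
  then have "closedin T (topspace T - (topspace T - b))" by blast
  moreover have "b \<inter> S = (topspace T - (topspace T - b)) \<inter> S" using assms(3) by auto
  ultimately show ?thesis by (auto simp: closedin_subtopology)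
qed

text \<open>A proper closed subset is contained in a basic one that misses a given point outside it,
  so coverings by two closed sets can be enlarged to coverings by basic ones.\<close>

lemma irreducible_subtopology_iff:
  assumes "top_basis T \<B>" "S \<subseteq> topspace T"
  shows "irreducible_space (subtopology T S) \<longleftrightarrow>
    S \<noteq> {} \<and> (\<forall>b\<in>\<B>. \<forall>b'\<in>\<B>. S \<subseteq> b \<union> b' \<longrightarrow> S \<subseteq> b \<or> S \<subseteq> b')"
proof -
  have top: "topspace (subtopology T S) = S" using assms(2) by (simp add: topspace_subtopology Int_absorb1)
  show ?thesis
  proof (intro iffI conjI ballI impI)
    assume irr: "irreducible_space (subtopology T S)"
    show "S \<noteq> {}" using irr unfolding irreducible_space_def top by blast
    fix b b' assume b: "b \<in> \<B>" "b' \<in> \<B>" "S \<subseteq> b \<union> b'"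
    have "b \<inter> S = S \<or> b' \<inter> S = S"
      using irr closedin_basis[OF assms(1) b(1) assms(2)] closedin_basis[OF assms(1) b(2) assms(2)] b(3)
      unfolding irreducible_space_def top by blast
    then show "S \<subseteq> b \<or> S \<subseteq> b'" by blast
  next
    assume *: "S \<noteq> {} \<and> (\<forall>b\<in>\<B>. \<forall>b'\<in>\<B>. S \<subseteq> b \<union> b' \<longrightarrow> S \<subseteq> b \<or> S \<subseteq> b')"
    show "irreducible_space (subtopology T S)"
      unfolding irreducible_space_def top
    proof (intro conjI allI impI)
      show "S \<noteq> {}" using * by simp
      fix C D assume CD: "closedin (subtopology T S) C" "closedin (subtopology T S) D" "C \<union> D = S"
      show "C = S \<or> D = S"
      proof (rule ccontr)
        assume "\<not> (C = S \<or> D = S)"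
        then obtain x y where x: "x \<in> S" "x \<notin> C" and y: "y \<in> S" "y \<notin> D" using CD(3) by blast
        obtain b where b: "b \<in> \<B>" "x \<notin> b" "C \<subseteq> b" by (rule closedin_separate[OF assms(1) CD(1) x assms(2)])
        obtain b' where b': "b' \<in> \<B>" "y \<notin> b'" "D \<subseteq> b'" by (rule closedin_separate[OF assms(1) CD(2) y assms(2)])
        have "S \<subseteq> b \<union> b'" using b b' CD(3) by blast
        then show False using * b b' x y by blast
      qed
    qed
  qed
qed

text \<open>A point of the closure can be added to \<open>Y\<close> without destroying
  irreducibility; by maximality it was already there.\<close>

lemma component_closed:
  assumes T: "top_basis T \<B>" and Y: "irreducible_component T Y" and x: "x \<in> topspace T"
    and b: "\<And>b. b \<in> \<B> \<Longrightarrow> Y \<subseteq> b \<Longrightarrow> x \<in> b"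
  shows "x \<in> Y"
proof -
  have Yt: "Y \<subseteq> topspace T" and irr: "irreducible_space (subtopology T Y)"
    and max: "\<And>Z. Y \<subseteq> Z \<Longrightarrow> Z \<subseteq> topspace T \<Longrightarrow> irreducible_space (subtopology T Z) \<Longrightarrow> Z = Y"
    using Y by (auto simp: irreducible_component_def)
  have sub: "insert x Y \<subseteq> topspace T" using x Yt by simp
  have "irreducible_space (subtopology T (insert x Y))"
    unfolding irreducible_subtopology_iff[OF T sub]
  proof (intro conjI ballI impI)
    fix c d assume c: "c \<in> \<B>" and d: "d \<in> \<B>" and "insert x Y \<subseteq> c \<union> d"
    then have "Y \<subseteq> c \<or> Y \<subseteq> d" using irr unfolding irreducible_subtopology_iff[OF T Yt] by blast
    then show "insert x Y \<subseteq> c \<or> insert x Y \<subseteq> d" using b[OF c] b[OF d] by blast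
  qed simp
  then have "insert x Y = Y" using max[OF _ sub] by blast
  then show ?thesis by blast
qed

lemma zariski_top_basis:
  "top_basis (zariski A) {proj_zeros A F | (F :: ('i, 'k::field) mpoly) d. F \<in> homog d}"
  unfolding top_basis_def
proof (intro conjI ballI allI impI)
  fix b assume "b \<in> {proj_zeros A F | (F :: ('i, 'k) mpoly) d. F \<in> homog d}"
  then show "openin (zariski A) (topspace (zariski A) - b)" using zariski_basic_open by blast
next
  fix U :: "('i \<Rightarrow> 'k alg_closure) set set" and x assume "openin (zariski A) U" "x \<in> U"
  then obtain F :: "('i, 'k) mpoly" and d where "F \<in> homog d" "x \<notin> proj_zeros A F" "proj_space A - proj_zeros A F \<subseteq> U"
    using zariski_basis by metis
  then show "\<exists>b\<in>{proj_zeros A F | (F :: ('i, 'k) mpoly) d. F \<in> homog d}. x \<notin> b \<and> topspace (zariski A) - b \<subseteq> U"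
    unfolding topspace_zariski by blast
qed

section \<open>The topology of the Hilbert scheme\<close>

definition pl_zeros :: "('x trm \<Rightarrow> 'x trm \<Rightarrow> bool) \<Rightarrow> nat \<Rightarrow> nat \<Rightarrow> ('x trm list, 'k::field) mpoly \<Rightarrow>
    ('x, 'k alg_closure) mpoly set set" where
  "pl_zeros prec m q F = {V. pluecker prec m q V \<in> proj_zeros (wedge_terms prec m q) F}"

lemma topspace_hilbert:
  "topspace (hilbert_top prec p m q) = {V\<in>hilbert_scheme p m q. pluecker prec m q V \<in> proj_space (wedge_terms prec m q)}"
  unfolding hilbert_top_def grassmannian_top_def topspace_subtopology topspace_pullback_topology topspace_zariski
  by (auto simp: hilbert_scheme_def)

lemma hilbert_top_basis:
  "top_basis (hilbert_top prec p m q :: ('x, 'k::field alg_closure) mpoly set topology)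
     {pl_zeros prec m q F | (F :: ('x trm list, 'k) mpoly) d. F \<in> homog d}"
proof -
  let ?A = "wedge_terms prec m q" and ?pl = "pluecker prec m q"
  let ?T = "hilbert_top prec p m q :: ('x, 'k alg_closure) mpoly set topology"
  have op: "openin ?T W \<longleftrightarrow> (\<exists>U. openin (zariski ?A) U \<and> W = {V\<in>hilbert_scheme p m q. ?pl V \<in> U})" for W
    unfolding hilbert_top_def openin_subtopology grassmannian_top_def openin_pullback_topology
    by (auto simp: hilbert_scheme_def)
  show ?thesis
    unfolding top_basis_def
  proof (intro conjI ballI allI impI)
    fix b assume "b \<in> {pl_zeros prec m q F | (F :: ('x trm list, 'k) mpoly) d. F \<in> homog d}"
    then obtain F :: "('x trm list, 'k) mpoly" and d where F: "F \<in> homog d" "b = pl_zeros prec m q F" by blast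
    have "topspace ?T - b = {V\<in>hilbert_scheme p m q. ?pl V \<in> proj_space ?A - proj_zeros ?A F}"
      unfolding topspace_hilbert F(2) pl_zeros_def by auto
    then show "openin ?T (topspace ?T - b)"
      unfolding op using zariski_basic_open[OF F(1), of ?A] unfolding topspace_zariski by blast
  next
    fix W V assume W: "openin ?T W" and V: "V \<in> W"
    obtain U where U: "openin (zariski ?A) U" "W = {V\<in>hilbert_scheme p m q. ?pl V \<in> U}" using W unfolding op by blast
    have "?pl V \<in> U" using V U(2) by simp
    then obtain F :: "('x trm list, 'k) mpoly" and d
      where F: "F \<in> homog d" "?pl V \<notin> proj_zeros ?A F" "proj_space ?A - proj_zeros ?A F \<subseteq> U"
      using zariski_basis[OF U(1)] by blast
    have "V \<notin> pl_zeros prec m q F" using F(2) by (simp add: pl_zeros_def)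
    moreover have "topspace ?T - pl_zeros prec m q F \<subseteq> W"
      unfolding topspace_hilbert U(2) pl_zeros_def using F(3) by blast
    ultimately show "\<exists>b\<in>{pl_zeros prec m q F | (F :: ('x trm list, 'k) mpoly) d. F \<in> homog d}. V \<notin> b \<and> topspace ?T - b \<subseteq> W"
      using F(1) by blast
  qed
qed

section \<open>Homogenization and one-parameter subgroups\<close>

lemma homog_monev:
  assumes "\<And>i. i \<in> pkeys t \<Longrightarrow> F i \<in> homog e" shows "monev F t \<in> homog (e * tdeg t)"
proof -
  have "monev F t \<in> homog (\<Sum>x\<in>pkeys t. e * plk t x)"
    unfolding monev_def by (rule homog_prod, rule homog_power, rule assms)
  then show ?thesis by (simp add: tdeg_def sum_distrib_left)
qed

text \<open>Each term is filled up to degree \<open>N\<close> by powers of the variable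
  \<open>i0\<close>. The factors \<sigma> serve to insert the signs between Pluecker and chart
  coordinates, and with value 0 to remove variables foreign to the chart.\<close>

lemma homogenize:
  fixes f :: "('e, 'k::field) mpoly" and \<iota> :: "'e \<Rightarrow> 'i" and \<sigma> :: "'e \<Rightarrow> 'k"
  assumes N: "\<And>t. t \<in> pkeys f \<Longrightarrow> tdeg t \<le> N"
  shows "\<exists>F \<in> homog N. \<forall>y. y i0 \<noteq> 0 \<longrightarrow>
    evalp to_ac y F = y i0 ^ N * evalp to_ac (\<lambda>e. to_ac (\<sigma> e) * y (\<iota> e) / y i0) f"
proof -
  let ?z = "\<lambda>e. const (\<sigma> e) * monomial (var (\<iota> e)) :: ('i, 'k) mpoly"
  let ?F = "\<Sum>t\<in>pkeys f. const (plk f t) * monev ?z t * monomial (var i0) ^ (N - tdeg t)"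
  have "?F \<in> homog N"
  proof (rule homog_sum)
    fix t assume t: "t \<in> pkeys f"
    have "?z e \<in> homog 1" for e
      using homog_mult[OF homog_const, of "monomial (var (\<iota> e))" 1 "\<sigma> e"] by (simp add: homog_monomial)
    then have "monev ?z t \<in> homog (1 * tdeg t)" by (rule homog_monev)
    then have "const (plk f t) * monev ?z t \<in> homog (0 + tdeg t)" by (intro homog_mult homog_const) simp
    moreover have "monomial (var i0) ^ (N - tdeg t) \<in> (homog (1 * (N - tdeg t)) :: ('i, 'k) mpoly set)"
      by (intro homog_power) (simp add: homog_monomial)
    ultimately show "const (plk f t) * monev ?z t * monomial (var i0) ^ (N - tdeg t) \<in> homog N"
      using homog_mult N[OF t] by fastforce
  qed
  moreover have "evalp to_ac y ?F = y i0 ^ N * evalp to_ac (\<lambda>e. to_ac (\<sigma> e) * y (\<iota> e) / y i0) f"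
    if y: "y i0 \<noteq> 0" for y
  proof -
    have "evalp to_ac y ?F = (\<Sum>t\<in>pkeys f. to_ac (plk f t) * monev (\<lambda>e. to_ac (\<sigma> e) * y (\<iota> e)) t * y i0 ^ (N - tdeg t))"
      by (simp add: evalp_sum[OF to_ac_hom] evalp_power[OF to_ac_hom] evalp_ac_simps hom_monev[OF evalp_hom[OF to_ac_hom]])
    also have "\<dots> = (\<Sum>t\<in>pkeys f. y i0 ^ N * (to_ac (plk f t) * monev (\<lambda>e. to_ac (\<sigma> e) * y (\<iota> e) / y i0) t))"
    proof (rule sum.cong[OF refl])
      fix t assume t: "t \<in> pkeys f"
      have "monev (\<lambda>e. to_ac (\<sigma> e) * y (\<iota> e) / y i0) t = monev (\<lambda>e. inverse (y i0) * (to_ac (\<sigma> e) * y (\<iota> e))) t"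
        by (rule monev_cong) (simp add: field_simps)
      also have "\<dots> = inverse (y i0) ^ tdeg t * monev (\<lambda>e. to_ac (\<sigma> e) * y (\<iota> e)) t" by (rule monev_scale)
      finally show "to_ac (plk f t) * monev (\<lambda>e. to_ac (\<sigma> e) * y (\<iota> e)) t * y i0 ^ (N - tdeg t) =
          y i0 ^ N * (to_ac (plk f t) * monev (\<lambda>e. to_ac (\<sigma> e) * y (\<iota> e) / y i0) t)"
        using y N[OF t] by (simp add: power_diff power_inverse field_simps)
    qed
    also have "\<dots> = y i0 ^ N * evalp to_ac (\<lambda>e. to_ac (\<sigma> e) * y (\<iota> e) / y i0) f"
      by (simp add: evalp_monev sum_distrib_left)
    finally show ?thesis .
  qed
  ultimately show ?thesis by blast
qed

lemma degree_bound: obtains N where "\<And>t. t \<in> pkeys f \<Longrightarrow> tdeg t \<le> N"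
proof
  show "tdeg t \<le> Max (tdeg ` pkeys f)" if "t \<in> pkeys f" for t using that by simp
qed

section \<open>Weights of terms and one-parameter subgroups\<close>

definition wt :: "('e \<Rightarrow> nat) \<Rightarrow> 'e trm \<Rightarrow> nat" where
  "wt a t = (\<Sum>e\<in>pkeys t. plk t e * a e)"

lemma monev_power: "monev (\<lambda>e. z ^ a e) t = z ^ wt a t"
  by (simp add: monev_def wt_def power_sum mult.commute flip: power_mult)

definition restr :: "('e trm \<Rightarrow> bool) \<Rightarrow> ('e, 'k::comm_ring_1) mpoly \<Rightarrow> ('e, 'k) mpoly" where
  "restr S f = (\<Sum>t\<in>{t\<in>pkeys f. S t}. psingle t (plk f t))"

lemma plk_restr: "plk (restr S f) t = (if S t then plk f t else 0)"
  by (auto simp: restr_def lookup_sum lookup_single when_def sum.delta' in_keys_iff)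

lemma evalp_restr: "evalp to_ac c (restr S f) = (\<Sum>t\<in>{t\<in>pkeys f. S t}. to_ac (plk f t) * monev c t)"
  by (simp add: restr_def evalp_sum[OF to_ac_hom] evalp_psingle[OF to_ac_hom])

text \<open>The value of \<open>f\<close> along an orbit of a one-parameter subgroup is a Laurent polynomial in the
  parameter; its coefficients are the values of the weight components of \<open>f\<close>.\<close>

lemma torus_poly:
  fixes f :: "('e, 'k::field) mpoly" and a b :: "'e \<Rightarrow> nat"
  defines "N \<equiv> \<Sum>t\<in>pkeys f. wt b t"
  obtains P where "\<And>z. z \<noteq> 0 \<Longrightarrow> poly P z = z ^ N * evalp to_ac (\<lambda>e. c e * (z ^ a e * inverse z ^ b e)) f"
    "\<And>j. Polynomial.coeff P j = evalp to_ac c (restr (\<lambda>t. N + wt a t = j + wt b t) f)"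
proof -
  let ?P = "\<Sum>t\<in>pkeys f. Polynomial.monom (to_ac (plk f t) * monev c t) (N + wt a t - wt b t)"
  \<comment> \<open>The factor \<open>z ^ N\<close> clears all denominators, and makes the truncated
    subtraction in the exponents exact.\<close>
  have Nb: "wt b t \<le> N" if "t \<in> pkeys f" for t
    unfolding N_def using that by (intro member_le_sum) auto
  show thesis
  proof (rule that[of ?P])
    fix z :: "'k alg_closure" assume z: "z \<noteq> 0"
    have "z ^ N * evalp to_ac (\<lambda>e. c e * (z ^ a e * inverse z ^ b e)) f =
        (\<Sum>t\<in>pkeys f. to_ac (plk f t) * monev c t * z ^ (N + wt a t - wt b t))"
      unfolding evalp_monev sum_distrib_left
    proof (rule sum.cong[OF refl])
      fix t assume t: "t \<in> pkeys f"
      show "z ^ N * (to_ac (plk f t) * monev (\<lambda>e. c e * (z ^ a e * inverse z ^ b e)) t) =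
          to_ac (plk f t) * monev c t * z ^ (N + wt a t - wt b t)"
      proof -
        have "monev (\<lambda>e. c e * (z ^ a e * inverse z ^ b e)) t = monev c t * (z ^ wt a t * inverse z ^ wt b t)"
          by (simp only: monev_mult monev_power)
        moreover have "z ^ (N + wt a t - wt b t) = z ^ N * z ^ wt a t * inverse z ^ wt b t"
          using z Nb[OF t] by (simp add: power_diff power_add power_inverse divide_inverse)
        ultimately show ?thesis by (simp only: ac_simps)
      qed
    qed
    then show "poly ?P z = z ^ N * evalp to_ac (\<lambda>e. c e * (z ^ a e * inverse z ^ b e)) f"
      by (simp add: poly_sum poly_monom)
  next
    fix j
    have "Polynomial.coeff ?P j = (\<Sum>t\<in>pkeys f. if N + wt a t = j + wt b t then to_ac (plk f t) * monev c t else 0)"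
      unfolding coeff_sum
    proof (rule sum.cong[OF refl])
      fix t assume t: "t \<in> pkeys f"
      have "N + wt a t - wt b t = j \<longleftrightarrow> N + wt a t = j + wt b t" using Nb[OF t] by linarith
      then show "Polynomial.coeff (Polynomial.monom (to_ac (plk f t) * monev c t) (N + wt a t - wt b t)) j =
          (if N + wt a t = j + wt b t then to_ac (plk f t) * monev c t else 0)" by simp
    qed
    also have "\<dots> = evalp to_ac c (restr (\<lambda>t. N + wt a t = j + wt b t) f)"
      unfolding evalp_restr by (rule sum.inter_filter[symmetric]) simp
    finally show "Polynomial.coeff ?P j = evalp to_ac c (restr (\<lambda>t. N + wt a t = j + wt b t) f)" .
  qed
qed

text \<open>Only parameters from K act on \<open>Y\<close>, while the polynomials in the parameter
  have coefficients in the algebraic closure; an infinite K still separates them from 0.\<close>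

lemma infinite_to_ac_nonroots:
  fixes P :: "'k::field alg_closure poly"
  assumes "infinite (UNIV :: 'k set)" "P \<noteq> 0"
  obtains s :: 'k where "s \<noteq> 0" "poly P (to_ac s) \<noteq> 0"
proof (rule ccontr)
  assume "\<not> thesis"
  then have "to_ac ` (UNIV - {0 :: 'k}) \<subseteq> {z. poly P z = 0}" using that by auto
  moreover have "finite {z. poly P z = 0}" using assms(2) by (rule poly_roots_finite)
  ultimately have "finite (to_ac ` (UNIV - {0 :: 'k}))" by (rule finite_subset)
  then have "finite (UNIV - {0 :: 'k})" by (rule finite_imageD) (auto simp: inj_on_def)
  then show False using assms(1) by simp
qed

subsection \<open>Rescaling a variable\<close>

text \<open>The substitution of \<open>s x\<close> for one variable \<open>x\<close>. For non-zero
  \<open>s\<close> these generate the diagonal torus.\<close>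

definition tact :: "'x \<Rightarrow> 'f::comm_ring_1 \<Rightarrow> ('x, 'f) mpoly \<Rightarrow> ('x, 'f) mpoly" where
  "tact x s f = (\<Sum>t\<in>pkeys f. psingle t (s ^ plk t x * plk f t))"

lemma plk_tact: "plk (tact x s f) t = s ^ plk t x * plk f t"
  by (auto simp: tact_def lookup_sum lookup_single when_def sum.delta' in_keys_iff)

lemma tact_add: "tact x s (f + g) = tact x s f + tact x s g"
  by (rule poly_mapping_eqI) (simp add: plk_tact lookup_add distrib_left)

lemma tact_0 [simp]: "tact x s 0 = 0"
  by (rule poly_mapping_eqI) (simp add: plk_tact)

lemma tact_psingle: "tact x s (psingle t c) = psingle t (s ^ plk t x * c)"
  by (rule poly_mapping_eqI) (auto simp: plk_tact lookup_single when_def)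

lemma tact_mult: "tact x s (f * g) = tact x s f * tact x s g"
proof (induction f rule: poly_mapping_single_induct)
  case (add f u c)
  have "tact x s (psingle u c * g) = tact x s (psingle u c) * tact x s g"
  proof (induction g rule: poly_mapping_single_induct)
    case (add g v d)
    then show ?case
      by (simp add: tact_add distrib_left mult_single tact_psingle lookup_add power_add mult_ac)
  qed simp
  with add show ?case by (simp add: distrib_right tact_add)
qed simp

lemma tact_scale: "tact x s (scale a f) = scale a (tact x s f)"
  by (rule poly_mapping_eqI) (simp add: plk_tact)

lemma tact_inverse: "(s :: 'f::field) \<noteq> 0 \<Longrightarrow> tact x s (tact x (inverse s) f) = f"
  by (rule poly_mapping_eqI) (simp add: plk_tact power_inverse)

lemma tact_hcomp: "tact x s (hcomp d f) = hcomp d (tact x s f)"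
  by (rule poly_mapping_eqI) (simp add: plk_tact plk_hcomp)

lemma keys_tact: "(s :: 'f::field) \<noteq> 0 \<Longrightarrow> pkeys (tact x s f) = pkeys f"
  by (auto simp: in_keys_iff plk_tact)

lemma tact_homog: "(s :: 'f::field) \<noteq> 0 \<Longrightarrow> tact x s f \<in> homog d \<longleftrightarrow> f \<in> homog d"
  by (simp add: homog_def keys_tact)

lemma tact_eq_0: "(s :: 'f::field) \<noteq> 0 \<Longrightarrow> tact x s f = 0 \<longleftrightarrow> f = 0"
  by (metis keys_empty_iff keys_tact)

lemma lt_tact: "(s :: 'f::field) \<noteq> 0 \<Longrightarrow> lt prec (tact x s f) = lt prec f"
  by (simp add: lt_def keys_tact)

text \<open>Rescaling keeps the support of a polynomial. The ideal and its preimage therefore have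
  the same leading terms in each degree, hence equal Hilbert functions.\<close>

lemma (in tord) tact_subscheme_ideals:
  fixes I :: "('x, 'f::field) mpoly set"
  assumes fin: "\<And>d. finite {t :: 'x trm. tdeg t = d}" and s: "s \<noteq> 0" and I: "I \<in> subscheme_ideals p"
  shows "{f. tact x s f \<in> I} \<in> subscheme_ideals p"
proof -
  let ?I = "{f. tact x s f \<in> I}"
  have sat: "saturated I" and id: "module.subspace (*) I" and hp: "has_hilbert_poly I p"
    and hI: "\<And>f d. f \<in> I \<Longrightarrow> hcomp d f \<in> I"
    using I by (auto simp: subscheme_ideals_def homogeneous_ideal_def)
  have id': "module.subspace (*) ?I"
    using id unfolding ideal_iff by (simp add: tact_add tact_mult)
  then have "homogeneous_ideal ?I" using hI by (simp add: homogeneous_ideal_def tact_hcomp)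
  moreover have "saturated ?I"
    unfolding saturated_def
  proof (intro allI impI)
    fix f assume "\<exists>k. \<forall>g\<in>homog k. g * f \<in> ?I"
    then obtain k where k: "\<And>g. g \<in> homog k \<Longrightarrow> tact x s (g * f) \<in> I" by blast
    have "g * tact x s f \<in> I" if g: "g \<in> homog k" for g
    proof -
      have "tact x (inverse s) g \<in> homog k" using g s by (simp add: tact_homog)
      from k[OF this] show ?thesis by (simp add: tact_mult tact_inverse[OF s])
    qed
    then have "tact x s f \<in> I" using sat unfolding saturated_def by blast
    then show "f \<in> ?I" by simp
  qed
  moreover have "vdim (?I \<inter> homog d) = vdim (I \<inter> homog d)" for d
  proof -
    have sub: "mp.subspace (I \<inter> homog d)" "mp.subspace (?I \<inter> homog d)"
      by (intro mp.subspace_inter ideal_subspace id id' subspace_homog)+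
    have "lt prec ` (?I \<inter> homog d - {0}) = lt prec ` (I \<inter> homog d - {0})"
    proof (intro equalityI image_subsetI)
      fix f assume "f \<in> ?I \<inter> homog d - {0}"
      then have "tact x s f \<in> I \<inter> homog d - {0}" using s by (simp add: tact_homog tact_eq_0)
      then have "lt prec (tact x s f) \<in> lt prec ` (I \<inter> homog d - {0})" by (rule imageI)
      then show "lt prec f \<in> lt prec ` (I \<inter> homog d - {0})" using s by (simp add: lt_tact)
    next
      fix f assume "f \<in> I \<inter> homog d - {0}"
      then have "tact x (inverse s) f \<in> ?I \<inter> homog d - {0}"
        using s by (simp add: tact_homog tact_eq_0 tact_inverse)
      then have "lt prec (tact x (inverse s) f) \<in> lt prec ` (?I \<inter> homog d - {0})" by (rule imageI)
      then show "lt prec f \<in> lt prec ` (?I \<inter> homog d - {0})" using s by (simp add: lt_tact)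
    qed
    then show ?thesis
      using vdim_lt_homog(1)[OF fin sub(1) Int_lower2] vdim_lt_homog(1)[OF fin sub(2) Int_lower2] by simp
  qed
  then have "has_hilbert_poly ?I p" using hp by (simp add: has_hilbert_poly_def)
  ultimately show ?thesis by (simp add: subscheme_ideals_def)
qed

section \<open>The chart of a component of the Hilbert scheme\<close>

lemma (in chart) pt_cong: "(\<And>e. e \<in> E \<Longrightarrow> c e = c' e) \<Longrightarrow> pt c = pt c'"
proof -
  assume c: "\<And>e. e \<in> E \<Longrightarrow> c e = c' e"
  have "bas c \<tau> = bas c' \<tau>" for \<tau> by (rule poly_mapping_eqI) (simp add: plk_bas c)
  then show ?thesis by (simp add: pt_def)
qed

text \<open>The generic initial enters as \<open>max\<close>: on \<open>Y\<close> all Pluecker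
  coordinates above \<open>L\<close> vanish. By \<open>reg\<close> and \<open>mr\<close>, degree
  \<open>m\<close> is in the range where Hilbert functions are polynomial and ideals are generated
  from their part of degree \<open>m\<close>.\<close>

locale hilb_chart = chart prec L m for prec :: "'x::finite trm \<Rightarrow> 'x trm \<Rightarrow> bool" and L m +
  fixes p :: "rat poly" and n r :: nat and Y :: "('x, 'k::field alg_closure) mpoly set set"
  assumes inf: "infinite (UNIV :: 'k set)"
    and card_n: "CARD('x) = n + 1"
    and reg: "\<And>I :: ('x, 'k alg_closure) mpoly set. I \<in> subscheme_ideals p \<Longrightarrow> regular_ideal r I"
    and mr: "m \<ge> r"
    and comp: "irreducible_component (hilbert_top prec p m (length L)) Y"
    and vsY: "vs L \<in> Y"
    and max: "\<And>V B M. V \<in> Y \<Longrightarrow> ordered_basis V B \<Longrightarrow> M \<in> wedge_terms prec m (length L) \<Longrightarrow>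
      pluecker_coord B M \<noteq> 0 \<Longrightarrow> M = L \<or> wedge_less prec M L"
begin

abbreviation A :: "'x trm list set" where "A \<equiv> wedge_terms prec m (length L)"
abbreviation pl :: "('x, 'k alg_closure) mpoly set \<Rightarrow> ('x trm list \<Rightarrow> 'k alg_closure) set" where
  "pl \<equiv> pluecker prec m (length L)"
abbreviation Hilb :: "('x, 'k alg_closure) mpoly set set" where "Hilb \<equiv> hilbert_scheme p m (length L)"
abbreviation HT :: "('x, 'k alg_closure) mpoly set topology" where "HT \<equiv> hilbert_top prec p m (length L)"
abbreviation zs :: "('x trm list, 'k) mpoly \<Rightarrow> ('x, 'k alg_closure) mpoly set set" where
  "zs \<equiv> pl_zeros prec m (length L)"

lemma Y_topspace: "Y \<subseteq> topspace HT" using comp by (simp add: irreducible_component_def)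
lemma Y_Hilb: "V \<in> Y \<Longrightarrow> V \<in> Hilb" using Y_topspace by (auto simp: topspace_hilbert)
lemma Y_proj: "V \<in> Y \<Longrightarrow> pl V \<in> proj_space A" using Y_topspace by (auto simp: topspace_hilbert)

lemma pl_pt_proj: "proj_point (pc c) \<in> proj_space A"
proof -
  have "pc c \<noteq> (\<lambda>_. 0)" using pc_L[of c] by (metis zero_neq_one)
  then show ?thesis unfolding proj_space_def using pc_outside by blast
qed

lemma zs_pt: "F \<in> homog d \<Longrightarrow> pt c \<in> zs F \<longleftrightarrow> evalp to_ac (pc c) F = 0"
  unfolding pl_zeros_def mem_Collect_eq pluecker_pt by (rule proj_zeros_iff[OF _ pl_pt_proj])

lemma pt_topspace: "pt c \<in> Hilb \<Longrightarrow> pt c \<in> topspace HT"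
  unfolding topspace_hilbert pluecker_pt using pl_pt_proj[of c] by (simp add: pluecker_pt)

text \<open>Values outside \<open>E\<close> are fixed as 0 so that a point of the chart has only one
  coordinate function.\<close>

definition Xs :: "('x trm \<times> 'x trm \<Rightarrow> 'k alg_closure) set" where
  "Xs = {c. (\<forall>e. e \<notin> E \<longrightarrow> c e = 0) \<and> pt c \<in> Y}"

lemma Xs_outside: "c \<in> Xs \<Longrightarrow> e \<notin> E \<Longrightarrow> c e = 0"
  by (cases e) (simp add: Xs_def)

lemma zero_Xs: "(\<lambda>_. 0) \<in> Xs"
  using vsY by (simp add: Xs_def vs_eq_pt)

lemma chart_point_nonzero:
  assumes V: "V \<in> Y" and d: "d \<in> pl V" "d L \<noteq> 0"
  obtains c where "c \<in> Xs" "V = pt c"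
proof -
  obtain B a where B: "ordered_basis V B" "d = (\<lambda>i. a * pvec prec m (length L) B i)"
    using d(1) unfolding pluecker_def proj_point_def pvec_def by blast
  have nz: "pluecker_coord B L \<noteq> 0" using d(2) B(2) L_wedge by (simp add: pvec_def)
  have "V \<in> grassmannian m (length L)" using Y_Hilb[OF V] by (simp add: hilbert_scheme_def)
  from pt_of_max[OF this B(1) nz max[OF V B(1)]] obtain c where c: "V = pt c" by metis
  let ?c = "\<lambda>e. if e \<in> E then c e else 0"
  have "pt ?c = V" unfolding c by (rule pt_cong) simp
  then have "?c \<in> Xs" using V by (simp add: Xs_def)
  with \<open>pt ?c = V\<close> that show thesis by metis
qed

lemma chart_point:
  assumes V: "V \<in> Y" and nz: "V \<notin> zs (monomial (var L))"
  obtains c where "c \<in> Xs" "V = pt c"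
proof -
  have "pl V \<notin> proj_zeros A (monomial (var L) :: (_, 'k) mpoly)" using nz by (simp add: pl_zeros_def)
  then obtain d where d: "d \<in> pl V" "d L \<noteq> 0"
    using Y_proj[OF V] by (auto simp: proj_zeros_def evalp_ac_simps)
  from chart_point_nonzero[OF V d] that show thesis by metis
qed

lemma Y_irreducible:
  assumes "F \<in> homog d" "G \<in> homog e" "Y \<subseteq> zs F \<union> zs G" shows "Y \<subseteq> zs F \<or> Y \<subseteq> zs G"
proof -
  have irr: "irreducible_space (subtopology HT Y)" using comp by (simp add: irreducible_component_def)
  from irr[unfolded irreducible_subtopology_iff[OF hilbert_top_basis Y_topspace]] assms
  show ?thesis by blast
qed

text \<open>\<open>Y\<close> is covered by the zeros of \<open>F\<close> and those of the coordinate
  at \<open>L\<close>. The latter miss \<open>vs L\<close>, so irreducibility leaves the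
  former.\<close>

lemma Y_dense:
  assumes F: "F \<in> homog d" and X: "\<And>c. c \<in> Xs \<Longrightarrow> evalp to_ac (pc c) F = 0" shows "Y \<subseteq> zs F"
proof -
  let ?L = "monomial (var L) :: ('x trm list, 'k) mpoly"
  have L1: "?L \<in> homog 1" by (simp add: homog_monomial)
  have "Y \<subseteq> zs ?L \<union> zs F"
  proof
    fix V assume V: "V \<in> Y"
    show "V \<in> zs ?L \<union> zs F"
    proof (cases "V \<in> zs ?L")
      case False
      with V obtain c where "c \<in> Xs" "V = pt c" by (rule chart_point)
      then show ?thesis using X zs_pt[OF F] by simp
    qed simp
  qed
  then have "Y \<subseteq> zs ?L \<or> Y \<subseteq> zs F" by (rule Y_irreducible[OF L1 F])
  moreover have "vs L \<notin> zs ?L"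
    unfolding vs_eq_pt zs_pt[OF L1] by (simp add: evalp_ac_simps pc_L)
  ultimately show ?thesis using vsY by blast
qed

definition sg :: "'x trm \<times> 'x trm \<Rightarrow> int" where
  "sg e = (SOME s. (s = 1 \<or> s = - 1) \<and> (\<forall>c :: _ \<Rightarrow> 'k alg_closure. pc c (swap e) = of_int s * c e))"

lemma sg: assumes "e \<in> E"
  shows "sg e = 1 \<or> sg e = - 1" "pc (c :: _ \<Rightarrow> 'k alg_closure) (swap e) = of_int (sg e) * c e"
proof -
  obtain s :: int where "s = 1 \<or> s = - 1" "\<And>c :: _ \<Rightarrow> 'k alg_closure. pc c (swap e) = of_int s * c e"
    using pc_swap[OF assms] by metis
  then have "\<exists>s. (s = 1 \<or> s = - 1) \<and> (\<forall>c :: _ \<Rightarrow> 'k alg_closure. pc c (swap e) = of_int s * c e)" by blast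
  then have "(sg e = 1 \<or> sg e = - 1) \<and> (\<forall>c :: _ \<Rightarrow> 'k alg_closure. pc c (swap e) = of_int (sg e) * c e)"
    unfolding sg_def by (rule someI_ex)
  then show "sg e = 1 \<or> sg e = - 1" "pc (c :: _ \<Rightarrow> 'k alg_closure) (swap e) = of_int (sg e) * c e" by blast+
qed

lemma sg_sg: "e \<in> E \<Longrightarrow> of_int (sg e) * (of_int (sg e) * z) = (z :: 'k alg_closure)"
  using sg(1)[of e] by auto

text \<open>On \<open>pc c\<close> the chart coordinates are Pluecker coordinates up to sign and the
  entry at \<open>L\<close> is 1. So each polynomial function on the chart comes from a form, and
  irreducibility of \<open>Y\<close>, which speaks of forms, passes to the chart.\<close>

lemma chart_form:
  fixes f :: "('x trm \<times> 'x trm, 'k) mpoly"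
  obtains N F where "F \<in> homog N" "\<And>c. c \<in> Xs \<Longrightarrow> evalp to_ac (pc c) F = evalp to_ac c f"
proof -
  obtain N where N: "\<And>t. t \<in> pkeys f \<Longrightarrow> tdeg t \<le> N" using degree_bound[of f] by metis
  \<comment> \<open>The value 0 outside \<open>E\<close> matches the normalization of
    \<open>Xs\<close>.\<close>
  let ?\<sigma> = "\<lambda>e. if e \<in> E then of_int (sg e) else 0 :: 'k"
  have "\<exists>F \<in> homog N. \<forall>y. y L \<noteq> 0 \<longrightarrow>
      evalp to_ac y F = y L ^ N * evalp to_ac (\<lambda>e. to_ac (?\<sigma> e) * y (swap e) / y L) f"
    using N by (rule homogenize)
  then obtain F where F: "F \<in> homog N" "\<And>y. y L \<noteq> 0 \<Longrightarrow>
      evalp to_ac y F = y L ^ N * evalp to_ac (\<lambda>e. to_ac (?\<sigma> e) * y (swap e) / y L) f"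
    by auto
  have "evalp to_ac (pc c) F = evalp to_ac c f" if c: "c \<in> Xs" for c
  proof -
    have "(\<lambda>e. to_ac (?\<sigma> e) * pc c (swap e) / pc c L) = c"
    proof
      fix e show "to_ac (?\<sigma> e) * pc c (swap e) / pc c L = c e"
      proof (cases "e \<in> E")
        case True then show ?thesis by (simp add: pc_L sg(2) sg_sg)
      next
        case False then show ?thesis using c by (simp add: Xs_outside)
      qed
    qed
    then show ?thesis using F(2)[of "pc c"] by (simp add: pc_L)
  qed
  with F(1) that show thesis by blast
qed

lemma Xs_irreducible:
  fixes f g :: "('x trm \<times> 'x trm, 'k) mpoly"
  assumes fg: "\<And>c. c \<in> Xs \<Longrightarrow> evalp to_ac c f * evalp to_ac c g = 0"
  shows "(\<forall>c\<in>Xs. evalp to_ac c f = 0) \<or> (\<forall>c\<in>Xs. evalp to_ac c g = 0)"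
proof -
  obtain N F where F: "F \<in> homog N" "\<And>c. c \<in> Xs \<Longrightarrow> evalp to_ac (pc c) F = evalp to_ac c f"
    using chart_form[of f] by metis
  obtain K G where G: "G \<in> homog K" "\<And>c. c \<in> Xs \<Longrightarrow> evalp to_ac (pc c) G = evalp to_ac c g"
    using chart_form[of g] by metis
  have "Y \<subseteq> zs (F * G)"
    by (rule Y_dense[OF homog_mult[OF F(1) G(1)]]) (simp add: evalp_ac_simps F(2) G(2) fg)
  also have "zs (F * G) = zs F \<union> zs G"
    unfolding pl_zeros_def proj_zeros_mult[OF F(1) G(1)] by auto
  finally have "Y \<subseteq> zs F \<or> Y \<subseteq> zs G" by (rule Y_irreducible[OF F(1) G(1)])
  then show ?thesis
  proof
    assume YF: "Y \<subseteq> zs F"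
    have "evalp to_ac c f = 0" if c: "c \<in> Xs" for c
    proof -
      have "pt c \<in> zs F" using c YF by (auto simp: Xs_def)
      then show ?thesis unfolding zs_pt[OF F(1)] F(2)[OF c] .
    qed
    then show ?thesis by simp
  next
    assume YG: "Y \<subseteq> zs G"
    have "evalp to_ac c g = 0" if c: "c \<in> Xs" for c
    proof -
      have "pt c \<in> zs G" using c YG by (auto simp: Xs_def)
      then show ?thesis unfolding zs_pt[OF G(1)] G(2)[OF c] .
    qed
    then show ?thesis by simp
  qed
qed

subsection \<open>The chart is closed\<close>

lemma Hilb_ideal:
  assumes V: "V \<in> Hilb"
  obtains I where "I \<in> subscheme_ideals p" "\<And>k. I \<inter> homog (m + k) = smul k V"
    "\<And>k. of_nat (vdim (smul k V)) = of_nat ((n + (m + k)) choose n) - poly p (of_nat (m + k))"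
proof -
  obtain I where I: "I \<in> subscheme_ideals p" "V = I \<inter> homog m"
    using V by (auto simp: hilbert_scheme_def)
  have id: "module.subspace (*) I" using I(1) by (simp add: subscheme_ideals_def homogeneous_ideal_def)
  have gen: "I \<inter> homog (m + k) = smul k V" for k
    unfolding I(2) by (rule regular_generated[OF id reg[OF I(1)] mr])
  have "of_nat (vdim (smul k V)) = (of_nat ((n + (m + k)) choose n) - poly p (of_nat (m + k)) :: rat)" for k
    unfolding gen[symmetric] by (rule regular_vdim[OF card_n I(1) reg[OF I(1)]]) (use mr in simp)
  with I(1) gen that show thesis by metis
qed

text \<open>Both dimensions are determined by the Hilbert polynomial, since
  \<open>m + k \<ge> r\<close>; at the special point they are counted by terms.\<close>

lemma vdim_smul_Hilb: assumes V: "V \<in> Hilb" shows "vdim (smul k V) = card (T k)"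
proof -
  obtain I where I: "\<And>k. of_nat (vdim (smul k V)) = (of_nat ((n + (m + k)) choose n) - poly p (of_nat (m + k)) :: rat)"
    using Hilb_ideal[OF V] by metis
  obtain I0 where I0: "\<And>k. of_nat (vdim (smul k (vs L :: ('x, 'k alg_closure) mpoly set)))
      = (of_nat ((n + (m + k)) choose n) - poly p (of_nat (m + k)) :: rat)"
    using Hilb_ideal[OF Y_Hilb[OF vsY]] by metis
  have "of_nat (vdim (smul k V)) = (of_nat (vdim (smul k (vs L :: ('x, 'k alg_closure) mpoly set))) :: rat)"
    unfolding I I0 ..
  then show ?thesis by (simp add: vdim_smul_vs)
qed

text \<open>If S_k V were too large at \<open>c\<close>, some minor would be non-zero there although
  it vanishes on \<open>Xs\<close>. So \<open>pt c\<close> is in the Hilbert scheme; it is in the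
  closure of \<open>Y\<close>, as the pulled back equations of \<open>Y\<close> hold at
  \<open>c\<close>.\<close>

lemma Xs_closed:
  assumes c: "\<And>f :: ('x trm \<times> 'x trm, 'k) mpoly. (\<And>c'. c' \<in> Xs \<Longrightarrow> evalp to_ac c' f = 0) \<Longrightarrow> evalp to_ac c f = 0"
  shows "c \<in> Xs"
proof -
  have "c e = 0" if "e \<notin> E" for e
  proof -
    have "evalp to_ac c (monomial (var e) :: (_, 'k) mpoly) = 0"
      by (rule c) (use that in \<open>simp add: evalp_ac_simps Xs_outside\<close>)
    then show ?thesis by (simp add: evalp_ac_simps)
  qed
  moreover have "pt c \<in> Y"
  proof -
    obtain I0 where I0: "I0 \<in> subscheme_ideals p" "\<And>k. I0 \<inter> homog (m + k) = smul k (vs L :: ('x, 'k alg_closure) mpoly set)"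
      using Hilb_ideal[OF Y_Hilb[OF vsY]] by metis
    have "vdim (smul k (pt c)) \<le> card (T k)" for k
    proof (rule ccontr)
      assume "\<not> ?thesis"
      then have "vdim (smul k (pt c)) > card (T k)" by simp
      then obtain D :: "('x trm \<times> 'x trm, 'k) mpoly" where D: "evalp to_ac c D \<noteq> 0"
        "\<And>c'. evalp to_ac c' D \<noteq> 0 \<Longrightarrow> vdim (smul k (pt c')) > card (T k)"
        using vdim_gt_polynomial by metis
      have "evalp to_ac c' D = 0" if "c' \<in> Xs" for c'
      proof -
        have "pt c' \<in> Hilb" using that Y_Hilb by (simp add: Xs_def)
        then have "vdim (smul k (pt c')) = card (T k)" by (rule vdim_smul_Hilb)
        then show ?thesis using D(2)[of c'] by fastforce
      qed
      then show False using c[of D] D(1) by blast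
    qed
    then have H: "pt c \<in> Hilb" by (rule hilbert_scheme_of_vdim_le[OF I0])
    show ?thesis
    proof (rule component_closed[OF hilbert_top_basis comp pt_topspace[OF H]])
      fix b assume "b \<in> {zs F | (F :: ('x trm list, 'k) mpoly) d. F \<in> homog d}" and Yb: "Y \<subseteq> b"
      then obtain F :: "('x trm list, 'k) mpoly" and d where F: "F \<in> homog d" "b = zs F" by blast
      have "evalp to_ac c (evalp const pcpoly F) = 0"
      proof (rule c)
        fix c' assume "c' \<in> Xs"
        then have "pt c' \<in> zs F" using Yb F(2) by (auto simp: Xs_def)
        then show "evalp to_ac c' (evalp const pcpoly F) = 0" unfolding evalp_pc_form zs_pt[OF F(1)] .
      qed
      then show "pt c \<in> b" unfolding F(2) zs_pt[OF F(1)] evalp_pc_form .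
    qed
  qed
  ultimately show ?thesis by (simp add: Xs_def)
qed

subsection \<open>The chart is invariant under the torus\<close>

text \<open>The action of \<open>tact\<close> on chart coordinates: the pair (\<tau>, \<eta>) has
  weight \<eta> - \<tau>, written as a numerator and a denominator because exponents are natural
  numbers.\<close>

definition chi :: "'x \<Rightarrow> 'k \<Rightarrow> ('x trm \<times> 'x trm \<Rightarrow> 'k alg_closure) \<Rightarrow> 'x trm \<times> 'x trm \<Rightarrow> 'k alg_closure" where
  "chi x s c = (\<lambda>e. c e * (to_ac s ^ plk (snd e) x * inverse (to_ac s) ^ plk (fst e) x))"

lemma chi_1 [simp]: "chi x 1 c = c" by (simp add: chi_def)

lemma tact_bas:
  assumes s: "s \<noteq> 0" shows "tact x (to_ac s) (bas c \<tau>) = scale (to_ac s ^ plk \<tau> x) (bas (chi x s c) \<tau>)"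
proof (rule poly_mapping_eqI)
  fix \<mu>
  have "to_ac s ^ k * inverse (to_ac s) ^ k = (1 :: 'k alg_closure)" for k
    using s by (simp add: power_inverse)
  then have "to_ac s ^ plk \<tau> x * (c (\<tau>, \<mu>) * (to_ac s ^ plk \<mu> x * inverse (to_ac s) ^ plk \<tau> x)) = to_ac s ^ plk \<mu> x * c (\<tau>, \<mu>)"
    by (metis (no_types, lifting) mult.assoc mult.commute mult_1)
  then show "plk (tact x (to_ac s) (bas c \<tau>)) \<mu> = plk (scale (to_ac s ^ plk \<tau> x) (bas (chi x s c) \<tau>)) \<mu>"
    by (auto simp: plk_tact plk_bas chi_def distrib_left)
qed

lemma tact_pt:
  assumes s: "s \<noteq> 0" and f: "f \<in> pt c" shows "tact x (to_ac s) f \<in> pt (chi x s c)"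
proof -
  have "pt c \<subseteq> {f. tact x (to_ac s) f \<in> pt (chi x s c)}"
    unfolding pt_def[of c]
  proof (rule mp.span_minimal)
    show "bas c ` set L \<subseteq> {f. tact x (to_ac s) f \<in> pt (chi x s c)}"
    proof (intro image_subsetI CollectI)
      fix \<tau> assume "\<tau> \<in> set L"
      then show "tact x (to_ac s) (bas c \<tau>) \<in> pt (chi x s c)"
        unfolding tact_bas[OF s] pt_def by (intro mp.span_scale mp.span_base imageI)
    qed
    show "mp.subspace {f. tact x (to_ac s) f \<in> pt (chi x s c)}"
      by (rule mp.subspaceI)
        (auto simp: tact_add tact_scale mp.subspace_0[OF pt_subspace] mp.subspace_add[OF pt_subspace] mp.subspace_scale[OF pt_subspace])
  qed
  then show ?thesis using f by blast
qed

lemma chi_chi: assumes "s \<noteq> 0" shows "chi x (inverse s) (chi x s c) = c"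
proof
  fix e
  have "to_ac s ^ k * inverse (to_ac s) ^ k = (1 :: 'k alg_closure)" for k
    using assms by (simp add: power_inverse)
  then show "chi x (inverse s) (chi x s c) e = c e"
    by (simp add: chi_def) (metis (no_types, lifting) mult.assoc mult.commute mult_1_right)
qed

lemma pt_chi_Hilb:
  assumes s: "s \<noteq> 0" and H: "pt c \<in> Hilb" shows "pt (chi x s c) \<in> Hilb"
proof -
  obtain I where I: "I \<in> subscheme_ideals p" "pt c = I \<inter> homog m"
    using H by (auto simp: hilbert_scheme_def)
  let ?s = "to_ac (inverse s) :: 'k alg_closure"
  have s': "?s \<noteq> 0" "inverse s \<noteq> 0" using s by auto
  let ?I = "{f. tact x ?s f \<in> I}"
  have "?I \<in> subscheme_ideals p" by (rule tact_subscheme_ideals[OF finite_terms_of_degree s'(1) I(1)])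
  moreover have "pt (chi x s c) = ?I \<inter> homog m"
  proof (intro equalityI subsetI)
    fix f assume f: "f \<in> pt (chi x s c)"
    then have "tact x ?s f \<in> pt c" using tact_pt[OF s'(2) f, of x] chi_chi[OF s] by simp
    then have "tact x ?s f \<in> I" unfolding I(2) by simp
    moreover have "f \<in> homog m" using f pt_homog[of "chi x s c"] by auto
    ultimately show "f \<in> ?I \<inter> homog m" by simp
  next
    fix f assume f: "f \<in> ?I \<inter> homog m"
    then have "tact x ?s f \<in> I" "tact x ?s f \<in> homog m" unfolding tact_homog[OF s'(1)] by auto
    then have "tact x ?s f \<in> pt c" unfolding I(2) by simp
    from tact_pt[OF s this, of x] show "f \<in> pt (chi x s c)"
      using tact_inverse[of "to_ac s" x f] s by simp
  qed
  ultimately show ?thesis using pt_grassmannian[of "chi x s c"] unfolding hilbert_scheme_def by blast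
qed

definition chi_poly :: "'x \<Rightarrow> 'k \<Rightarrow> ('x trm \<times> 'x trm, 'k) mpoly \<Rightarrow> ('x trm \<times> 'x trm, 'k) mpoly" where
  "chi_poly x s f = evalp const (\<lambda>e. const (s ^ plk (snd e) x * inverse s ^ plk (fst e) x) * monomial (var e)) f"

lemma evalp_chi_poly: "evalp to_ac c (chi_poly x s f) = evalp to_ac (chi x s c) f"
  unfolding chi_poly_def evalp_compose[OF to_ac_hom]
  by (simp add: evalp_ac_simps chi_def mult.commute)

lemma chi_values:
  "\<exists>P N. \<forall>s. s \<noteq> 0 \<longrightarrow> poly P (to_ac s) = to_ac s ^ N * evalp to_ac (chi x s c) f"
proof (rule torus_poly[where f = f and c = c and a = "\<lambda>e. plk (snd e) x" and b = "\<lambda>e. plk (fst e) x"])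
  fix P assume P: "\<And>z. z \<noteq> 0 \<Longrightarrow> poly P z = z ^ (\<Sum>t\<in>pkeys f. wt (\<lambda>e. plk (fst e) x) t) *
    evalp to_ac (\<lambda>e. c e * (z ^ plk (snd e) x * inverse z ^ plk (fst e) x)) f"
  show ?thesis
  proof (intro exI allI impI)
    fix s :: 'k assume "s \<noteq> 0"
    then show "poly P (to_ac s) = to_ac s ^ (\<Sum>t\<in>pkeys f. wt (\<lambda>e. plk (fst e) x) t) * evalp to_ac (chi x s c) f"
      unfolding chi_def by (intro P) simp
  qed
qed

text \<open>The union of \<open>Y\<close> and the translates of its chart is irreducible: if two
  forms are non-zero somewhere on it, both are non-zero on the translate by a common parameter,
  where irreducibility of the chart applies. By maximality the union is \<open>Y\<close>.\<close>

lemma chi_Xs: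
  assumes s: "s \<noteq> 0" and c: "c \<in> Xs" shows "chi x s c \<in> Xs"
proof -
  let ?Z = "Y \<union> {pt (chi x s c) | s c. s \<noteq> 0 \<and> c \<in> Xs}"
  have Zt: "?Z \<subseteq> topspace HT"
  proof -
    have "pt (chi x s c) \<in> topspace HT" if "s \<noteq> 0" "c \<in> Xs" for s c
      using that Y_Hilb by (intro pt_topspace pt_chi_Hilb) (auto simp: Xs_def)
    then show ?thesis using Y_topspace by blast
  qed
  have "irreducible_space (subtopology HT ?Z)"
    unfolding irreducible_subtopology_iff[OF hilbert_top_basis Zt]
  proof (intro conjI ballI impI)
    show "?Z \<noteq> {}" using vsY by blast
    fix b b' assume "b \<in> {zs F | (F :: ('x trm list, 'k) mpoly) d. F \<in> homog d}"
      and "b' \<in> {zs F | (F :: ('x trm list, 'k) mpoly) d. F \<in> homog d}" and Zb: "?Z \<subseteq> b \<union> b'"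
    then obtain F G :: "('x trm list, 'k) mpoly" and d e
      where F: "F \<in> homog d" "b = zs F" and G: "G \<in> homog e" "b' = zs G" by blast
    let ?f = "evalp const pcpoly F" and ?g = "evalp const pcpoly G"
    have nonzero: "\<exists>s c. s \<noteq> 0 \<and> c \<in> Xs \<and> evalp to_ac (chi x s c) (evalp const pcpoly H) \<noteq> 0"
      if H: "H \<in> homog i" "\<not> ?Z \<subseteq> zs H" for H i
    proof (rule ccontr)
      assume no: "\<not> ?thesis"
      then have z: "evalp to_ac (pc (chi x s c)) H = 0" if "s \<noteq> 0" "c \<in> Xs" for s c
        using that unfolding evalp_pc_form by blast
      have "Y \<subseteq> zs H" by (rule Y_dense[OF H(1)]) (use z[of 1] in simp)
      moreover have "pt (chi x s c) \<in> zs H" if "s \<noteq> 0" "c \<in> Xs" for s c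
        using z[OF that] zs_pt[OF H(1)] by blast
      ultimately show False using H(2) by blast
    qed
    show "?Z \<subseteq> b \<or> ?Z \<subseteq> b'"
    proof (rule ccontr)
      assume "\<not> ?thesis"
      then have nF: "\<not> ?Z \<subseteq> zs F" and nG: "\<not> ?Z \<subseteq> zs G" using F(2) G(2) by auto
      from nonzero[OF F(1) nF] obtain s1 c1 where 1: "s1 \<noteq> 0" "c1 \<in> Xs" "evalp to_ac (chi x s1 c1) ?f \<noteq> 0" by blast
      from nonzero[OF G(1) nG] obtain s2 c2 where 2: "s2 \<noteq> 0" "c2 \<in> Xs" "evalp to_ac (chi x s2 c2) ?g \<noteq> 0" by blast
      from chi_values[of x c1 ?f] obtain P N where
        P': "\<And>s. s \<noteq> 0 \<Longrightarrow> poly P (to_ac s) = to_ac s ^ N * evalp to_ac (chi x s c1) ?f" by blast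
      from chi_values[of x c2 ?g] obtain Q M where
        Q': "\<And>s. s \<noteq> 0 \<Longrightarrow> poly Q (to_ac s) = to_ac s ^ M * evalp to_ac (chi x s c2) ?g" by blast
      have "poly P (to_ac s1) \<noteq> 0" using P'[OF 1(1)] 1 by simp
      then have "P \<noteq> 0" by auto
      moreover have "poly Q (to_ac s2) \<noteq> 0" using Q'[OF 2(1)] 2 by simp
      then have "Q \<noteq> 0" by auto
      ultimately have "P * Q \<noteq> 0" by simp
      with inf obtain s where s: "s \<noteq> 0" "poly (P * Q) (to_ac s) \<noteq> 0" by (rule infinite_to_ac_nonroots)
      have ns: "evalp to_ac (chi x s c1) ?f \<noteq> 0" "evalp to_ac (chi x s c2) ?g \<noteq> 0"
        using s(2) unfolding poly_mult P'[OF s(1)] Q'[OF s(1)] by auto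
      have "(\<forall>c\<in>Xs. evalp to_ac c (chi_poly x s ?f) = 0) \<or> (\<forall>c\<in>Xs. evalp to_ac c (chi_poly x s ?g) = 0)"
      proof (rule Xs_irreducible)
        fix c assume "c \<in> Xs"
        then have "pt (chi x s c) \<in> zs F \<union> zs G" using Zb s(1) F(2) G(2) by blast
        then have "evalp to_ac (chi x s c) ?f = 0 \<or> evalp to_ac (chi x s c) ?g = 0"
          unfolding Un_iff zs_pt[OF F(1)] zs_pt[OF G(1)] evalp_pc_form .
        then show "evalp to_ac c (chi_poly x s ?f) * evalp to_ac c (chi_poly x s ?g) = 0"
          unfolding evalp_chi_poly by auto
      qed
      then show False unfolding evalp_chi_poly using ns 1(2) 2(2) by blast
    qed
  qed
  then have "?Z = Y" using comp Zt unfolding irreducible_component_def by blast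
  then have "pt (chi x s c) \<in> Y" using s c by blast
  moreover have "chi x s c e = 0" if "e \<notin> E" for e using c that by (simp add: Xs_outside chi_def)
  ultimately show ?thesis by (simp add: Xs_def)
qed

end

section \<open>Cones with positive weights\<close>

lemma restr_restr: "restr S (restr S' f) = restr (\<lambda>t. S t \<and> S' t) f"
  by (rule poly_mapping_eqI) (simp add: plk_restr)

lemma evalp_restr_eq:
  assumes "\<And>t. t \<in> pkeys f \<Longrightarrow> \<not> S t \<Longrightarrow> monev y t = 0"
  shows "evalp to_ac y f = evalp to_ac y (restr S f)"
  unfolding evalp_restr unfolding evalp_monev
  by (rule sum.mono_neutral_right) (use assms in auto)

lemma wt_var: "wt a (var e) = a e"
  by (simp add: wt_def var_def)

lemma monev_eq_0: "x \<in> pkeys t \<Longrightarrow> a x = (0 :: 'f::idom) \<Longrightarrow> monev a t = 0"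
  unfolding monev_def by (rule prod_zero[OF finite_keys]) (auto simp: in_keys_iff zero_power)

text \<open>The exponents \<open>a x\<close> and \<open>b x\<close> give the weight \<open>a x - b x\<close> of the coordinates under the
  one-parameter subgroup belonging to \<open>x\<close>; the rank expresses that the weights are positive: a monomial
  of degree at least two of the same weight as \<open>e\<close> involves only coordinates that precede \<open>e\<close>.\<close>

locale weighted_cone =
  fixes E :: "'e set" and Z :: "('e \<Rightarrow> 'k::field alg_closure) set"
    and a b :: "'x::finite \<Rightarrow> 'e \<Rightarrow> nat" and rank :: "'e \<Rightarrow> nat"
  assumes inf: "infinite (UNIV :: 'k set)"
    and finE: "finite E"
    and zero: "(\<lambda>_. 0) \<in> Z"
    and outside: "\<And>c e. c \<in> Z \<Longrightarrow> e \<notin> E \<Longrightarrow> c e = 0"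
    and closed: "\<And>c. (\<And>f :: ('e, 'k) mpoly. (\<And>c'. c' \<in> Z \<Longrightarrow> evalp to_ac c' f = 0) \<Longrightarrow> evalp to_ac c f = 0) \<Longrightarrow> c \<in> Z"
    and stable: "\<And>c x s. c \<in> Z \<Longrightarrow> s \<noteq> 0 \<Longrightarrow> (\<lambda>e. c e * (to_ac s ^ a x e * inverse (to_ac s) ^ b x e)) \<in> Z"
    and rank: "\<And>t e e'. e \<in> E \<Longrightarrow> pkeys t \<subseteq> E \<Longrightarrow> tdeg t \<ge> 2 \<Longrightarrow>
      (\<And>x. wt (a x) t + b x e = wt (b x) t + a x e) \<Longrightarrow> e' \<in> pkeys t \<Longrightarrow> rank e' < rank e"
begin

definition van :: "('e, 'k) mpoly \<Rightarrow> bool" where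
  "van f \<longleftrightarrow> (\<forall>c\<in>Z. evalp to_ac c f = 0)"

lemma van_restr_E: assumes "van f" shows "van (restr (\<lambda>t. pkeys t \<subseteq> E) f)"
  unfolding van_def
proof
  fix c assume c: "c \<in> Z"
  have "evalp to_ac c f = evalp to_ac c (restr (\<lambda>t. pkeys t \<subseteq> E) f)"
  proof (rule evalp_restr_eq)
    fix t :: "'e trm" assume "\<not> pkeys t \<subseteq> E"
    then obtain e where "e \<in> pkeys t" "e \<notin> E" by blast
    then show "monev c t = 0" using outside[OF c] by (intro monev_eq_0) auto
  qed
  then show "evalp to_ac c (restr (\<lambda>t. pkeys t \<subseteq> E) f) = 0" using assms c by (simp add: van_def)
qed

text \<open>Along the orbit of \<open>c\<close>, \<open>f\<close> vanishes for infinitely many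
  parameters, so all coefficients of the polynomial in the parameter are 0; they are the values of
  the weight components. The wanted weight is given as the difference of \<alpha> and
  \<beta>.\<close>

lemma van_restr_weight1:
  assumes f: "van f" shows "van (restr (\<lambda>t. wt (a x) t + \<beta> = wt (b x) t + \<alpha>) f)"
  unfolding van_def
proof
  fix c assume c: "c \<in> Z"
  let ?N = "\<Sum>t\<in>pkeys f. wt (b x) t"
  have Nb: "wt (b x) t \<le> ?N" if "t \<in> pkeys f" for t
    using that by (intro member_le_sum) auto
  show "evalp to_ac c (restr (\<lambda>t. wt (a x) t + \<beta> = wt (b x) t + \<alpha>) f) = 0"
  proof (rule torus_poly[where f = f and c = c and a = "a x" and b = "b x"])
    fix P assume P: "\<And>z. z \<noteq> 0 \<Longrightarrow> poly P z = z ^ ?N * evalp to_ac (\<lambda>e. c e * (z ^ a x e * inverse z ^ b x e)) f"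
      and co: "\<And>j. Polynomial.coeff P j = evalp to_ac c (restr (\<lambda>t. ?N + wt (a x) t = j + wt (b x) t) f)"
    have "P = 0"
    proof (rule ccontr)
      assume "P \<noteq> 0"
      with inf obtain s :: 'k where s: "s \<noteq> 0" "poly P (to_ac s) \<noteq> 0" by (rule infinite_to_ac_nonroots)
      have "evalp to_ac (\<lambda>e. c e * (to_ac s ^ a x e * inverse (to_ac s) ^ b x e)) f = 0"
        using f stable[OF c s(1)] by (simp add: van_def)
      then show False using s P[of "to_ac s"] by simp
    qed
    then have co0: "evalp to_ac c (restr (\<lambda>t. ?N + wt (a x) t = j + wt (b x) t) f) = 0" for j
      using co[of j] by simp
    show ?thesis
    \<comment> \<open>The weight corresponds to the exponent \<open>?N + \<alpha> - \<beta>\<close>;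
      if this is negative, no term of \<open>f\<close> has that weight.\<close>
    proof (cases "\<beta> \<le> ?N + \<alpha>")
      case True
      have "?N + wt (a x) t = (?N + \<alpha> - \<beta>) + wt (b x) t \<longleftrightarrow> wt (a x) t + \<beta> = wt (b x) t + \<alpha>" for t
        using True by linarith
      then show ?thesis using co0[of "?N + \<alpha> - \<beta>"] by simp
    next
      case False
      have "{t\<in>pkeys f. wt (a x) t + \<beta> = wt (b x) t + \<alpha>} = {}"
      proof -
        have "wt (a x) t + \<beta> \<noteq> wt (b x) t + \<alpha>" if "t \<in> pkeys f" for t
          using Nb[OF that] False by linarith
        then show ?thesis by blast
      qed
      then show ?thesis unfolding evalp_restr by (simp only: sum.empty)
    qed
  qed
qed

lemma van_restr_weight:
  assumes f: "van f" shows "van (restr (\<lambda>t. \<forall>x. wt (a x) t + b x e = wt (b x) t + a x e) f)"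
proof -
  have "van (restr (\<lambda>t. \<forall>x\<in>S. wt (a x) t + b x e = wt (b x) t + a x e) f)" if "finite S" for S
    using that
  proof (induction S)
    case empty
    have "restr (\<lambda>t. True) f = f" by (rule poly_mapping_eqI) (simp add: plk_restr)
    then show ?case using f by simp
  next
    case (insert x S)
    from van_restr_weight1[OF insert.IH, of x "b x e" "a x e"]
    show ?case unfolding restr_restr by simp
  qed
  from this[of UNIV] show ?thesis by simp
qed

lemma van_const: "van f \<Longrightarrow> plk f 0 = 0"
proof -
  assume "van f"
  then have "0 = (\<Sum>t\<in>pkeys f. to_ac (plk f t) * monev (\<lambda>_. 0 :: 'k alg_closure) t)"
    using zero by (simp add: van_def evalp_monev)
  also have "\<dots> = (\<Sum>t\<in>pkeys f. if t = 0 then to_ac (plk f t) else 0)"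
  proof (rule sum.cong[OF refl])
    fix t :: "'e trm"
    show "to_ac (plk f t) * monev (\<lambda>_. 0) t = (if t = 0 then to_ac (plk f t) else 0 :: 'k alg_closure)"
    proof (cases "t = 0")
      case False
      then obtain x where "x \<in> pkeys t" by (metis keys_empty_iff ex_in_conv)
      then show ?thesis using False monev_eq_0[of x t "\<lambda>_. 0 :: 'k alg_closure"] by simp
    qed simp
  qed
  also have "\<dots> = to_ac (plk f 0)" by (simp add: sum.delta in_keys_iff)
  finally show ?thesis by simp
qed

lemma van_scale: "van f \<Longrightarrow> van (scale c f)"
  by (simp add: van_def evalp_ac_simps)

text \<open>The differentials of the coordinates in \<open>D\<close> are independent in the
  cotangent space at the vertex: no equation of \<open>Z\<close> has a non-zero linear part that
  involves only \<open>D\<close>.\<close>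

definition lin_free :: "'e set \<Rightarrow> bool" where
  "lin_free D \<longleftrightarrow> (\<forall>f. van f \<longrightarrow> (\<forall>e\<in>E - D. plk f (var e) = 0) \<longrightarrow> (\<forall>d\<in>D. plk f (var d) = 0))"

text \<open>If \<open>D\<close> cannot be enlarged by \<open>e\<close>, some equation has a linear
  part in \<open>e\<close> and \<open>D\<close> only, and \<open>e\<close> occurs in it, because
  \<open>D\<close> itself is free. Such pivots express the other differentials through
  \<open>D\<close>.\<close>

lemma lin_free_maximal:
  obtains D where "D \<subseteq> E" "lin_free D"
    "\<And>e. e \<in> E - D \<Longrightarrow> \<exists>f. van f \<and> plk f (var e) = 1 \<and> (\<forall>e'\<in>E - D - {e}. plk f (var e') = 0)"
proof -
  let ?S = "{D. D \<subseteq> E \<and> lin_free D}"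
  have "finite ?S" using finE by simp
  moreover have "{} \<in> ?S" by (simp add: lin_free_def)
  then have "?S \<noteq> {}" by (metis empty_iff)
  ultimately have "\<exists>D\<in>?S. \<forall>D'\<in>?S. D \<subseteq> D' \<longrightarrow> D = D'" by (rule finite_has_maximal)
  then obtain D where D: "D \<in> ?S" "\<And>D'. D' \<in> ?S \<Longrightarrow> D \<subseteq> D' \<Longrightarrow> D = D'" by metis
  have "\<exists>f. van f \<and> plk f (var e) = 1 \<and> (\<forall>e'\<in>E - D - {e}. plk f (var e') = 0)" if e: "e \<in> E - D" for e
  proof -
    have "\<not> lin_free (insert e D)" using D(2)[of "insert e D"] D(1) e by blast
    then obtain f d where f: "van f" "\<forall>e'\<in>E - insert e D. plk f (var e') = 0" "d \<in> insert e D" "plk f (var d) \<noteq> 0"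
      unfolding lin_free_def by blast
    have fe: "plk f (var e) \<noteq> 0"
    proof
      assume fe0: "plk f (var e) = 0"
      have "\<forall>e'\<in>E - D. plk f (var e') = 0"
      proof
        fix e' assume "e' \<in> E - D"
        then show "plk f (var e') = 0" using f(2) fe0 by (cases "e' = e") auto
      qed
      then have "\<forall>d\<in>D. plk f (var d) = 0" using D(1) f(1) unfolding lin_free_def by blast
      then show False using f(3,4) fe0 by auto
    qed
    have "van (scale (inverse (plk f (var e))) f)" by (rule van_scale[OF f(1)])
    moreover have "plk (scale (inverse (plk f (var e))) f) (var e) = 1" using fe by simp
    moreover have "\<forall>e'\<in>E - D - {e}. plk (scale (inverse (plk f (var e))) f) (var e') = 0" using f(2) by auto
    ultimately show ?thesis by blast
  qed
  with D that show thesis by blast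
qed

text \<open>The weight component of \<open>f\<close> expresses the coordinate \<open>e\<close> through the coordinates in \<open>D\<close> and
  those of smaller rank.\<close>

lemma coordinate_polynomials:
  assumes D: "D \<subseteq> E"
    and piv: "\<And>e. e \<in> E - D \<Longrightarrow> \<exists>f. van f \<and> plk f (var e) = 1 \<and> (\<forall>e'\<in>E - D - {e}. plk f (var e') = 0)"
  shows "e \<in> E \<Longrightarrow> \<exists>g :: ('e, 'k) mpoly. (\<forall>c\<in>Z. c e = evalp to_ac c g) \<and>
    (\<forall>c c'. (\<forall>d\<in>D. c d = c' d) \<longrightarrow> evalp to_ac c g = evalp to_ac c' g)"
proof (induction "rank e" arbitrary: e rule: less_induct)
  case less
  let ?P = "\<lambda>e g. (\<forall>c\<in>Z. c e = evalp to_ac c g) \<and>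
    (\<forall>c c'. (\<forall>d\<in>D. c d = c' d) \<longrightarrow> evalp to_ac c g = evalp to_ac c' g)"
  have inD: "?P d (monomial (var d) :: ('e, 'k) mpoly)" if "d \<in> D" for d
    using that by (simp add: evalp_ac_simps)
  show ?case
  proof (cases "e \<in> D")
    case True
    show ?thesis by (rule exI, rule inD[OF True])
  next
    case False
    then obtain f0 where f0: "van f0" "plk f0 (var e) = 1" "\<forall>e'\<in>E - D - {e}. plk f0 (var e') = 0"
      using piv[of e] less.prems by blast
    \<comment> \<open>Only the terms of the weight of \<open>e\<close> in variables from
      \<open>E\<close> are kept; the result still vanishes on \<open>Z\<close>.\<close>
    define f where "f = restr (\<lambda>t. pkeys t \<subseteq> E) (restr (\<lambda>t. \<forall>x. wt (a x) t + b x e = wt (b x) t + a x e) f0)"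
    have vf: "van f" unfolding f_def by (intro van_restr_E van_restr_weight f0(1))
    have fE: "pkeys t \<subseteq> E" and fw: "\<And>x. wt (a x) t + b x e = wt (b x) t + a x e" and ft: "plk f t = plk f0 t"
      if "t \<in> pkeys f" for t
      using that unfolding in_keys_iff f_def by (auto simp: plk_restr split: if_splits)
    have fe: "plk f (var e) = 1"
      using less.prems f0(2) by (simp add: f_def plk_restr wt_var) (simp add: var_def)
    define h where "h = (SOME h. \<forall>e'. e' \<in> E \<and> (e' \<in> D \<or> rank e' < rank e) \<longrightarrow> ?P e' (h e'))"
    have "\<forall>e'. \<exists>g. e' \<in> E \<and> (e' \<in> D \<or> rank e' < rank e) \<longrightarrow> ?P e' g"
    proof
      fix e'
      show "\<exists>g. e' \<in> E \<and> (e' \<in> D \<or> rank e' < rank e) \<longrightarrow> ?P e' g"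
      proof (cases "e' \<in> E \<and> (e' \<in> D \<or> rank e' < rank e)")
        case True
        then show ?thesis
        proof (cases "e' \<in> D")
          case True then show ?thesis using inD[OF True] by blast
        next
          case False
          then show ?thesis using less.hyps[of e'] True by blast
        qed
      qed blast
    qed
    then have "\<exists>h. \<forall>e'. e' \<in> E \<and> (e' \<in> D \<or> rank e' < rank e) \<longrightarrow> ?P e' (h e')" by (rule choice)
    then have h: "\<And>e'. e' \<in> E \<Longrightarrow> e' \<in> D \<or> rank e' < rank e \<Longrightarrow> ?P e' (h e')"
      unfolding h_def by (rule someI2_ex) blast
    \<comment> \<open>A linear term other than \<open>var e\<close> is in \<open>D\<close> by the
      choice of \<open>f0\<close>; a term of higher degree involves only coordinates of smaller rank
      by positivity of the weights.\<close>
    have good: "e' \<in> E \<and> (e' \<in> D \<or> rank e' < rank e)" if t: "t \<in> pkeys f" "t \<noteq> var e" and e': "e' \<in> pkeys t" for t e'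
    proof -
      have e'E: "e' \<in> E" using fE[OF t(1)] e' by blast
      have "tdeg t \<noteq> 0" using van_const[OF vf] t(1) by (auto simp: tdeg_eq_0_iff in_keys_iff)
      then consider "tdeg t = 1" | "tdeg t \<ge> 2" by linarith
      then show ?thesis
      proof cases
        case 1
        then obtain y where y: "t = var y" by (rule tdeg_1_var)
        then have "y = e'" using e' by (simp add: var_def split: if_splits)
        then have "t = var e'" "e' \<noteq> e" using y t(2) by auto
        then have "plk f0 (var e') \<noteq> 0" using ft[OF t(1)] t(1) by (simp add: in_keys_iff)
        then have "e' \<in> D" using f0(3) e'E \<open>e' \<noteq> e\<close> by blast
        then show ?thesis using e'E by simp
      next
        case 2
        then show ?thesis using rank[OF less.prems fE[OF t(1)] 2 fw[OF t(1)] e'] e'E by simp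
      qed
    qed
    let ?K = "pkeys f - {var e}"
    let ?g = "- (\<Sum>t\<in>?K. const (plk f t) * monev h t)"
    have evg: "evalp to_ac c ?g = - (\<Sum>t\<in>?K. to_ac (plk f t) * monev (\<lambda>e'. evalp to_ac c (h e')) t)" for c
      by (simp add: evalp_ac_simps evalp_sum[OF to_ac_hom] hom_monev[OF evalp_hom[OF to_ac_hom]])
    have "c e = evalp to_ac c ?g" if c: "c \<in> Z" for c
    proof -
      have "var e \<in> pkeys f" using fe by (simp add: in_keys_iff)
      then have "evalp to_ac c f = to_ac (plk f (var e)) * monev c (var e) + (\<Sum>t\<in>?K. to_ac (plk f t) * monev c t)"
        unfolding evalp_monev by (intro sum.remove) auto
      moreover have "evalp to_ac c f = 0" using vf c by (simp add: van_def)
      ultimately have "c e = - (\<Sum>t\<in>?K. to_ac (plk f t) * monev c t)"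
        by (simp add: fe eq_neg_iff_add_eq_0)
      also have "(\<Sum>t\<in>?K. to_ac (plk f t) * monev c t) = (\<Sum>t\<in>?K. to_ac (plk f t) * monev (\<lambda>e'. evalp to_ac c (h e')) t)"
      proof (intro sum.cong refl arg_cong2[of _ _ _ _ "(*)"] monev_cong)
        fix t e' assume "t \<in> ?K" "e' \<in> pkeys t"
        then have "e' \<in> E \<and> (e' \<in> D \<or> rank e' < rank e)" by (intro good) auto
        then show "c e' = evalp to_ac c (h e')" using h c by blast
      qed
      finally show ?thesis unfolding evg .
    qed
    moreover have "evalp to_ac c ?g = evalp to_ac c' ?g" if cc: "\<forall>d\<in>D. c d = c' d" for c c'
      unfolding evg
    proof (intro arg_cong[of _ _ uminus] sum.cong refl arg_cong2[of _ _ _ _ "(*)"] monev_cong)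
      fix t e' assume "t \<in> ?K" "e' \<in> pkeys t"
      then have "e' \<in> E \<and> (e' \<in> D \<or> rank e' < rank e)" by (intro good) auto
      then show "evalp to_ac c (h e') = evalp to_ac c' (h e')" using h cc by blast
    qed
    ultimately show ?thesis by blast
  qed
qed

end

section \<open>Counting monomials\<close>

text \<open>By Pascal's rule each of the \<open>g\<close> steps adds one binomial coefficient over
  \<open>d'\<close>, which is at most a \<open>d'\<close>-th power.\<close>

lemma binomial_diff_le: "(d + N + g) choose Suc d' \<le> ((d + N) choose Suc d') + g * (d + N + g) ^ d'"
proof (induction g)
  case (Suc g)
  have "(d + N + g) choose d' \<le> (d + N + g) ^ d'"
    by (cases "d' \<le> d + N + g") (auto intro: binomial_le_pow simp: binomial_eq_0)
  also have "\<dots> \<le> (d + N + Suc g) ^ d'" by (rule power_mono) auto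
  finally have "(d + N + Suc g) choose Suc d' \<le> ((d + N + g) choose Suc d') + (d + N + Suc g) ^ d'" by simp
  also have "\<dots> \<le> ((d + N) choose Suc d') + g * (d + N + g) ^ d' + (d + N + Suc g) ^ d'" using Suc by simp
  also have "g * (d + N + g) ^ d' \<le> g * (d + N + Suc g) ^ d'" by (intro mult_left_mono power_mono) auto
  finally show ?case by simp
qed simp

lemma power_le_fact_binomial: "s ^ d \<le> fact d * ((d + s) choose d)"
proof (induction d)
  case (Suc d)
  have "Suc d * ((Suc d + s) choose Suc d) = (Suc d + s) * ((d + s) choose d)"
    using Suc_times_binomial[of d "d + s"] by simp
  then have "fact (Suc d) * ((Suc d + s) choose Suc d) = (Suc d + s) * (fact d * ((d + s) choose d))"
    by (metis fact_Suc mult.assoc mult.commute of_nat_id)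
  moreover have "s * s ^ d \<le> (Suc d + s) * (fact d * ((d + s) choose d))"
    using Suc by (intro mult_mono) auto
  ultimately show ?case by simp
qed simp

text \<open>The \<open>g\<close> additional degrees cost on the order of the power
  \<open>d - 1\<close> of \<open>s\<close>, while the extra binomial coefficient grows like
  \<open>s ^ d / fact d\<close>.\<close>

lemma binomial_growth:
  obtains s where "(d + B * s + g) choose d < ((d + s) choose d) + ((d + B * s) choose d)"
proof (cases d)
  case 0
  then show thesis using that[of 0] by simp
next
  case (Suc d')
  \<comment> \<open>\<open>C\<close> is \<open>fact d\<close> times the cost divided by
    \<open>s ^ d'\<close>; any \<open>s > C\<close> works, provided that it also absorbs
    \<open>d + g\<close>.\<close>
  define C :: nat where "C = fact d * (g * (Suc B) ^ d')"
  define s where "s = d + g + C + 1"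
  have s1: "d + B * s + g \<le> Suc B * s" by (simp add: s_def)
  have "g * (d + B * s + g) ^ d' \<le> g * (Suc B * s) ^ d'"
    by (intro mult_left_mono power_mono s1) auto
  then have "fact d * (g * (d + B * s + g) ^ d') \<le> fact d * (g * (Suc B * s) ^ d')" by simp
  also have "\<dots> = C * s ^ d'" by (simp only: C_def power_mult_distrib mult_ac)
  also have "\<dots> < s * s ^ d'" by (rule mult_strict_right_mono) (simp_all add: s_def)
  also have "\<dots> = s ^ d" using Suc by simp
  also have "\<dots> \<le> fact d * ((d + s) choose d)" by (rule power_le_fact_binomial)
  finally have "g * (d + B * s + g) ^ d' < (d + s) choose d" by simp
  moreover have "(d + B * s + g) choose d \<le> ((d + B * s) choose d) + g * (d + B * s + g) ^ d'"
    using binomial_diff_le[of d "B * s" g d'] Suc by simp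
  ultimately show thesis using that[of s] by linarith
qed

lemma card_terms_eq_initial:
  "card {t :: nat trm. pkeys t \<subseteq> {..d} \<and> tdeg t = s} = (d + s) choose d"
proof (cases s)
  case 0
  have "{t :: nat trm. pkeys t \<subseteq> {..d} \<and> tdeg t = 0} = {0}" by (auto simp: tdeg_eq_0_iff)
  then show ?thesis using 0 by simp
next
  case (Suc e)
  let ?M = "\<lambda>N. {t :: nat trm. pkeys t \<subseteq> {..d} \<and> tdeg t \<le> N}"
  have c: "card (?M N) = (d + 1 + N) choose (d + 1)" for N
    using card_terms_le[of "{..d}" N] by simp
  have "{t :: nat trm. pkeys t \<subseteq> {..d} \<and> tdeg t = s} = ?M s - ?M e" using Suc by auto
  moreover have "finite (?M e)" using finite_tdeg_eq[of "{..d}" e] by simp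
  moreover have "?M e \<subseteq> ?M s" using Suc by auto
  ultimately have "card {t :: nat trm. pkeys t \<subseteq> {..d} \<and> tdeg t = s} = card (?M s) - card (?M e)"
    by (simp add: card_Diff_subset)
  then show ?thesis unfolding c by (simp add: Suc)
qed

section \<open>Polynomials of bounded degree in finitely many variables\<close>

definition pdeg_le :: "nat \<Rightarrow> nat \<Rightarrow> (nat, 'k::field) mpoly set" where
  "pdeg_le d N = {f. \<forall>t\<in>pkeys f. pkeys t \<subseteq> {..<d} \<and> tdeg t \<le> N}"

lemma pdeg_le_mult:
  assumes "f \<in> pdeg_le d N" "g \<in> pdeg_le d M" shows "f * g \<in> pdeg_le d (N + M)"
  unfolding pdeg_le_def
proof (intro CollectI ballI)
  fix t assume "t \<in> pkeys (f * g)"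
  then obtain u v where "t = u + v" "u \<in> pkeys f" "v \<in> pkeys g" using Poly_Mapping.keys_mult[of f g] by blast
  then show "pkeys t \<subseteq> {..<d} \<and> tdeg t \<le> N + M"
    using assms Poly_Mapping.keys_add[of u v] unfolding pdeg_le_def by (fastforce simp: tdeg_add intro: add_mono)
qed

lemma pdeg_le_power: "f \<in> pdeg_le d N \<Longrightarrow> f ^ k \<in> pdeg_le d (N * k)"
proof (induction k)
  case 0
  show ?case by (simp add: pdeg_le_def)
next
  case (Suc k)
  then show ?case using pdeg_le_mult[of f d N "f ^ k" "N * k"] by simp
qed

lemma pdeg_le_prod: "(\<And>i. i \<in> I \<Longrightarrow> F i \<in> pdeg_le d (n i)) \<Longrightarrow> prod F I \<in> pdeg_le d (sum n I)"
proof (induction I rule: infinite_finite_induct)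
  case (insert x I)
  then show ?case using pdeg_le_mult[of "F x" d "n x" "prod F I" "sum n I"] by simp
qed (simp_all add: pdeg_le_def)

lemma pdeg_le_span: "pdeg_le d N \<subseteq> mp.span (monomial ` {t. pkeys t \<subseteq> {..<d} \<and> tdeg t \<le> N})"
proof
  fix f :: "(nat, 'a) mpoly" assume f: "f \<in> pdeg_le d N"
  have "(\<Sum>t\<in>pkeys f. scale (plk f t) (monomial t)) \<in> mp.span (monomial ` {t. pkeys t \<subseteq> {..<d} \<and> tdeg t \<le> N})"
    by (intro mp.span_sum mp.span_scale mp.span_base imageI) (use f in \<open>auto simp: pdeg_le_def\<close>)
  then show "f \<in> mp.span (monomial ` {t. pkeys t \<subseteq> {..<d} \<and> tdeg t \<le> N})" by (simp only: sum_scale_monomials)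
qed

text \<open>If a non-zero polynomial in \<open>d\<close> variables vanishes on \<open>Z\<close>, then \<open>d + 1\<close> functions on \<open>Z\<close> that
  are polynomials in these variables satisfy a homogeneous relation: there are not enough monomials.\<close>

lemma relation_exists:
  fixes Z :: "(nat \<Rightarrow> 'k::field alg_closure) set" and F :: "nat \<Rightarrow> (nat, 'k) mpoly"
  assumes G: "G \<in> pdeg_le d g" "G \<noteq> 0" "\<And>v. v \<in> Z \<Longrightarrow> evalp to_ac v G = 0"
    and F: "\<And>i. i \<le> d \<Longrightarrow> F i \<in> pdeg_le d B"
  obtains s P where "P \<in> homog s" "P \<noteq> (0 :: (nat, 'k) mpoly)" "pvars P \<subseteq> {..d}"
    "\<And>v. v \<in> Z \<Longrightarrow> evalp to_ac (\<lambda>i. evalp to_ac v (F i)) P = 0"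
proof -
  obtain s where s: "(d + B * s + g) choose d < ((d + s) choose d) + ((d + B * s) choose d)"
    by (rule binomial_growth)
  \<comment> \<open>\<open>?I1\<close> indexes the monomials of degree \<open>s\<close> in the
    \<open>F i\<close>, \<open>?I2\<close> the multiples of \<open>G\<close>. All of them have
    degree at most \<open>B * s + g\<close>, and there are more of them than terms in
    \<open>?T\<close>.\<close>
  let ?I1 = "{t :: nat trm. pkeys t \<subseteq> {..d} \<and> tdeg t = s}" and ?I2 = "{t :: nat trm. pkeys t \<subseteq> {..<d} \<and> tdeg t \<le> B * s}"
  let ?T = "{t :: nat trm. pkeys t \<subseteq> {..<d} \<and> tdeg t \<le> B * s + g}"
  let ?I = "?I1 <+> ?I2"
  let ?W = "case_sum (\<lambda>t. monev F t) (\<lambda>u. monomial u * G)"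
  have fin: "finite ?I1" "finite ?I2" "finite ?T"
    using finite_tdeg_eq[of "{..<d}"] finite_subset[OF _ finite_tdeg_eq[of "{..d}" s], of ?I1] by auto
  have cardT: "card (monomial ` ?T :: (nat, 'k) mpoly set) < card ?I"
  proof -
    have "card (monomial ` ?T :: (nat, 'k) mpoly set) \<le> card ?T" by (rule card_image_le[OF fin(3)])
    also have "card ?T = (d + B * s + g) choose d" using card_terms_le[of "{..<d}" "B * s + g"] by (simp add: add.assoc)
    also have "\<dots> < card ?I1 + card ?I2"
      unfolding card_terms_eq_initial using s card_terms_le[of "{..<d}" "B * s"] by simp
    also have "\<dots> = card ?I" using fin by (simp add: card_Plus)
    finally show ?thesis .
  qed
  have mem: "?W i \<in> mp.span (monomial ` ?T)" if i: "i \<in> ?I" for i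
  proof (rule subsetD[OF pdeg_le_span])
    from i show "?W i \<in> pdeg_le d (B * s + g)"
    proof
      fix t assume t: "t \<in> ?I1" "i = Inl t"
      have "monev F t \<in> pdeg_le d (\<Sum>x\<in>pkeys t. B * plk t x)"
        unfolding monev_def by (intro pdeg_le_prod pdeg_le_power F) (use t in auto)
      also have "(\<Sum>x\<in>pkeys t. B * plk t x) = B * s" using t by (simp add: tdeg_def flip: sum_distrib_left)
      finally show ?thesis using t(2) unfolding pdeg_le_def by fastforce
    next
      fix u assume u: "u \<in> ?I2" "i = Inr u"
      then have "(monomial u :: (nat, 'k) mpoly) \<in> pdeg_le d (B * s)" by (auto simp: pdeg_le_def monomial_def)
      from pdeg_le_mult[OF this G(1)] show ?thesis using u(2) by simp
    qed
  qed
  obtain w where w: "(\<Sum>i\<in>?I. scale (w i) (?W i)) = 0" "\<exists>i\<in>?I. w i \<noteq> 0"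
    by (rule mp.family_dependent[of ?I "monomial ` ?T" ?W]) (use fin mem cardT in auto)
  let ?P = "\<Sum>t\<in>?I1. scale (w (Inl t)) (monomial t) :: (nat, 'k) mpoly"
  let ?Q = "\<Sum>u\<in>?I2. scale (w (Inr u)) (monomial u) :: (nat, 'k) mpoly"
  have rel: "(\<Sum>t\<in>?I1. scale (w (Inl t)) (monev F t)) + ?Q * G = 0"
    using w(1) fin by (simp add: sum.Plus sum_distrib_right scale_mult_left)
  have val: "evalp to_ac (\<lambda>i. evalp to_ac v (F i)) ?P = 0" if v: "v \<in> Z" for v
  proof -
    have "0 = evalp to_ac v ((\<Sum>t\<in>?I1. scale (w (Inl t)) (monev F t)) + ?Q * G)"
      unfolding rel by (simp add: evalp_ac_simps)
    also have "\<dots> = evalp to_ac v (\<Sum>t\<in>?I1. scale (w (Inl t)) (monev F t))"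
      using G(3)[OF v] by (simp add: evalp_ac_simps)
    also have "\<dots> = evalp to_ac (\<lambda>i. evalp to_ac v (F i)) ?P"
      by (simp add: evalp_sum[OF to_ac_hom] evalp_ac_simps hom_monev[OF evalp_hom[OF to_ac_hom]])
    finally show ?thesis by simp
  qed
  \<comment> \<open>If \<open>?P\<close> were 0, the relation would read \<open>?Q * G = 0\<close>,
    so \<open>?Q\<close> would be 0 too and the relation trivial.\<close>
  have "?P \<noteq> 0"
  proof
    assume P0: "?P = 0"
    have w1: "w (Inl t) = 0" if "t \<in> ?I1" for t
      by (rule monomials_independent[OF fin(1) P0 that])
    then have "(\<Sum>t\<in>?I1. scale (w (Inl t)) (monev F t)) = 0" by (intro sum.neutral) simp
    then have "?Q * G = 0" using rel by simp
    then have Q0: "?Q = 0" using G(2) by simp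
    have "w (Inr u) = 0" if "u \<in> ?I2" for u
      by (rule monomials_independent[OF fin(2) Q0 that])
    with w1 w(2) show False by auto
  qed
  moreover have "?P \<in> homog s"
    by (intro homog_sum homog_scale) (simp add: homog_monomial)
  moreover have "pvars ?P \<subseteq> {..d}"
    unfolding pvars_def
  proof (rule UN_least)
    fix t assume "t \<in> pkeys ?P"
    then have "(\<Sum>u\<in>?I1. w (Inl u) * plk (monomial u :: (nat, 'k) mpoly) t) \<noteq> 0" by (simp add: in_keys_iff lookup_sum)
    then obtain u where "u \<in> ?I1" "w (Inl u) * plk (monomial u :: (nat, 'k) mpoly) t \<noteq> 0"
      by (rule sum.not_neutral_contains_not_neutral)
    then show "pkeys t \<subseteq> {..d}" by (simp add: plk_monomial split: if_splits)
  qed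
  ultimately show thesis using that val by blast
qed

section \<open>Chains of irreducible closed sets\<close>

text \<open>The smallest exponent of \<open>v\<close> is divided out. What remains is still non-zero
  after setting \<open>v\<close> to 0.\<close>

lemma factor_variable:
  fixes P :: "('i, 'k::field) mpoly"
  assumes "P \<noteq> 0"
  obtains r P' t where "P = monomial (psingle v r) * P'" "t \<in> pkeys P'" "plk t v = 0"
proof -
  let ?M = "(\<lambda>t. plk t v) ` pkeys P"
  have ne: "?M \<noteq> {}" "finite ?M" using assms by (auto simp: keys_empty_iff)
  define r where "r = Min ?M"
  have r: "r \<le> plk t v" if "t \<in> pkeys P" for t unfolding r_def using ne that by (intro Min_le) auto
  obtain t0 where t0: "t0 \<in> pkeys P" "r = plk t0 v" using Min_in[OF ne(2,1)] unfolding r_def by auto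
  let ?u = "psingle v r"
  have add: "?u + (t - ?u) = t" if "t \<in> pkeys P" for t
    by (rule poly_mapping_eqI) (use r[OF that] in \<open>auto simp: lookup_add lookup_minus lookup_single when_def\<close>)
  let ?P' = "\<Sum>t\<in>pkeys P. psingle (t - ?u) (plk P t)"
  have "monomial ?u * ?P' = (\<Sum>t\<in>pkeys P. psingle t (plk P t))"
    unfolding sum_distrib_left by (rule sum.cong[OF refl]) (simp add: monomial_def mult_single add)
  then have P: "P = monomial ?u * ?P'" by (simp only: sum_singles)
  have "t0 - ?u \<in> pkeys ?P'"
  proof -
    have "plk ?P' (t0 - ?u) = plk (monomial ?u * ?P') (?u + (t0 - ?u))" by (rule plk_monomial_mult[symmetric])
    also have "\<dots> = plk P t0" unfolding add[OF t0(1)] P[symmetric] ..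
    finally show ?thesis using t0(1) by (simp add: in_keys_iff)
  qed
  moreover have "plk (t0 - ?u) v = 0" by (simp add: lookup_minus t0(2))
  ultimately show thesis using that P by blast
qed

lemma homog_factor:
  assumes "monomial u * P' \<in> homog s" shows "P' \<in> homog (s - tdeg u)"
proof (rule homogI)
  fix t assume "plk P' t \<noteq> 0"
  then have "tdeg (u + t) = s" using homogD[OF assms, of "u + t"] by (simp add: plk_monomial_mult)
  then show "tdeg t = s - tdeg u" by (simp add: tdeg_add)
qed

lemma pvars_factor: "pvars P' \<subseteq> pvars (monomial u * P' :: ('i, 'k::comm_ring_1) mpoly)"
proof -
  have "pkeys t \<subseteq> pkeys (u + t)" for t by (auto simp: in_keys_iff lookup_add)
  then show ?thesis unfolding pvars_def monomial_mult_keys by auto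
qed

text \<open>Irreducibility of a set of coordinate vectors, in the form needed for cancelling: forms
  that do not vanish identically on \<open>C\<close> have a product of the same kind.\<close>

definition form_irr :: "('i \<Rightarrow> 'k::field alg_closure) set \<Rightarrow> bool" where
  "form_irr C \<longleftrightarrow> (\<forall>(F :: ('i, 'k) mpoly) G d e. F \<in> homog d \<longrightarrow> G \<in> homog e \<longrightarrow>
     (\<exists>c\<in>C. evalp to_ac c F \<noteq> 0) \<longrightarrow> (\<exists>c\<in>C. evalp to_ac c G \<noteq> 0) \<longrightarrow> (\<exists>c\<in>C. evalp to_ac c (F * G) \<noteq> 0))"

lemma form_irr_mult:
  "form_irr C \<Longrightarrow> (F :: ('i, 'k::field) mpoly) \<in> homog d \<Longrightarrow> G \<in> homog e \<Longrightarrow> \<exists>c\<in>C. evalp to_ac c F \<noteq> 0 \<Longrightarrow>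
   \<exists>c\<in>C. evalp to_ac c G \<noteq> 0 \<Longrightarrow> \<exists>c\<in>C. evalp to_ac c (F * G) \<noteq> 0"
  unfolding form_irr_def by blast

text \<open>Restricting a relation to the next smaller set of the chain kills the last form; after division by
  a power of this form, which is possible by irreducibility, a relation between the other forms remains.\<close>

lemma chain_independent:
  fixes C :: "nat \<Rightarrow> ('i \<Rightarrow> 'k::field alg_closure) set" and F :: "nat \<Rightarrow> ('i, 'k) mpoly"
  assumes irr: "\<And>j. j \<le> k \<Longrightarrow> form_irr (C j)" and F: "\<And>j. F j \<in> homog e"
    and sub: "\<And>j. j < k \<Longrightarrow> C j \<subseteq> C (Suc j)"
    and nz: "\<And>j. j \<le> k \<Longrightarrow> \<exists>c\<in>C j. evalp to_ac c (F j) \<noteq> 0"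
    and van: "\<And>j c. j < k \<Longrightarrow> c \<in> C j \<Longrightarrow> evalp to_ac c (F (Suc j)) = 0"
  shows "j \<le> k \<Longrightarrow> P \<in> homog s \<Longrightarrow> P \<noteq> 0 \<Longrightarrow> pvars P \<subseteq> {..j} \<Longrightarrow>
    \<exists>c\<in>C j. evalp to_ac (\<lambda>i. evalp to_ac c (F i)) P \<noteq> 0"
proof (induction j arbitrary: P s)
  case 0
  obtain c where c: "c \<in> C 0" "evalp to_ac c (F 0) \<noteq> 0" using nz[of 0] by auto
  have t: "t = psingle 0 s" if t: "t \<in> pkeys P" for t
  proof (rule poly_mapping_eqI)
    fix i
    have k0: "pkeys t \<subseteq> {0}" using 0(4) t unfolding pvars_def by auto
    have "tdeg t = s" using 0(2) t by (simp add: homog_def)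
    then have "plk t 0 = s" using tdeg_superset[of "{0}" t] k0 by simp
    moreover have "plk t i = 0" if "i \<noteq> 0" using k0 that by (auto simp: in_keys_iff)
    ultimately show "plk t i = plk (psingle 0 s) i" by (simp add: lookup_single when_def)
  qed
  have "pkeys P \<noteq> {}" using 0(3) by (simp add: keys_empty_iff)
  then have "pkeys P = {psingle 0 s}" using t by blast
  then have "evalp to_ac (\<lambda>i. evalp to_ac c (F i)) P = to_ac (plk P (psingle 0 s)) * evalp to_ac c (F 0) ^ s"
    by (simp add: evalp_monev monev_single)
  moreover have "plk P (psingle 0 s) \<noteq> 0" using \<open>pkeys P = {psingle 0 s}\<close> by (metis in_keys_iff singletonI)
  ultimately have "evalp to_ac (\<lambda>i. evalp to_ac c (F i)) P \<noteq> 0" using c(2) by simp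
  then show ?case using c(1) by blast
next
  case (Suc j)
  let ?v = "Suc j"
  obtain r P' t0 where P': "P = monomial (psingle ?v r) * P'" "t0 \<in> pkeys P'" "plk t0 ?v = 0"
    using factor_variable[OF Suc.prems(3), of ?v] by metis
  have hP': "P' \<in> homog (s - r)" using homog_factor[of "psingle ?v r" P' s] Suc.prems(2) P'(1) by simp
  have vP': "pvars P' \<subseteq> {..Suc j}" using pvars_factor[of P' "psingle ?v r"] Suc.prems(4) unfolding P'(1)[symmetric] by blast
  \<comment> \<open>\<open>P'\<close> with the last variable set to 0: the two agree on
    \<open>C j\<close>, where \<open>F ?v\<close> vanishes.\<close>
  let ?P2 = "restr (\<lambda>t. plk t ?v = 0) P'"
  have "?P2 \<in> homog (s - r)" by (rule homogI) (use homogD[OF hP'] in \<open>auto simp: plk_restr split: if_splits\<close>)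
  moreover have "plk ?P2 t0 \<noteq> 0" using P'(2,3) by (simp add: plk_restr in_keys_iff)
  then have "?P2 \<noteq> 0" by auto
  moreover have "pvars ?P2 \<subseteq> {..j}"
    unfolding pvars_def
  proof (intro UN_least subsetI)
    fix t i assume t: "t \<in> pkeys ?P2" and i: "i \<in> pkeys t"
    have "t \<in> pkeys P'" "plk t ?v = 0" using t by (auto simp: in_keys_iff plk_restr split: if_splits)
    then have "i \<in> pvars P'" using i unfolding pvars_def by blast
    then have "i \<le> Suc j" using vP' by auto
    moreover have "i \<noteq> Suc j" using i \<open>plk t ?v = 0\<close> by (auto simp: in_keys_iff)
    ultimately show "i \<in> {..j}" by simp
  qed
  ultimately obtain c where c: "c \<in> C j" "evalp to_ac (\<lambda>i. evalp to_ac c (F i)) ?P2 \<noteq> 0"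
    using Suc.IH[of ?P2 "s - r"] Suc.prems(1) by auto
  have Fc: "evalp to_ac c (F ?v) = 0" using van[of j c] c(1) Suc.prems(1) by simp
  have "evalp to_ac (\<lambda>i. evalp to_ac c (F i)) P' = evalp to_ac (\<lambda>i. evalp to_ac c (F i)) ?P2"
  proof (rule evalp_restr_eq)
    fix t :: "nat trm" assume "plk t ?v \<noteq> 0"
    then show "monev (\<lambda>i. evalp to_ac c (F i)) t = 0"
      using Fc by (intro monev_eq_0) (auto simp: in_keys_iff)
  qed
  then have "evalp to_ac c (evalp const F P') \<noteq> 0"
    using c(2) unfolding evalp_compose[OF to_ac_hom] by simp
  moreover have "c \<in> C ?v" using c(1) sub[of j] Suc.prems(1) by auto
  ultimately have "\<exists>c\<in>C ?v. evalp to_ac c (evalp const F P') \<noteq> 0" by blast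
  moreover have "\<exists>c\<in>C ?v. evalp to_ac c (F ?v ^ r) \<noteq> 0"
    using nz[of ?v] Suc.prems(1) by (auto simp: evalp_power[OF to_ac_hom])
  moreover have "evalp const F P' \<in> homog (e * (s - r))" by (rule homog_subst[OF hP' F])
  moreover have "F ?v ^ r \<in> homog (e * r)" by (rule homog_power[OF F])
  ultimately have "\<exists>c\<in>C ?v. evalp to_ac c (F ?v ^ r * evalp const F P') \<noteq> 0"
    using form_irr_mult[OF irr[OF Suc.prems(1)], of "F ?v ^ r" "e * r" "evalp const F P'" "e * (s - r)"] by blast
  then show ?case
    unfolding P'(1) by (simp add: evalp_ac_simps evalp_compose[OF to_ac_hom] evalp_power[OF to_ac_hom] monev_single)
qed

section \<open>The tangent space at the special point\<close>

lemma wt_add: "wt a (s + t) = wt a s + wt a t"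
proof -
  let ?S = "pkeys s \<union> pkeys t"
  have sup: "wt a u = (\<Sum>e\<in>?S. plk u e * a e)" if "pkeys u \<subseteq> ?S" for u
    unfolding wt_def using that by (intro sum.mono_neutral_left) (auto simp: in_keys_iff)
  have "wt a (s + t) = (\<Sum>e\<in>?S. plk (s + t) e * a e)" by (rule sup) (rule Poly_Mapping.keys_add)
  then show ?thesis using sup[of s] sup[of t] by (simp add: lookup_add sum.distrib algebra_simps)
qed

context chart
begin

text \<open>Compares the differences of first and second component in the extension of the term
  order to vectors with signs, written without subtraction.\<close>

definition prior :: "'x trm \<times> 'x trm \<Rightarrow> 'x trm \<times> 'x trm \<Rightarrow> bool" where
  "prior e' e \<longleftrightarrow> prec (fst e' + snd e) (fst e + snd e')"

definition erank :: "'x trm \<times> 'x trm \<Rightarrow> nat" where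
  "erank e = card {e'\<in>E. prior e' e}"

lemma prior_trans: assumes "prior e1 e2" "prior e2 e3" shows "prior e1 e3"
proof -
  have "prec ((fst e1 + snd e2) + (fst e2 + snd e3)) ((fst e2 + snd e1) + (fst e3 + snd e2))"
    using assms unfolding prior_def by (rule prec_add_mono)
  then have "prec ((fst e1 + snd e3) + (fst e2 + snd e2)) ((fst e3 + snd e1) + (fst e2 + snd e2))"
    by (simp add: ac_simps)
  then show ?thesis unfolding prior_def prec_add_cancel .
qed

lemma erank_less: assumes "prior e' e" "e' \<in> E" shows "erank e' < erank e"
  unfolding erank_def
proof (rule psubset_card_mono)
  show "finite {e'\<in>E. prior e' e}" by simp
  have "{e''\<in>E. prior e'' e'} \<subseteq> {e''\<in>E. prior e'' e}" using prior_trans[OF _ assms(1)] by auto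
  moreover have "e' \<in> {e''\<in>E. prior e'' e}" "e' \<notin> {e''\<in>E. prior e'' e'}"
    using assms prec_irrefl by (auto simp: prior_def)
  ultimately show "{e''\<in>E. prior e'' e'} \<subset> {e''\<in>E. prior e'' e}" by blast
qed

text \<open>Adds up \<open>f e\<close> over a monomial in the chart coordinates, each with its
  exponent as multiplicity; with \<open>fst\<close> and \<open>snd\<close> the difference is minus
  the weight of the monomial.\<close>

definition sumterm :: "('x trm \<times> 'x trm \<Rightarrow> 'x trm) \<Rightarrow> ('x trm \<times> 'x trm) trm \<Rightarrow> 'x trm" where
  "sumterm f t = (\<Sum>e\<in>pkeys t. \<Sum>i<plk t e. f e)"

lemma plk_sumterm: "plk (sumterm f t) x = wt (\<lambda>e. plk (f e) x) t"
  by (simp add: sumterm_def wt_def lookup_sum)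

lemma sumterm_add: "sumterm f (s + t) = sumterm f s + sumterm f t"
  by (rule poly_mapping_eqI) (simp add: plk_sumterm wt_add lookup_add)

lemma sumterm_var: "sumterm f (var e) = f e"
  by (rule poly_mapping_eqI) (simp add: plk_sumterm wt_var)

lemma sumterm_less:
  assumes "pkeys t \<subseteq> E" "t \<noteq> 0" shows "prec (sumterm snd t) (sumterm fst t)"
  using assms
proof (induction "tdeg t" arbitrary: t)
  case 0
  then show ?case by (simp add: tdeg_eq_0_iff)
next
  case (Suc d)
  obtain e u where t: "t = var e + u" "tdeg u = d" using trm_eq_var_add[OF Suc.hyps(2)[symmetric]] .
  have k: "e \<in> pkeys t" "pkeys u \<subseteq> pkeys t"
    unfolding t(1) by (auto simp: in_keys_iff lookup_add var_def)
  then have e: "prec (snd e) (fst e)" using Suc.prems(1) by (auto simp: E_def)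
  show ?case
  proof (cases "u = 0")
    case True
    then show ?thesis using e by (simp add: t(1) sumterm_var)
  next
    case False
    have "prec (sumterm snd u) (sumterm fst u)" using Suc.hyps(1)[OF t(2)[symmetric]] k(2) Suc.prems(1) False by blast
    with e have "prec (snd e + sumterm snd u) (fst e + sumterm fst u)" by (rule prec_add_mono)
    then show ?thesis by (simp add: t(1) sumterm_add sumterm_var)
  qed
qed

text \<open>The difference belonging to \<open>e\<close> is the one of \<open>e'\<close> plus that
  of the remaining factors. As the remainder is not 0, its difference is positive by
  \<open>sumterm_less\<close>, so \<open>e'\<close> is prior to \<open>e\<close>.\<close>

lemma erank_weight:
  assumes t: "pkeys t \<subseteq> E" "tdeg t \<ge> 2" and e': "e' \<in> pkeys t"
    and w: "\<And>x. wt (\<lambda>e. plk (snd e) x) t + plk (fst e) x = wt (\<lambda>e. plk (fst e) x) t + plk (snd e) x"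
  shows "erank e' < erank e"
proof -
  let ?u = "t - var e'"
  have tu: "t = ?u + var e'" by (rule tdeg_minus_var[OF e'])
  have "tdeg t = tdeg ?u + 1" by (subst tu) (simp add: tdeg_add)
  then have u0: "?u \<noteq> 0" using t(2) by auto
  have "pkeys ?u \<subseteq> pkeys t" by (auto simp: in_keys_iff lookup_minus)
  then have uE: "pkeys ?u \<subseteq> E" using t(1) by simp
  have eq: "sumterm snd t + fst e = sumterm fst t + snd e"
    by (rule poly_mapping_eqI) (simp add: lookup_add plk_sumterm w)
  have split: "sumterm f t = sumterm f ?u + f e'" for f
    by (subst tu) (simp add: sumterm_add sumterm_var)
  have eq2: "sumterm snd ?u + (snd e' + fst e) = sumterm fst ?u + (fst e' + snd e)"
    using eq unfolding split by (simp add: add.assoc)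
  have lt: "prec (sumterm snd ?u) (sumterm fst ?u)" by (rule sumterm_less[OF uE u0])
  have "prec (fst e' + snd e) (fst e + snd e')"
  proof (rule ccontr)
    assume "\<not> ?thesis"
    then consider "fst e' + snd e = fst e + snd e'" | "prec (fst e + snd e') (fst e' + snd e)"
      using prec_total by blast
    then have "prec (sumterm snd ?u + (snd e' + fst e)) (sumterm fst ?u + (fst e' + snd e))"
    proof cases
      case 1
      then have "snd e' + fst e = fst e' + snd e" by (simp add: add.commute)
      then show ?thesis using prec_add[OF lt] by simp
    next
      case 2
      then have "prec (snd e' + fst e) (fst e' + snd e)" by (simp add: add.commute)
      with lt show ?thesis by (rule prec_add_mono)
    qed
    then show False unfolding eq2 using prec_irrefl by blast
  qed
  then show ?thesis using e' t(1) by (intro erank_less) (auto simp: prior_def)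
qed

lemma finite_wedge: "finite (wedge_terms prec m (length L))"
proof (rule finite_subset)
  show "wedge_terms prec m (length L) \<subseteq> {xs. set xs \<subseteq> {t. tdeg t = m} \<and> length xs = length L}"
    by (auto simp: wedge_terms_def)
qed (rule finite_lists_length_eq[OF finite_terms_of_degree])

lemma pc_zero: "pc (\<lambda>_. 0 :: 'f::field) M = (if M = L then 1 else 0)"
proof (cases "M = L \<or> M \<notin> wedge_terms prec m (length L)")
  case True
  then show ?thesis using pc_L pc_outside by auto
next
  case False
  then have M: "M \<in> wedge_terms prec m (length L)" "M \<noteq> L" by auto
  then have Ms: "length M = length L" "sorted_wrt (\<lambda>s t. prec t s) M" by (auto simp: wedge_terms_def)
  have "set M \<noteq> set L" using sorted_unique[OF Ms(2) L_sorted] M(2) by blast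
  moreover have "card (set M) = card (set L)"
    using Ms(1) sorted_distinct[OF Ms(2)] L_distinct by (simp add: distinct_card)
  ultimately have "\<not> set L \<subseteq> set M" using card_subset_eq[of "set M" "set L"] by auto
  then obtain \<tau> where \<tau>: "\<tau> \<in> set L" "\<tau> \<notin> set M" by blast
  let ?f = "bas (\<lambda>_. 0 :: 'f) \<tau>"
  have "?f \<in> pt (\<lambda>_. 0)" using \<tau>(1) by (simp add: pt_def mp.span_base)
  moreover have "\<forall>t\<in>set M. plk ?f t = 0" using \<tau>(2) by (auto simp: plk_bas)
  ultimately have "pluecker_coord (map (bas (\<lambda>_. 0 :: 'f)) L) M = 0"
    using pluecker_coord_nonzero_iff[OF pt_basis, of M "\<lambda>_. 0"] Ms(1) bas_nonzero[OF \<tau>(1)] by auto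
  then show ?thesis using M by (simp add: pc_def pvec_def)
qed

end

text \<open>Coefficients of K as constants in a parameter, for evaluating polynomials along
  polynomial arcs.\<close>

definition kap :: "'k::field \<Rightarrow> 'k alg_closure Polynomial.poly" where "kap a = [:to_ac a:]"

lemma kap_hom: "comm_ring_hom kap"
  by unfold_locales (auto simp: kap_def one_pCons)

lemma poly_hom: "comm_ring_hom (\<lambda>p. poly p z)"
  by unfold_locales auto

lemma poly_evalp: "poly (evalp kap Q f) z = evalp to_ac (\<lambda>i. poly (Q i) z) f"
  by (subst hom_evalp[OF poly_hom kap_hom]) (simp add: kap_def)

subsection \<open>First order expansion along polynomial arcs\<close>

lemma plk_minus_var: "plk (t - var x) y = plk t y - (if y = x then 1 else 0)"
  by (simp add: lookup_minus var_def lookup_single when_def)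

lemma coeff_1_mult: "Polynomial.coeff (p * q) 1 = Polynomial.coeff p 0 * Polynomial.coeff q 1 + Polynomial.coeff p 1 * Polynomial.coeff q 0"
  for p q :: "'a::comm_ring_1 Polynomial.poly"
  by (simp add: coeff_mult)

lemma coeff_0_monev: "Polynomial.coeff (monev Q t) 0 = monev (\<lambda>i. Polynomial.coeff (Q i) 0) t"
  for Q :: "'i \<Rightarrow> 'a::comm_ring_1 Polynomial.poly"
proof -
  have "comm_ring_hom (\<lambda>p :: 'a Polynomial.poly. Polynomial.coeff p 0)"
    by unfold_locales (auto simp: coeff_mult)
  then show ?thesis by (rule hom_monev)
qed

text \<open>The product rule, by splitting off one variable. \<open>S\<close> contains all
  coordinates that move to first order.\<close>

lemma coeff_1_monev:
  fixes Q :: "'i \<Rightarrow> 'a::comm_ring_1 Polynomial.poly"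
  assumes S: "finite S" "\<And>i. i \<notin> S \<Longrightarrow> Polynomial.coeff (Q i) 1 = 0"
  shows "Polynomial.coeff (monev Q t) 1 =
    (\<Sum>i\<in>S. of_nat (plk t i) * monev (\<lambda>i. Polynomial.coeff (Q i) 0) (t - var i) * Polynomial.coeff (Q i) 1)"
proof (induction "tdeg t" arbitrary: t)
  case 0
  then show ?case by (simp add: tdeg_eq_0_iff)
next
  case (Suc d)
  let ?y = "\<lambda>i. Polynomial.coeff (Q i) 0" and ?w = "\<lambda>i. Polynomial.coeff (Q i) 1"
  obtain j u where t: "t = var j + u" "tdeg u = d" using trm_eq_var_add[OF Suc.hyps(2)[symmetric]] .
  have "Polynomial.coeff (monev Q t) 1 = ?y j * Polynomial.coeff (monev Q u) 1 + ?w j * monev ?y u"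
    by (simp add: t(1) monev_add coeff_1_mult[unfolded One_nat_def] coeff_0_monev)
  also have "Polynomial.coeff (monev Q u) 1 = (\<Sum>i\<in>S. of_nat (plk u i) * monev ?y (u - var i) * ?w i)"
    by (rule Suc.hyps(1)[OF t(2)[symmetric]])
  also have "?y j * (\<Sum>i\<in>S. of_nat (plk u i) * monev ?y (u - var i) * ?w i) + ?w j * monev ?y u
      = (\<Sum>i\<in>S. ?y j * (of_nat (plk u i) * monev ?y (u - var i) * ?w i)) + (\<Sum>i\<in>S. if i = j then ?w j * monev ?y u else 0)"
    using S by (simp add: sum_distrib_left)
  also have "\<dots> = (\<Sum>i\<in>S. of_nat (plk t i) * monev ?y (t - var i) * ?w i)"
    unfolding sum.distrib[symmetric]
  proof (rule sum.cong[OF refl])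
    fix i assume "i \<in> S"
    have ti: "of_nat (plk u i) * (?y j * monev ?y (u - var i)) = of_nat (plk u i) * monev ?y (t - var i)"
    proof (cases "plk u i = 0")
      case False
      then have "t - var i = var j + (u - var i)"
        by (intro poly_mapping_eqI) (auto simp: t(1) plk_minus_var lookup_add)
      then show ?thesis by (simp add: monev_add)
    qed simp
    have jj: "t - var j = u" unfolding t(1) by simp
    have pj: "plk t i = plk u i + (if i = j then 1 else 0)"
      by (simp add: t(1) lookup_add var_def lookup_single when_def)
    have "?y j * (of_nat (plk u i) * monev ?y (u - var i) * ?w i) =
        (of_nat (plk u i) * (?y j * monev ?y (u - var i))) * ?w i" by (simp only: mult_ac)
    also have "\<dots> = of_nat (plk u i) * monev ?y (t - var i) * ?w i" unfolding ti ..
    finally have yi: "?y j * (of_nat (plk u i) * monev ?y (u - var i) * ?w i) =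
        of_nat (plk u i) * monev ?y (t - var i) * ?w i" .
    show "?y j * (of_nat (plk u i) * monev ?y (u - var i) * ?w i) + (if i = j then ?w j * monev ?y u else 0)
        = of_nat (plk t i) * monev ?y (t - var i) * ?w i"
      unfolding yi using jj pj by (cases "i = j") (simp_all add: algebra_simps)
  qed
  finally show ?case .
qed

text \<open>The chain rule at parameter 0: gradient times velocity. It connects the partial
  derivatives in \<open>tangent_space\<close> with arcs.\<close>

lemma coeff_1_evalp:
  fixes f :: "('i, 'k::field) mpoly"
  assumes S: "finite S" "\<And>i. i \<notin> S \<Longrightarrow> Polynomial.coeff (Q i) 1 = 0"
  shows "Polynomial.coeff (evalp kap Q f) 1 =
    (\<Sum>i\<in>S. evalp to_ac (\<lambda>i. Polynomial.coeff (Q i) 0) (pdiff i f) * Polynomial.coeff (Q i) 1)"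
proof -
  let ?y = "\<lambda>i. Polynomial.coeff (Q i) 0" and ?w = "\<lambda>i. Polynomial.coeff (Q i) 1"
  have "Polynomial.coeff (evalp kap Q f) 1 = (\<Sum>t\<in>pkeys f. to_ac (plk f t) * Polynomial.coeff (monev Q t) 1)"
    by (simp add: evalp_monev coeff_sum kap_def)
  also have "\<dots> = (\<Sum>t\<in>pkeys f. \<Sum>i\<in>S. to_ac (plk f t) * (of_nat (plk t i) * monev ?y (t - var i) * ?w i))"
  proof (rule sum.cong[OF refl])
    fix t
    have "Polynomial.coeff (monev Q t) 1 = (\<Sum>i\<in>S. of_nat (plk t i) * monev ?y (t - var i) * ?w i)"
      by (rule coeff_1_monev[OF S])
    then show "to_ac (plk f t) * Polynomial.coeff (monev Q t) 1 =
        (\<Sum>i\<in>S. to_ac (plk f t) * (of_nat (plk t i) * monev ?y (t - var i) * ?w i))"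
      by (simp only: sum_distrib_left)
  qed
  also have "\<dots> = (\<Sum>i\<in>S. \<Sum>t\<in>pkeys f. to_ac (plk f t) * (of_nat (plk t i) * monev ?y (t - var i) * ?w i))"
    by (rule sum.swap)
  also have "\<dots> = (\<Sum>i\<in>S. evalp to_ac ?y (pdiff i f) * ?w i)"
    by (simp add: pdiff_def evalp_sum[OF to_ac_hom] evalp_psingle[OF to_ac_hom] sum_distrib_right sum_distrib_left mult_ac)
  finally show ?thesis .
qed

text \<open>On the line with direction \<open>v\<close> a term of degree \<open>k\<close>
  contributes only to the \<open>k\<close>-th power of the parameter.\<close>

lemma coeff_1_line:
  fixes v :: "'e \<Rightarrow> 'k::field alg_closure"
  shows "Polynomial.coeff (evalp kap (\<lambda>e. [:0, v e:]) f) 1 = (\<Sum>t\<in>{t\<in>pkeys f. tdeg t = 1}. to_ac (plk f t) * monev v t)"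
proof -
  have m: "monev (\<lambda>e. [:0, v e:]) t = Polynomial.monom (monev v t) (tdeg t)" for t
  proof -
    have "comm_ring_hom (\<lambda>a :: 'k alg_closure. [:a:])" by unfold_locales (auto simp: one_pCons)
    then have "monev (\<lambda>e. [:v e:]) t = [:monev v t:]" by (rule hom_monev[symmetric])
    moreover have "monev (\<lambda>e. [:0, v e:]) t = monev (\<lambda>e. [:0, 1:] * [:v e:]) t" by simp
    ultimately show ?thesis unfolding monev_scale by (simp add: monom_altdef)
  qed
  have "Polynomial.coeff (evalp kap (\<lambda>e. [:0, v e:]) f) 1 = (\<Sum>t\<in>pkeys f. if tdeg t = 1 then to_ac (plk f t) * monev v t else 0)"
    unfolding evalp_monev m coeff_sum by (rule sum.cong) (auto simp: kap_def)
  also have "\<dots> = (\<Sum>t\<in>{t\<in>pkeys f. tdeg t = 1}. to_ac (plk f t) * monev v t)"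
    by (rule sum.inter_filter[symmetric]) simp
  finally show ?thesis .
qed

lemma sum_linear_terms:
  fixes v :: "'e \<Rightarrow> 'k::field alg_closure"
  assumes "finite E" "\<And>e. e \<notin> E \<Longrightarrow> v e = 0"
  shows "(\<Sum>t\<in>{t\<in>pkeys f. tdeg t = 1}. to_ac (plk f t) * monev v t) = (\<Sum>e\<in>E. to_ac (plk f (var e)) * v e)"
proof -
  have inj: "inj_on var E"
    by (rule inj_onI) (metis keys_single singleton_inject var_def zero_neq_one)
  have "(\<Sum>e\<in>E. to_ac (plk f (var e)) * v e) = (\<Sum>t\<in>var ` E. to_ac (plk f t) * monev v t)"
    by (simp add: sum.reindex[OF inj])
  also have "\<dots> = (\<Sum>t\<in>{t\<in>pkeys f. tdeg t = 1} \<union> var ` E. to_ac (plk f t) * monev v t)"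
  proof (rule sum.mono_neutral_left)
    show "\<forall>t\<in>{t\<in>pkeys f. tdeg t = 1} \<union> var ` E - var ` E. to_ac (plk f t) * monev v t = 0"
    proof
      fix t assume t: "t \<in> {t\<in>pkeys f. tdeg t = 1} \<union> var ` E - var ` E"
      then obtain e where "t = var e" using tdeg_1_var[of t] by blast
      then show "to_ac (plk f t) * monev v t = 0" using t assms(2)[of e] by auto
    qed
  qed (use assms(1) in auto)
  also have "\<dots> = (\<Sum>t\<in>{t\<in>pkeys f. tdeg t = 1}. to_ac (plk f t) * monev v t)"
    by (rule sum.mono_neutral_right) (use assms(1) in \<open>auto simp: in_keys_iff\<close>)
  finally show ?thesis by simp
qed

lemma plk_map_mult: "plk (Poly_Mapping.map ((*) a) v) i = a * plk v i" for a :: "'f::field"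
  by (simp add: Poly_Mapping.map.rep_eq when_def)

lemma map_vector_space: "vector_space (\<lambda>a :: 'f::field. Poly_Mapping.map ((*) a) :: ('i \<Rightarrow>\<^sub>0 'f) \<Rightarrow> _)"
  by unfold_locales (rule poly_mapping_eqI, simp add: plk_map_mult lookup_add algebra_simps)+

section \<open>Tangent vectors at the vertex\<close>

context weighted_cone
begin

text \<open>A basis vector dual to \<open>D\<close>. Its entries on \<open>D\<close> are prescribed,
  and the pivot equation of \<open>e\<close> determines the entry at each \<open>e\<close> outside
  \<open>D\<close>.\<close>

lemma tangent_vector:
  assumes D: "D \<subseteq> E" "lin_free D"
    and piv: "\<And>e. e \<in> E - D \<Longrightarrow> \<exists>f. van f \<and> plk f (var e) = 1 \<and> (\<forall>e'\<in>E - D - {e}. plk f (var e') = 0)"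
    and \<delta>: "\<delta> \<in> D"
  obtains v :: "'e \<Rightarrow> 'k alg_closure" where "\<And>e. e \<notin> E \<Longrightarrow> v e = 0"
    "\<And>d. d \<in> D \<Longrightarrow> v d = (if d = \<delta> then 1 else 0)"
    "\<And>f. van f \<Longrightarrow> (\<Sum>e\<in>E. to_ac (plk f (var e)) * v e) = 0"
proof -
  have "\<forall>e\<in>E - D. \<exists>f. van f \<and> plk f (var e) = 1 \<and> (\<forall>e'\<in>E - D - {e}. plk f (var e') = 0)" using piv by blast
  then obtain \<phi> where "\<forall>e\<in>E - D. van (\<phi> e) \<and> plk (\<phi> e) (var e) = 1 \<and> (\<forall>e'\<in>E - D - {e}. plk (\<phi> e) (var e') = 0)"
    by (rule bchoice[THEN exE])
  then have \<phi>: "\<And>e. e \<in> E - D \<Longrightarrow> van (\<phi> e)"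
    "\<And>e e'. e \<in> E - D \<Longrightarrow> e' \<in> E - D \<Longrightarrow> plk (\<phi> e) (var e') = (if e' = e then 1 else 0)" by auto
  define v where "v e = (if e \<in> D then (if e = \<delta> then 1 else 0) else if e \<in> E then - to_ac (plk (\<phi> e) (var \<delta>)) else 0)" for e
  show thesis
  proof (rule that[of v])
    show "v e = 0" if "e \<notin> E" for e using that D(1) by (auto simp: v_def)
    show "v d = (if d = \<delta> then 1 else 0)" if "d \<in> D" for d using that by (simp add: v_def)
    fix f assume f: "van f"
    \<comment> \<open>Subtracting pivots leaves an equation whose linear part lies in
      \<open>D\<close>, and it vanishes by freeness. So the linear part of \<open>f\<close> is a
      combination of those of the pivots.\<close>
    let ?g = "f - (\<Sum>e\<in>E - D. scale (plk f (var e)) (\<phi> e))"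
    have "van ?g"
      unfolding van_def
    proof
      fix c assume c: "c \<in> Z"
      have "evalp to_ac c (\<phi> e) = 0" if "e \<in> E - D" for e using \<phi>(1)[OF that] c by (simp add: van_def)
      then show "evalp to_ac c ?g = 0"
        using f c by (simp add: van_def evalp_ac_simps evalp_sum[OF to_ac_hom])
    qed
    moreover have "\<forall>e\<in>E - D. plk ?g (var e) = 0"
    proof
      fix e' assume e': "e' \<in> E - D"
      have "plk (\<Sum>e\<in>E - D. scale (plk f (var e)) (\<phi> e)) (var e') = (\<Sum>e\<in>E - D. if e = e' then plk f (var e) else 0)"
        unfolding lookup_sum using e' by (intro sum.cong) (auto simp: \<phi>(2))
      also have "\<dots> = plk f (var e')" using finE e' by simp
      finally show "plk ?g (var e') = 0" by (simp add: lookup_minus)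
    qed
    ultimately have "plk ?g (var \<delta>) = 0" using D(2) \<delta> unfolding lin_free_def by blast
    then have *: "plk f (var \<delta>) = (\<Sum>e\<in>E - D. plk f (var e) * plk (\<phi> e) (var \<delta>))"
      by (simp add: lookup_minus lookup_sum)
    have "(\<Sum>e\<in>E. to_ac (plk f (var e)) * v e) =
        (\<Sum>e\<in>E - D. to_ac (plk f (var e)) * v e) + (\<Sum>e\<in>D. to_ac (plk f (var e)) * v e)"
      by (rule sum.subset_diff[OF D(1) finE])
    also have "(\<Sum>e\<in>D. to_ac (plk f (var e)) * v e) = (\<Sum>e\<in>D. if e = \<delta> then to_ac (plk f (var e)) else 0)"
      by (rule sum.cong) (auto simp: v_def)
    also have "\<dots> = to_ac (plk f (var \<delta>))" using \<delta> finite_subset[OF D(1) finE] by simp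
    also have "(\<Sum>e\<in>E - D. to_ac (plk f (var e)) * v e) = - to_ac (\<Sum>e\<in>E - D. plk f (var e) * plk (\<phi> e) (var \<delta>))"
      unfolding to_ac_sum sum_negf[symmetric] by (rule sum.cong) (auto simp: v_def)
    finally show "(\<Sum>e\<in>E. to_ac (plk f (var e)) * v e) = 0" unfolding *[symmetric] by simp
  qed
qed

end

context hilb_chart
begin

sublocale cone: weighted_cone E Xs "\<lambda>x e. plk (snd e) x" "\<lambda>x e. plk (fst e) x" erank
proof
  show "infinite (UNIV :: 'k set)" by (rule inf)
  show "finite E" by simp
  show "(\<lambda>_. 0) \<in> Xs" by (rule zero_Xs)
  show "c e = 0" if "c \<in> Xs" "e \<notin> E" for c e using that by (rule Xs_outside)
  show "c \<in> Xs" if "\<And>f :: ('x trm \<times> 'x trm, 'k) mpoly. (\<And>c'. c' \<in> Xs \<Longrightarrow> evalp to_ac c' f = 0) \<Longrightarrow> evalp to_ac c f = 0" for c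
    using that by (rule Xs_closed)
  show "(\<lambda>e. c e * (to_ac s ^ plk (snd e) x * inverse (to_ac s) ^ plk (fst e) x)) \<in> Xs" if "c \<in> Xs" "s \<noteq> 0" for c x s
    using chi_Xs[OF that(2,1), of x] by (simp add: chi_def)
  show "erank e' < erank e" if "e \<in> E" "pkeys t \<subseteq> E" "2 \<le> tdeg t"
    "\<And>x. wt (\<lambda>e. plk (snd e) x) t + plk (fst e) x = wt (\<lambda>e. plk (fst e) x) t + plk (snd e) x" "e' \<in> pkeys t" for t e e'
    by (rule erank_weight[OF that(2,3,5,4)])
qed

text \<open>The tangent vectors dual to \<open>D\<close> are carried to Pluecker coordinates as
  velocities. They stay independent, since the entry at \<open>swap d\<close> is, up to sign, the
  chart coordinate at \<open>d\<close>.\<close>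

lemma tangent_dim_ge:
  assumes D: "D \<subseteq> E" "cone.lin_free D"
    and piv: "\<And>e. e \<in> E - D \<Longrightarrow> \<exists>f. cone.van f \<and> plk f (var e) = 1 \<and> (\<forall>e'\<in>E - D - {e}. plk f (var e') = 0)"
  shows "card D \<le> vector_space.dim (\<lambda>a. Poly_Mapping.map ((*) a)) (tangent_space A L (pl ` Y) (pc (\<lambda>_. 0)))"
proof -
  let ?sc = "\<lambda>a :: 'k alg_closure. Poly_Mapping.map ((*) a) :: ('x trm list \<Rightarrow>\<^sub>0 'k alg_closure) \<Rightarrow> _"
  interpret mv: vector_space ?sc by (rule map_vector_space)
  let ?T = "tangent_space A L (pl ` Y) (pc (\<lambda>_. 0))"
  have "\<forall>\<delta>\<in>D. \<exists>v. (\<forall>e. e \<notin> E \<longrightarrow> v e = 0) \<and> (\<forall>d\<in>D. v d = (if d = \<delta> then 1 else 0)) \<and>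
      (\<forall>f. cone.van f \<longrightarrow> (\<Sum>e\<in>E. to_ac (plk f (var e)) * v e) = (0 :: 'k alg_closure))"
  proof
    fix \<delta> assume \<delta>: "\<delta> \<in> D"
    show "\<exists>v. (\<forall>e. e \<notin> E \<longrightarrow> v e = 0) \<and> (\<forall>d\<in>D. v d = (if d = \<delta> then 1 else 0)) \<and>
      (\<forall>f. cone.van f \<longrightarrow> (\<Sum>e\<in>E. to_ac (plk f (var e)) * v e) = (0 :: 'k alg_closure))"
    proof (rule cone.tangent_vector[OF D piv \<delta>])
      fix v :: "'x trm \<times> 'x trm \<Rightarrow> 'k alg_closure"
      assume "\<And>e. e \<notin> E \<Longrightarrow> v e = 0" "\<And>d. d \<in> D \<Longrightarrow> v d = (if d = \<delta> then 1 else 0)"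
        "\<And>f. cone.van f \<Longrightarrow> (\<Sum>e\<in>E. to_ac (plk f (var e)) * v e) = 0"
      then show ?thesis by (intro exI[of _ v] conjI) simp_all
    qed
  qed
  then obtain v where "\<forall>\<delta>\<in>D. (\<forall>e. e \<notin> E \<longrightarrow> v \<delta> e = 0) \<and> (\<forall>d\<in>D. v \<delta> d = (if d = \<delta> then 1 else 0)) \<and>
      (\<forall>f. cone.van f \<longrightarrow> (\<Sum>e\<in>E. to_ac (plk f (var e)) * v \<delta> e) = (0 :: 'k alg_closure))"
    by (rule bchoice[THEN exE])
  then have v: "\<And>\<delta> e. \<delta> \<in> D \<Longrightarrow> e \<notin> E \<Longrightarrow> v \<delta> e = 0"
    "\<And>\<delta> d. \<delta> \<in> D \<Longrightarrow> d \<in> D \<Longrightarrow> v \<delta> d = (if d = \<delta> then 1 else 0)"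
    "\<And>\<delta> f. \<delta> \<in> D \<Longrightarrow> cone.van f \<Longrightarrow> (\<Sum>e\<in>E. to_ac (plk f (var e)) * v \<delta> e) = 0" by auto
  \<comment> \<open>The Pluecker vector along the line through the vertex with direction
    \<open>v \<delta>\<close>. The line is tangent to the chart but need not lie in it; only first
    order terms count.\<close>
  define Q where "Q \<delta> M = evalp kap (\<lambda>e. [:0, v \<delta> e:]) (pcpoly M)" for \<delta> M
  define w where "w \<delta> = (\<Sum>M\<in>A. psingle M (Polynomial.coeff (Q \<delta> M) 1))" for \<delta>
  have polyQ: "poly (Q \<delta> M) z = pc (\<lambda>e. z * v \<delta> e) M" for \<delta> M z
    unfolding Q_def poly_evalp by (simp add: evalp_pcpoly)
  have Qout: "Polynomial.coeff (Q \<delta> M) 1 = 0" if "M \<notin> A" for \<delta> M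
    using that by (simp add: Q_def pcpoly_def evalp_0[OF kap_hom])
  have Q0: "Polynomial.coeff (Q \<delta> M) 0 = pc (\<lambda>_. 0) M" for \<delta> M
    using polyQ[of \<delta> M 0] by (simp add: poly_0_coeff_0)
  have plkw: "plk (w \<delta>) M = Polynomial.coeff (Q \<delta> M) 1" for \<delta> M
  proof -
    have "plk (w \<delta>) M = (\<Sum>N\<in>A. if N = M then Polynomial.coeff (Q \<delta> N) 1 else 0)"
      unfolding w_def lookup_sum by (rule sum.cong) (auto simp: lookup_single when_def)
    then show ?thesis using Qout[of M \<delta>] finite_wedge by simp
  qed
  have wT: "w \<delta> \<in> ?T" if \<delta>: "\<delta> \<in> D" for \<delta>
    unfolding tangent_space_def
  proof (intro CollectI conjI ballI)
    show "pkeys (w \<delta>) \<subseteq> A"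
    proof
      fix M assume "M \<in> pkeys (w \<delta>)"
      then show "M \<in> A" using Qout[of M \<delta>] by (auto simp: in_keys_iff plkw)
    qed
    fix f :: "('x trm list, 'k) mpoly" assume f: "f \<in> chart_ideal L (pl ` Y)"
    let ?h = "evalp const pcpoly f"
    have "cone.van ?h"
      unfolding cone.van_def
    proof
      fix c assume "c \<in> Xs"
      then have "pt c \<in> Y" by (simp add: Xs_def)
      moreover have "pc c \<in> pl (pt c)" unfolding pluecker_pt by (rule proj_point_self)
      ultimately show "evalp to_ac c ?h = 0" using f pc_L[of c] unfolding chart_ideal_def evalp_pc_form by blast
    qed
    then have "(\<Sum>e\<in>E. to_ac (plk ?h (var e)) * v \<delta> e) = 0" by (rule v(3)[OF \<delta>])
    then have "Polynomial.coeff (evalp kap (\<lambda>e. [:0, v \<delta> e:]) ?h) 1 = 0"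
      unfolding coeff_1_line using sum_linear_terms[OF finite_E v(1)[OF \<delta>]] by simp
    \<comment> \<open>Evaluating \<open>f\<close> along the Pluecker arc is evaluating its pull-back
      along the line.\<close>
    moreover have "evalp kap (\<lambda>e. [:0, v \<delta> e:]) ?h = evalp kap (Q \<delta>) f"
      unfolding evalp_compose[OF kap_hom] Q_def ..
    ultimately have "Polynomial.coeff (evalp kap (Q \<delta>) f) 1 = 0" by simp
    moreover have "Polynomial.coeff (evalp kap (Q \<delta>) f) 1 =
        (\<Sum>j\<in>A. evalp to_ac (\<lambda>M. Polynomial.coeff (Q \<delta> M) 0) (pdiff j f) * Polynomial.coeff (Q \<delta> j) 1)"
      by (rule coeff_1_evalp[OF finite_wedge Qout])
    ultimately show "(\<Sum>j\<in>A. evalp to_ac (pc (\<lambda>_. 0)) (pdiff j f) * plk (w \<delta>) j) = 0"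
      unfolding Q0 plkw by simp
  qed
  have wswap: "plk (w \<delta>) (swap d) = (if d = \<delta> then of_int (sg d) else 0)" if "\<delta> \<in> D" "d \<in> D" for \<delta> d
  proof -
    have dE: "d \<in> E" using that(2) D(1) by blast
    \<comment> \<open>By \<open>sg\<close>, both polynomials agree at every parameter.\<close>
    have "Q \<delta> (swap d) = [:0, of_int (sg d) * v \<delta> d:]"
    proof (rule ccontr)
      assume "Q \<delta> (swap d) \<noteq> [:0, of_int (sg d) * v \<delta> d:]"
      then have "Q \<delta> (swap d) - [:0, of_int (sg d) * v \<delta> d:] \<noteq> 0" by simp
      with inf obtain s :: 'k where "poly (Q \<delta> (swap d) - [:0, of_int (sg d) * v \<delta> d:]) (to_ac s) \<noteq> 0"
        by (rule infinite_to_ac_nonroots)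
      then show False by (simp add: polyQ sg(2)[OF dE])
    qed
    then show ?thesis unfolding plkw using v(2)[OF that] by simp
  qed
  show ?thesis
  proof (rule mv.card_le_dim[of D "(\<lambda>M. psingle M 1) ` A" ?T w])
    show "finite D" using D(1) finite_E finite_subset by blast
    show "finite ((\<lambda>M. psingle M 1) ` A)" using finite_wedge by simp
    show "?T \<subseteq> mv.span ((\<lambda>M. psingle M 1) ` A)"
    proof
      fix u assume u: "u \<in> ?T"
      have "u = (\<Sum>M\<in>A. ?sc (plk u M) (psingle M 1))"
      proof (rule poly_mapping_eqI)
        fix N
        have "plk (\<Sum>M\<in>A. ?sc (plk u M) (psingle M 1)) N = (\<Sum>M\<in>A. if M = N then plk u M else 0)"
          unfolding lookup_sum plk_map_mult by (rule sum.cong) (auto simp: lookup_single when_def)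
        also have "\<dots> = plk u N"
          using u finite_wedge by (auto simp: tangent_space_def in_keys_iff)
        finally show "plk u N = plk (\<Sum>M\<in>A. ?sc (plk u M) (psingle M 1)) N" by simp
      qed
      also have "\<dots> \<in> mv.span ((\<lambda>M. psingle M 1) ` A)"
        by (intro mv.span_sum mv.span_scale mv.span_base imageI)
      finally show "u \<in> mv.span ((\<lambda>M. psingle M 1) ` A)" .
    qed
    show "w \<delta> \<in> ?T" if "\<delta> \<in> D" for \<delta> by (rule wT[OF that])
    fix a assume a: "(\<Sum>\<delta>\<in>D. ?sc (a \<delta>) (w \<delta>)) = 0"
    show "\<forall>d\<in>D. a d = 0"
    proof
      fix d assume d: "d \<in> D"
      have "0 = plk (\<Sum>\<delta>\<in>D. ?sc (a \<delta>) (w \<delta>)) (swap d)" by (simp add: a)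
      also have "\<dots> = (\<Sum>\<delta>\<in>D. if \<delta> = d then a \<delta> * of_int (sg d) else 0)"
        unfolding lookup_sum plk_map_mult using d by (intro sum.cong) (auto simp: wswap)
      also have "\<dots> = a d * of_int (sg d)" using d D(1) finite_E finite_subset[of D E] by simp
      finally have "a d * of_int (sg d) = 0" by simp
      moreover have "sg d = 1 \<or> sg d = - 1" by (rule sg(1)[OF subsetD[OF D(1) d]])
      ultimately show "a d = 0" by auto
    qed
  qed
qed

end

section \<open>Krull dimension\<close>

lemma nonvanishing_iff:
  assumes "S \<subseteq> proj_space A"
  shows "(\<exists>c\<in>\<Union>S. evalp to_ac c F \<noteq> 0) \<longleftrightarrow> \<not> S \<subseteq> proj_zeros A F"
  using assms unfolding proj_zeros_def by blast

lemma form_irr_irreducible: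
  fixes S :: "('i \<Rightarrow> 'k::field alg_closure) set set"
  assumes S: "S \<subseteq> proj_space A" and irr: "irreducible_space (subtopology (zariski A) S)"
  shows "form_irr (\<Union>S)"
  unfolding form_irr_def nonvanishing_iff[OF S]
proof (intro allI impI notI)
  fix F G :: "('i, 'k) mpoly" and d e
  assume F: "F \<in> homog d" and G: "G \<in> homog e" and nF: "\<not> S \<subseteq> proj_zeros A F" and nG: "\<not> S \<subseteq> proj_zeros A G"
    and FG: "S \<subseteq> proj_zeros A (F * G)"
  have St: "S \<subseteq> topspace (zariski A)" using S by (simp add: topspace_zariski)
  have "S \<subseteq> proj_zeros A F \<or> S \<subseteq> proj_zeros A G"
    using irr FG F G unfolding irreducible_subtopology_iff[OF zariski_top_basis St] proj_zeros_mult[OF F G] by blast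
  then show False using nF nG by blast
qed

text \<open>Each strict inclusion yields a form that vanishes on the smaller set but not on the
  larger one; \<open>chain_independent\<close> shows that these, brought to a common degree, have no
  homogeneous relation.\<close>

lemma chain_forms:
  fixes S :: "('i \<Rightarrow> 'k::field alg_closure) set set"
  assumes S: "S \<subseteq> proj_space A"
    and Z: "\<forall>i\<le>k. closedin (subtopology (zariski A) S) (Z i) \<and> irreducible_space (subtopology (subtopology (zariski A) S) (Z i))"
    and strict: "\<forall>i<k. Z i \<subset> Z (Suc i)"
  shows "\<exists>(F :: nat \<Rightarrow> ('i, 'k) mpoly) e. (\<forall>j. F j \<in> homog e) \<and> (\<forall>s P. P \<in> homog s \<longrightarrow> P \<noteq> 0 \<longrightarrow> pvars P \<subseteq> {..k} \<longrightarrow>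
     (\<exists>c\<in>\<Union>S. evalp to_ac (\<lambda>i. evalp to_ac c (F i)) P \<noteq> 0))"
proof -
  have ZS: "Z i \<subseteq> S" if "i \<le> k" for i
    using Z that closedin_subset[of "subtopology (zariski A) S" "Z i"] by auto
  have Zp: "Z i \<subseteq> proj_space A" if "i \<le> k" for i using ZS[OF that] S by simp
  have irrZ: "irreducible_space (subtopology (zariski A) (Z i))" if "i \<le> k" for i
  proof -
    have "irreducible_space (subtopology (zariski A) (S \<inter> Z i))"
      using Z that by (simp add: subtopology_subtopology)
    moreover have "S \<inter> Z i = Z i" using ZS[OF that] by auto
    ultimately show ?thesis by simp
  qed
  have neZ: "Z 0 \<noteq> {}"
    using irrZ[of 0] Zp[of 0] by (simp add: irreducible_space_def topspace_zariski Int_absorb1)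
  have mono: "i \<le> k \<Longrightarrow> Z 0 \<subseteq> Z i" for i
  proof (induction i)
    case (Suc i)
    have "Z i \<subset> Z (Suc i)" using strict Suc.prems by simp
    moreover have "Z 0 \<subseteq> Z i" using Suc by simp
    ultimately show ?case by auto
  qed simp
  have "\<forall>j. \<exists>f :: ('i, 'k) mpoly. \<exists>d. j < k \<longrightarrow> f \<in> homog d \<and> (\<forall>c\<in>\<Union>(Z j). evalp to_ac c f = 0) \<and> (\<exists>c\<in>\<Union>(Z (Suc j)). evalp to_ac c f \<noteq> 0)"
  proof
    fix j
    show "\<exists>f :: ('i, 'k) mpoly. \<exists>d. j < k \<longrightarrow> f \<in> homog d \<and> (\<forall>c\<in>\<Union>(Z j). evalp to_ac c f = 0) \<and> (\<exists>c\<in>\<Union>(Z (Suc j)). evalp to_ac c f \<noteq> 0)"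
    proof (cases "j < k")
      case True
      then obtain P where P: "P \<in> Z (Suc j)" "P \<notin> Z j" using strict by blast
      have St: "S \<subseteq> topspace (zariski A)" using S by (simp add: topspace_zariski)
      have cl: "closedin (subtopology (zariski A) S) (Z j)" using Z True by simp
      have PS: "P \<in> S" using P(1) ZS[of "Suc j"] True by auto
      obtain b where b: "b \<in> {proj_zeros A F | (F :: ('i, 'k) mpoly) d. F \<in> homog d}" "P \<notin> b" "Z j \<subseteq> b"
        by (rule closedin_separate[OF zariski_top_basis cl PS P(2) St])
      then obtain f :: "('i, 'k) mpoly" and d where f: "f \<in> homog d" "b = proj_zeros A f" by blast
      have "\<not> Z (Suc j) \<subseteq> proj_zeros A f" using b(2) P(1) f(2) by blast
      then have "\<exists>c\<in>\<Union>(Z (Suc j)). evalp to_ac c f \<noteq> 0" using nonvanishing_iff[OF Zp[of "Suc j"], of f] True by simp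
      moreover have "\<forall>c\<in>\<Union>(Z j). evalp to_ac c f = 0" using nonvanishing_iff[OF Zp[of j], of f] b(3) f(2) True by simp
      ultimately show ?thesis using f(1) by blast
    qed simp
  qed
  then obtain f :: "nat \<Rightarrow> ('i, 'k) mpoly" where "\<forall>j. \<exists>d. j < k \<longrightarrow> f j \<in> homog d \<and> (\<forall>c\<in>\<Union>(Z j). evalp to_ac c (f j) = 0) \<and> (\<exists>c\<in>\<Union>(Z (Suc j)). evalp to_ac c (f j) \<noteq> 0)"
    by (rule choice[THEN exE])
  then obtain d where "\<forall>j. j < k \<longrightarrow> f j \<in> homog (d j) \<and> (\<forall>c\<in>\<Union>(Z j). evalp to_ac c (f j) = 0) \<and> (\<exists>c\<in>\<Union>(Z (Suc j)). evalp to_ac c (f j) \<noteq> 0)"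
    by (rule choice[THEN exE])
  then have f: "\<And>j. j < k \<Longrightarrow> f j \<in> homog (d j)" "\<And>j c. j < k \<Longrightarrow> c \<in> \<Union>(Z j) \<Longrightarrow> evalp to_ac c (f j) = 0"
    "\<And>j. j < k \<Longrightarrow> \<exists>c\<in>\<Union>(Z (Suc j)). evalp to_ac c (f j) \<noteq> 0" by auto
  obtain P0 where P0: "P0 \<in> Z 0" using neZ by blast
  then have "P0 \<in> proj_space A" using Zp[of 0] by auto
  then obtain c0 where c0: "P0 = proj_point c0" "c0 \<noteq> (\<lambda>_. 0)" by (rule proj_spaceE)
  \<comment> \<open>This coordinate is non-zero at a point of \<open>Z 0\<close>, so its powers
    vanish identically on no member of the chain.\<close>
  then obtain a where a: "c0 a \<noteq> 0" by fast
  let ?l = "monomial (var a) :: ('i, 'k) mpoly"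
  have l1: "?l ^ n \<in> homog n" for n using homog_power[of ?l 1 n] by (simp add: homog_monomial)
  have c0Z: "c0 \<in> \<Union>(Z i)" if "i \<le> k" for i
    using mono[OF that] P0 c0(1) proj_point_self[of c0] by blast
  have lnz: "evalp to_ac c0 (?l ^ n) \<noteq> 0" for n using a by (simp add: evalp_power[OF to_ac_hom] evalp_ac_simps)
  define e where "e = (\<Sum>j<k. d j) + 1"
  have de: "d j \<le> e" if "j < k" for j
    using that member_le_sum[of j "{..<k}" d] by (simp add: e_def)
  \<comment> \<open>The separating forms are raised to degree \<open>e\<close> by powers of
    \<open>?l\<close>; the pure power starts the list, so that a chain of length \<open>k\<close>
    gives \<open>k + 1\<close> forms.\<close>
  define F where "F j = (case j of 0 \<Rightarrow> ?l ^ e | Suc i \<Rightarrow> if i < k then f i * ?l ^ (e - d i) else 0)" for j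
  have Fh: "F j \<in> homog e" for j
  proof (cases j)
    case 0
    then show ?thesis by (simp add: F_def l1)
  next
    case (Suc i)
    then show ?thesis using homog_mult[OF f(1)[of i] l1[of "e - d i"]] de[of i] by (auto simp: F_def)
  qed
  have irr: "form_irr (\<Union>(Z j))" if "j \<le> k" for j by (rule form_irr_irreducible[OF Zp[OF that] irrZ[OF that]])
  have nz: "\<exists>c\<in>\<Union>(Z j). evalp to_ac c (F j) \<noteq> 0" if j: "j \<le> k" for j
  proof (cases j)
    case 0
    then show ?thesis using c0Z[of 0] lnz[of e] by (auto simp: F_def)
  next
    case (Suc i)
    then have i: "i < k" using j by simp
    have "\<exists>c\<in>\<Union>(Z (Suc i)). evalp to_ac c (f i * ?l ^ (e - d i)) \<noteq> 0"
    proof (rule form_irr_mult[OF irr f(1)[OF i] l1 f(3)[OF i]])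
      show "Suc i \<le> k" using i by simp
      show "\<exists>c\<in>\<Union>(Z (Suc i)). evalp to_ac c (?l ^ (e - d i)) \<noteq> 0" using c0Z[of "Suc i"] lnz i by auto
    qed
    then show ?thesis using Suc i by (simp add: F_def)
  qed
  have ind: "\<exists>c\<in>\<Union>(Z k). evalp to_ac (\<lambda>i. evalp to_ac c (F i)) P \<noteq> 0"
    if "P \<in> homog s" "P \<noteq> 0" "pvars P \<subseteq> {..k}" for s P
  proof (rule chain_independent[where C = "\<lambda>j. \<Union>(Z j)" and k = k and F = F and e = e, OF irr Fh _ nz _ le_refl that])
    show "\<Union>(Z j) \<subseteq> \<Union>(Z (Suc j))" if "j < k" for j using strict that by blast
    show "evalp to_ac c (F (Suc j)) = 0" if "j < k" "c \<in> \<Union>(Z j)" for j c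
      using f(2)[OF that] that(1) by (simp add: F_def evalp_ac_simps)
  qed
  show ?thesis
  proof (intro exI conjI allI impI)
    show "F j \<in> homog e" for j by (rule Fh)
    fix s and P :: "(nat, 'k) mpoly" assume "P \<in> homog s" "P \<noteq> 0" "pvars P \<subseteq> {..k}"
    then have "\<exists>c\<in>\<Union>(Z k). evalp to_ac (\<lambda>i. evalp to_ac c (F i)) P \<noteq> 0" by (rule ind)
    then show "\<exists>c\<in>\<Union>S. evalp to_ac (\<lambda>i. evalp to_ac c (F i)) P \<noteq> 0" using ZS[of k] by blast
  qed
qed

section \<open>The chart is an affine space\<close>

text \<open>\<open>g e\<close> expresses the coordinate \<open>e\<close> through those in
  \<open>D\<close>, \<beta> enumerates \<open>D\<close>, and \<open>krull\<close> is the
  contribution of smoothness.\<close>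

locale chart_coordinates = hilb_chart prec L m p n r Y
  for prec :: "'x::finite trm \<Rightarrow> 'x trm \<Rightarrow> bool" and L m p n r and Y :: "('x, 'k::field alg_closure) mpoly set set" +
  fixes D :: "('x trm \<times> 'x trm) set" and g :: "'x trm \<times> 'x trm \<Rightarrow> ('x trm \<times> 'x trm, 'k) mpoly"
    and d :: nat and \<beta> :: "nat \<Rightarrow> 'x trm \<times> 'x trm"
  assumes D: "D \<subseteq> E"
    and g_val: "\<And>c e. c \<in> Xs \<Longrightarrow> e \<in> E \<Longrightarrow> evalp to_ac c (g e) = c e"
    and g_dep: "\<And>c c' e. e \<in> E \<Longrightarrow> (\<And>\<delta>. \<delta> \<in> D \<Longrightarrow> c \<delta> = c' \<delta>) \<Longrightarrow> evalp to_ac c (g e) = evalp to_ac c' (g e)"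
    and \<beta>: "bij_betw \<beta> {..<d} D"
    and krull: "enat d \<le> krull_dim (subtopology (zariski A) (pl ` Y))"
begin

definition ext :: "('x trm \<times> 'x trm \<Rightarrow> 'k alg_closure) \<Rightarrow> nat \<Rightarrow> 'k alg_closure" where
  "ext c = (\<lambda>i. if i < d then c (\<beta> i) else 0)"

text \<open>\<open>g e\<close> with the variables in \<open>D\<close> renamed to indices. The others
  can be set to 0, since by \<open>g_dep\<close> they do not affect the values.\<close>

definition \<gamma> :: "'x trm \<times> 'x trm \<Rightarrow> (nat, 'k) mpoly" where
  "\<gamma> e = (if e \<in> E then evalp const (\<lambda>e'. if e' \<in> D then monomial (var (inv_into {..<d} \<beta> e')) else 0) (g e) else 0)"

text \<open>The candidate for the inverse of \<open>ext\<close>. That its values lie in the chart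
  depends on the absence of relations.\<close>

definition \<Phi> :: "(nat \<Rightarrow> 'k alg_closure) \<Rightarrow> 'x trm \<times> 'x trm \<Rightarrow> 'k alg_closure" where
  "\<Phi> z = (\<lambda>e. evalp to_ac z (\<gamma> e))"

lemma \<Phi>_ext: assumes c: "c \<in> Xs" shows "\<Phi> (ext c) = c"
proof
  fix e
  show "\<Phi> (ext c) e = c e"
  proof (cases "e \<in> E")
    case True
    have "evalp to_ac (ext c) (\<gamma> e) = evalp to_ac (\<lambda>e'. evalp to_ac (ext c) (if e' \<in> D then monomial (var (inv_into {..<d} \<beta> e')) else 0)) (g e)"
      unfolding \<gamma>_def using True by (simp add: evalp_compose[OF to_ac_hom])
    also have "\<dots> = evalp to_ac c (g e)"
    proof (rule g_dep[OF True])
      fix \<delta> assume \<delta>: "\<delta> \<in> D"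
      then have "\<delta> \<in> \<beta> ` {..<d}" using \<beta> by (simp add: bij_betw_def)
      then have "inv_into {..<d} \<beta> \<delta> < d" "\<beta> (inv_into {..<d} \<beta> \<delta>) = \<delta>"
        using inv_into_into[of \<delta> \<beta> "{..<d}"] f_inv_into_f[of \<delta> \<beta> "{..<d}"] by auto
      then show "evalp to_ac (ext c) (if \<delta> \<in> D then monomial (var (inv_into {..<d} \<beta> \<delta>)) else 0) = c \<delta>"
        using \<delta> by (simp add: ext_def evalp_ac_simps)
    qed
    finally show ?thesis using g_val[OF c True] by (simp add: \<Phi>_def)
  next
    case False
    then show ?thesis using Xs_outside[OF c False] by (simp add: \<Phi>_def \<gamma>_def evalp_ac_simps)
  qed
qed

lemma evalp_\<gamma>: "evalp to_ac z (evalp const \<gamma> f) = evalp to_ac (\<Phi> z) f"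
  unfolding \<Phi>_def by (rule evalp_compose[OF to_ac_hom])

text \<open>A non-trivial relation between the coordinates in \<open>D\<close> would make the Krull dimension smaller
  than the dimension of the tangent space.\<close>

lemma no_relation_forms:
  fixes F :: "nat \<Rightarrow> ('x trm list, 'k) mpoly"
  assumes G: "G \<in> pdeg_le d N" "G \<noteq> 0" "\<And>c. c \<in> Xs \<Longrightarrow> evalp to_ac (ext c) G = 0"
    and F: "\<And>j. F j \<in> homog e"
    and ind: "\<And>s P. P \<in> homog s \<Longrightarrow> P \<noteq> 0 \<Longrightarrow> pvars P \<subseteq> {..d} \<Longrightarrow>
      \<exists>c\<in>\<Union>(pl ` Y). evalp to_ac (\<lambda>i. evalp to_ac c (F i)) P \<noteq> 0"
  shows False
proof -
  \<comment> \<open>The function on the chart given by \<open>F i\<close>, as a polynomial in the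
    \<open>d\<close> coordinates. Terms with other variables are dropped, as \<open>ext\<close> is 0
    there.\<close>
  define H where "H i = restr (\<lambda>t. pkeys t \<subseteq> {..<d}) (evalp const \<gamma> (evalp const pcpoly (F i)))" for i
  have H: "evalp to_ac (ext c) (H i) = evalp to_ac (pc c) (F i)" if c: "c \<in> Xs" for c i
  proof -
    have "evalp to_ac (ext c) (evalp const \<gamma> (evalp const pcpoly (F i))) = evalp to_ac (ext c) (H i)"
      unfolding H_def
    proof (rule evalp_restr_eq)
      fix t :: "nat trm" assume "\<not> pkeys t \<subseteq> {..<d}"
      then obtain i where "i \<in> pkeys t" "\<not> i < d" by auto
      then show "monev (ext c) t = 0" by (intro monev_eq_0) (auto simp: ext_def)
    qed
    then show ?thesis unfolding evalp_\<gamma> \<Phi>_ext[OF c] evalp_pc_form by simp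
  qed
  define B where "B = (\<Sum>i\<le>d. \<Sum>t\<in>pkeys (H i). tdeg t)"
  have HB: "H i \<in> pdeg_le d B" if "i \<le> d" for i
    unfolding pdeg_le_def
  proof (intro CollectI ballI conjI)
    fix t assume t: "t \<in> pkeys (H i)"
    then show "pkeys t \<subseteq> {..<d}" by (auto simp: H_def in_keys_iff plk_restr split: if_splits)
    have "tdeg t \<le> (\<Sum>t\<in>pkeys (H i). tdeg t)" using t by (intro member_le_sum) auto
    also have "\<dots> \<le> B" unfolding B_def using that by (intro member_le_sum) auto
    finally show "tdeg t \<le> B" .
  qed
  have Gv: "evalp to_ac v G = 0" if "v \<in> ext ` Xs" for v using that G(3) by auto
  show False
  proof (rule relation_exists[OF G(1,2) Gv HB])
    fix s P assume P: "P \<in> homog s" "P \<noteq> (0 :: (nat, 'k) mpoly)" "pvars P \<subseteq> {..d}"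
      and van: "\<And>v. v \<in> ext ` Xs \<Longrightarrow> evalp to_ac (\<lambda>i. evalp to_ac v (H i)) P = 0"
    have R: "evalp const F P \<in> homog (e * s)" by (rule homog_subst[OF P(1) F])
    have "Y \<subseteq> zs (evalp const F P)"
    proof (rule Y_dense[OF R])
      fix c assume c: "c \<in> Xs"
      show "evalp to_ac (pc c) (evalp const F P) = 0"
        unfolding evalp_compose[OF to_ac_hom] using van[of "ext c"] c by (simp add: H[OF c])
    qed
    then have "\<forall>c\<in>\<Union>(pl ` Y). evalp to_ac c (evalp const F P) = 0"
      unfolding pl_zeros_def proj_zeros_def by blast
    then show False using ind[OF P] unfolding evalp_compose[OF to_ac_hom] by blast
  qed
qed

lemma pl_Y_proj: "pl ` Y \<subseteq> proj_space A" using Y_proj by blast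

text \<open>A chain of length at least \<open>d\<close> would provide \<open>d + 1\<close> forms
  without homogeneous relation. So all chains are shorter than \<open>d\<close>, against
  \<open>krull\<close>.\<close>

lemma no_relation:
  assumes G: "G \<in> pdeg_le d N" "G \<noteq> 0" "\<And>c. c \<in> Xs \<Longrightarrow> evalp to_ac (ext c) G = 0" shows False
proof -
  let ?T = "subtopology (zariski A) (pl ` Y) :: ('x trm list \<Rightarrow> 'k alg_closure) set topology"
  let ?K = "{k. \<exists>Z. (\<forall>i\<le>k. closedin ?T (Z i) \<and> irreducible_space (subtopology ?T (Z i))) \<and> (\<forall>i<k. Z i \<subset> Z (Suc i))}"
  have lt: "k < d" if k: "k \<in> ?K" for k
  proof (rule ccontr)
    assume kd: "\<not> k < d"
    obtain Z where Z: "\<forall>i\<le>k. closedin ?T (Z i) \<and> irreducible_space (subtopology ?T (Z i))" "\<forall>i<k. Z i \<subset> Z (Suc i)"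
      using k by blast
    obtain F e where F: "\<forall>j. (F :: nat \<Rightarrow> ('x trm list, 'k) mpoly) j \<in> homog e"
      "\<forall>s P. P \<in> homog s \<longrightarrow> P \<noteq> 0 \<longrightarrow> pvars P \<subseteq> {..k} \<longrightarrow> (\<exists>c\<in>\<Union>(pl ` Y). evalp to_ac (\<lambda>i. evalp to_ac c (F i)) P \<noteq> 0)"
      using chain_forms[OF pl_Y_proj Z] by blast
    show False
    proof (rule no_relation_forms[OF G])
      show "F j \<in> homog e" for j using F(1) by blast
      fix s and P :: "(nat, 'k) mpoly" assume P: "P \<in> homog s" "P \<noteq> 0" "pvars P \<subseteq> {..d}"
      have "{..d} \<subseteq> {..k}" using kd by auto
      with P(3) have "pvars P \<subseteq> {..k}" by (rule subset_trans)
      then show "\<exists>c\<in>\<Union>(pl ` Y). evalp to_ac (\<lambda>i. evalp to_ac c (F i)) P \<noteq> 0" using F(2) P(1,2) by blast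
    qed
  qed
  have "0 \<in> ?K"
  proof -
    have Yt: "pl ` Y \<subseteq> topspace (zariski A)" using pl_Y_proj by (simp add: topspace_zariski)
    have "irreducible_space ?T"
      unfolding irreducible_subtopology_iff[OF zariski_top_basis Yt]
    proof (intro conjI ballI impI)
      show "pl ` Y \<noteq> {}" using vsY by blast
      fix b b' assume "b \<in> {proj_zeros A F | (F :: ('x trm list, 'k) mpoly) d. F \<in> homog d}"
        and "b' \<in> {proj_zeros A F | (F :: ('x trm list, 'k) mpoly) d. F \<in> homog d}" and sub: "pl ` Y \<subseteq> b \<union> b'"
      then obtain F G :: "('x trm list, 'k) mpoly" and d e
        where F: "F \<in> homog d" "b = proj_zeros A F" and G: "G \<in> homog e" "b' = proj_zeros A G" by blast
      have "Y \<subseteq> zs F \<union> zs G" using sub F(2) G(2) by (auto simp: pl_zeros_def)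
      then have "Y \<subseteq> zs F \<or> Y \<subseteq> zs G" by (rule Y_irreducible[OF F(1) G(1)])
      then show "pl ` Y \<subseteq> b \<or> pl ` Y \<subseteq> b'" using F(2) G(2) by (auto simp: pl_zeros_def)
    qed
    moreover have "topspace ?T = pl ` Y" using Yt by (simp add: Int_absorb1)
    then have "subtopology ?T (pl ` Y) = ?T" by (metis subtopology_topspace)
    moreover have "closedin ?T (pl ` Y)" using closedin_topspace[of ?T] \<open>topspace ?T = pl ` Y\<close> by simp
    ultimately show ?thesis by (intro CollectI exI[of _ "\<lambda>_. pl ` Y"]) simp
  qed
  then have d0: "0 < d" by (rule lt)
  have "krull_dim ?T \<le> enat (d - 1)"
    unfolding krull_dim_def
  proof (rule SUP_least)
    fix k assume "k \<in> ?K"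
    then have "k < d" by (rule lt)
    then show "enat k \<le> enat (d - 1)" by simp
  qed
  then have "enat d \<le> enat (d - 1)" using krull order_trans by blast
  then show False using d0 by simp
qed

text \<open>The image of \<open>ext\<close> is dense in affine \<open>d\<close>-space: after terms
  in other variables are removed, a polynomial that vanishes on it is a relation and thus 0.\<close>

lemma vanishing_relation:
  fixes G :: "(nat, 'k) mpoly"
  assumes G: "\<And>c. c \<in> Xs \<Longrightarrow> evalp to_ac (ext c) G = 0" and z: "\<And>i. \<not> i < d \<Longrightarrow> z i = 0"
  shows "evalp to_ac z G = 0"
proof (rule ccontr)
  assume nz: "evalp to_ac z G \<noteq> 0"
  let ?G = "restr (\<lambda>t. pkeys t \<subseteq> {..<d}) G"
  have eq: "evalp to_ac v G = evalp to_ac v ?G" if v: "\<And>i. \<not> i < d \<Longrightarrow> v i = 0" for v :: "nat \<Rightarrow> 'k alg_closure"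
  proof (rule evalp_restr_eq)
    fix t :: "nat trm" assume "\<not> pkeys t \<subseteq> {..<d}"
    then obtain i where "i \<in> pkeys t" "\<not> i < d" by auto
    then show "monev v t = 0" using v by (intro monev_eq_0) auto
  qed
  have "evalp to_ac z ?G \<noteq> 0" using nz eq[OF z] by simp
  then have G0: "?G \<noteq> 0" by (auto simp: evalp_ac_simps)
  have "evalp to_ac (ext c) ?G = 0" if "c \<in> Xs" for c
    using G[OF that] eq[of "ext c"] by (simp add: ext_def)
  moreover have "?G \<in> pdeg_le d (\<Sum>t\<in>pkeys ?G. tdeg t)"
    unfolding pdeg_le_def
  proof (intro CollectI ballI conjI)
    fix t assume t: "t \<in> pkeys ?G"
    then show "pkeys t \<subseteq> {..<d}" by (auto simp: in_keys_iff plk_restr split: if_splits)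
    show "tdeg t \<le> (\<Sum>t\<in>pkeys ?G. tdeg t)" using t by (intro member_le_sum) auto
  qed
  ultimately show False using no_relation[of ?G] G0 by blast
qed

text \<open>An equation of the chart, pulled back by \<Phi>, vanishes on the image of
  \<open>ext\<close>, hence everywhere; as the chart is closed, \<Phi> maps into it.\<close>

lemma \<Phi>_Xs: assumes z: "\<And>i. \<not> i < d \<Longrightarrow> z i = 0" shows "\<Phi> z \<in> Xs"
proof (rule Xs_closed)
  fix f :: "('x trm \<times> 'x trm, 'k) mpoly" assume f: "\<And>c'. c' \<in> Xs \<Longrightarrow> evalp to_ac c' f = 0"
  have "evalp to_ac z (evalp const \<gamma> f) = 0"
    by (rule vanishing_relation[OF _ z]) (simp_all add: evalp_\<gamma> \<Phi>_ext f)
  then show "evalp to_ac (\<Phi> z) f = 0" unfolding evalp_\<gamma> .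
qed

lemma ext_\<Phi>: assumes z: "\<And>i. \<not> i < d \<Longrightarrow> z i = 0" shows "ext (\<Phi> z) = z"
proof
  fix i show "ext (\<Phi> z) i = z i"
  proof (cases "i < d")
    case True
    have "evalp to_ac z (\<gamma> (\<beta> i) - monomial (var i)) = 0"
    proof (rule vanishing_relation[OF _ z])
      fix c assume "c \<in> Xs"
      then have "evalp to_ac (ext c) (\<gamma> (\<beta> i)) = c (\<beta> i)" using fun_cong[OF \<Phi>_ext[of c], of "\<beta> i"] by (simp add: \<Phi>_def)
      then show "evalp to_ac (ext c) (\<gamma> (\<beta> i) - monomial (var i)) = 0" using True by (simp add: evalp_ac_simps ext_def)
    qed
    then show ?thesis using True by (simp add: evalp_ac_simps ext_def \<Phi>_def)
  qed (simp add: ext_def z)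
qed

subsection \<open>The birational map\<close>

definition aff :: "(nat \<Rightarrow> 'k alg_closure) \<Rightarrow> nat \<Rightarrow> 'k alg_closure" where
  "aff y = (\<lambda>i. if i < d then y (Suc i) / y 0 else 0)"

definition emb :: "(nat \<Rightarrow> 'k alg_closure) \<Rightarrow> nat \<Rightarrow> 'k alg_closure" where
  "emb z = (\<lambda>j. case j of 0 \<Rightarrow> 1 | Suc i \<Rightarrow> if i < d then z i else 0)"

text \<open>The linear projection to the Pluecker coordinates that carry the chart coordinates in
  \<open>D\<close>, with the signs removed. It induces the birational map.\<close>

definition lproj :: "('x trm list \<Rightarrow> 'k alg_closure) \<Rightarrow> nat \<Rightarrow> 'k alg_closure" where
  "lproj y = (\<lambda>j. case j of 0 \<Rightarrow> y L | Suc i \<Rightarrow> if i < d then of_int (sg (\<beta> i)) * y (swap (\<beta> i)) else 0)"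

lemma aff_outside: "\<not> i < d \<Longrightarrow> aff y i = 0" by (simp add: aff_def)

lemma aff_scale: "a \<noteq> 0 \<Longrightarrow> aff (\<lambda>i. a * y i) = aff y"
  by (simp add: aff_def fun_eq_iff)

lemma aff_emb: "(\<And>i. \<not> i < d \<Longrightarrow> z i = 0) \<Longrightarrow> aff (emb z) = z"
  by (simp add: aff_def emb_def fun_eq_iff)

lemma emb_aff:
  assumes "y 0 \<noteq> 0" "\<And>j. \<not> j \<le> d \<Longrightarrow> y j = 0" shows "y = (\<lambda>j. y 0 * emb (aff y) j)"
proof
  fix j show "y j = y 0 * emb (aff y) j"
    using assms by (cases j) (auto simp: emb_def aff_def)
qed

lemma \<beta>_E: "i < d \<Longrightarrow> \<beta> i \<in> E" using \<beta> D by (auto simp: bij_betw_def)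

lemma lproj_pc: "lproj (pc c) = emb (ext c)"
proof
  fix j show "lproj (pc c) j = emb (ext c) j"
    by (cases j) (auto simp: lproj_def emb_def ext_def pc_L sg(2)[OF \<beta>_E] sg_sg[OF \<beta>_E])
qed

lemma lproj_point: "lproj ` proj_point y = proj_point (lproj y)"
proof -
  have "lproj (\<lambda>i. a * y i) = (\<lambda>j. a * lproj y j)" for a
    by (auto simp: lproj_def fun_eq_iff split: nat.splits)
  then show ?thesis unfolding proj_point_def by (auto simp: image_iff) metis+
qed

definition \<psi> :: "(nat \<Rightarrow> 'k alg_closure) set \<Rightarrow> ('x trm list \<Rightarrow> 'k alg_closure) set" where
  "\<psi> Q = proj_point (pc (\<Phi> (aff (SOME y. y \<in> Q))))"

lemma \<psi>_point: assumes y: "y \<in> Q" and Q: "Q \<in> proj_space {..d}" shows "\<psi> Q = proj_point (pc (\<Phi> (aff y)))"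
proof -
  obtain c where c: "Q = proj_point c" using Q by (rule proj_spaceE)
  have *: "aff y' = aff c" if "y' \<in> Q" for y'
  proof -
    have "y' \<in> proj_point c" using that unfolding c .
    then obtain a where "a \<noteq> 0" "y' = (\<lambda>i. a * c i)" by (auto simp: proj_point_def)
    then show ?thesis by (simp add: aff_scale)
  qed
  have "(SOME y. y \<in> Q) \<in> Q" using y by (rule someI[where P = "\<lambda>y. y \<in> Q"])
  then have "aff (SOME y. y \<in> Q) = aff y" using *[OF y] *[of "SOME y. y \<in> Q"] by simp
  then show ?thesis by (simp add: \<psi>_def)
qed

text \<open>One direction is the linear projection \<open>lproj\<close>, the other is \<Phi>
  followed by the Pluecker vector. They are inverse between the open sets where the coordinate at
  \<open>L\<close> and the coordinate 0 are non-zero.\<close>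

lemma rational: "rational_variety A (pl ` Y)"
proof -
  let ?L = "monomial (var L) :: ('x trm list, 'k) mpoly" and ?x0 = "monomial (var 0) :: (nat, 'k) mpoly"
  have L1: "?L \<in> homog 1" and x1: "?x0 \<in> homog 1" by (simp_all add: homog_monomial)
  define U where "U = pl ` Y - proj_zeros A ?L"
  define W where "W = proj_space {..d} - proj_zeros {..d} ?x0"
  let ?\<phi> = "\<lambda>P. lproj ` P"
  have UI: "proj_point (pc c) \<in> U" if c: "c \<in> Xs" for c
  proof -
    have "proj_point (pc c) \<in> pl ` Y" using c pluecker_pt[of c] by (metis (no_types, lifting) Xs_def imageI mem_Collect_eq)
    moreover have "proj_point (pc c) \<notin> proj_zeros A ?L"
      unfolding proj_zeros_iff[OF L1 pl_pt_proj] by (simp add: evalp_ac_simps pc_L)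
    ultimately show ?thesis by (simp add: U_def)
  qed
  have UE: "\<exists>c\<in>Xs. P = proj_point (pc c)" if P: "P \<in> U" for P
  proof -
    obtain V where V: "V \<in> Y" "P = pl V" "V \<notin> zs ?L" using P by (auto simp: U_def pl_zeros_def)
    obtain c where "c \<in> Xs" "V = pt c" using chart_point[OF V(1,3)] by metis
    then show ?thesis using V(2) pluecker_pt by blast
  qed
  have WE: "\<exists>y. Q = proj_point y \<and> y 0 \<noteq> 0 \<and> (\<forall>j. \<not> j \<le> d \<longrightarrow> y j = 0)" if Q: "Q \<in> W" for Q
  proof -
    have Qs: "Q \<in> proj_space {..d}" "Q \<notin> proj_zeros {..d} ?x0" using Q by (simp_all add: W_def)
    obtain y where y: "Q = proj_point y" "\<forall>i. i \<notin> {..d} \<longrightarrow> y i = 0" "y \<noteq> (\<lambda>_. 0)" using Qs(1) by (rule proj_spaceE)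
    have "evalp to_ac y ?x0 \<noteq> 0" using Qs proj_zeros_iff[OF x1, of y "{..d}"] unfolding y(1) by blast
    then have "y 0 \<noteq> 0" by (simp add: evalp_ac_simps)
    then show ?thesis using y by auto
  qed
  have WI: "proj_point (emb z) \<in> W" for z
  proof -
    have "emb z \<noteq> (\<lambda>_. 0)" by (auto simp: emb_def fun_eq_iff intro: exI[of _ 0])
    moreover have "\<forall>i. i \<notin> {..d} \<longrightarrow> emb z i = 0" by (auto simp: emb_def split: nat.splits)
    ultimately have ps: "proj_point (emb z) \<in> proj_space {..d}" unfolding proj_space_def by blast
    have "proj_point (emb z) \<notin> proj_zeros {..d} ?x0"
      unfolding proj_zeros_iff[OF x1 ps] by (simp add: evalp_ac_simps emb_def)
    then show ?thesis using ps by (simp add: W_def)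
  qed
  have \<phi>_val: "?\<phi> (proj_point (pc c)) = proj_point (emb (ext c))" for c
    unfolding lproj_point lproj_pc ..
  have \<psi>_val: "\<psi> Q = proj_point (pc (\<Phi> (aff y)))" if "Q \<in> W" "y \<in> Q" for Q y
    using \<psi>_point[OF that(2)] that(1) by (simp add: W_def)
  have \<Phi>aff: "\<Phi> (aff y) \<in> Xs" for y by (rule \<Phi>_Xs) (rule aff_outside)
  have openU: "openin (subtopology (zariski A) (pl ` Y)) U"
    unfolding openin_subtopology U_def
    using zariski_basic_open[OF L1, of A] pl_Y_proj unfolding topspace_zariski by blast
  have openW: "openin (subtopology (zariski {..d}) (proj_space {..d})) W"
    unfolding openin_subtopology W_def
    using zariski_basic_open[OF x1, of "{..d}"] unfolding topspace_zariski by blast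
  have Uproj: "U \<subseteq> proj_space A" using pl_Y_proj by (auto simp: U_def)
  have Wproj: "W \<subseteq> proj_space {..d}" by (auto simp: W_def)
  have selfU: "openin (subtopology (zariski A) U) (U :: ('x trm list \<Rightarrow> 'k alg_closure) set set)"
    using openin_topspace[of "subtopology (zariski A) U"] Uproj by (simp add: topspace_zariski Int_absorb1)
  have selfW: "openin (subtopology (zariski {..d}) W) (W :: (nat \<Rightarrow> 'k alg_closure) set set)"
    using openin_topspace[of "subtopology (zariski {..d}) W"] Wproj by (simp add: topspace_zariski Int_absorb1)
  have \<phi>W: "?\<phi> P \<in> W" if "P \<in> U" for P using UE[OF that] WI \<phi>_val by auto
  have \<psi>U: "\<psi> Q \<in> U" if Q: "Q \<in> W" for Q
  proof -
    obtain y where "Q = proj_point y" using WE[OF Q] by blast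
    then have "y \<in> Q" using proj_point_self by blast
    from \<psi>_val[OF Q this] show ?thesis using UI[OF \<Phi>aff] by simp
  qed
  have reg_\<phi>: "regular_map A U {..d} ?\<phi>"
    unfolding regular_map_def
  proof (intro conjI ballI)
    show "?\<phi> ` U \<subseteq> proj_space {..d}" using \<phi>W Wproj by blast
    fix P assume P: "P \<in> U"
    let ?F = "\<lambda>j. case j of 0 \<Rightarrow> ?L | Suc i \<Rightarrow> if i < d then const (of_int (sg (\<beta> i))) * monomial (var (swap (\<beta> i))) else 0"
    have Fh: "?F j \<in> homog 1" for j
    proof (cases j)
      case (Suc i)
      have "const (of_int (sg (\<beta> i))) * monomial (var (swap (\<beta> i))) \<in> (homog (0 + 1) :: ('x trm list, 'k) mpoly set)"
        by (intro homog_mult homog_const) (simp add: homog_monomial)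
      then show ?thesis using Suc by simp
    qed (use L1 in simp)
    have val: "(\<lambda>j. if j \<in> {..d} then evalp to_ac c (?F j) else 0) = lproj c" for c
    proof
      fix j show "(if j \<in> {..d} then evalp to_ac c (?F j) else 0) = lproj c j"
        by (cases j) (auto simp: lproj_def evalp_ac_simps)
    qed
    show "\<exists>N F d'. openin (subtopology (zariski A) U) N \<and> P \<in> N \<and> (\<forall>j. (F :: nat \<Rightarrow> ('x trm list, 'k) mpoly) j \<in> homog d') \<and>
        (\<forall>Q\<in>N. \<forall>c\<in>Q. (\<lambda>j. if j \<in> {..d} then evalp to_ac c (F j) else 0) \<in> ?\<phi> Q)"
    proof (intro exI conjI ballI allI)
      show "openin (subtopology (zariski A) U) U" by (rule selfU)
      show "P \<in> U" by (rule P)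
      show "?F j \<in> homog 1" for j by (rule Fh)
      show "(\<lambda>j. if j \<in> {..d} then evalp to_ac c (?F j) else 0) \<in> ?\<phi> Q" if "Q \<in> U" "c \<in> Q" for Q c
        unfolding val using that(2) by (rule imageI)
    qed
  qed
  have reg_\<psi>: "regular_map {..d} W A \<psi>"
    unfolding regular_map_def
  proof (intro conjI ballI)
    show "\<psi> ` W \<subseteq> proj_space A" using \<psi>U Uproj by blast
    fix Q0 assume Q0: "Q0 \<in> W"
    define f where "f M = evalp const \<gamma> (pcpoly M)" for M
    \<comment> \<open>A common bound for all Pluecker indices, because the components of a map to
      projective space must be forms of the same degree.\<close>
    define N where "N = (\<Sum>M\<in>A. \<Sum>t\<in>pkeys (f M). tdeg t)"
    have "\<forall>M. \<exists>F. M \<in> A \<longrightarrow> F \<in> homog N \<and> (\<forall>y. y 0 \<noteq> 0 \<longrightarrow>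
        evalp to_ac y F = y 0 ^ N * evalp to_ac (\<lambda>i. to_ac (if i < d then 1 else 0) * y (Suc i) / y 0) (f M))"
    proof
      fix M
      show "\<exists>F. M \<in> A \<longrightarrow> F \<in> homog N \<and> (\<forall>y. y 0 \<noteq> 0 \<longrightarrow>
        evalp to_ac y F = y 0 ^ N * evalp to_ac (\<lambda>i. to_ac (if i < d then 1 else 0) * y (Suc i) / y 0) (f M))"
      proof (cases "M \<in> A")
        case True
        have "tdeg t \<le> N" if t: "t \<in> pkeys (f M)" for t
        proof -
          have "tdeg t \<le> (\<Sum>t\<in>pkeys (f M). tdeg t)" using t by (intro member_le_sum) auto
          also have "\<dots> \<le> N" unfolding N_def using True finite_wedge by (intro member_le_sum) auto
          finally show ?thesis .
        qed
        from homogenize[of "f M" N 0 "\<lambda>i. if i < d then 1 else 0" Suc, OF this] show ?thesis by blast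
      qed simp
    qed
    then obtain F where F: "\<forall>M. M \<in> A \<longrightarrow> F M \<in> homog N \<and> (\<forall>y. y 0 \<noteq> 0 \<longrightarrow>
        evalp to_ac y (F M) = y 0 ^ N * evalp to_ac (\<lambda>i. to_ac (if i < d then 1 else 0) * y (Suc i) / y 0) (f M))"
      by (rule choice[THEN exE])
    let ?F = "\<lambda>M. if M \<in> A then F M else 0"
    have val: "(\<lambda>M. if M \<in> A then evalp to_ac y (?F M) else 0) = (\<lambda>M. y 0 ^ N * pc (\<Phi> (aff y)) M)" if y0: "y 0 \<noteq> 0" for y
    proof
      fix M
      have ay: "(\<lambda>i. to_ac (if i < d then 1 else 0) * y (Suc i) / y 0) = aff y" by (auto simp: aff_def)
      show "(if M \<in> A then evalp to_ac y (?F M) else 0) = y 0 ^ N * pc (\<Phi> (aff y)) M"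
      proof (cases "M \<in> A")
        case True
        have "evalp to_ac y (F M) = y 0 ^ N * evalp to_ac (aff y) (f M)"
          using conjunct2[OF F[THEN spec, THEN mp, OF True], THEN spec[of _ y], THEN mp, OF y0] unfolding ay .
        then show ?thesis using True by (simp add: f_def evalp_\<gamma> evalp_pcpoly)
      qed (simp add: pc_outside)
    qed
    show "\<exists>N' F' d'. openin (subtopology (zariski {..d}) W) N' \<and> Q0 \<in> N' \<and> (\<forall>j. (F' :: 'x trm list \<Rightarrow> (nat, 'k) mpoly) j \<in> homog d') \<and>
        (\<forall>Q\<in>N'. \<forall>c\<in>Q. (\<lambda>j. if j \<in> A then evalp to_ac c (F' j) else 0) \<in> \<psi> Q)"
    proof (intro exI conjI ballI allI)
      show "openin (subtopology (zariski {..d}) W) W" by (rule selfW)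
      show "Q0 \<in> W" by (rule Q0)
      show "?F j \<in> homog N" for j using F by simp
      fix Q y assume Q: "Q \<in> W" and y: "y \<in> Q"
      obtain y1 where y1: "Q = proj_point y1" "y1 0 \<noteq> 0" using WE[OF Q] by blast
      have y0: "y 0 \<noteq> 0" using y y1 by (auto simp: proj_point_def)
      have "(\<lambda>M. y 0 ^ N * pc (\<Phi> (aff y)) M) \<in> proj_point (pc (\<Phi> (aff y)))"
        unfolding proj_point_def using y0 by (intro CollectI exI[of _ "y 0 ^ N"]) simp
      then show "(\<lambda>j. if j \<in> A then evalp to_ac y (?F j) else 0) \<in> \<psi> Q"
        unfolding val[of y, OF y0] \<psi>_val[OF Q y] .
    qed
  qed
  have inv1: "\<psi> (?\<phi> P) = P" if P: "P \<in> U" for P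
  proof -
    obtain c where c: "c \<in> Xs" "P = proj_point (pc c)" using UE[OF P] by blast
    have "\<psi> (proj_point (emb (ext c))) = proj_point (pc (\<Phi> (aff (emb (ext c)))))"
      by (rule \<psi>_val[OF WI proj_point_self])
    also have "aff (emb (ext c)) = ext c" by (rule aff_emb) (simp add: ext_def)
    finally show ?thesis unfolding c(2) \<phi>_val \<Phi>_ext[OF c(1)] .
  qed
  have inv2: "?\<phi> (\<psi> Q) = Q" if Q: "Q \<in> W" for Q
  proof -
    obtain y where y: "Q = proj_point y" "y 0 \<noteq> 0" "\<forall>j. \<not> j \<le> d \<longrightarrow> y j = 0" using WE[OF Q] by blast
    have "\<psi> Q = proj_point (pc (\<Phi> (aff y)))" by (rule \<psi>_val[OF Q]) (simp add: y(1) proj_point_self)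
    then have "?\<phi> (\<psi> Q) = proj_point (emb (ext (\<Phi> (aff y))))" by (simp only: \<phi>_val)
    also have "ext (\<Phi> (aff y)) = aff y" by (rule ext_\<Phi>) (rule aff_outside)
    also have "proj_point (emb (aff y)) = proj_point (\<lambda>j. y 0 * emb (aff y) j)" by (rule proj_point_scale[OF y(2), symmetric])
    also have "\<dots> = Q" using emb_aff[of y] y by simp
    finally show ?thesis .
  qed
  have "U \<noteq> {}" using UI[OF zero_Xs] by (metis empty_iff)
  moreover have "W \<noteq> {}" using WI[of "\<lambda>_. 0"] by (metis empty_iff)
  moreover have "?\<phi> ` U \<subseteq> W" by (rule image_subsetI) (rule \<phi>W)
  moreover have "\<psi> ` W \<subseteq> U" by (rule image_subsetI) (rule \<psi>U)
  moreover have "\<forall>P\<in>U. \<psi> (?\<phi> P) = P" by (intro ballI inv1)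
  moreover have "\<forall>Q\<in>W. ?\<phi> (\<psi> Q) = Q" by (intro ballI inv2)
  ultimately have "openin (subtopology (zariski A) (pl ` Y)) U \<and> U \<noteq> {} \<and>
      openin (subtopology (zariski {..d}) (proj_space {..d})) W \<and> W \<noteq> {} \<and>
      regular_map A U {..d} ?\<phi> \<and> ?\<phi> ` U \<subseteq> W \<and> regular_map {..d} W A \<psi> \<and> \<psi> ` W \<subseteq> U \<and>
      (\<forall>P\<in>U. \<psi> (?\<phi> P) = P) \<and> (\<forall>Q\<in>W. ?\<phi> (\<psi> Q) = Q)"
    using openU openW reg_\<phi> reg_\<psi> by simp
  then show ?thesis
    unfolding rational_variety_def birational_def
    by (rule exI[of _ d, OF exI[of _ U, OF exI[of _ W, OF exI[of _ ?\<phi>, OF exI[of _ \<psi>]]]]])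
qed

end

lemma (in hilb_chart) rational_of_smooth:
  assumes smooth: "enat (vector_space.dim (\<lambda>a. Poly_Mapping.map ((*) a)) (tangent_space A L (pl ` Y) (pc (\<lambda>_. 0)))) =
    krull_dim (subtopology (zariski A) (pl ` Y))"
  shows "rational_variety A (pl ` Y)"
proof (rule cone.lin_free_maximal)
  fix D assume D: "D \<subseteq> E" "cone.lin_free D"
    and piv: "\<And>e. e \<in> E - D \<Longrightarrow> \<exists>f. cone.van f \<and> plk f (var e) = 1 \<and> (\<forall>e'\<in>E - D - {e}. plk f (var e') = 0)"
  let ?P = "\<lambda>e g. (\<forall>c\<in>Xs. c e = evalp to_ac c g) \<and>
    (\<forall>c c' :: _ \<Rightarrow> 'k alg_closure. (\<forall>d\<in>D. c d = c' d) \<longrightarrow> evalp to_ac c g = evalp to_ac c' g)"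
  have "\<forall>e\<in>E. \<exists>g. ?P e g" using cone.coordinate_polynomials[OF D(1) piv] by blast
  then obtain g where "\<forall>e\<in>E. ?P e (g e)" by (rule bchoice[THEN exE])
  then have g: "\<And>e. e \<in> E \<Longrightarrow> ?P e (g e)" by blast
  have finD: "finite D" using D(1) finite_E finite_subset by blast
  obtain \<beta> where \<beta>: "bij_betw \<beta> {0..<card D} D" using ex_bij_betw_nat_finite[OF finD] by blast
  have kr: "enat (card D) \<le> krull_dim (subtopology (zariski A) (pl ` Y))"
    unfolding smooth[symmetric] using tangent_dim_ge[OF D piv] by simp
  have "chart_coordinates prec L m p n r Y D g (card D) \<beta>"
  proof unfold_locales
    show "D \<subseteq> E" by (rule D(1))
    show "evalp to_ac c (g e) = c e" if "c \<in> Xs" "e \<in> E" for c e using g[OF that(2)] that(1) by simp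
    show "evalp to_ac c (g e) = evalp to_ac c' (g e)" if "e \<in> E" "\<And>\<delta>. \<delta> \<in> D \<Longrightarrow> c \<delta> = c' \<delta>" for c c' e
      using g[OF that(1)] that(2) by blast
    show "bij_betw \<beta> {..<card D} D" using \<beta> by (simp add: lessThan_atLeast0)
    show "enat (card D) \<le> krull_dim (subtopology (zariski A) (pl ` Y))" by (rule kr)
  qed
  then show ?thesis by (rule chart_coordinates.rational)
qed

section \<open>The generic initial point\<close>

context tord
begin

lemma wedge_less_trans: assumes "wedge_less prec L M" "wedge_less prec M N" shows "wedge_less prec L N"
proof -
  obtain i where i: "i < length L" "i < length M" "\<forall>k<i. L ! k = M ! k" "prec (L ! i) (M ! i)"
    using assms(1) by (auto simp: wedge_less_def)
  obtain j where j: "j < length M" "j < length N" "\<forall>k<j. M ! k = N ! k" "prec (M ! j) (N ! j)"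
    using assms(2) by (auto simp: wedge_less_def)
  consider "i < j" | "i = j" | "j < i" by linarith
  then show ?thesis
  proof cases
    case 1
    then show ?thesis unfolding wedge_less_def using i j by (intro exI[of _ i]) auto
  next
    case 2
    then have "prec (L ! i) (N ! i)" using prec_trans[OF i(4)] j(4) by simp
    then show ?thesis unfolding wedge_less_def using i j 2 by (intro exI[of _ i]) auto
  next
    case 3
    then show ?thesis unfolding wedge_less_def using i j by (intro exI[of _ j]) auto
  qed
qed

lemma wedge_less_irrefl: "\<not> wedge_less prec L L"
  by (auto simp: wedge_less_def prec_irrefl)

lemma wedge_less_total: assumes "length L = length M" "L \<noteq> M" shows "wedge_less prec L M \<or> wedge_less prec M L"
proof -
  have ex: "\<exists>j. j < length L \<and> L ! j \<noteq> M ! j" using assms nth_equalityI by blast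
  define j where "j = (LEAST j. j < length L \<and> L ! j \<noteq> M ! j)"
  have j: "j < length L" "L ! j \<noteq> M ! j" using LeastI_ex[OF ex] by (auto simp: j_def)
  have below: "L ! i = M ! i" if "i < j" for i
    using not_less_Least[of i "\<lambda>j. j < length L \<and> L ! j \<noteq> M ! j"] that j(1) unfolding j_def by auto
  from prec_total[OF j(2)] show ?thesis
  proof
    assume "prec (L ! j) (M ! j)"
    then have "wedge_less prec L M" unfolding wedge_less_def using j below assms(1) by (intro exI[of _ j]) auto
    then show ?thesis ..
  next
    assume "prec (M ! j) (L ! j)"
    then have "wedge_less prec M L" unfolding wedge_less_def using j below assms(1) by (intro exI[of _ j]) auto
    then show ?thesis ..
  qed
qed

lemma wedge_max:
  assumes "finite S" "S \<noteq> {}" "\<And>M. M \<in> S \<Longrightarrow> length M = q"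
  shows "\<exists>L\<in>S. \<forall>M\<in>S. M = L \<or> wedge_less prec M L"
  using assms
proof (induction S rule: finite_ne_induct)
  case (insert N S)
  then obtain L where L: "L \<in> S" "\<forall>M\<in>S. M = L \<or> wedge_less prec M L" by auto
  show ?case
  proof (cases "N = L \<or> wedge_less prec N L")
    case True then show ?thesis using L by auto
  next
    case False
    then have LN: "wedge_less prec L N" using wedge_less_total[of N L] insert.prems L(1) by auto
    have "\<forall>M\<in>S. M = N \<or> wedge_less prec M N" using L(2) LN wedge_less_trans by metis
    then show ?thesis by auto
  qed
qed simp

end

lemma lin_subst_id: "lin_subst (Finite_Cartesian_Product.mat 1 :: 'k::field ^ 'x ^ 'x) f = (f :: ('x::finite, 'k alg_closure) mpoly)"
proof -
  have "(\<Sum>j\<in>UNIV. scale (to_ac ((Finite_Cartesian_Product.mat 1 :: 'k ^ 'x ^ 'x) $ i $ j)) (monomial (var j)))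
      = (monomial (var i) :: ('x, 'k alg_closure) mpoly)" for i
  proof -
    have "(\<Sum>j\<in>UNIV. scale (to_ac ((Finite_Cartesian_Product.mat 1 :: 'k ^ 'x ^ 'x) $ i $ j)) (monomial (var j)))
      = (\<Sum>j\<in>UNIV. if j = i then monomial (var j) else 0 :: ('x, 'k alg_closure) mpoly)"
      by (rule sum.cong) (auto simp: Finite_Cartesian_Product.mat_def scale_def const_def)
    then show ?thesis by simp
  qed
  then have "lin_subst (Finite_Cartesian_Product.mat 1 :: 'k ^ 'x ^ 'x) f = evalp const (\<lambda>i. monomial (var i)) f"
    by (simp add: lin_subst_def)
  also have "\<dots> = (\<Sum>t\<in>pkeys f. scale (plk f t) (monomial t))"
  proof -
    have "monev (\<lambda>i. monomial (var i)) t = (monomial t :: ('x, 'k alg_closure) mpoly)" for t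
    proof (induction "tdeg t" arbitrary: t)
      case 0
      then show ?case by (simp add: tdeg_eq_0_iff)
    next
      case (Suc d)
      obtain x u where "t = var x + u" "tdeg u = d" using trm_eq_var_add[OF Suc.hyps(2)[symmetric]] .
      then show ?case using Suc.hyps(1)[of u] by (simp add: monev_add monomial_add)
    qed
    then show ?thesis by (simp add: evalp_monev scale_def)
  qed
  also have "\<dots> = f" by (rule sum_scale_monomials)
  finally show ?thesis .
qed

lemma subset_gl_orbit: "Y \<subseteq> gl_orbit (Y :: ('x::finite, 'k::field alg_closure) mpoly set set)"
proof
  fix V assume V: "V \<in> Y"
  have "lin_subst (Finite_Cartesian_Product.mat 1 :: 'k ^ 'x ^ 'x) ` V = V" by (simp add: lin_subst_id)
  moreover have "invertible (Finite_Cartesian_Product.mat 1 :: 'k ^ 'x ^ 'x)" unfolding invertible_def by (intro exI[of _ "Finite_Cartesian_Product.mat 1"]) simp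
  ultimately show "V \<in> gl_orbit Y" using V unfolding gl_orbit_def by blast
qed

theorem theorem6p10:
  fixes prec :: "'x::{finite, linorder} trm \<Rightarrow> 'x trm \<Rightarrow> bool"
    and p :: "rat poly"
    and n m q r :: nat
    and Y :: "('x, 'k::field alg_closure) mpoly set set"
  assumes "infinite (UNIV :: 'k set)"
    and "CARD('x) = n + 1"
    and "term_order prec"
    and "\<And>i j :: 'x. i < j \<Longrightarrow> prec (var i) (var j)"
    and "gotzmann_number (subscheme_ideals p :: ('x, 'k alg_closure) mpoly set set) r"
    and "m \<ge> r"
    and "of_nat q = of_nat ((n + m) choose n) - poly p (of_nat m)"
    and "irreducible_component (hilbert_top prec p m q) Y"
    and "smooth_point (wedge_terms prec m q) (pluecker prec m q ` Y)
           (pluecker prec m q (vs (gin prec m q Y)))"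
  shows "rational_variety (wedge_terms prec m q) (pluecker prec m q ` Y)"
proof -
  interpret tord prec by unfold_locales (rule assms(3))
  let ?A = "wedge_terms prec m q" and ?pl = "pluecker prec m q"
  let ?S = "delta_supp prec m q (gl_orbit Y)"
  have Yt: "V \<in> hilbert_scheme p m q" "?pl V \<in> proj_space ?A" if "V \<in> Y" for V
    using assms(8) that unfolding irreducible_component_def topspace_hilbert by auto
  have Yg: "V \<in> grassmannian m q" if "V \<in> Y" for V using Yt(1)[OF that] by (simp add: hilbert_scheme_def)
  have supp: "M \<in> ?S" if V: "V \<in> Y" and B: "ordered_basis V B" and M: "M \<in> ?A" "pluecker_coord B M \<noteq> 0" for V B M
  proof -
    have "length B = q" using ordered_basis_vdim[OF B] Yg[OF V] by (simp add: grassmannian_def)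
    then have "?pl V = proj_point (pvec prec m q B)" by (rule pluecker_eq[OF B])
    then have "\<forall>c\<in>?pl V. c M \<noteq> 0" using M by (auto simp: proj_point_def pvec_def)
    then have "V \<in> pluecker_open prec m q M" using Yg[OF V] by (simp add: pluecker_open_def)
    moreover have "V \<in> gl_orbit Y" using V subset_gl_orbit by blast
    ultimately show ?thesis using M(1) unfolding delta_supp_def by blast
  qed
  have basis_of: "\<exists>B a. ordered_basis V B \<and> c = (\<lambda>i. a * pvec prec m q B i)" if "c \<in> ?pl V" for c V
    using that unfolding pluecker_def proj_point_def pvec_def by blast
  have finS: "finite ?S"
  proof (rule finite_subset)
    show "?S \<subseteq> {xs. set xs \<subseteq> {t. tdeg t = m} \<and> length xs = q}" by (auto simp: delta_supp_def wedge_terms_def)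
  qed (rule finite_lists_length_eq[OF finite_terms_of_degree])
  \<comment> \<open>Smoothness refers to the Pluecker image of \<open>Y\<close>, so at first it only
    provides some \<open>V0\<close> in \<open>Y\<close> with the same image as the special
    point.\<close>
  obtain V0 where V0: "V0 \<in> Y" "?pl V0 = ?pl (vs (gin prec m q Y))"
    using assms(9) by (auto simp: smooth_point_def)
  have "?S \<noteq> {}"
  proof -
    obtain c where c: "?pl V0 = proj_point c" "\<forall>i. i \<notin> ?A \<longrightarrow> c i = 0" "c \<noteq> (\<lambda>_. 0)"
      using Yt(2)[OF V0(1)] by (rule proj_spaceE)
    then obtain M where M: "c M \<noteq> 0" "M \<in> ?A" by fastforce
    obtain B a where B: "ordered_basis V0 B" "c = (\<lambda>i. a * pvec prec m q B i)"
      using basis_of[of c V0] proj_point_self[of c] c(1) by auto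
    then have "pluecker_coord B M \<noteq> 0" using M by (auto simp: pvec_def)
    then show ?thesis using supp[OF V0(1) B(1) M(2)] by blast
  qed
  moreover have "length M = q" if "M \<in> ?S" for M using that by (simp add: delta_supp_def wedge_terms_def)
  ultimately obtain L where L: "L \<in> ?S" "\<forall>M\<in>?S. M = L \<or> wedge_less prec M L"
    using wedge_max[OF finS] by blast
  have gin: "gin prec m q Y = L"
    unfolding gin_def
  proof (rule the_equality)
    show "L \<in> ?S \<and> (\<forall>M\<in>?S. M = L \<or> wedge_less prec M L)" using L by blast
    fix L' assume L': "L' \<in> ?S \<and> (\<forall>M\<in>?S. M = L' \<or> wedge_less prec M L')"
    show "L' = L"
    proof (rule ccontr)
      assume "L' \<noteq> L"
      then have "wedge_less prec L' L" "wedge_less prec L L'" using L L' by auto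
      then show False using wedge_less_trans wedge_less_irrefl by blast
    qed
  qed
  have LA: "L \<in> ?A" using L(1) by (simp add: delta_supp_def)
  then have q: "q = length L" by (simp add: wedge_terms_def)
  interpret chart prec L m by unfold_locales (use LA q in simp)
  have max: "M = L \<or> wedge_less prec M L"
    if "V \<in> Y" "ordered_basis V B" "M \<in> ?A" "pluecker_coord B M \<noteq> 0" for V B M
    using supp[OF that] L(2) by blast
  \<comment> \<open>The coordinate of \<open>V0\<close> at \<open>L\<close> is non-zero, so
    \<open>V0\<close> is in the chart; there the Pluecker vector determines the chart coordinates by
    \<open>pc_swap\<close>, and they are all 0.\<close>
  have vsY: "vs L \<in> Y"
  proof -
    have "?pl V0 = ?pl (vs L)" using V0(2) gin by simp
    also have "\<dots> = proj_point (pc (\<lambda>_. 0))" unfolding vs_eq_pt q by (rule pluecker_pt)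
    finally have c0: "pc (\<lambda>_. 0) \<in> ?pl V0" by (simp add: proj_point_self)
    obtain B a where B: "ordered_basis V0 B" "pc (\<lambda>_. 0) = (\<lambda>i. a * pvec prec m q B i)" using basis_of[OF c0] by blast
    have "pvec prec m q B L \<noteq> 0" using fun_cong[OF B(2), of L] by (auto simp: pc_L)
    then have nz: "pluecker_coord B L \<noteq> 0" using LA by (simp add: pvec_def)
    have "V0 \<in> grassmannian m (length L)" using Yg[OF V0(1)] q by simp
    then obtain c where c: "V0 = pt c"
      using pt_of_max[OF _ B(1) nz max[OF V0(1) B(1), unfolded q]] by metis
    have "pc (\<lambda>_. 0) \<in> proj_point (pc c)" using c0 unfolding c q pluecker_pt .
    then obtain a' where a': "pc (\<lambda>_. 0) = (\<lambda>i. a' * pc c i)" by (auto simp: proj_point_def)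
    have "a' = 1" using fun_cong[OF a', of L] by (simp add: pc_L)
    then have eq: "pc (\<lambda>_. 0) = pc c" using a' by simp
    have "c e = 0" if e: "e \<in> E" for e
    proof -
      obtain s :: int where s: "s = 1 \<or> s = - 1" "\<And>c :: _ \<Rightarrow> 'k alg_closure. pc c (swap e) = of_int s * c e"
        using pc_swap[OF e] by metis
      have "of_int s * c e = 0" using fun_cong[OF eq, of "swap e"] unfolding s(2) by simp
      then show ?thesis using s(1) by auto
    qed
    then have "pt c = pt (\<lambda>_. 0)" by (intro pt_cong) simp
    then show ?thesis using V0(1) c vs_eq_pt by metis
  qed
  interpret hilb_chart prec L m p n r Y
  proof unfold_locales
    show "infinite (UNIV :: 'k set)" "CARD('x) = n + 1" "r \<le> m" "vs L \<in> Y" by (rule assms(1) assms(2) assms(6) vsY)+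
    show "regular_ideal r I" if "I \<in> subscheme_ideals p" for I :: "('x, 'k alg_closure) mpoly set"
      using assms(5) that by (simp add: gotzmann_number_def)
    show "irreducible_component (hilbert_top prec p m (length L)) Y" using assms(8) q by simp
    show "M = L \<or> wedge_less prec M L"
      if "V \<in> Y" "ordered_basis V B" "M \<in> wedge_terms prec m (length L)" "pluecker_coord B M \<noteq> 0" for V B M
      by (rule max[OF that(1,2) _ that(4)]) (use that(3) q in simp)
  qed
  obtain i c where i: "i \<in> A" "c \<in> pl (vs L)" "c i = 1"
    and dim: "enat (vector_space.dim (\<lambda>a. Poly_Mapping.map ((*) a)) (tangent_space A i (pl ` Y) c)) = krull_dim (subtopology (zariski A) (pl ` Y))"
  proof -
    have "smooth_point A (pl ` Y) (pl (vs L))" using assms(9) gin q by simp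
    then show thesis using that unfolding smooth_point_def by blast
  qed
  obtain a where a: "c = (\<lambda>i. a * pc (\<lambda>_. 0) i)" using i(2) unfolding vs_eq_pt pluecker_pt by (auto simp: proj_point_def)
  \<comment> \<open>The Pluecker vector of the special point has its only non-zero entry at
    \<open>L\<close>, which forces the affine chart and the representative chosen in
    \<open>smooth_point\<close>.\<close>
  have "i = L" "a = 1" using i(3) unfolding a by (auto simp: pc_zero split: if_splits)
  then have "c = pc (\<lambda>_. 0)" "i = L" using a by auto
  then have "rational_variety A (pl ` Y)" using dim by (intro rational_of_smooth) simp
  then show ?thesis using q by simp
qed

end
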